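(* If $\psi:S^2\to \mathrm{U}(3)$ is a totally unramified minimal immersion with constant curvature and uniton number $2$, then $\psi$ is unitarily congruent to $\pi_{V_1^2}-\pi_{V_1^2}^\perp$.
   Context: Metrics: $\mathrm{U}(n)$ carries the bi-invariant metric $h_n(\xi,\eta)=\frac18\mathrm{tr}(\xi\eta^* )$, $\xi,\eta\in\mathfrak{u}(n)$. "Constant curvature" means that the induced metric on $S^2$ has constant Gaussian curvature. $S^2$ is the Riemann sphere with local complex coordinate $z$; every nonconstant harmonic map $S^2\to \mathrm{U}(n)$ is a branched minimal immersion. Extended solutions: for smooth $\psi:S^2\to \mathrm{U}(n)$ write $\frac12\psi^{-1}d\psi=A^\psi_z dz+A^\psi_{\bar z}d\bar z$. If $\psi$ is harmonic, an extended solution of $\psi$ is a smooth map $\Psi:S^2\to\Omega \mathrm{U}(n)=\{\gamma:S^1\to \mathrm{U}(n)\text{ smooth}:\gamma(1)=I_n\}$ with $\Psi^{-1}d\Psi=(1-\lambda^{-1})A^\psi_zdz+(1-\lambda)A^\psi_{\bar z}d\bar z$ for all $\lambda\in S^1$; it is unique up to left multiplication by a constant loop, and $\psi=\Psi_{-1}$ up to left multiplication by a constant element of $\mathrm{U}(n)$ (here $\Psi_\lambda(z)=\Psi(z)(\lambda)$). Let $\mathcal{H}_+\subset L^2(S^1,\mathbb{C}^n)$ be the closed subspace of Fourier series with vanishing negative coefficients. $\Psi$ is identified with the subbundle $W=\Psi\mathcal{H}_+$ of $S^2\times L^2(S^1,\mathbb{C}^n)$, with fibers $W(z)=\Psi(z)\mathcal{H}_+$.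 The uniton number of $\psi$ is the smallest $r$ for which $\psi$ has a polynomial extended solution $\Psi=\sum_{i=0}^r\lambda^iA_i$. If $\psi$ has uniton number $r$, a normalized extended solution of $\psi$ is one with $\lambda^r\mathcal{H}_+\subset W\subset\mathcal{H}_+$ such that $\bigcup_{z\in S^2}W(z)$ spans $\mathcal{H}_+$; then $W=X\oplus\lambda^r\mathcal{H}_+$ with $X=W\cap\bigoplus_{j=0}^{r-1}\lambda^j\mathbb{C}^n$ (zeros filled out), which is a holomorphic map $X:S^2\to G_k(\mathbb{C}^{rn})$ for some $k$, with $\mathbb{C}^{rn}\cong\bigoplus_{j=0}^{r-1}\lambda^j\mathbb{C}^n$. Totally unramified: a smooth map $Y:S^2\to G_k(\mathbb{C}^N)$ is identified with a rank-$k$ subbundle of $S^2\times\mathbb{C}^N$; its $\partial_z$-second fundamental form $A'_Y\in\mathrm{Hom}(Y,Y^\perp)$ is $A'_Y(s)=\pi_Y^\perp\partial_zs$ for $s\in\Gamma(Y)$. For $Y$ holomorphic, $G^{(0)}(Y)=Y$ and $G^{(i+1)}(Y)$ is the subbundle generated by the image of $A'_{G^{(i)}(Y)}$ (zeros filled out). With $q$ the smallest integer such that $G^{(q+1)}(Y)=\{0\}$, the holomorphic map $Y$ is totally unramified if $\det A'_{G^{(i)}(Y)}(A'_{G^{(i)}(Y)})^*\neq0$ everywhere on $S^2$ for all $i\in\{0,\dots,q-1\}$, where $A'_{G^{(i)}(Y)}$ is regarded as a map $G^{(i)}(Y)\to G^{(i+1)}(Y)$. A harmonic map $\psi:S^2\to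 \mathrm{U}(n)$ of uniton number $r>0$ is totally unramified if the holomorphic map $X:S^2\to G_k(\mathbb{C}^{rn})$ associated with its normalized extended solution is totally unramified. Veronese sequence: $V_0^n:S^2\to\mathbb{C}P^n$ is spanned by $f(z)=\big(\sqrt{\tbinom{n}{k}}\,z^k\big)_{k=0}^n$, and $V_i^n$ is the orthogonal complement of $\mathrm{span}\{f,\dots,\partial_z^{i-1}f\}$ in $\mathrm{span}\{f,\dots,\partial_z^if\}$ (extended to all of $S^2$), $0\le i\le n$. For a subbundle $Y$, $\pi_Y$ and $\pi_Y^\perp$ are the orthogonal projections onto $Y$ and $Y^\perp$. Unitary congruence: $\psi,\tilde\psi:S^2\to \mathrm{U}(n)$ are unitarily congruent if $\tilde\psi=A\,(\psi\circ g)\,B$ for some constants $A,B\in \mathrm{U}(n)$ and some biholomorphism $g$ of $S^2$ (choice of complex coordinate). *)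

theory Defs
  imports "HOL-Analysis.Analysis"
begin

section \<open>Smooth maps and complex derivatives\<close>

primrec Ck :: "nat \<Rightarrow> ('a::euclidean_space \<Rightarrow> 'b::real_normed_vector) \<Rightarrow> bool" where
  "Ck 0 f \<longleftrightarrow> continuous_on UNIV f"
| "Ck (Suc k) f \<longleftrightarrow> (\<forall>x. f differentiable (at x)) \<and>
     (\<forall>b\<in>Basis. Ck k (\<lambda>x. frechet_derivative f (at x) b))"

definition smooth :: "('a::euclidean_space \<Rightarrow> 'b::real_normed_vector) \<Rightarrow> bool" where
  "smooth f \<longleftrightarrow> (\<forall>k. Ck k f)"

text \<open>The real directional derivative; for \<^term>\<open>b = 1\<close> and \<^term>\<open>b = \<i>\<close> these are the
  partial derivatives in \<open>x\<close> and \<open>y\<close>, where \<open>z = x + \<i> y\<close>.\<close>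

definition pd :: "complex \<Rightarrow> (complex \<Rightarrow> 'b::real_normed_vector) \<Rightarrow> complex \<Rightarrow> 'b" where
  "pd b f z = frechet_derivative f (at z) b"

definition dz :: "(complex \<Rightarrow> complex) \<Rightarrow> complex \<Rightarrow> complex" where
  "dz f z = (pd 1 f z - \<i> * pd \<i> f z) / 2"

definition dzbar :: "(complex \<Rightarrow> complex) \<Rightarrow> complex \<Rightarrow> complex" where
  "dzbar f z = (pd 1 f z + \<i> * pd \<i> f z) / 2"

definition dz_vec :: "(complex \<Rightarrow> complex^'m) \<Rightarrow> complex \<Rightarrow> complex^'m" where
  "dz_vec s z = (\<chi> i. dz (\<lambda>w. s w $ i) z)"

definition dz_mat :: "(complex \<Rightarrow> complex^'m^'l) \<Rightarrow> complex \<Rightarrow> complex^'m^'l" where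
  "dz_mat F z = (\<chi> i j. dz (\<lambda>w. F w $ i $ j) z)"

definition dzbar_mat :: "(complex \<Rightarrow> complex^'m^'l) \<Rightarrow> complex \<Rightarrow> complex^'m^'l" where
  "dzbar_mat F z = (\<chi> i j. dzbar (\<lambda>w. F w $ i $ j) z)"


section \<open>The Riemann sphere\<close>

datatype riemann_sphere = Affine complex | Infty

text \<open>Inverse coordinate charts, each defined on all of the complex plane. The transition map
  is \<open>w = 1 / z\<close>.\<close>

definition chart0 :: "complex \<Rightarrow> riemann_sphere" where
  "chart0 z = Affine z"

definition chart1 :: "complex \<Rightarrow> riemann_sphere" where
  "chart1 w = (if w = 0 then Infty else Affine (1 / w))"

definition charts :: "(complex \<Rightarrow> riemann_sphere) set" where
  "charts = {chart0, chart1}"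

definition smooth_on_sphere :: "(riemann_sphere \<Rightarrow> 'b::real_normed_vector) \<Rightarrow> bool" where
  "smooth_on_sphere F \<longleftrightarrow> (\<forall>c\<in>charts. smooth (\<lambda>z. F (c z)))"

definition holomorphic_self_map :: "(riemann_sphere \<Rightarrow> riemann_sphere) \<Rightarrow> bool" where
  "holomorphic_self_map g \<longleftrightarrow> (\<forall>c\<in>charts. \<forall>c'\<in>charts.
     open {z. g (c z) \<in> range c'} \<and>
     (\<lambda>z. inv c' (g (c z))) holomorphic_on {z. g (c z) \<in> range c'})"

definition biholomorphism :: "(riemann_sphere \<Rightarrow> riemann_sphere) \<Rightarrow> bool" where
  "biholomorphism g \<longleftrightarrow> bij g \<and> holomorphic_self_map g \<and> holomorphic_self_map (inv g)"


section \<open>Hermitian linear algebra and the unitary group\<close>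

definition hinner :: "complex^'m \<Rightarrow> complex^'m \<Rightarrow> complex" where
  "hinner v w = (\<Sum>i\<in>UNIV. v $ i * cnj (w $ i))"

definition ctranspose :: "complex^'m^'l \<Rightarrow> complex^'l^'m" where
  "ctranspose A = (\<chi> i j. cnj (A $ j $ i))"

definition unitary_group :: "(complex^'n^'n) set" where
  "unitary_group = {A. A ** ctranspose A = mat 1 \<and> ctranspose A ** A = mat 1}"

text \<open>The matrix of the Hermitian orthogonal projection onto a complex subspace.\<close>

definition proj :: "(complex^'m) set \<Rightarrow> complex^'m^'m" where
  "proj V = (THE P. ctranspose P = P \<and> P ** P = P \<and> range ((*v) P) = V)"

definition proj_perp :: "(complex^'m) set \<Rightarrow> complex^'m^'m" where
  "proj_perp V = mat 1 - proj V"

text \<open>The determinant of an endomorphism \<open>T\<close> of a subspace \<open>V\<close>, computed after extending \<open>T\<close> by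
  the identity on the orthogonal complement of \<open>V\<close>.\<close>

definition det_on :: "(complex^'m) set \<Rightarrow> complex^'m^'m \<Rightarrow> complex" where
  "det_on V T = det (T ** proj V + proj_perp V)"

text \<open>The value at the identity of the bi-invariant metric, for skew-Hermitian arguments; there the
  trace is real.\<close>

definition h_metric :: "complex^'n^'n \<Rightarrow> complex^'n^'n \<Rightarrow> real" where
  "h_metric \<xi> \<eta> = Re (trace (\<xi> ** ctranspose \<eta>)) / 8"


section \<open>Maps into the unitary group\<close>

definition smooth_unitary_map :: "(riemann_sphere \<Rightarrow> complex^'n^'n) \<Rightarrow> bool" where
  "smooth_unitary_map \<psi> \<longleftrightarrow> smooth_on_sphere \<psi> \<and> range \<psi> \<subseteq> unitary_group"

text \<open>\<open>(1/2) \<psi>\<inverse> d\<psi> = A_z dz + A_zbar dzbar\<close> in the chart \<open>c\<close>.\<close>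

definition A_z ::
  "(riemann_sphere \<Rightarrow> complex^'n^'n) \<Rightarrow> (complex \<Rightarrow> riemann_sphere) \<Rightarrow> complex \<Rightarrow> complex^'n^'n" where
  "A_z \<psi> c z = (1/2) *\<^sub>R (matrix_inv (\<psi> (c z)) ** dz_mat (\<lambda>w. \<psi> (c w)) z)"

definition A_zbar ::
  "(riemann_sphere \<Rightarrow> complex^'n^'n) \<Rightarrow> (complex \<Rightarrow> riemann_sphere) \<Rightarrow> complex \<Rightarrow> complex^'n^'n" where
  "A_zbar \<psi> c z = (1/2) *\<^sub>R (matrix_inv (\<psi> (c z)) ** dzbar_mat (\<lambda>w. \<psi> (c w)) z)"

text \<open>For a bi-invariant metric on \<open>U(n)\<close> the harmonic map equation is
  \<open>d\<^sup>* (\<psi>\<inverse> d\<psi>) = 0\<close>; on a surface it depends only on the conformal structure.\<close>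

definition harmonic :: "(riemann_sphere \<Rightarrow> complex^'n^'n) \<Rightarrow> bool" where
  "harmonic \<psi> \<longleftrightarrow> smooth_unitary_map \<psi> \<and>
     (\<forall>c\<in>charts. \<forall>z. dzbar_mat (A_z \<psi> c) z + dz_mat (A_zbar \<psi> c) z = 0)"

definition induced_metric ::
  "(riemann_sphere \<Rightarrow> complex^'n^'n) \<Rightarrow> (complex \<Rightarrow> riemann_sphere) \<Rightarrow> complex \<Rightarrow>
    complex \<Rightarrow> complex \<Rightarrow> real" where
  "induced_metric \<psi> c z u v =
     h_metric (matrix_inv (\<psi> (c z)) ** pd u (\<lambda>w. \<psi> (c w)) z)
              (matrix_inv (\<psi> (c z)) ** pd v (\<lambda>w. \<psi> (c w)) z)"

definition immersion :: "(riemann_sphere \<Rightarrow> complex^'n^'n) \<Rightarrow> bool" where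
  "immersion \<psi> \<longleftrightarrow>
     (\<forall>c\<in>charts. \<forall>z. inj (\<lambda>u. pd u (\<lambda>w. \<psi> (c w)) z))"

definition conformal :: "(riemann_sphere \<Rightarrow> complex^'n^'n) \<Rightarrow> bool" where
  "conformal \<psi> \<longleftrightarrow> (\<forall>c\<in>charts. \<forall>z.
     induced_metric \<psi> c z 1 1 = induced_metric \<psi> c z \<i> \<i> \<and> induced_metric \<psi> c z 1 \<i> = 0)"

definition minimal_immersion :: "(riemann_sphere \<Rightarrow> complex^'n^'n) \<Rightarrow> bool" where
  "minimal_immersion \<psi> \<longleftrightarrow> harmonic \<psi> \<and> immersion \<psi> \<and> conformal \<psi>"

text \<open>The Gaussian curvature \<open>- \<Delta> (ln E) / (2 E)\<close> of an induced metric \<open>E (dx\<^sup>2 + dy\<^sup>2)\<close>; this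
  formula is meant for conformal immersions, where the metric has this form.\<close>

definition gauss_curvature ::
  "(riemann_sphere \<Rightarrow> complex^'n^'n) \<Rightarrow> (complex \<Rightarrow> riemann_sphere) \<Rightarrow> complex \<Rightarrow> real" where
  "gauss_curvature \<psi> c z =
     (let E = (\<lambda>w. induced_metric \<psi> c w 1 1); L = (\<lambda>w. ln (E w))
      in - (pd 1 (pd 1 L) z + pd \<i> (pd \<i> L) z) / (2 * E z))"

definition constant_curvature :: "(riemann_sphere \<Rightarrow> complex^'n^'n) \<Rightarrow> bool" where
  "constant_curvature \<psi> \<longleftrightarrow> (\<exists>K. \<forall>c\<in>charts. \<forall>z. gauss_curvature \<psi> c z = K)"

definition unitarily_congruent ::
  "(riemann_sphere \<Rightarrow> complex^'n^'n) \<Rightarrow> (riemann_sphere \<Rightarrow> complex^'n^'n) \<Rightarrow> bool" where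
  "unitarily_congruent \<psi> \<psi>' \<longleftrightarrow>
     (\<exists>A\<in>unitary_group. \<exists>B\<in>unitary_group. \<exists>g. biholomorphism g \<and>
        (\<forall>p. \<psi>' p = A ** \<psi> (g p) ** B))"


section \<open>Extended solutions and the uniton number\<close>

text \<open>A map into the loop group \<open>\<Omega> U(n)\<close> is a function of the point and of the loop parameter
  \<open>\<lambda>\<close>, written \<open>\<mu>\<close> in formulas; only its values for \<open>\<bar>\<mu>\<bar> = 1\<close> are used.
  It is smooth if it is jointly smooth on \<open>S\<^sup>2 \<times> S\<^sup>1\<close>.\<close>

definition smooth_loop_map :: "(riemann_sphere \<Rightarrow> complex \<Rightarrow> complex^'n^'n) \<Rightarrow> bool" where
  "smooth_loop_map \<Psi> \<longleftrightarrow>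
     (\<forall>c\<in>charts. smooth (\<lambda>(z::complex, \<theta>::real). \<Psi> (c z) (cis \<theta>))) \<and>
     (\<forall>p \<mu>. norm \<mu> = 1 \<longrightarrow> \<Psi> p \<mu> \<in> unitary_group) \<and>
     (\<forall>p. \<Psi> p 1 = mat 1)"

definition extended_solution ::
  "(riemann_sphere \<Rightarrow> complex^'n^'n) \<Rightarrow> (riemann_sphere \<Rightarrow> complex \<Rightarrow> complex^'n^'n) \<Rightarrow> bool" where
  "extended_solution \<psi> \<Psi> \<longleftrightarrow> smooth_loop_map \<Psi> \<and>
     (\<forall>c\<in>charts. \<forall>z \<mu>. norm \<mu> = 1 \<longrightarrow>
        matrix_inv (\<Psi> (c z) \<mu>) ** dz_mat (\<lambda>w. \<Psi> (c w) \<mu>) z = mat (1 - inverse \<mu>) ** A_z \<psi> c z \<and>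
        matrix_inv (\<Psi> (c z) \<mu>) ** dzbar_mat (\<lambda>w. \<Psi> (c w) \<mu>) z = mat (1 - \<mu>) ** A_zbar \<psi> c z)"

definition has_polynomial_extended_solution ::
  "(riemann_sphere \<Rightarrow> complex^'n^'n) \<Rightarrow> nat \<Rightarrow> bool" where
  "has_polynomial_extended_solution \<psi> r \<longleftrightarrow>
     (\<exists>\<Psi> A. extended_solution \<psi> \<Psi> \<and>
        (\<forall>p \<mu>. norm \<mu> = 1 \<longrightarrow> \<Psi> p \<mu> = (\<Sum>i\<le>r. mat (\<mu> ^ i) ** A i p)))"

definition has_uniton_number :: "(riemann_sphere \<Rightarrow> complex^'n^'n) \<Rightarrow> nat \<Rightarrow> bool" where
  "has_uniton_number \<psi> r \<longleftrightarrow> harmonic \<psi> \<and> has_polynomial_extended_solution \<psi> r \<and>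
     (\<forall>r'<r. \<not> has_polynomial_extended_solution \<psi> r')"


section \<open>The Grassmannian model\<close>

text \<open>An element of \<open>L\<^sup>2(S\<^sup>1, \<complex>\<^sup>n)\<close> is represented by all functions on the complex plane
  whose restrictions to the unit circle belong to its almost-everywhere class. All sets of functions
  below are closed under changing a function off the circle or on a null set of the circle.\<close>

definition L2_circle :: "(complex \<Rightarrow> complex^'n) set" where
  "L2_circle = {f. (\<lambda>\<theta>. f (cis \<theta>)) \<in> borel_measurable (lebesgue_on {0..2*pi}) \<and>
     integrable (lebesgue_on {0..2*pi}) (\<lambda>\<theta>. (norm (f (cis \<theta>)))\<^sup>2)}"

definition fourier_coeff :: "(complex \<Rightarrow> complex^'n) \<Rightarrow> int \<Rightarrow> complex^'n" where
  "fourier_coeff f k =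
     (\<chi> i. (\<integral>\<theta>. cis (- of_int k * \<theta>) * f (cis \<theta>) $ i \<partial>(lebesgue_on {0..2*pi})) / (2 * pi))"

definition H_plus :: "(complex \<Rightarrow> complex^'n) set" where
  "H_plus = {f \<in> L2_circle. \<forall>k<0. fourier_coeff f k = 0}"

definition W_bundle ::
  "(riemann_sphere \<Rightarrow> complex \<Rightarrow> complex^'n^'n) \<Rightarrow> riemann_sphere \<Rightarrow> (complex \<Rightarrow> complex^'n) set" where
  "W_bundle \<Psi> p = {g. \<exists>f\<in>H_plus. \<forall>\<mu>. norm \<mu> = 1 \<longrightarrow> g \<mu> = \<Psi> p \<mu> *v f \<mu>}"

text \<open>The last clause says that the linear span of the fibers is \<^term>\<open>H_plus\<close>. Because it contains
  the closed subspace \<open>\<lambda>\<^sup>r H_plus\<close> of finite codimension, this span is closed, so the algebraic span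
  and the closed span agree.\<close>

definition normalized_extended_solution ::
  "nat \<Rightarrow> (riemann_sphere \<Rightarrow> complex^'n^'n) \<Rightarrow> (riemann_sphere \<Rightarrow> complex \<Rightarrow> complex^'n^'n) \<Rightarrow> bool"
  where
  "normalized_extended_solution r \<psi> \<Psi> \<longleftrightarrow> extended_solution \<psi> \<Psi> \<and>
     (\<forall>p. \<forall>f\<in>H_plus. (\<lambda>\<mu>. \<mu> ^ r *s f \<mu>) \<in> W_bundle \<Psi> p) \<and>
     (\<forall>p. W_bundle \<Psi> p \<subseteq> H_plus) \<and>
     (\<forall>f\<in>H_plus. \<exists>(m::nat) p g a. (\<forall>i<m. g i \<in> W_bundle \<Psi> (p i)) \<and>
        (\<forall>\<mu>. norm \<mu> = 1 \<longrightarrow> f \<mu> = (\<Sum>i<m. a i *s g i \<mu>)))"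

text \<open>The position of an element in a finite linear order, counted from 0. For the numeral types
  this is the usual representative.\<close>

definition idx :: "'r::{finite,linorder} \<Rightarrow> nat" where
  "idx j = card {i. i < j}"

text \<open>\<open>\<complex>\<^sup>r\<^sup>n\<close> is modelled by the index type \<open>'r \<times> 'n\<close>, where \<open>r\<close> is the cardinality of \<open>'r\<close>:
  the component \<open>(j, i)\<close> is the \<open>i\<close>-th component of the coefficient of \<open>\<lambda>\<^sup>j\<close>.\<close>

definition poly_of ::
  "complex^('r::{finite,linorder} \<times> 'n::finite) \<Rightarrow> complex \<Rightarrow> complex^'n" where
  "poly_of v \<mu> = (\<chi> i. \<Sum>j\<in>UNIV. \<mu> ^ idx j * v $ (j, i))"

definition X_bundle ::
  "(riemann_sphere \<Rightarrow> complex \<Rightarrow> complex^'n^'n) \<Rightarrow> riemann_sphere \<Rightarrow>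
    (complex^('r::{finite,linorder} \<times> 'n::finite)) set" where
  "X_bundle \<Psi> p = {v. poly_of v \<in> W_bundle \<Psi> p}"


section \<open>Totally unramified maps\<close>

definition smooth_subbundle :: "nat \<Rightarrow> (riemann_sphere \<Rightarrow> (complex^'m) set) \<Rightarrow> bool" where
  "smooth_subbundle k Y \<longleftrightarrow> (\<forall>p. vec.subspace (Y p) \<and> vec.dim (Y p) = k) \<and>
     smooth_on_sphere (\<lambda>p. proj (Y p))"

text \<open>Holomorphic maps into the Grassmannian: locally the fibers have holomorphic frames.\<close>

definition holomorphic_subbundle :: "nat \<Rightarrow> (riemann_sphere \<Rightarrow> (complex^'m) set) \<Rightarrow> bool" where
  "holomorphic_subbundle k Y \<longleftrightarrow> smooth_subbundle k Y \<and>
     (\<forall>c\<in>charts. \<forall>z0. \<exists>U (f :: nat \<Rightarrow> complex \<Rightarrow> complex^'m). open U \<and> z0 \<in> U \<and>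
        (\<forall>i<k. \<forall>j. (\<lambda>z. f i z $ j) holomorphic_on U) \<and>
        (\<forall>z\<in>U. Y (c z) = vec.span ((\<lambda>i. f i z) ` {..<k})))"

text \<open>Smooth sections over the domain of a chart.\<close>

definition sections ::
  "(complex \<Rightarrow> riemann_sphere) \<Rightarrow> (riemann_sphere \<Rightarrow> (complex^'m) set) \<Rightarrow> (complex \<Rightarrow> complex^'m) set"
  where
  "sections c Y = {s. smooth s \<and> (\<forall>z. s z \<in> Y (c z))}"

text \<open>The matrix of the \<open>\<partial>_z\<close>-second fundamental form \<open>s \<mapsto> proj_perp \<partial>_z s\<close> at a point, extended by
  zero on the orthogonal complement of the fiber.\<close>

definition second_ff ::
  "(complex \<Rightarrow> riemann_sphere) \<Rightarrow> (riemann_sphere \<Rightarrow> (complex^'m) set) \<Rightarrow> complex \<Rightarrow> complex^'m^'m"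
  where
  "second_ff c Y z = (THE M.
     (\<forall>s\<in>sections c Y. M *v s z = proj_perp (Y (c z)) *v dz_vec s z) \<and>
     (\<forall>v. (\<forall>u\<in>Y (c z). hinner v u = 0) \<longrightarrow> M *v v = 0))"

text \<open>\<open>Z\<close> is the subbundle generated by the image of the second fundamental form of \<open>Y\<close>, with zeros
  filled out: it equals the image outside a finite set, and by continuity this determines it.\<close>

definition gauss_step ::
  "(riemann_sphere \<Rightarrow> (complex^'m) set) \<Rightarrow> (riemann_sphere \<Rightarrow> (complex^'m) set) \<Rightarrow> bool" where
  "gauss_step Y Z \<longleftrightarrow> (\<exists>k. smooth_subbundle k Z) \<and>
     (\<exists>F. finite F \<and> (\<forall>c\<in>charts. \<forall>z. c z \<notin> F \<longrightarrow>
        Z (c z) = (\<lambda>v. second_ff c Y z *v v) ` Y (c z)))"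

definition totally_unramified :: "(riemann_sphere \<Rightarrow> (complex^'m) set) \<Rightarrow> bool" where
  "totally_unramified Y \<longleftrightarrow> (\<exists>k. holomorphic_subbundle k Y) \<and>
     (\<exists>(G :: nat \<Rightarrow> riemann_sphere \<Rightarrow> (complex^'m) set) q.
        G 0 = Y \<and> (\<forall>i. gauss_step (G i) (G (Suc i))) \<and>
        (\<forall>p. G (Suc q) p = {0}) \<and> (\<forall>j<q. \<not> (\<forall>p. G (Suc j) p = {0})) \<and>
        (\<forall>i<q. \<forall>c\<in>charts. \<forall>z.
           det_on (G (Suc i) (c z))
             (second_ff c (G i) z ** ctranspose (second_ff c (G i) z)) \<noteq> 0))"

text \<open>The type argument \<open>'r\<close> carries the uniton number. Normalized extended solutions are unique up
  to left multiplication by a constant element of \<open>U(n)\<close>, which acts unitarily on \<^const>\<open>X_bundle\<close>, so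
  it does not matter which one is chosen.\<close>

definition totally_unramified_harmonic ::
  "'r::{finite,linorder} itself \<Rightarrow> (riemann_sphere \<Rightarrow> complex^'n::finite^'n) \<Rightarrow> bool" where
  "totally_unramified_harmonic _ \<psi> \<longleftrightarrow> has_uniton_number \<psi> CARD('r) \<and>
     (\<exists>\<Psi>. normalized_extended_solution CARD('r) \<psi> \<Psi> \<and>
        totally_unramified (X_bundle \<Psi> :: riemann_sphere \<Rightarrow> (complex^('r \<times> 'n)) set))"


section \<open>The Veronese sequence\<close>

text \<open>Here \<open>'m\<close> has \<open>N + 1\<close> elements, for a map into \<open>\<complex>P\<^sup>N\<close>. The second lift is
  \<open>w\<^sup>N f(1/w)\<close>, which spans the same line as \<open>f\<close> in the coordinate \<open>w = 1/z\<close> and extends over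
  \<open>w = 0\<close>. Rescaling the lift and changing the coordinate do not affect the span of the derivatives up
  to a given order, so the two cases of \<open>veronese\<close> fit together smoothly.\<close>

definition veronese_lift0 :: "complex \<Rightarrow> complex^'m::{finite,linorder}" where
  "veronese_lift0 z = (\<chi> k. of_real (sqrt (real ((CARD('m) - 1) choose idx k))) * z ^ idx k)"

definition veronese_lift1 :: "complex \<Rightarrow> complex^'m::{finite,linorder}" where
  "veronese_lift1 w =
     (\<chi> k. of_real (sqrt (real ((CARD('m) - 1) choose idx k))) * w ^ (CARD('m) - 1 - idx k))"

definition osculating :: "(complex \<Rightarrow> complex^'m) \<Rightarrow> nat \<Rightarrow> complex \<Rightarrow> (complex^'m) set" where
  "osculating f i z = vec.span ((\<lambda>l. (dz_vec ^^ l) f z) ` {..<i})"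

definition osculating_complement ::
  "(complex \<Rightarrow> complex^'m) \<Rightarrow> nat \<Rightarrow> complex \<Rightarrow> (complex^'m) set" where
  "osculating_complement f i z =
     {v \<in> osculating f (Suc i) z. \<forall>u\<in>osculating f i z. hinner v u = 0}"

fun veronese :: "nat \<Rightarrow> riemann_sphere \<Rightarrow> (complex^'m::{finite,linorder}) set" where
  "veronese i (Affine z) = osculating_complement veronese_lift0 i z"
| "veronese i Infty = osculating_complement veronese_lift1 i 0"

end

theory Submission imports Defs "HOL-Complex_Analysis.Complex_Analysis" "HOL-Computational_Algebra.Fundamental_Theorem_Algebra" begin

unbundle no Formal_Power_Series.fps_syntax

text \<open>Write the normalized extended solution as \<open>A0 + \<mu> A1 + \<mu>\<^sup>2 A2\<close>. Total unramifiedness makes \<open>A_z\<close> of rank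
  two everywhere and \<open>A0\<close>, \<open>A2\<close> of rank one; the range of \<open>A0\<close> is spanned by a polynomial curve \<open>f\<close>, and since
  neither the affine part nor infinity is ramified, its Wronskian forces degree two. With the extension class \<open>q\<close>, a
  polynomial of degree at most four, the function \<open>e = \<bar>f\<bar>\<^sup>2 \<bar>f \<times> f'\<bar>\<^sup>2 + \<bar>q\<bar>\<^sup>2\<close> is a potential of the energy
  density: \<open>E = dz (dzbar (ln e))\<close>. If \<open>E\<close> has constant curvature, two applications of Liouville's theorem give
  \<open>E = \<phi>\<^sup>-\<^sup>2\<close> and \<open>e = C \<phi>\<^sup>4\<close> with a positive Hermitian form \<open>\<phi>\<close> in \<open>(z, 1)\<close>. A Moebius transformation turns \<open>\<phi>\<close>
  into \<open>1 + \<bar>z\<bar>\<^sup>2\<close> and moves a zero of \<open>q\<close> to the origin; comparing coefficients then gives \<open>q = 0\<close> and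
  identifies \<open>f\<close> with the Veronese curve.\<close>

text \<open>The potential \<open>e\<close> comes from the Grassmannian model. Let n be the conjugate
  of f x f'. The fibre of X is spanned by (f, q n / |n|^2), (0, f) and (0, f'), and \<open>e\<close>
  is the Gram determinant of these vectors, that is, the squared norm of the Pluecker vector of X.
  Rank one of \<open>A_z\<close> has to be excluded separately: with conformality it gives
  \<open>A_z ** A_z = 0\<close>, and then some constant vector is orthogonal to all ranges of
  \<open>A0\<close>, against the fullness of a normalized solution. The obstacle is q: a priori it
  is only holomorphic, and the identity |f|^2 |f x f'|^2 + |q|^2 = C (1 + |z|^2)^4 mixes it with the
  first term. A zero of q at the origin separates them: polarize the identity and set one variable
  to 0; the q-term disappears, a product of two quadratic polynomials is a nonzero constant, so both
  are constant, and this is the orthogonality of the coefficients of f. The curvature constant is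
  not prescribed; it is forced by the growth orders |z|^-4 of \<open>E\<close> and |z|^8 of
  \<open>e\<close> at infinity.\<close>

abbreviation adj :: "complex^'m^'l => complex^'l^'m" where
  "adj == ctranspose"

section \<open>Calculus in one complex coordinate and Hermitian linear algebra\<close>

section \<open>Wirtinger derivatives\<close>

text \<open>Real differentiability and both Wirtinger derivatives in one predicate. The operators
  \<open>dz\<close> and \<open>dzbar\<close> have arbitrary values at points of
  non-differentiability, so the calculus rules are stated for the predicate; \<open>b = 0\<close>
  expresses complex differentiability.\<close>

definition has_wd :: "(complex => complex) => complex => complex => complex => bool" where
  "has_wd f a b z \<longleftrightarrow> (f has_derivative (\<lambda>t. a * t + b * cnj t)) (at z)"

lemma has_wd_frechet: "has_wd f a b z ==> frechet_derivative f (at z) = (\<lambda>t. a * t + b * cnj t)"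
  unfolding has_wd_def by (metis frechet_derivative_at)

lemma has_wd_pd: "has_wd f a b z ==> pd t f z = a * t + b * cnj t"
  by (simp add: pd_def has_wd_frechet)

lemma has_wd_dz: "has_wd f a b z ==> dz f z = a"
  by (simp add: dz_def has_wd_pd algebra_simps)

lemma has_wd_dzbar: "has_wd f a b z ==> dzbar f z = b"
  by (simp add: dzbar_def has_wd_pd algebra_simps)

lemma has_wd_unique: "has_wd f a b z ==> has_wd f c d z ==> a = c \<and> b = d"
  using has_wd_dz has_wd_dzbar by blast

lemma differentiable_has_wd:
  assumes "f differentiable (at z)" shows "has_wd f (dz f z) (dzbar f z) z"
proof -
  let ?T = "frechet_derivative f (at z)"
  have D: "(f has_derivative ?T) (at z)" using assms frechet_derivative_works by blast
  then have L: "linear ?T" by (simp add: has_derivative_linear)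
  have "?T t = dz f z * t + dzbar f z * cnj t" for t
  proof -
    have "t = Re t *\<^sub>R 1 + Im t *\<^sub>R \<i>" by (simp add: complex_eq_iff)
    then have "?T t = ?T (Re t *\<^sub>R 1 + Im t *\<^sub>R \<i>)" by (rule arg_cong)
    also have "\<dots> = Re t *\<^sub>R ?T 1 + Im t *\<^sub>R ?T \<i>"
      by (simp add: linear_add[OF L] linear_scale[OF L])
    also have "\<dots> = dz f z * t + dzbar f z * cnj t"
      by (simp add: dz_def dzbar_def pd_def complex_eq_iff algebra_simps add_divide_distrib diff_divide_distrib)
    finally show ?thesis .
  qed
  then have "?T = (\<lambda>t. dz f z * t + dzbar f z * cnj t)" by auto
  then show ?thesis using D by (simp add: has_wd_def)
qed

lemma has_wd_isCont: "has_wd f a b z ==> isCont f z"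
  unfolding has_wd_def using has_derivative_continuous by blast

lemma has_wd_const [intro]: "has_wd (\<lambda>w. c) 0 0 z"
  by (simp add: has_wd_def)

lemma has_wd_ident [intro]: "has_wd (\<lambda>w. w) 1 0 z"
  by (simp add: has_wd_def)

lemma has_wd_add: "has_wd f a b z ==> has_wd g c d z ==> has_wd (\<lambda>w. f w + g w) (a + c) (b + d) z"
  unfolding has_wd_def by (drule (1) has_derivative_add) (simp add: algebra_simps)

lemma has_wd_diff: "has_wd f a b z ==> has_wd g c d z ==> has_wd (\<lambda>w. f w - g w) (a - c) (b - d) z"
  unfolding has_wd_def by (drule (1) has_derivative_diff) (simp add: algebra_simps)

lemma has_wd_mult:
  "has_wd f a b z ==> has_wd g c d z ==> has_wd (\<lambda>w. f w * g w) (a * g z + f z * c) (b * g z + f z * d) z"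
  unfolding has_wd_def by (drule (1) has_derivative_mult) (simp add: algebra_simps)

lemma has_wd_cnj: "has_wd f a b z ==> has_wd (\<lambda>w. cnj (f w)) (cnj b) (cnj a) z"
  unfolding has_wd_def by (drule has_derivative_cnj) (simp add: algebra_simps)

lemma has_wd_sum:
  "finite I ==> (!!i. i \<in> I ==> has_wd (f i) (a i) (b i) z) ==>
    has_wd (\<lambda>w. \<Sum>i\<in>I. f i w) (\<Sum>i\<in>I. a i) (\<Sum>i\<in>I. b i) z"
  by (induction I rule: finite_induct) (auto intro!: has_wd_add)

lemma has_wd_inverse:
  assumes "has_wd f a b z" "f z ~= 0"
  shows "has_wd (\<lambda>w. inverse (f w)) (- a / (f z)\<^sup>2) (- b / (f z)\<^sup>2) z"
  unfolding has_wd_def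
  by (rule has_derivative_eq_rhs[OF Deriv.has_derivative_inverse[OF assms(2) assms(1)[unfolded has_wd_def]]])
     (simp add: fun_eq_iff power2_eq_square divide_inverse algebra_simps)

lemma has_wd_divide:
  assumes "has_wd f a b z" "has_wd g c d z" "g z ~= 0"
  shows "has_wd (\<lambda>w. f w / g w) ((a * g z - f z * c) / (g z)\<^sup>2) ((b * g z - f z * d) / (g z)\<^sup>2) z"
proof -
  have "has_wd (\<lambda>w. f w * inverse (g w)) (a * inverse (g z) + f z * (- c / (g z)\<^sup>2))
     (b * inverse (g z) + f z * (- d / (g z)\<^sup>2)) z"
    by (intro has_wd_mult has_wd_inverse assms)
  moreover have "x * inverse y + u * (- v / y\<^sup>2) = (x * y - u * v) / y\<^sup>2" if "y ~= 0" for x y u v :: complex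
    using that by (simp add: field_simps power2_eq_square)
  moreover have "(\<lambda>w. f w / g w) = (\<lambda>w. f w * inverse (g w))" by (simp add: divide_inverse)
  ultimately show ?thesis using assms(3) by (metis (no_types, lifting))
qed

lemma has_wd_field_derivative: "has_wd f a 0 z \<longleftrightarrow> (f has_field_derivative a) (at z)"
  by (simp add: has_wd_def has_field_derivative_def)

lemma has_wd_compose_holo:
  assumes "(g has_field_derivative g') (at z)" "has_wd f a b (g z)"
  shows "has_wd (\<lambda>w. f (g w)) (a * g') (b * cnj g') z"
  using has_derivative_compose[OF assms(1)[unfolded has_field_derivative_def] assms(2)[unfolded has_wd_def]]
  unfolding has_wd_def by (simp add: algebra_simps)

lemma has_wd_transform:
  assumes "has_wd f a b z" "open S" "z \<in> S" "!!w. w \<in> S ==> f w = g w"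
  shows "has_wd g a b z"
  using has_derivative_transform_within_open[OF assms(1)[unfolded has_wd_def] assms(2,3,4)]
  by (simp add: has_wd_def)

lemma has_wd_eq: "has_wd f a b z ==> a = a' ==> b = b' ==> has_wd f a' b' z"
  by simp

lemma has_wd_zero_imp_constant:
  assumes "!!z. has_wd f 0 0 z" shows "f z = f w"
proof -
  have "(f has_field_derivative 0) (at z)" for z
    using assms by (simp add: has_wd_field_derivative)
  then obtain c where "\<forall>x\<in>UNIV. f x = c"
    using has_field_derivative_zero_constant[of UNIV f] by auto
  then show ?thesis by simp
qed

lemma has_wd_real_fun:
  fixes u :: "complex => real"
  assumes u: "has_wd (\<lambda>w. of_real (u w)) a b z" and h: "(h has_real_derivative h') (at (u z))"
  shows "has_wd (\<lambda>w. of_real (h (u w))) (of_real h' * a) (of_real h' * b) z"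
proof -
  have 1: "(u has_derivative (\<lambda>t. Re (a * t + b * cnj t))) (at z)"
    using has_derivative_Re[OF u[unfolded has_wd_def]] by simp
  \<comment> \<open>The function is real-valued, so its derivative has no imaginary part; this
    allows the real chain rule to be read back as an expression in \<open>t\<close> and
    \<open>cnj t\<close>.\<close>
  have 2: "Im (a * t + b * cnj t) = 0" for t
    using has_derivative_unique[OF has_derivative_Im[OF u[unfolded has_wd_def]], of "\<lambda>t. 0"]
    by (simp add: fun_eq_iff)
  have "((\<lambda>w. h (u w)) has_derivative (\<lambda>t. h' * Re (a * t + b * cnj t))) (at z)"
    using has_derivative_compose[OF 1 h[unfolded has_field_derivative_def]] by simp
  then have "((\<lambda>w. of_real (h (u w))) has_derivative (\<lambda>t. complex_of_real (h' * Re (a * t + b * cnj t)))) (at z)"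
    by (rule has_derivative_of_real)
  moreover have "complex_of_real (h' * Re (a * t + b * cnj t)) = of_real h' * a * t + of_real h' * b * cnj t" for t
  proof -
    have "complex_of_real (Re (a * t + b * cnj t)) = a * t + b * cnj t"
      using 2[of t] by (simp add: complex_eq_iff del: times_complex.simps plus_complex.simps)
    then have "complex_of_real (h' * Re (a * t + b * cnj t)) = of_real h' * (a * t + b * cnj t)"
      by (metis of_real_mult)
    then show ?thesis by (simp add: algebra_simps)
  qed
  ultimately show ?thesis unfolding has_wd_def by simp
qed

subsection \<open>Vector and matrix valued maps\<close>

definition vwd :: "(complex => complex^'m) => complex^'m => complex^'m => complex => bool" where
  "vwd s p q z \<longleftrightarrow> (\<forall>i. has_wd (\<lambda>w. s w $ i) (p $ i) (q $ i) z)"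

definition mwd :: "(complex => complex^'m^'l) => complex^'m^'l => complex^'m^'l => complex => bool" where
  "mwd F P Q z \<longleftrightarrow> (\<forall>i j. has_wd (\<lambda>w. F w $ i $ j) (P $ i $ j) (Q $ i $ j) z)"

lemma vwd_dz: "vwd s p q z ==> dz_vec s z = p"
  by (auto simp: vwd_def dz_vec_def vec_eq_iff intro!: has_wd_dz)

lemma mwd_dz: "mwd F P Q z ==> dz_mat F z = P"
  by (auto simp: mwd_def dz_mat_def vec_eq_iff intro!: has_wd_dz)

lemma mwd_dzbar: "mwd F P Q z ==> dzbar_mat F z = Q"
  by (auto simp: mwd_def dzbar_mat_def vec_eq_iff intro!: has_wd_dzbar)

lemma mwd_unique: "mwd F P Q z ==> mwd F P' Q' z ==> P = P' \<and> Q = Q'"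
  using mwd_dz mwd_dzbar by blast

lemma vwd_unique: "vwd F P Q z ==> vwd F P' Q' z ==> P = P' \<and> Q = Q'"
  unfolding vwd_def vec_eq_iff using has_wd_unique by blast

lemma vwd_transform:
  assumes "vwd f a b z" "open S" "z \<in> S" "!!w. w \<in> S ==> f w = g w"
  shows "vwd g a b z"
  unfolding vwd_def
proof
  fix i show "has_wd (\<lambda>w. g w $ i) (a $ i) (b $ i) z"
    by (rule has_wd_transform[of "\<lambda>w. f w $ i" "a $ i" "b $ i" z S]) (use assms in \<open>auto simp: vwd_def\<close>)
qed

lemma mwd_transform:
  assumes "mwd f a b z" "open S" "z \<in> S" "!!w. w \<in> S ==> f w = g w"
  shows "mwd g a b z"
  unfolding mwd_def
proof (intro allI)
  fix i j show "has_wd (\<lambda>w. g w $ i $ j) (a $ i $ j) (b $ i $ j) z"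
    by (rule has_wd_transform[of "\<lambda>w. f w $ i $ j" "a $ i $ j" "b $ i $ j" z S]) (use assms in \<open>auto simp: mwd_def\<close>)
qed

lemma mwd_const [intro]: "mwd (\<lambda>w. C) 0 0 z"
  by (auto simp: mwd_def)

lemma vwd_const [intro]: "vwd (\<lambda>w. C) 0 0 z"
  by (auto simp: vwd_def)

lemma mwd_add: "mwd F P Q z ==> mwd H R S z ==> mwd (\<lambda>w. F w + H w) (P + R) (Q + S) z"
  by (auto simp: mwd_def intro!: has_wd_add)

lemma mwd_diff: "mwd F P Q z ==> mwd H R S z ==> mwd (\<lambda>w. F w - H w) (P - R) (Q - S) z"
  by (auto simp: mwd_def intro!: has_wd_diff)

lemma mwd_mult:
  assumes "mwd F P Q z" "mwd H R S z"
  shows "mwd (\<lambda>w. F w ** H w) (P ** H z + F z ** R) (Q ** H z + F z ** S) z"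
  unfolding mwd_def matrix_matrix_mult_def
proof (intro allI)
  fix i j
  have "has_wd (\<lambda>w. \<Sum>k\<in>UNIV. F w $ i $ k * H w $ k $ j)
     (\<Sum>k\<in>UNIV. P $ i $ k * H z $ k $ j + F z $ i $ k * R $ k $ j)
     (\<Sum>k\<in>UNIV. Q $ i $ k * H z $ k $ j + F z $ i $ k * S $ k $ j) z"
    using assms by (intro has_wd_sum has_wd_mult) (auto simp: mwd_def)
  then show "has_wd (\<lambda>w. (\<chi> i j. \<Sum>k\<in>UNIV. F w $ i $ k * H w $ k $ j) $ i $ j)
     (((\<chi> i j. \<Sum>k\<in>UNIV. P $ i $ k * H z $ k $ j) + (\<chi> i j. \<Sum>k\<in>UNIV. F z $ i $ k * R $ k $ j)) $ i $ j)
     (((\<chi> i j. \<Sum>k\<in>UNIV. Q $ i $ k * H z $ k $ j) + (\<chi> i j. \<Sum>k\<in>UNIV. F z $ i $ k * S $ k $ j)) $ i $ j) z"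
    by (simp add: sum.distrib)
qed

lemma mwd_mult_vec:
  assumes "mwd F P Q z" "vwd s p q z"
  shows "vwd (\<lambda>w. F w *v s w) (P *v s z + F z *v p) (Q *v s z + F z *v q) z"
  unfolding vwd_def matrix_vector_mult_def
proof (intro allI)
  fix i
  have "has_wd (\<lambda>w. \<Sum>k\<in>UNIV. F w $ i $ k * s w $ k)
     (\<Sum>k\<in>UNIV. P $ i $ k * s z $ k + F z $ i $ k * p $ k)
     (\<Sum>k\<in>UNIV. Q $ i $ k * s z $ k + F z $ i $ k * q $ k) z"
    using assms by (intro has_wd_sum has_wd_mult) (auto simp: mwd_def vwd_def)
  then show "has_wd (\<lambda>w. (\<chi> i. \<Sum>j\<in>UNIV. F w $ i $ j * s w $ j) $ i)
          (((\<chi> i. \<Sum>j\<in>UNIV. P $ i $ j * s z $ j) + (\<chi> i. \<Sum>j\<in>UNIV. F z $ i $ j * p $ j)) $ i)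
          (((\<chi> i. \<Sum>j\<in>UNIV. Q $ i $ j * s z $ j) + (\<chi> i. \<Sum>j\<in>UNIV. F z $ i $ j * q $ j)) $ i) z"
    by (simp add: sum.distrib)
qed

lemma mwd_ctranspose: "mwd F P Q z ==> mwd (\<lambda>w. adj (F w)) (adj Q) (adj P) z"
  by (auto simp: mwd_def ctranspose_def intro!: has_wd_cnj)

lemma mwd_trace: "mwd F P Q z ==> has_wd (\<lambda>w. trace (F w)) (trace P) (trace Q) z"
  by (auto simp: mwd_def trace_def intro!: has_wd_sum)

section \<open>Smooth maps\<close>

lemma Ck_SucD: "Ck (Suc k) f ==> Ck k f"
proof (induction k arbitrary: f)
  case 0
  then have "isCont f x" for x by (simp add: differentiable_imp_continuous_within)
  then show ?case by (simp add: continuous_at_imp_continuous_on)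
next
  case (Suc k)
  have *: "(\<forall>x. f differentiable (at x)) \<and>
     (\<forall>b\<in>Basis. Ck (Suc k) (\<lambda>x. frechet_derivative f (at x) b))"
    using Suc.prems by (rule Ck.simps(2)[THEN iffD1])
  show ?case
    by (rule Ck.simps(2)[THEN iffD2]) (use * Suc.IH in blast)
qed

lemma Ck_const: "Ck k (\<lambda>x. c)"
proof (induction k arbitrary: c)
  case (Suc k)
  then show ?case by (simp add: frechet_derivative_const)
qed simp

lemma Ck_has_derivative: "Ck (Suc k) f ==> (f has_derivative frechet_derivative f (at x)) (at x)"
  using frechet_derivative_works[of f "at x"] by simp

lemma Ck_SucI:
  assumes f': "!!x. (f has_derivative f' x) (at x)" and k: "!!b. b \<in> Basis ==> Ck k (\<lambda>x. f' x b)"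
  shows "Ck (Suc k) f"
proof -
  have "frechet_derivative f (at x) = f' x" for x
    using frechet_derivative_at[OF f'[of x]] by (rule sym)
  moreover have "f differentiable (at x)" for x
    unfolding differentiable_def using f' by blast
  ultimately show ?thesis using k by simp
qed

lemma Ck_bounded_linear: "bounded_linear L ==> Ck k f ==> Ck k (\<lambda>x. L (f x))"
proof (induction k arbitrary: f)
  case 0
  then show ?case by (simp add: bounded_linear.continuous_on)
next
  case (Suc k)
  show ?case
    by (rule Ck_SucI, rule bounded_linear.has_derivative[OF Suc.prems(1) Ck_has_derivative[OF Suc.prems(2)]])
       (use Suc in simp)
qed

lemma Ck_add: "Ck k f ==> Ck k g ==> Ck k (\<lambda>x. f x + g x)"
proof (induction k arbitrary: f g)
  case 0
  then show ?case by (simp add: continuous_on_add)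
next
  case (Suc k)
  show ?case
    by (rule Ck_SucI, rule has_derivative_add[OF Ck_has_derivative[OF Suc.prems(1)] Ck_has_derivative[OF Suc.prems(2)]])
       (use Suc in simp)
qed

lemma Ck_bilinear:
  fixes f :: "'a::euclidean_space => 'b::real_normed_vector"
  shows "bounded_bilinear B ==> Ck k f ==> Ck k g ==> Ck k (\<lambda>x. B (f x) (g x))"
proof (induction k arbitrary: f g)
  case 0
  then show ?case by (simp add: bounded_bilinear.continuous_on)
next
  case (Suc k)
  show ?case
  proof (rule Ck_SucI, rule bounded_bilinear.FDERIV[OF Suc.prems(1)
        Ck_has_derivative[OF Suc.prems(2)] Ck_has_derivative[OF Suc.prems(3)]], rule Ck_add)
    fix b :: 'a assume "b \<in> Basis"
    then show "Ck k (\<lambda>x. B (f x) (frechet_derivative g (at x) b))"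
      using Suc.IH[OF Suc.prems(1)] Ck_SucD[OF Suc.prems(2)] Suc.prems(3) by simp
    show "Ck k (\<lambda>x. B (frechet_derivative f (at x) b) (g x))"
      using Suc.IH[OF Suc.prems(1)] Ck_SucD[OF Suc.prems(3)] Suc.prems(2) \<open>b \<in> Basis\<close> by simp
  qed
qed

lemma smooth_const: "smooth (\<lambda>x. c)" by (simp add: smooth_def Ck_const)

lemma smooth_bounded_linear: "bounded_linear L ==> smooth f ==> smooth (\<lambda>x. L (f x))"
  by (simp add: smooth_def Ck_bounded_linear)

lemma smooth_add: "smooth f ==> smooth g ==> smooth (\<lambda>x. f x + g x)"
  by (simp add: smooth_def Ck_add)

lemma smooth_mult:
  fixes f g :: "'a::euclidean_space => 'b::real_normed_algebra"
  shows "smooth f ==> smooth g ==> smooth (\<lambda>x. f x * g x)"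
  by (simp add: smooth_def Ck_bilinear[OF bounded_bilinear_mult])

lemma smooth_sum: "finite I ==> (!!i. i \<in> I ==> smooth (f i)) ==> smooth (\<lambda>x. \<Sum>i\<in>I. f i x)"
  by (induction I rule: finite_induct) (auto intro: smooth_add smooth_const)

lemma smooth_cnj: "smooth f ==> smooth (\<lambda>x. cnj (f x))"
  by (rule smooth_bounded_linear[OF bounded_linear_cnj])

lemma smooth_differentiable: "smooth f ==> f differentiable (at x)"
  unfolding smooth_def by (metis Ck.simps(2))

lemma smooth_continuous: "smooth f ==> continuous_on S f"
  unfolding smooth_def by (metis Ck.simps(1) continuous_on_subset top_greatest)

lemma smooth_frechet: "smooth f ==> b \<in> Basis ==> smooth (\<lambda>x. frechet_derivative f (at x) b)"
  unfolding smooth_def by (metis Ck.simps(2))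

lemma smooth_pd_basis: "smooth f ==> smooth (pd 1 f)" "smooth f ==> smooth (pd \<i> f)"
  unfolding pd_def[abs_def] by (auto intro!: smooth_frechet simp: Basis_complex_def)

lemma smooth_cmult: "smooth f ==> smooth (\<lambda>x. c * f x)" for c :: "'b::real_normed_algebra"
  by (rule smooth_mult[OF smooth_const])

lemma smooth_dz: assumes "smooth f" shows "smooth (dz f)"
proof -
  have "smooth (\<lambda>z. (1/2) * pd 1 f z + (- \<i>/2) * pd \<i> f z)"
    by (rule smooth_add; rule smooth_cmult; rule smooth_pd_basis; rule assms)
  then show ?thesis unfolding dz_def[abs_def] by (simp add: algebra_simps diff_divide_distrib)
qed

lemma smooth_has_wd: "smooth f ==> has_wd f (dz f z) (dzbar f z) z"
  by (simp add: smooth_differentiable differentiable_has_wd)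

lemma smooth_vec_nth: "smooth f ==> smooth (\<lambda>x. f x $ i)"
  by (rule smooth_bounded_linear[OF bounded_linear_vec_nth])

lemma bounded_linear_axis: "bounded_linear (axis i :: 'b::euclidean_space => 'b^'n)"
  by (intro linear_conv_bounded_linear[THEN iffD1] linearI) (auto simp: axis_def vec_eq_iff)

lemma smooth_vecI:
  fixes f :: "'a::euclidean_space => 'b::euclidean_space^'n"
  assumes "!!i. smooth (\<lambda>x. f x $ i)" shows "smooth f"
proof -
  have "(\<Sum>i\<in>UNIV. axis i (f x $ i)) = f x" for x
    unfolding vec_eq_iff sum_component axis_def by simp
  moreover have "smooth (\<lambda>x. \<Sum>i\<in>UNIV. axis i (f x $ i))"
    by (rule smooth_sum, simp, rule smooth_bounded_linear[OF bounded_linear_axis assms])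
  ultimately show ?thesis by simp
qed

lemma smooth_vwd:
  fixes s :: "complex => complex^'m"
  assumes "smooth s" shows "\<exists>q. vwd s (dz_vec s z) q z"
proof (rule exI)
  show "vwd s (dz_vec s z) (\<chi> i. dzbar (\<lambda>w. s w $ i) z) z"
    using smooth_has_wd[OF smooth_vec_nth[OF assms]] by (simp add: vwd_def dz_vec_def)
qed

lemma smooth_mwd:
  fixes F :: "complex => complex^'m^'l"
  assumes "smooth F" shows "mwd F (dz_mat F z) (dzbar_mat F z) z"
  using smooth_has_wd[OF smooth_vec_nth[OF smooth_vec_nth[OF assms]]]
  by (simp add: mwd_def dz_mat_def dzbar_mat_def)

lemma smooth_matI:
  fixes F :: "'a::euclidean_space => complex^'m^'l"
  assumes "!!i j. smooth (\<lambda>x. F x $ i $ j)" shows "smooth F"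
  by (rule smooth_vecI, rule smooth_vecI, rule assms)

lemma smooth_dz_mat:
  fixes F :: "complex => complex^'m^'l"
  assumes "smooth F" shows "smooth (dz_mat F)"
proof (rule smooth_matI)
  fix i j
  have "smooth (dz (\<lambda>w. F w $ i $ j))"
    by (rule smooth_dz, rule smooth_vec_nth, rule smooth_vec_nth, rule assms)
  then show "smooth (\<lambda>x. dz_mat F x $ i $ j)" by (simp add: dz_mat_def)
qed

text \<open>Extended solutions are jointly smooth in the point and the loop angle. Freezing the
  angle makes their values at fixed loop parameters smooth in the point.\<close>

lemma Ck_slice:
  fixes f :: "'a::euclidean_space \<times> 'b::euclidean_space => 'c::real_normed_vector"
  shows "Ck k f ==> Ck k (\<lambda>x. f (x, t))"
proof (induction k arbitrary: f)
  case 0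
  then have "continuous_on UNIV f" by simp
  then have "continuous_on UNIV (\<lambda>x. f (x, t))"
    by (rule continuous_on_compose2) (auto intro: continuous_intros)
  then show ?case by simp
next
  case (Suc k)
  have 1: "((\<lambda>x. (x, t)) has_derivative (\<lambda>h. (h, 0))) (at x)" for x
    by (rule has_derivative_Pair[OF has_derivative_ident has_derivative_const])
  show ?case
  proof (rule Ck_SucI, rule has_derivative_compose[OF 1 Ck_has_derivative[OF Suc.prems]])
    fix b :: 'a assume "b \<in> Basis"
    then have "(b, 0) \<in> (Basis :: ('a \<times> 'b) set)" by (simp add: Basis_prod_def)
    then show "Ck k (\<lambda>x. frechet_derivative f (at (x, t)) (b, 0))"
      using Suc.IH[of "\<lambda>p. frechet_derivative f (at p) (b, 0)"] Suc.prems by simp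
  qed
qed

lemma smooth_slice: "smooth f ==> smooth (\<lambda>x. f (x, t))"
  by (simp add: smooth_def Ck_slice)

section \<open>Hermitian linear algebra\<close>

lemma matrix_add_rdistrib': "(A + B) ** C = A ** C + B ** C"
  for A B :: "'a::semiring_1^'n^'m"
  by (vector matrix_matrix_mult_def sum.distrib[symmetric] field_simps)

lemma matrix_diff_ldistrib: "A ** (B - C) = A ** B - A ** C"
  for A :: "'a::ring_1^'n^'m"
  by (simp add: vec_eq_iff matrix_matrix_mult_def sum_subtractf algebra_simps)

lemma matrix_diff_rdistrib: "(A - B) ** C = A ** C - B ** C"
  for A :: "'a::ring_1^'n^'m"
  by (simp add: vec_eq_iff matrix_matrix_mult_def sum_subtractf algebra_simps)

lemma matrix_minus_left: "(- A) ** B = - (A ** B)"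
  for A :: "'a::ring_1^'n^'m"
  by (simp add: vec_eq_iff matrix_matrix_mult_def sum_negf)

lemma matrix_minus_right: "A ** (- B) = - (A ** B)"
  for A :: "'a::ring_1^'n^'m"
  by (simp add: vec_eq_iff matrix_matrix_mult_def sum_negf)

lemma matrix_zero_left [simp]: "0 ** B = (0 :: 'a::ring_1^'n^'m)"
  by (simp add: vec_eq_iff matrix_matrix_mult_def)

lemma matrix_zero_right [simp]: "A ** 0 = (0 :: 'a::ring_1^'n^'m)"
  by (simp add: vec_eq_iff matrix_matrix_mult_def)

lemma matrix_minus_vec: "(- A) *v x = - (A *v x)"
  for A :: "'a::ring_1^'n^'m"
  by (simp add: vec_eq_iff matrix_vector_mult_def sum_negf)

lemma matrix_vec_minus: "A *v (- x) = - (A *v x)"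
  for A :: "'a::ring_1^'n^'m"
  by (simp add: vec_eq_iff matrix_vector_mult_def sum_negf)

lemmas matrix_distribs = matrix_add_ldistrib matrix_add_rdistrib' matrix_diff_ldistrib
  matrix_diff_rdistrib matrix_minus_left matrix_minus_right

lemmas vector_distribs = matrix_vector_right_distrib matrix_vector_mult_diff_distrib
  matrix_vector_mult_add_rdistrib matrix_vector_mult_diff_rdistrib matrix_minus_vec matrix_vec_minus

lemma mat_mult_entry [simp]: "(mat c ** A) $ i $ j = c * A $ i $ j"
  for A :: "'a::comm_semiring_1^'n^'m"
  by (simp add: matrix_matrix_mult_def mat_def if_distrib if_distribR cong: if_cong)

lemma matrix_mult_mat_commute: "A ** mat c = mat c ** A"
  for A :: "'a::comm_semiring_1^'n^'m"
  by (simp add: vec_eq_iff) (simp add: matrix_matrix_mult_def mat_def if_distrib if_distribR mult.commute cong: if_cong)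

lemma mat_mult_vec: "(mat c ** A) *v x = c *s (A *v x)"
  for A :: "'a::comm_semiring_1^'n^'m"
  by (simp add: vec_eq_iff matrix_vector_mult_def sum_distrib_left mult.assoc)

lemma matrix_eqI: "(!!x. A *v x = B *v x) ==> A = B"
  for A :: "'a::comm_semiring_1^'n^'m"
  by (simp add: matrix_eq)

lemma ctranspose_nth [simp]: "adj A $ i $ j = cnj (A $ j $ i)"
  by (simp add: ctranspose_def)

lemma ctranspose_ctranspose [simp]: "adj (adj A) = A"
  by (simp add: vec_eq_iff)

lemma ctranspose_mult: "adj (A ** B) = adj B ** adj A"
  by (simp add: vec_eq_iff matrix_matrix_mult_def mult.commute)

lemma ctranspose_add: "adj (A + B) = adj A + adj B"
  by (simp add: vec_eq_iff)

lemma ctranspose_diff: "adj (A - B) = adj A - adj B"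
  by (simp add: vec_eq_iff)

lemma ctranspose_minus: "adj (- A) = - adj A"
  by (simp add: vec_eq_iff)

lemma ctranspose_zero [simp]: "adj 0 = 0"
  by (simp add: vec_eq_iff)

lemma ctranspose_mat [simp]: "adj (mat c) = mat (cnj c)"
  by (simp add: vec_eq_iff mat_def)

lemmas ctranspose_simps = ctranspose_mult ctranspose_add ctranspose_diff ctranspose_minus

lemma hinner_add_left: "hinner (u + v) w = hinner u w + hinner v w"
  by (simp add: hinner_def sum.distrib algebra_simps)
lemma hinner_add_right: "hinner w (u + v) = hinner w u + hinner w v"
  by (simp add: hinner_def sum.distrib algebra_simps)
lemma hinner_diff_left: "hinner (u - v) w = hinner u w - hinner v w"
  by (simp add: hinner_def sum_subtractf algebra_simps)
lemma hinner_diff_right: "hinner w (u - v) = hinner w u - hinner w v"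
  by (simp add: hinner_def sum_subtractf algebra_simps)
lemma hinner_minus_left: "hinner (- u) w = - hinner u w"
  by (simp add: hinner_def sum_negf)
lemma hinner_minus_right: "hinner w (- u) = - hinner w u"
  by (simp add: hinner_def sum_negf)
lemma hinner_scale_left: "hinner (c *s u) w = c * hinner u w"
  by (simp add: hinner_def sum_distrib_left algebra_simps)
lemma hinner_scale_right: "hinner w (c *s u) = cnj c * hinner w u"
  by (simp add: hinner_def sum_distrib_left algebra_simps)
lemma hinner_zero_left [simp]: "hinner 0 w = 0"
  by (simp add: hinner_def)
lemma hinner_zero_right [simp]: "hinner w 0 = 0"
  by (simp add: hinner_def)
lemma hinner_cnj: "cnj (hinner v w) = hinner w v"
  by (simp add: hinner_def mult.commute)

lemmas hinner_simps = hinner_add_left hinner_add_right hinner_diff_left hinner_diff_right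
  hinner_minus_left hinner_minus_right hinner_scale_left hinner_scale_right

lemma hinner_swap_zero: "hinner v w = 0 ==> hinner w v = 0"
  by (metis hinner_cnj complex_cnj_zero)

lemma hinner_matrix: "hinner (M *v v) w = hinner v (adj M *v w)"
proof -
  have "hinner (M *v v) w = (\<Sum>i\<in>UNIV. \<Sum>j\<in>UNIV. M $ i $ j * v $ j * cnj (w $ i))"
    by (simp add: hinner_def matrix_vector_mult_def sum_distrib_right)
  also have "\<dots> = (\<Sum>j\<in>UNIV. \<Sum>i\<in>UNIV. M $ i $ j * v $ j * cnj (w $ i))"
    by (rule sum.swap)
  also have "\<dots> = hinner v (adj M *v w)"
    by (simp add: hinner_def matrix_vector_mult_def sum_distrib_left algebra_simps)
  finally show ?thesis .
qed

lemma hinner_matrix_right: "hinner v (M *v w) = hinner (adj M *v v) w"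
  by (simp add: hinner_matrix)

lemma hinner_self: "hinner v v = of_real ((norm v)\<^sup>2)"
proof -
  have "(norm v)\<^sup>2 = (\<Sum>i\<in>UNIV. (norm (v $ i))\<^sup>2)"
    by (simp add: norm_vec_def L2_set_def sum_nonneg)
  moreover have "v $ i * cnj (v $ i) = of_real ((norm (v $ i))\<^sup>2)" for i
    by (rule complex_norm_square[symmetric])
  ultimately show ?thesis by (simp add: hinner_def)
qed

lemma hinner_self_zero [simp]: "hinner v v = 0 \<longleftrightarrow> v = 0"
  by (simp add: hinner_self)

lemma hinner_eqI: "(!!w. hinner v w = hinner v' w) ==> v = v'"
  by (metis hinner_diff_left hinner_self_zero eq_iff_diff_eq_0)

definition outer :: "complex^'l => complex^'m => complex^'m^'l" where
  "outer v w = (\<chi> i j. v $ i * cnj (w $ j))"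

lemma outer_nth [simp]: "outer v w $ i $ j = v $ i * cnj (w $ j)"
  by (simp add: outer_def)

lemma outer_vec: "outer v w *v x = hinner x w *s v"
  by (simp add: vec_eq_iff matrix_vector_mult_def hinner_def sum_distrib_left sum_distrib_right mult_ac)

lemma ctranspose_outer [simp]: "adj (outer v w) = outer w v"
  by (simp add: vec_eq_iff)

lemma matrix_mult_outer: "M ** outer v w = outer (M *v v) w"
  by (simp add: vec_eq_iff matrix_matrix_mult_def matrix_vector_mult_def sum_distrib_left sum_distrib_right mult_ac)

lemma outer_matrix_mult: "outer v w ** M = outer v (adj M *v w)"
  by (simp add: vec_eq_iff matrix_matrix_mult_def matrix_vector_mult_def sum_distrib_left mult_ac)

lemma trace_outer: "trace (outer v w) = hinner v w"
  by (simp add: trace_def hinner_def)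

text \<open>Gram-Schmidt for projections: a new spanning vector \<open>b\<close> contributes the
  rank-one projection onto its residual \<open>c = b - P *v b\<close>, unless that residual
  vanishes.\<close>

lemma projection_exists:
  fixes B :: "(complex^'m) set"
  assumes "finite B"
  shows "\<exists>P. adj P = P \<and> P ** P = P \<and> range ((*v) P) = vec.span B"
  using assms
proof (induction B rule: finite_induct)
  case empty
  have "range ((*v) (0 :: complex^'m^'m)) = {0}" by auto
  then show ?case by (intro exI[of _ 0]) simp
next
  case (insert b B)
  then obtain P where P: "adj P = P" "P ** P = P" "range ((*v) P) = vec.span B" by blast
  have PP: "P *v (P *v x) = P *v x" for x by (simp add: matrix_vector_mul_assoc P)
  have fix_span: "P *v y = y" if "y \<in> vec.span B" for y
    using that PP unfolding P(3)[symmetric] by auto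
  define c where "c = b - P *v b"
  show ?case
  proof (cases "c = 0")
    case True
    then have "b \<in> vec.span B" using P(3) unfolding c_def by (metis eq_iff_diff_eq_0 rangeI)
    then have "vec.span (insert b B) = vec.span B" by (rule vec.span_redundant)
    then show ?thesis using P by auto
  next
    case False
    define r where "r = hinner c c"
    have r: "r ~= 0" using False by (simp add: r_def)
    have rr: "cnj r = r" by (simp add: r_def hinner_cnj)
    have Pc: "P *v c = 0" by (simp add: c_def vector_distribs PP)
    have cP: "hinner (P *v x) c = 0" for x by (simp add: hinner_matrix P Pc)
    have bc: "hinner b c = r" using cP[of b] by (simp add: r_def c_def hinner_simps)
    define Q where "Q = P + mat (1 / r) ** outer c c"
    have Qv: "Q *v x = P *v x + (hinner x c / r) *s c" for x
      by (simp add: Q_def vector_distribs mat_mult_vec outer_vec vec.scale_scale)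
    have "adj Q = Q"
      by (simp add: Q_def ctranspose_simps P rr matrix_mult_mat_commute)
    moreover have "Q ** Q = Q"
    proof (rule matrix_eqI)
      fix x show "(Q ** Q) *v x = Q *v x"
        using r by (simp add: matrix_vector_mul_assoc[symmetric] Qv vector_distribs vector_scalar_commute
            PP Pc hinner_simps cP r_def[symmetric])
    qed
    moreover have "range ((*v) Q) = vec.span (insert b B)"
    proof
      show "range ((*v) Q) \<subseteq> vec.span (insert b B)"
      proof safe
        fix x
        have "P *v y \<in> vec.span (insert b B)" for y
          using P(3) vec.span_mono[of B "insert b B"] by blast
        moreover have "b \<in> vec.span (insert b B)" by (simp add: vec.span_base)
        ultimately show "Q *v x \<in> vec.span (insert b B)"
          by (simp add: Qv c_def vec.span_add vec.span_diff vec.span_scale)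
      qed
      show "vec.span (insert b B) \<subseteq> range ((*v) Q)"
      proof
        fix x assume "x \<in> vec.span (insert b B)"
        then obtain k where k: "x - k *s b \<in> vec.span B" using vec.span_breakdown_eq by blast
        have "Q *v (x - k *s b) = x - k *s b"
          using cP[of "x - k *s b"] by (simp add: Qv fix_span[OF k])
        moreover have "Q *v b = b" using r by (simp add: Qv bc) (simp add: c_def)
        ultimately have "Q *v x = x" by (simp add: vector_distribs vector_scalar_commute)
        then show "x \<in> range ((*v) Q)" by (metis rangeI)
      qed
    qed
    ultimately show ?thesis by blast
  qed
qed

text \<open>Equal ranges give \<open>P ** Q = Q\<close> and \<open>Q ** P = P\<close>. The adjoint
  of the first identity is \<open>Q ** P = Q\<close>. This gives the description in
  \<open>proj\<close> its meaning.\<close>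

lemma projection_unique:
  assumes P: "adj P = P" "P ** P = P" and Q: "adj Q = Q" "Q ** Q = Q"
    and R: "range ((*v) P) = range ((*v) Q)"
  shows "P = (Q :: complex^'m^'m)"
proof -
  have 1: "M ** N = N" if M: "M ** M = M" "range ((*v) N) \<subseteq> range ((*v) M)" for M N :: "complex^'m^'m"
  proof (rule matrix_eqI)
    fix x obtain y where "N *v x = M *v y" using M(2) by blast
    then show "(M ** N) *v x = N *v x"
      by (metis M(1) matrix_vector_mul_assoc)
  qed
  have "P ** Q = Q" "Q ** P = P" using 1 P Q R by auto
  then show ?thesis by (metis P(1) Q(1) ctranspose_mult)
qed

lemma proj_properties:
  fixes V :: "(complex^'m) set"
  assumes "vec.subspace V"
  shows "adj (proj V) = proj V" "proj V ** proj V = proj V" "range ((*v) (proj V)) = V"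
proof -
  obtain B where "finite B" "vec.span B = V" using vec.basis_subspace_exists[OF assms] by metis
  then obtain P where P: "adj P = P \<and> P ** P = P \<and> range ((*v) P) = V"
    using projection_exists by metis
  have "adj (proj V) = proj V \<and> proj V ** proj V = proj V \<and> range ((*v) (proj V)) = V"
    unfolding proj_def
  proof (rule theI[where a = P])
    show "adj P = P \<and> P ** P = P \<and> range ((*v) P) = V" by (rule P)
    show "Q = P" if "adj Q = Q \<and> Q ** Q = Q \<and> range ((*v) Q) = V" for Q
      by (rule projection_unique) (use that P in auto)
  qed
  then show "adj (proj V) = proj V" "proj V ** proj V = proj V" "range ((*v) (proj V)) = V"
    by auto
qed

lemma proj_fix: "vec.subspace V ==> v \<in> V ==> proj V *v v = v"
  using proj_properties[of V] by (metis matrix_vector_mul_assoc rangeE)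

lemma proj_in: "vec.subspace V ==> proj V *v v \<in> V"
  using proj_properties(3)[of V] by blast

lemma proj_orthogonal: "vec.subspace V ==> (!!u. u \<in> V ==> hinner v u = 0) ==> proj V *v v = 0"
  by (rule hinner_eqI) (simp add: hinner_matrix proj_properties proj_in)

lemma proj_perp_orthogonal: "vec.subspace V ==> u \<in> V ==> hinner (proj_perp V *v v) u = 0"
  by (simp add: proj_perp_def vector_distribs hinner_simps hinner_matrix proj_properties proj_fix)

section \<open>The second fundamental form of a totally unramified bundle\<close>

text \<open>With \<open>p\<close> the projection onto the fibre, a section satisfies
  \<open>p s = s\<close>. Differentiating and projecting to the complement leaves only the term with
  the derivative of \<open>p\<close>, so the witness is the tensor
  \<open>proj_perp ** dz p ** p\<close>.\<close>

lemma second_ff: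
  fixes Y :: "riemann_sphere => (complex^'m) set"
  assumes Y: "smooth_subbundle k Y" and c: "c \<in> charts"
  shows second_ff_section: "s \<in> sections c Y ==> second_ff c Y z *v s z = proj_perp (Y (c z)) *v dz_vec s z"
    and second_ff_perp: "(!!u. u \<in> Y (c z) ==> hinner v u = 0) ==> second_ff c Y z *v v = 0"
proof -
  define p where "p = (\<lambda>z. proj (Y (c z)))"
  have sub: "vec.subspace (Y (c z))" for z using Y by (simp add: smooth_subbundle_def)
  have "smooth p" using Y c by (simp add: smooth_subbundle_def smooth_on_sphere_def p_def)
  then have pd: "mwd p (dz_mat p z) (dzbar_mat p z) z" for z by (rule smooth_mwd)
  let ?Q = "\<lambda>M. (\<forall>s\<in>sections c Y. M *v s z = proj_perp (Y (c z)) *v dz_vec s z) \<and>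
     (\<forall>v. (\<forall>u\<in>Y (c z). hinner v u = 0) --> M *v v = 0)"
  let ?M = "proj_perp (Y (c z)) ** dz_mat p z ** p z"
  have Q: "?Q ?M"
  proof (intro conjI ballI allI impI)
    fix s assume s: "s \<in> sections c Y"
    then have "smooth s" by (simp add: sections_def)
    then obtain q where "vwd s (dz_vec s z) q z" using smooth_vwd by blast
    then have "dz_vec (\<lambda>w. p w *v s w) z = dz_mat p z *v s z + p z *v dz_vec s z"
      using mwd_mult_vec[OF pd] vwd_dz by blast
    moreover have ps: "(\<lambda>w. p w *v s w) = s"
      using s by (auto simp: sections_def p_def proj_fix[OF sub])
    ultimately have 1: "dz_vec s z = dz_mat p z *v s z + p z *v dz_vec s z" by simp
    have "proj_perp (Y (c z)) *v (p z *v dz_vec s z) = 0"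
      by (simp add: proj_perp_def p_def vector_distribs proj_fix[OF sub] proj_in[OF sub])
    then have "proj_perp (Y (c z)) *v dz_vec s z = proj_perp (Y (c z)) *v (dz_mat p z *v s z)"
      by (subst 1) (simp add: vector_distribs)
    moreover have "p z *v s z = s z" using ps by metis
    ultimately show "?M *v s z = proj_perp (Y (c z)) *v dz_vec s z"
      by (simp add: matrix_vector_mul_assoc[symmetric])
  next
    fix v assume "\<forall>u\<in>Y (c z). hinner v u = 0"
    then have "p z *v v = 0" unfolding p_def by (intro proj_orthogonal[OF sub]) auto
    then show "?M *v v = 0" by (simp add: matrix_vector_mul_assoc[symmetric])
  qed
  have U: "M = ?M" if M: "?Q M" for M
  proof (rule matrix_eqI)
    fix v
    \<comment> \<open>Projecting a constant vector to all fibres produces a global smooth section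
      with prescribed value at one point; hence the section clause determines the matrix on the
      whole fibre.\<close>
    define s where "s = (\<lambda>w. p w *v v)"
    have "smooth (\<lambda>w. p w *v v)"
      by (rule smooth_vecI, unfold matrix_vector_mult_def, simp)
         (rule smooth_sum, simp, subst mult.commute, rule smooth_cmult,
           rule smooth_vec_nth, rule smooth_vec_nth, rule \<open>smooth p\<close>)
    then have s: "s \<in> sections c Y"
      by (auto simp: sections_def s_def p_def proj_in[OF sub])
    have 1: "M *v s z = ?M *v s z" using M Q s by (metis (no_types, lifting))
    have "hinner (v - s z) u = 0" if "u \<in> Y (c z)" for u
      using proj_perp_orthogonal[OF sub that, of v] by (simp add: s_def p_def proj_perp_def vector_distribs)
    then have "M *v (v - s z) = 0" "?M *v (v - s z) = 0" using M Q by blast+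
    then have "M *v (v - s z) + M *v s z = ?M *v (v - s z) + ?M *v s z" using 1 by metis
    then show "M *v v = ?M *v v" by (simp only: matrix_vector_right_distrib[symmetric]) simp
  qed
  have "?Q (second_ff c Y z)"
    unfolding second_ff_def by (rule theI[where a = ?M], rule Q, rule U)
  then show "s \<in> sections c Y ==> second_ff c Y z *v s z = proj_perp (Y (c z)) *v dz_vec s z"
    "(!!u. u \<in> Y (c z) ==> hinner v u = 0) ==> second_ff c Y z *v v = 0"
    by blast+
qed

text \<open>Off a finite set the image of the second fundamental form is the fibre of the first
  Gauss bundle, of dimension \<open>k\<close>. At every point the nonvanishing determinant makes
  \<open>M ** adj M\<close> injective on that fibre, which bounds the rank of \<open>M\<close> from
  below.\<close>

lemma totally_unramified_rank:
  fixes Y :: "riemann_sphere => (complex^'m) set"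
  assumes Y: "totally_unramified Y"
  obtains k F where "finite F"
    and "!!c z. c \<in> charts ==> c z \<notin> F ==> vec.dim ((\<lambda>v. second_ff c Y z *v v) ` Y (c z)) = k"
    and "!!c z. k ~= 0 ==> c \<in> charts ==> k \<le> vec.dim ((\<lambda>v. second_ff c Y z *v v) ` Y (c z))"
proof -
  obtain r where "holomorphic_subbundle r Y" using Y by (auto simp: totally_unramified_def)
  then have sY: "smooth_subbundle r Y" by (simp add: holomorphic_subbundle_def)
  then have subY: "vec.subspace (Y p)" for p by (simp add: smooth_subbundle_def)
  from Y obtain G q where G: "G 0 = Y" "gauss_step (G 0) (G (Suc 0))" "!!p. G (Suc q) p = {0}"
    "!!i c z. i < q ==> c \<in> charts ==> det_on (G (Suc i) (c z))
             (second_ff c (G i) z ** adj (second_ff c (G i) z)) ~= 0"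
    unfolding totally_unramified_def by blast
  define Z where "Z = G (Suc 0)"
  from G(1,2) obtain k F where Z: "smooth_subbundle k Z" and F: "finite F"
    "!!c z. c \<in> charts ==> c z \<notin> F ==> Z (c z) = (\<lambda>v. second_ff c Y z *v v) ` Y (c z)"
    unfolding gauss_step_def Z_def by metis
  have subZ: "vec.subspace (Z p)" and dimZ: "vec.dim (Z p) = k" for p
    using Z by (auto simp: smooth_subbundle_def)
  show ?thesis
  proof (rule that[OF F(1)])
    show "vec.dim ((\<lambda>v. second_ff c Y z *v v) ` Y (c z)) = k" if "c \<in> charts" "c z \<notin> F" for c z
      using F(2)[OF that] dimZ by metis
    show "k \<le> vec.dim ((\<lambda>v. second_ff c Y z *v v) ` Y (c z))" if "k ~= 0" "c \<in> charts" for c z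
    proof -
      \<comment> \<open>If \<open>q = 0\<close>, the first Gauss bundle is already zero, contrary to
        \<open>k ~= 0\<close>; so the determinant condition is available for index 0.\<close>
      have "q ~= 0"
      proof
        assume "q = 0"
        then have "vec.dim (Z (c z)) = 0" using G(3) by (simp add: Z_def)
        then show False using dimZ that by simp
      qed
      let ?M = "second_ff c Y z"
      let ?N = "?M ** adj ?M"
      let ?V = "Z (c z)"
      have "det (?N ** proj ?V + proj_perp ?V) ~= 0"
        using G(4)[of 0 c z] \<open>q ~= 0\<close> that(2) G(1) by (simp add: det_on_def Z_def)
      then have "invertible (?N ** proj ?V + proj_perp ?V)" by (simp add: invertible_det_nz)
      then have inj: "inj ((*v) (?N ** proj ?V + proj_perp ?V))"
        by (metis invertible_def matrix_left_invertible_injective)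
      have "(?N ** proj ?V + proj_perp ?V) *v v = ?N *v v" if "v \<in> ?V" for v
        using proj_fix[OF subZ that]
        by (simp add: vector_distribs proj_perp_def matrix_vector_mul_assoc[symmetric])
      then have "inj_on ((*v) ?N) ?V"
        using inj by (metis (mono_tags, lifting) inj_def inj_onI)
      then have "vec.dim ((*v) ?N ` ?V) = k"
        using vec.dim_image_eq[of "(*v) ?N" ?V] dimZ subZ by (simp add: vec.span_eq_iff[THEN iffD2])
      \<comment> \<open>\<open>M\<close> vanishes on the complement of the fibre, so
        \<open>adj M *v v\<close> may be replaced by its projection to the fibre.\<close>
      moreover have "(*v) ?N ` ?V \<subseteq> (\<lambda>v. ?M *v v) ` Y (c z)"
      proof safe
        fix v
        define x where "x = adj ?M *v v"
        have "?M *v (x - proj (Y (c z)) *v x) = 0"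
          by (rule second_ff_perp[OF sY that(2)])
             (use proj_perp_orthogonal[OF subY] in \<open>simp add: proj_perp_def vector_distribs\<close>)
        then have "?N *v v = ?M *v (proj (Y (c z)) *v x)"
          by (simp add: x_def matrix_vector_mul_assoc[symmetric] vector_distribs)
        then show "?N *v v \<in> (\<lambda>v. ?M *v v) ` Y (c z)"
          using proj_in[OF subY] by blast
      qed
      ultimately show ?thesis using vec.dim_subset by metis
    qed
  qed
qed

section \<open>From loops to three matrix coefficients and their first-order system\<close>

section \<open>Fourier coefficients on the circle\<close>

abbreviation circle_measure :: "real measure" where
  "circle_measure \<equiv> lebesgue_on {0..2*pi}"

definition fcoeff :: "(complex => complex) => int => complex" where
  "fcoeff h k = (\<integral>\<theta>. cis (- of_int k * \<theta>) * h (cis \<theta>) \<partial>circle_measure) / (2 * pi)"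

definition cint :: "(complex => complex) => bool" where
  "cint h \<longleftrightarrow> integrable circle_measure (\<lambda>\<theta>. h (cis \<theta>))"

lemma fourier_coeff_nth: "fourier_coeff f k $ i = fcoeff (\<lambda>\<mu>. f \<mu> $ i) k"
  by (simp add: fourier_coeff_def fcoeff_def)

lemma finite_circle_measure: "finite_measure circle_measure"
  by (rule finite_measureI) (simp add: emeasure_restrict_space)

lemma continuous_circle_measurable:
  "continuous_on {0..2*pi} g ==> g \<in> borel_measurable circle_measure"
  by (rule continuous_imp_measurable_on_sets_lebesgue) auto

lemma cis_measurable: "(\<lambda>\<theta>. cis (c * \<theta>)) \<in> borel_measurable circle_measure"
  by (rule continuous_circle_measurable) (auto intro!: continuous_intros continuous_on_cis)

lemma integrable_cis_mult:
  assumes "cint h" shows "integrable circle_measure (\<lambda>\<theta>. cis (c * \<theta>) * h (cis \<theta>))"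
proof (rule Bochner_Integration.integrable_bound)
  show "integrable circle_measure (\<lambda>\<theta>. h (cis \<theta>))" using assms by (simp add: cint_def)
  then show "(\<lambda>\<theta>. cis (c * \<theta>) * h (cis \<theta>)) \<in> borel_measurable circle_measure"
    by (intro borel_measurable_times cis_measurable borel_measurable_integrable)
qed (simp add: norm_mult)

lemma fcoeff_cong: "(!!\<mu>. norm \<mu> = 1 ==> h \<mu> = g \<mu>) ==> fcoeff h k = fcoeff g k"
  by (simp add: fcoeff_def)

lemma cint_add: "cint h ==> cint g ==> cint (\<lambda>\<mu>. h \<mu> + g \<mu>)"
  by (simp add: cint_def)

lemma cint_cmult: "cint h ==> cint (\<lambda>\<mu>. c * h \<mu>)"
  by (simp add: cint_def)

lemma cint_sum: "(!!i. i \<in> I ==> cint (h i)) ==> cint (\<lambda>\<mu>. \<Sum>i\<in>I. h i \<mu>)"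
  by (simp add: cint_def)

lemma cint_shift: "cint h ==> cint (\<lambda>\<mu>. \<mu> ^ n * h \<mu>)"
  using integrable_cis_mult[of h "real n"] by (simp add: cint_def Complex.DeMoivre)

lemma cint_const: "cint (\<lambda>\<mu>. c)"
  using finite_measure.integrable_const[OF finite_circle_measure] by (simp add: cint_def)

lemma cint_continuous: "continuous_on UNIV (\<lambda>\<theta>. h (cis \<theta>)) ==> cint h"
proof -
  assume "continuous_on UNIV (\<lambda>\<theta>. h (cis \<theta>))"
  then have c: "continuous_on {0..2*pi} (\<lambda>\<theta>. h (cis \<theta>))" by (rule continuous_on_subset) simp
  then have "compact ((\<lambda>\<theta>. h (cis \<theta>)) ` {0..2*pi})" by (rule compact_continuous_image) simp
  then obtain B where "!!x. x \<in> {0..2*pi} ==> norm (h (cis x)) \<le> B"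
    using compact_imp_bounded bounded_iff by (metis image_eqI)
  then show ?thesis unfolding cint_def
    by (intro finite_measure.integrable_const_bound[OF finite_circle_measure, where B = B] AE_I2
        continuous_circle_measurable c) simp
qed

lemma fcoeff_add: "cint h ==> cint g ==> fcoeff (\<lambda>\<mu>. h \<mu> + g \<mu>) k = fcoeff h k + fcoeff g k"
  using integrable_cis_mult[of h "- of_int k"] integrable_cis_mult[of g "- of_int k"]
  by (simp add: fcoeff_def distrib_left add_divide_distrib)

lemma fcoeff_cmult: "fcoeff (\<lambda>\<mu>. c * h \<mu>) k = c * fcoeff h k"
proof -
  have "(\<lambda>\<theta>. cis (- of_int k * \<theta>) * (c * h (cis \<theta>))) = (\<lambda>\<theta>. c * (cis (- of_int k * \<theta>) * h (cis \<theta>)))"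
    by (simp add: algebra_simps)
  then show ?thesis unfolding fcoeff_def by simp
qed

lemma fcoeff_sum:
  "finite I ==> (!!i. i \<in> I ==> cint (h i)) ==> fcoeff (\<lambda>\<mu>. \<Sum>i\<in>I. h i \<mu>) k = (\<Sum>i\<in>I. fcoeff (h i) k)"
proof (induction I rule: finite_induct)
  case empty
  then show ?case by (simp add: fcoeff_def)
next
  case (insert x F)
  then show ?case by (simp add: fcoeff_add cint_sum)
qed

lemma fcoeff_shift: "fcoeff (\<lambda>\<mu>. \<mu> ^ n * h \<mu>) k = fcoeff h (k - int n)"
proof -
  have "cis (- of_int k * \<theta>) * (cis \<theta> ^ n * h (cis \<theta>)) = cis (- of_int (k - int n) * \<theta>) * h (cis \<theta>)" for \<theta>
    by (simp add: Complex.DeMoivre cis_mult algebra_simps flip: mult.assoc)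
  then show ?thesis by (simp only: fcoeff_def)
qed

lemma integral_cis: "(\<integral>\<theta>. cis (of_int m * \<theta>) \<partial>circle_measure) = (if m = 0 then 2 * pi else 0)"
proof -
  have c: "continuous_on UNIV (\<lambda>\<theta>. cis (of_int m * \<theta>))"
    by (auto intro!: continuous_intros continuous_on_cis)
  have "integrable circle_measure (\<lambda>\<theta>. cis (of_int m * \<theta>))"
    using integrable_cis_mult[OF cint_const[of 1], of "of_int m"] by simp
  then have 1: "(\<integral>\<theta>. cis (of_int m * \<theta>) \<partial>circle_measure) = integral {0..2*pi} (\<lambda>\<theta>. cis (of_int m * \<theta>))"
    by (rule lebesgue_integral_eq_integral) simp
  show ?thesis
  proof (cases "m = 0")
    case True
    then show ?thesis unfolding 1 by (simp add: scaleR_conv_of_real)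
  next
    case False
    define F where "F = (\<lambda>\<theta>::real. cis (of_int m * \<theta>) / (\<i> * of_int m))"
    have "((\<lambda>\<theta>. cis (of_int m * \<theta>)) has_integral (F (2*pi) - F 0)) {0..2*pi}"
    proof (rule fundamental_theorem_of_calculus)
      fix x :: real assume "x \<in> {0..2*pi}"
      have "((\<lambda>\<theta>::real. exp (\<i> * of_int m * of_real \<theta>) / (\<i> * of_int m)) has_vector_derivative
          exp (\<i> * of_int m * of_real x)) (at x within {0..2*pi})"
        using False by (auto intro!: derivative_eq_intros has_vector_derivative_real_field)
      then show "(F has_vector_derivative cis (of_int m * x)) (at x within {0..2*pi})"
        unfolding F_def by (simp add: cis_conv_exp algebra_simps)
    qed simp
    moreover have "cis (of_int m * (2 * pi)) = 1"
      by (metis cis_multiple_2pi Ints_of_int mult.commute mult.left_commute)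
    ultimately have "((\<lambda>\<theta>. cis (of_int m * \<theta>)) has_integral 0) {0..2*pi}"
      by (simp add: F_def)
    then show ?thesis using False unfolding 1 by (simp add: integral_unique)
  qed
qed

lemma fcoeff_const: "fcoeff (\<lambda>\<mu>. c) k = (if k = 0 then c else 0)"
proof -
  have "fcoeff (\<lambda>\<mu>. 1) k = (if k = 0 then 1 else 0)"
    using integral_cis[of "- k"] by (simp add: fcoeff_def)
  then show ?thesis using fcoeff_cmult[of c "\<lambda>\<mu>. 1" k] by simp
qed

lemma fcoeff_monomial: "fcoeff (\<lambda>\<mu>. \<mu> ^ n * c) k = (if k = int n then c else 0)"
  by (simp add: fcoeff_shift fcoeff_const)


text \<open>Smoothness of a loop is formulated in the angle, while Stone-Weierstrass is applied on
  the circle itself as a compact subset of the plane.\<close>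

lemma continuous_on_circle_of_cis:
  fixes h :: "complex => complex"
  assumes h: "continuous_on UNIV (\<lambda>\<theta>. h (cis \<theta>))"
  shows "continuous_on (sphere 0 1) h"
  unfolding continuous_on_eq_continuous_within
proof
  fix \<mu> :: complex assume "\<mu> \<in> sphere 0 1"
  then have \<mu>: "norm \<mu> = 1" "\<mu> ~= 0" by auto
  \<comment> \<open>A local inverse of \<open>cis\<close> near \<mu>: the quotient
    \<open>w / \<mu>\<close> stays near 1, away from the branch cut of \<open>Arg\<close>.\<close>
  define g where "g = (\<lambda>w. h (cis (Arg \<mu> + Arg (w / \<mu>))))"
  have "isCont (\<lambda>w. Arg (w / \<mu>)) \<mu>"
    by (rule isCont_o2[where g = Arg]) (use \<mu> in \<open>auto intro!: continuous_intros continuous_at_Arg\<close>)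
  then have "isCont (\<lambda>w. Arg \<mu> + Arg (w / \<mu>)) \<mu>" by (intro continuous_intros)
  moreover have "isCont (\<lambda>\<theta>. h (cis \<theta>)) \<theta>" for \<theta> using h by (simp add: continuous_on_eq_continuous_at)
  ultimately have "isCont g \<mu>" unfolding g_def by (rule isCont_o2)
  then have "continuous (at \<mu> within sphere 0 1) g" by (rule continuous_at_imp_continuous_at_within)
  moreover have "g w = h w" if "w \<in> sphere 0 1" for w
  proof -
    have c: "cis (Arg v) = v" if "norm v = 1" for v
      using that by (subst cis_Arg) (auto simp: sgn_div_norm)
    have "cis (Arg \<mu>) = \<mu>" "cis (Arg (w / \<mu>)) = w / \<mu>"
      using \<mu> that by (auto intro!: c simp: norm_divide)
    then show ?thesis using \<mu> by (simp add: g_def cis_mult[symmetric])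
  qed
  ultimately show "continuous (at \<mu> within sphere 0 1) h"
    using \<open>\<mu> \<in> sphere 0 1\<close> continuous_transform_within[of \<mu> "sphere 0 1" g 1 h] by auto
qed

text \<open>On the circle a real linear form is \<open>a * \<mu> + cnj a * inverse \<mu>\<close>, so
  multiplication by it only shifts frequencies by one; products and sums follow by
  induction.\<close>

lemma fcoeff_times_polynomial:
  assumes r: "real_polynomial_function r"
  shows "continuous_on UNIV (\<lambda>\<theta>. h (cis \<theta>)) ==> (!!k. fcoeff h k = 0) ==>
    fcoeff (\<lambda>\<mu>. h \<mu> * of_real (r \<mu>)) k = 0"
  using r
proof (induction r arbitrary: h k rule: real_polynomial_function.induct)
  case (linear f)
  define a where "a = Complex (f 1 / 2) (- f \<i> / 2)"
  have ci: "cint h" using linear by (intro cint_continuous)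
  have f: "of_real (f \<mu>) = a * \<mu> + cnj a * cnj \<mu>" for \<mu>
  proof -
    have "\<mu> = Re \<mu> *\<^sub>R 1 + Im \<mu> *\<^sub>R \<i>" by (simp add: complex_eq_iff)
    then have "f \<mu> = f (Re \<mu> *\<^sub>R 1 + Im \<mu> *\<^sub>R \<i>)" by (rule arg_cong)
    also have "\<dots> = Re \<mu> *\<^sub>R f 1 + Im \<mu> *\<^sub>R f \<i>"
      using bounded_linear.linear[OF linear(1)] by (simp only: linear_add linear_scale)
    finally show ?thesis by (simp add: a_def complex_eq_iff)
  qed
  have "cis (- of_int k * \<theta>) * (h (cis \<theta>) * of_real (f (cis \<theta>))) =
     a * (cis (- of_int (k - 1) * \<theta>) * h (cis \<theta>)) + cnj a * (cis (- of_int (k + 1) * \<theta>) * h (cis \<theta>))" for \<theta>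
  proof -
    have "cis (- of_int (k - 1) * \<theta>) = cis (- of_int k * \<theta>) * cis \<theta>"
      "cis (- of_int (k + 1) * \<theta>) = cis (- of_int k * \<theta>) * cnj (cis \<theta>)"
      by (simp_all add: cis_cnj cis_mult algebra_simps)
    then show ?thesis unfolding f by (simp add: algebra_simps)
  qed
  then have "fcoeff (\<lambda>\<mu>. h \<mu> * of_real (f \<mu>)) k = a * fcoeff h (k - 1) + cnj a * fcoeff h (k + 1)"
    using integrable_cis_mult[OF ci, of "- of_int (k - 1)"] integrable_cis_mult[OF ci, of "- of_int (k + 1)"]
    by (simp add: fcoeff_def add_divide_distrib del: of_int_diff of_int_add)
  then show ?case using linear by simp
next
  case (const c)
  then show ?case using fcoeff_cmult[of "of_real c" h k] by (simp add: mult.commute)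
next
  case (add f g)
  have cont: "continuous_on UNIV (\<lambda>\<theta>. h (cis \<theta>) * of_real (p (cis \<theta>)))" if "real_polynomial_function p" for p
  proof -
    have "continuous_on UNIV p" using that by (simp add: continuous_on_polymonial_function real_polynomial_function_eq)
    then have "continuous_on UNIV (\<lambda>\<theta>. p (cis \<theta>))"
      by (rule continuous_on_compose2) (auto intro!: continuous_on_cis continuous_on_id)
    then show ?thesis by (intro continuous_on_mult continuous_on_of_real add.prems(1))
  qed
  have "fcoeff (\<lambda>\<mu>. h \<mu> * of_real (f \<mu>) + h \<mu> * of_real (g \<mu>)) k = 0"
    using add cont by (subst fcoeff_add) (auto intro!: cint_continuous)
  then show ?case by (simp add: distrib_left)
next
  case (mult f g)
  have "continuous_on UNIV f" using mult.hyps(1) by (simp add: continuous_on_polymonial_function real_polynomial_function_eq)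
  then have "continuous_on UNIV (\<lambda>\<theta>. f (cis \<theta>))"
    by (rule continuous_on_compose2) (auto intro!: continuous_on_cis continuous_on_id)
  then have cont: "continuous_on UNIV (\<lambda>\<theta>. h (cis \<theta>) * of_real (f (cis \<theta>)))"
    by (intro continuous_on_mult continuous_on_of_real mult.prems(1))
  have "fcoeff (\<lambda>\<mu>. (h \<mu> * of_real (f \<mu>)) * of_real (g \<mu>)) k = 0"
    by (rule mult.IH(2)[OF cont]) (rule mult.IH(1)[OF mult.prems])
  then show ?case by (simp add: mult.assoc)
qed

text \<open>By Stone-Weierstrass \<open>cnj h\<close> is a uniform limit of polynomials in the real
  coordinates, each with vanishing integral against \<open>h\<close>. Hence the integral of |h|^2 is
  zero, and continuity makes \<open>h\<close> zero pointwise.\<close>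

lemma fourier_unique_zero:
  assumes h: "continuous_on UNIV (\<lambda>\<theta>. h (cis \<theta>))" and z: "!!k. fcoeff h k = 0" and \<mu>: "norm \<mu> = 1"
  shows "h \<mu> = 0"
proof -
  have hs: "continuous_on (sphere 0 1) h" by (rule continuous_on_circle_of_cis[OF h])
  then have "compact (h ` sphere 0 1)" by (rule compact_continuous_image) simp
  then obtain B where B: "B > 0" "\<forall>x\<in>h ` sphere 0 1. norm x \<le> B"
    using compact_imp_bounded bounded_pos by metis
  have ci: "cint (\<lambda>\<mu>. h \<mu> * cnj (h \<mu>))"
    by (rule cint_continuous) (intro continuous_on_mult h continuous_on_cnj)
  define N where "N = (\<integral>\<theta>. h (cis \<theta>) * cnj (h (cis \<theta>)) \<partial>circle_measure)"
  have "norm N \<le> e" if e: "e > 0" for e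
  proof -
    \<comment> \<open>The circle has length \<open>2 * pi\<close> and \<open>B\<close> bounds
      \<open>h\<close>, so an approximation error \<open>d\<close> changes the integral by at most
      \<open>e\<close>.\<close>
    define d where "d = e / (2 * pi * B)"
    have d: "d > 0" using e B(1) by (simp add: d_def)
    have "continuous_on (sphere 0 1) (\<lambda>w. cnj (h w))" by (intro continuous_on_cnj hs)
    then obtain g :: "complex => complex" where g: "polynomial_function g"
      "\<forall>w\<in>sphere 0 1. norm (cnj (h w) - g w) < d"
      using Stone_Weierstrass_polynomial_function[OF compact_sphere _ d] by metis
    have rp: "real_polynomial_function (\<lambda>w. Re (g w))" "real_polynomial_function (\<lambda>w. Im (g w))"
      using g(1) bounded_linear_Re bounded_linear_Im unfolding polynomial_function_def o_def by blast+
    have gc: "continuous_on UNIV (\<lambda>\<theta>. g (cis \<theta>))"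
      by (rule continuous_on_compose2[OF continuous_on_polymonial_function[OF g(1), of UNIV]])
         (auto intro!: continuous_on_cis continuous_on_id)
    have f0: "fcoeff (\<lambda>\<mu>. h \<mu> * of_real (Re (g \<mu>))) 0 = 0" "fcoeff (\<lambda>\<mu>. h \<mu> * of_real (Im (g \<mu>))) 0 = 0"
      using fcoeff_times_polynomial[OF rp(1) h z] fcoeff_times_polynomial[OF rp(2) h z] by blast+
    have c1: "cint (\<lambda>\<mu>. h \<mu> * of_real (Re (g \<mu>)))" "cint (\<lambda>\<mu>. h \<mu> * of_real (Im (g \<mu>)))"
      by (rule cint_continuous, intro continuous_on_mult h continuous_on_of_real continuous_on_Re continuous_on_Im gc)+
    have "fcoeff (\<lambda>\<mu>. h \<mu> * of_real (Re (g \<mu>)) + \<i> * (h \<mu> * of_real (Im (g \<mu>)))) 0 = 0"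
      by (subst fcoeff_add) (simp_all add: c1 cint_cmult fcoeff_cmult f0)
    moreover have "h \<mu> * of_real (Re (g \<mu>)) + \<i> * (h \<mu> * of_real (Im (g \<mu>))) = h \<mu> * g \<mu>" for \<mu>
      by (metis complex_eq distrib_left mult.left_commute)
    ultimately have hg: "(\<integral>\<theta>. h (cis \<theta>) * g (cis \<theta>) \<partial>circle_measure) = 0"
      by (simp add: fcoeff_def)
    have ig: "cint (\<lambda>\<mu>. h \<mu> * g \<mu>)" by (rule cint_continuous) (intro continuous_on_mult h gc)
    have "N = (\<integral>\<theta>. h (cis \<theta>) * cnj (h (cis \<theta>)) - h (cis \<theta>) * g (cis \<theta>) \<partial>circle_measure)"
      using ci ig hg by (simp add: N_def cint_def)
    also have "norm \<dots> \<le> (\<integral>\<theta>. B * d \<partial>circle_measure)"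
    proof (rule Bochner_Integration.integral_norm_bound_integral)
      show "integrable circle_measure (\<lambda>\<theta>. h (cis \<theta>) * cnj (h (cis \<theta>)) - h (cis \<theta>) * g (cis \<theta>))"
        using ci ig by (simp add: cint_def)
      show "integrable circle_measure (\<lambda>\<theta>. B * d)"
        by (rule finite_measure.integrable_const[OF finite_circle_measure])
      fix \<theta>
      have "norm (h (cis \<theta>) * (cnj (h (cis \<theta>)) - g (cis \<theta>))) \<le> B * d"
        unfolding norm_mult
      proof (rule mult_mono)
        show "norm (h (cis \<theta>)) \<le> B" using B(2) by simp
        show "norm (cnj (h (cis \<theta>)) - g (cis \<theta>)) \<le> d" using g(2)[rule_format, of "cis \<theta>"] by simp
      qed (use B in auto)
      then show "norm (h (cis \<theta>) * cnj (h (cis \<theta>)) - h (cis \<theta>) * g (cis \<theta>)) \<le> B * d"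
        by (simp add: right_diff_distrib)
    qed
    also have "\<dots> = e" using B(1) by (simp add: d_def measure_restrict_space)
    finally show ?thesis .
  qed
  then have "norm N \<le> 0" by (meson dense_ge)
  then have N0: "N = 0" by simp
  have sq: "h \<mu> * cnj (h \<mu>) = of_real ((norm (h \<mu>))\<^sup>2)" for \<mu> by (rule complex_norm_square[symmetric])
  have "complex_of_real (\<integral>\<theta>. (norm (h (cis \<theta>)))\<^sup>2 \<partial>circle_measure) = 0"
    using N0 unfolding N_def sq by (simp only: integral_complex_of_real)
  moreover have "integrable circle_measure (\<lambda>\<theta>. (norm (h (cis \<theta>)))\<^sup>2)"
    using ci unfolding cint_def sq by (simp only: complex_of_real_integrable_eq)
  ultimately have "((\<lambda>\<theta>. (norm (h (cis \<theta>)))\<^sup>2) has_integral 0) {0..2*pi}"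
    using has_integral_integral_lebesgue_on[of "{0..2*pi}" "\<lambda>\<theta>. (norm (h (cis \<theta>)))\<^sup>2"] by simp
  then have "((\<lambda>\<theta>. (norm (h (cis \<theta>)))\<^sup>2) has_integral 0) (cbox 0 (2*pi))" by simp
  moreover have "continuous_on (cbox 0 (2*pi)) (\<lambda>\<theta>. (norm (h (cis \<theta>)))\<^sup>2)"
    by (intro continuous_on_power continuous_on_norm continuous_on_subset[OF h]) auto
  ultimately have z2: "(norm (h (cis \<theta>)))\<^sup>2 = 0" if "\<theta> \<in> {0..2*pi}" for \<theta>
    using has_integral_0_cbox_imp_0[of 0 "2*pi" "\<lambda>\<theta>. (norm (h (cis \<theta>)))\<^sup>2" \<theta>] that pi_gt_zero
    by (simp del: pi_gt_zero)
  have "cis (Arg2pi \<mu>) = \<mu>" using \<mu> Arg2pi_eq[of \<mu>] by (simp add: cis_conv_exp mult.commute)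
  moreover have "Arg2pi \<mu> \<in> {0..2*pi}" using Arg2pi[of \<mu>] by simp
  ultimately show ?thesis using z2[of "Arg2pi \<mu>"] by simp
qed

section \<open>The Grassmannian model of a normalized extended solution\<close>

text \<open>Complex multiples of a matrix. Products \<open>mat c ** A\<close> are rewritten to this
  form so that scalars can be collected in front.\<close>

definition smul :: "complex => complex^'m^'l => complex^'m^'l" where
  "smul c A = (\<chi> i j. c * A $ i $ j)"

lemma smul_nth [simp]: "smul c A $ i $ j = c * A $ i $ j"
  by (simp add: smul_def)

lemma mat_mult_smul: "mat c ** A = smul c A"
  by (simp add: vec_eq_iff)

lemma smul_mult_left: "smul c A ** B = smul c (A ** B)"
  by (simp add: vec_eq_iff matrix_matrix_mult_def sum_distrib_left mult_ac)

lemma smul_mult_right: "A ** smul c B = smul c (A ** B)"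
  by (simp add: vec_eq_iff matrix_matrix_mult_def sum_distrib_left mult_ac)

lemma smul_smul: "smul c (smul d A) = smul (c * d) A"
  by (simp add: vec_eq_iff mult_ac)

lemma smul_one [simp]: "smul 1 A = A"
  by (simp add: vec_eq_iff)

lemma smul_zero [simp]: "smul 0 A = 0" "smul c 0 = 0"
  by (simp_all add: vec_eq_iff)

lemma smul_vec: "smul c A *v x = c *s (A *v x)"
  by (simp add: vec_eq_iff matrix_vector_mult_def sum_distrib_left mult_ac)

lemma smul_add_right: "smul c (A + B) = smul c A + smul c B"
  by (simp add: vec_eq_iff algebra_simps)

lemma smul_diff_right: "smul c (A - B) = smul c A - smul c B"
  by (simp add: vec_eq_iff algebra_simps)

lemma ctranspose_smul: "adj (smul c A) = smul (cnj c) (adj A)"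
  by (simp add: vec_eq_iff)

lemmas smul_simps = mat_mult_smul smul_mult_left smul_mult_right smul_smul smul_vec
  smul_add_right smul_diff_right ctranspose_smul

text \<open>Square integrability implies integrability on a finite measure space, by
  \<open>x \<le> 1 + x\<^sup>2\<close>.\<close>

lemma L2_circle_cint:
  assumes "f \<in> L2_circle" shows "cint (\<lambda>\<mu>. f \<mu> $ i)"
  unfolding cint_def
proof (rule Bochner_Integration.integrable_bound)
  have m: "(\<lambda>\<theta>. f (cis \<theta>)) \<in> borel_measurable circle_measure"
    and i: "integrable circle_measure (\<lambda>\<theta>. (norm (f (cis \<theta>)))\<^sup>2)"
    using assms by (auto simp: L2_circle_def)
  show "integrable circle_measure (\<lambda>\<theta>. 1 + (norm (f (cis \<theta>)))\<^sup>2)"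
    using i finite_measure.integrable_const[OF finite_circle_measure] by auto
  show "(\<lambda>\<theta>. f (cis \<theta>) $ i) \<in> borel_measurable circle_measure"
    by (rule borel_measurable_continuous_on[OF _ m, of "\<lambda>v. v $ i"])
       (auto intro!: linear_continuous_on bounded_linear_vec_nth)
  have "norm (f (cis \<theta>) $ i) \<le> 1 + (norm (f (cis \<theta>)))\<^sup>2" for \<theta>
  proof -
    have "norm (f (cis \<theta>) $ i) \<le> norm (f (cis \<theta>))" by (rule Finite_Cartesian_Product.norm_nth_le)
    also have "x \<le> 1 + x\<^sup>2" for x :: real using sum_squares_bound[of x 1] by (smt (verit) power2_eq_square zero_le_square mult.right_neutral one_power2)
    finally show ?thesis .
  qed
  then show "AE \<theta> in circle_measure. norm (f (cis \<theta>) $ i) \<le> norm (1 + (norm (f (cis \<theta>)))\<^sup>2)"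
    by (intro AE_I2) simp
qed

text \<open>Degree one suffices: for uniton number two the elements of the fibres of X have just the
  coefficients of \<mu>^0 and \<mu>^1.\<close>

lemma H_plus_linear: "(\<lambda>\<mu>. a + \<mu> *s b) \<in> H_plus"
proof -
  have c: "continuous_on {0..2*pi} (\<lambda>\<theta>. a + cis \<theta> *s b)"
  proof -
    have "continuous_on {0..2*pi} (\<lambda>\<theta>. \<chi> i. a $ i + cis \<theta> * b $ i)"
      by (intro continuous_on_vec_lambda continuous_intros continuous_on_cis)
    then show ?thesis by (rule continuous_on_eq) (simp add: vec_eq_iff)
  qed
  have "integrable (lebesgue_on (cbox 0 (2*pi))) (\<lambda>\<theta>. (norm (a + cis \<theta> *s b))\<^sup>2)"
    by (rule continuous_imp_integrable) (use c in \<open>auto intro!: continuous_intros\<close>)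
  then have "(\<lambda>\<mu>. a + \<mu> *s b) \<in> L2_circle"
    using continuous_circle_measurable[OF c] by (simp add: L2_circle_def)
  moreover have "fcoeff (\<lambda>\<mu>. a $ i + \<mu> * b $ i) k = 0" if "k < 0" for i k
  proof -
    have "fcoeff (\<lambda>\<mu>. a $ i + \<mu> ^ 1 * b $ i) k = 0"
      using that by (subst fcoeff_add) (simp_all only: cint_const cint_shift fcoeff_const fcoeff_monomial, simp)
    then show ?thesis by simp
  qed
  ultimately show ?thesis by (simp add: H_plus_def vec_eq_iff fourier_coeff_nth)
qed

lemma H_plus_const: "(\<lambda>\<mu>. a) \<in> H_plus"
  using H_plus_linear[of a 0] by simp

lemma circle_polynomial_zero:
  assumes "!!\<mu>. norm \<mu> = 1 ==> (\<Sum>j\<le>n. \<mu> ^ j * c j) = 0" "j \<le> n"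
  shows "c j = (0::complex)"
proof -
  have "fcoeff (\<lambda>\<mu>. \<Sum>i\<le>n. \<mu> ^ i * c i) (int j) = (\<Sum>i\<le>n. fcoeff (\<lambda>\<mu>. \<mu> ^ i * c i) (int j))"
    by (rule fcoeff_sum) (auto intro: cint_shift cint_const)
  also have "\<dots> = c j" using assms(2) by (simp add: fcoeff_monomial)
  finally have "fcoeff (\<lambda>\<mu>. \<Sum>i\<le>n. \<mu> ^ i * c i) (int j) = c j" .
  moreover have "fcoeff (\<lambda>\<mu>. \<Sum>i\<le>n. \<mu> ^ i * c i) (int j) = fcoeff (\<lambda>\<mu>. 0) (int j)"
    by (rule fcoeff_cong) (rule assms(1))
  ultimately show ?thesis by (simp add: fcoeff_def)
qed

text \<open>Degree four is what unitarity of a quadratic loop produces once the powers down to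
  \<mu>^-2 are cleared.\<close>

lemma circle_polynomial_zero4:
  assumes "!!\<mu>. norm \<mu> = 1 ==> c0 + \<mu> * c1 + \<mu>\<^sup>2 * c2 + \<mu> ^ 3 * c3 + \<mu> ^ 4 * c4 = (0::complex)"
  shows "c0 = 0 \<and> c1 = 0 \<and> c2 = 0 \<and> c3 = 0 \<and> c4 = 0"
proof -
  define c where "c = (\<lambda>j::nat. [c0, c1, c2, c3, c4] ! j)"
  have "c j = 0" if "j \<le> 4" for j
    by (rule circle_polynomial_zero[OF _ that])
       (use assms in \<open>simp add: c_def eval_nat_numeral algebra_simps\<close>)
  from this[of 0] this[of 1] this[of 2] this[of 3] this[of 4] show ?thesis by (simp add: c_def)
qed

lemma sphere_cases: obtains z where "p = chart0 z" | "p = chart1 0"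
  by (cases p) (auto simp: chart0_def chart1_def)

lemma sphere_chart: obtains c z where "c \<in> charts" "p = c z"
  by (rule sphere_cases[of p]) (auto simp: charts_def)

lemma loop_continuous:
  assumes "smooth_loop_map \<Psi>"
  shows "continuous_on UNIV (\<lambda>\<theta>. \<Psi> p (cis \<theta>) $ i $ j)"
proof -
  obtain c z where c: "c \<in> charts" "p = c z" by (rule sphere_chart)
  then have "smooth (\<lambda>(z::complex, \<theta>::real). \<Psi> (c z) (cis \<theta>))"
    using assms by (simp add: smooth_loop_map_def)
  then have "continuous_on UNIV (\<lambda>(z::complex, \<theta>::real). \<Psi> (c z) (cis \<theta>))"
    by (rule smooth_continuous)
  then have "continuous_on UNIV (\<lambda>\<theta>. (\<lambda>(z::complex, \<theta>::real). \<Psi> (c z) (cis \<theta>)) (z, \<theta>))"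
    by (rule continuous_on_compose2) (auto intro: continuous_intros)
  then show ?thesis using c by (auto intro!: continuous_intros)
qed

text \<open>Each inclusion of a normalized solution bounds the Fourier support on one side. Applying
  \<Psi> to constant vectors and using \<open>W_bundle \<Psi> p \<subseteq> H_plus\<close> removes
  negative frequencies. The elements \<open>\<mu>\<^sup>2 *s axis i 1\<close> lie in the fibre, and
  solving for their preimages with the adjoint of \<Psi> removes frequencies above two. Uniqueness
  of Fourier coefficients then identifies \<Psi> with its quadratic part.\<close>

lemma normalized_polynomial:
  fixes \<Psi> :: "riemann_sphere => complex => complex^'n^'n"
  assumes N: "normalized_extended_solution 2 \<psi> \<Psi>"
  obtains A0 A1 A2 where
    "!!p \<mu>. norm \<mu> = 1 ==> \<Psi> p \<mu> = A0 p + mat \<mu> ** A1 p + mat (\<mu>\<^sup>2) ** A2 p"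
proof -
  have L: "smooth_loop_map \<Psi>" using N by (simp add: normalized_extended_solution_def extended_solution_def)
  define a where "a = (\<lambda>k p. \<chi> i j. fcoeff (\<lambda>\<mu>. \<Psi> p \<mu> $ i $ j) k)"
  have unit: "\<Psi> p \<mu> \<in> unitary_group" if "norm \<mu> = 1" for p \<mu> using L that by (simp add: smooth_loop_map_def)
  have zero: "fcoeff (\<lambda>\<mu>. \<Psi> p \<mu> $ i $ j) k = 0" if k: "k < 0 \<or> k > 2" for p i j k
    using k
  proof
    assume "k < 0"
    define g where "g = (\<lambda>\<mu>. \<Psi> p \<mu> *v axis j 1)"
    have "g \<in> W_bundle \<Psi> p"
      using H_plus_const[of "axis j 1"] by (auto simp: W_bundle_def g_def)
    then have "g \<in> H_plus" using N by (auto simp: normalized_extended_solution_def)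
    then have "fourier_coeff g k $ i = 0" using \<open>k < 0\<close> by (simp add: H_plus_def)
    then show ?thesis
      by (simp add: fourier_coeff_nth g_def matrix_vector_mult_def axis_def if_distrib cong: if_cong)
  next
    assume "k > 2"
    have "\<forall>p. \<forall>f\<in>H_plus. (\<lambda>\<mu>. \<mu> ^ 2 *s f \<mu>) \<in> W_bundle \<Psi> p"
      using N unfolding normalized_extended_solution_def by blast
    from this[rule_format, OF H_plus_const[of "axis i 1"]]
    have "(\<lambda>\<mu>. \<mu> ^ 2 *s axis i 1) \<in> W_bundle \<Psi> p" .
    then obtain f where f: "f \<in> H_plus" "!!\<mu>. norm \<mu> = 1 ==> \<mu> ^ 2 *s axis i 1 = \<Psi> p \<mu> *v f \<mu>"
      unfolding W_bundle_def by blast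
    have fj: "f \<mu> $ j = \<mu>\<^sup>2 * cnj (\<Psi> p \<mu> $ i $ j)" if "norm \<mu> = 1" for \<mu>
    proof -
      have "f \<mu> = (adj (\<Psi> p \<mu>) ** \<Psi> p \<mu>) *v f \<mu>"
        using unit[OF that, of p] by (simp add: unitary_group_def)
      also have "\<dots> = adj (\<Psi> p \<mu>) *v (\<mu> ^ 2 *s axis i 1)"
        by (simp add: matrix_vector_mul_assoc[symmetric] f(2)[OF that])
      finally have "f \<mu> $ j = (adj (\<Psi> p \<mu>) *v (\<mu> ^ 2 *s axis i 1)) $ j" by simp
      also have "\<dots> = \<mu>\<^sup>2 * cnj (\<Psi> p \<mu> $ i $ j)"
        by (simp add: matrix_vector_mult_def axis_def if_distrib mult.commute cong: if_cong)
      finally show ?thesis .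
    qed
    have "fcoeff (\<lambda>\<mu>. f \<mu> $ j) (2 - k) = 0"
      using f(1) \<open>k > 2\<close> by (simp add: H_plus_def fourier_coeff_nth[symmetric])
    moreover have "fcoeff (\<lambda>\<mu>. f \<mu> $ j) (2 - k) = fcoeff (\<lambda>\<mu>. \<mu> ^ 2 * cnj (\<Psi> p \<mu> $ i $ j)) (2 - k)"
      by (rule fcoeff_cong) (rule fj)
    ultimately have "fcoeff (\<lambda>\<mu>. cnj (\<Psi> p \<mu> $ i $ j)) (- k) = 0"
      by (simp add: fcoeff_shift)
    then have "(\<integral>\<theta>. cis (of_int k * \<theta>) * cnj (\<Psi> p (cis \<theta>) $ i $ j) \<partial>circle_measure) = 0"
      by (simp add: fcoeff_def)
    moreover have "cis (of_int k * \<theta>) * cnj (\<Psi> p (cis \<theta>) $ i $ j) = cnj (cis (- of_int k * \<theta>) * \<Psi> p (cis \<theta>) $ i $ j)" for \<theta>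
      by (simp add: cis_cnj)
    ultimately have "cnj (\<integral>\<theta>. cis (- of_int k * \<theta>) * \<Psi> p (cis \<theta>) $ i $ j \<partial>circle_measure) = 0"
      by (simp only: Bochner_Integration.integral_cnj)
    then show ?thesis by (simp add: fcoeff_def)
  qed
  have "\<Psi> p \<mu> $ i $ j = a 0 p $ i $ j + \<mu> * a 1 p $ i $ j + \<mu>\<^sup>2 * a 2 p $ i $ j" if "norm \<mu> = 1" for p \<mu> i j
  proof -
    define h where "h = (\<lambda>\<mu>. \<Psi> p \<mu> $ i $ j + \<mu> ^ 0 * - a 0 p $ i $ j + \<mu> ^ 1 * - a 1 p $ i $ j + \<mu> ^ 2 * - a 2 p $ i $ j)"
    have c: "continuous_on UNIV (\<lambda>\<theta>. \<Psi> p (cis \<theta>) $ i $ j)" by (rule loop_continuous[OF L])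
    have "h \<mu> = 0"
    proof (rule fourier_unique_zero[OF _ _ that])
      show "continuous_on UNIV (\<lambda>\<theta>. h (cis \<theta>))" unfolding h_def
        by (intro continuous_on_add c continuous_on_mult continuous_on_power continuous_on_cis continuous_on_id continuous_on_const)
      fix k
      have fh: "fcoeff h k = fcoeff (\<lambda>\<mu>. \<Psi> p \<mu> $ i $ j) k + (if k = 0 then - a 0 p $ i $ j else 0) +
         (if k = 1 then - a 1 p $ i $ j else 0) + (if k = 2 then - a 2 p $ i $ j else 0)"
      proof -
        let ?b = "\<lambda>n \<mu>::complex. \<mu> ^ n * - a (int n) p $ i $ j"
        have m: "cint (?b n)" for n by (rule cint_shift, rule cint_const)
        have c0: "cint (\<lambda>\<mu>. \<Psi> p \<mu> $ i $ j)" by (rule cint_continuous[OF c])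
        have c1: "cint (\<lambda>\<mu>. \<Psi> p \<mu> $ i $ j + ?b 0 \<mu>)" by (rule cint_add[OF c0 m])
        have c2: "cint (\<lambda>\<mu>. \<Psi> p \<mu> $ i $ j + ?b 0 \<mu> + ?b 1 \<mu>)" by (rule cint_add[OF c1 m])
        have f: "fcoeff (?b n) k = (if k = int n then - a (int n) p $ i $ j else 0)" for n
          by (rule fcoeff_monomial)
        show ?thesis
          using f[of 0] f[of 1] f[of 2] fcoeff_add[OF c2 m[of 2], of k] fcoeff_add[OF c1 m[of 1], of k] fcoeff_add[OF c0 m[of 0], of k]
          unfolding h_def by simp
      qed
      have aa: "a k p $ i $ j = fcoeff (\<lambda>\<mu>. \<Psi> p \<mu> $ i $ j) k" for k by (simp add: a_def)
      show "fcoeff h k = 0"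
      proof (cases "k < 0 \<or> k > 2")
        case True
        then show ?thesis using zero[OF True, of p i j] fh by auto
      next
        case False
        then have "k = 0 \<or> k = 1 \<or> k = 2" by arith
        then show ?thesis unfolding fh aa by (elim disjE) simp_all
      qed
    qed
    then show ?thesis by (simp add: h_def algebra_simps)
  qed
  then have "\<Psi> p \<mu> = a 0 p + mat \<mu> ** a 1 p + mat (\<mu>\<^sup>2) ** a 2 p" if "norm \<mu> = 1" for p \<mu>
    using that by (simp add: vec_eq_iff)
  then show ?thesis by (rule that)
qed

definition vlo :: "complex^(2 \<times> 'n::finite) => complex^'n" where "vlo v = (\<chi> i. v $ (0, i))"
definition vhi :: "complex^(2 \<times> 'n::finite) => complex^'n" where "vhi v = (\<chi> i. v $ (1, i))"

lemma UNIV_2': "(UNIV :: 2 set) = {0, 1}"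
  using UNIV_2 by auto

lemma idx_2: "idx (0 :: 2) = 0" "idx (1 :: 2) = 1"
proof -
  have "(0::2) \<le> 1" "(0::2) ~= 1" by (simp_all add: less_eq_bit0_def bit0.Rep_0 bit0.Rep_1)
  then have "{i :: 2. i < 0} = {}" "{i :: 2. i < 1} = {0}"
    using UNIV_2' by (auto simp: less_le)
  then show "idx (0 :: 2) = 0" "idx (1 :: 2) = 1" by (simp_all add: idx_def)
qed

lemma poly_of_2: "poly_of v \<mu> = vlo v + \<mu> *s vhi v"
  by (simp add: vec_eq_iff poly_of_def UNIV_2' idx_2 vlo_def vhi_def)

lemma fourier_polynomial_product:
  fixes B0 B1 B2 :: "complex^'n^'n"
  assumes f: "f \<in> H_plus"
    and g: "!!\<mu>. norm \<mu> = 1 ==> g \<mu> = (B0 + mat \<mu> ** B1 + mat (\<mu>\<^sup>2) ** B2) *v f \<mu>"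
  shows "fourier_coeff g 0 = B0 *v fourier_coeff f 0"
    and "fourier_coeff g 1 = B1 *v fourier_coeff f 0 + B0 *v fourier_coeff f 1"
proof -
  have ci: "cint (\<lambda>\<mu>. f \<mu> $ j)" for j using f by (auto intro: L2_circle_cint simp: H_plus_def)
  have neg: "fcoeff (\<lambda>\<mu>. f \<mu> $ j) k = 0" if "k < 0" for j k
    using f that by (simp add: H_plus_def fourier_coeff_nth[symmetric])
  have "fourier_coeff g k $ i = (\<Sum>j\<in>UNIV. B0 $ i $ j * fcoeff (\<lambda>\<mu>. f \<mu> $ j) k +
     (B1 $ i $ j * fcoeff (\<lambda>\<mu>. f \<mu> $ j) (k - 1) + B2 $ i $ j * fcoeff (\<lambda>\<mu>. f \<mu> $ j) (k - 2)))" for k i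
  proof -
    have "fourier_coeff g k $ i = fcoeff (\<lambda>\<mu>. \<Sum>j\<in>UNIV. B0 $ i $ j * f \<mu> $ j +
       (B1 $ i $ j * (\<mu> ^ 1 * f \<mu> $ j) + B2 $ i $ j * (\<mu> ^ 2 * f \<mu> $ j))) k"
      unfolding fourier_coeff_nth
      by (rule fcoeff_cong) (simp add: g matrix_vector_mult_def algebra_simps)
    also have "\<dots> = (\<Sum>j\<in>UNIV. fcoeff (\<lambda>\<mu>. B0 $ i $ j * f \<mu> $ j +
       (B1 $ i $ j * (\<mu> ^ 1 * f \<mu> $ j) + B2 $ i $ j * (\<mu> ^ 2 * f \<mu> $ j))) k)"
      by (rule fcoeff_sum) (auto intro!: cint_add cint_cmult cint_shift cint_shift[of _ 1, simplified] ci)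
    also have "\<dots> = (\<Sum>j\<in>UNIV. B0 $ i $ j * fcoeff (\<lambda>\<mu>. f \<mu> $ j) k +
     (B1 $ i $ j * fcoeff (\<lambda>\<mu>. f \<mu> $ j) (k - 1) + B2 $ i $ j * fcoeff (\<lambda>\<mu>. f \<mu> $ j) (k - 2)))"
    proof (rule sum.cong[OF refl])
      fix j
      have c0: "cint (\<lambda>\<mu>. B0 $ i $ j * f \<mu> $ j)" and c1: "cint (\<lambda>\<mu>. B1 $ i $ j * (\<mu> ^ 1 * f \<mu> $ j))"
        and c2: "cint (\<lambda>\<mu>. B2 $ i $ j * (\<mu> ^ 2 * f \<mu> $ j))"
        by (rule cint_cmult cint_shift ci)+
      show "fcoeff (\<lambda>\<mu>. B0 $ i $ j * f \<mu> $ j +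
       (B1 $ i $ j * (\<mu> ^ 1 * f \<mu> $ j) + B2 $ i $ j * (\<mu> ^ 2 * f \<mu> $ j))) k =
         B0 $ i $ j * fcoeff (\<lambda>\<mu>. f \<mu> $ j) k +
     (B1 $ i $ j * fcoeff (\<lambda>\<mu>. f \<mu> $ j) (k - 1) + B2 $ i $ j * fcoeff (\<lambda>\<mu>. f \<mu> $ j) (k - 2))"
        by (simp only: fcoeff_add[OF c0 cint_add[OF c1 c2]] fcoeff_add[OF c1 c2] fcoeff_cmult fcoeff_shift) simp
    qed
    finally show ?thesis .
  qed
  note * = this
  show "fourier_coeff g 0 = B0 *v fourier_coeff f 0"
    by (simp only: vec_eq_iff *) (simp add: neg matrix_vector_mult_def fourier_coeff_nth)
  show "fourier_coeff g 1 = B1 *v fourier_coeff f 0 + B0 *v fourier_coeff f 1"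
    by (simp only: vec_eq_iff *) (simp add: neg matrix_vector_mult_def fourier_coeff_nth sum.distrib)
qed

text \<open>The Fourier coefficients of the two unitarity equations of the loop
  \<open>B0 + \<mu> B1 + \<mu>\<^sup>2 B2\<close>; coefficients of opposite frequency are adjoint to
  the listed ones. The last clause is the normalization at \<mu> = 1.\<close>

definition loop_unitary :: "complex^'n^'n => complex^'n^'n => complex^'n^'n => bool" where
  "loop_unitary B0 B1 B2 \<longleftrightarrow>
     adj B0 ** B0 + adj B1 ** B1 + adj B2 ** B2 = mat 1 \<and>
     adj B0 ** B1 + adj B1 ** B2 = 0 \<and> adj B0 ** B2 = 0 \<and>
     B0 ** adj B0 + B1 ** adj B1 + B2 ** adj B2 = mat 1 \<and>
     B1 ** adj B0 + B2 ** adj B1 = 0 \<and> B2 ** adj B0 = 0 \<and>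
     B0 + B1 + B2 = mat 1"

lemma mat_mult_mat [simp]: "mat a ** mat b = mat (a * b :: 'a::comm_semiring_1)"
  by (simp add: vec_eq_iff) (simp add: mat_def)

text \<open>Here \<open>m\<close> stands for \<mu> and \<open>n\<close> for
  \<open>cnj \<mu>\<close>; on the circle multiplication by \<open>m\<^sup>2\<close> turns the
  Laurent polynomial into a polynomial of degree four.\<close>

lemma loop_polynomial_coefficients:
  fixes P00 :: complex
  assumes "m * n = 1" "P00 + n * P01 + n\<^sup>2 * P02 + m * P10 + m * n * P11 + m * n\<^sup>2 * P12 + m\<^sup>2 * P20 + m\<^sup>2 * n * P21 + m\<^sup>2 * n\<^sup>2 * P22 = d"
  shows "P02 + m * (P01 + P12) + m\<^sup>2 * (P00 + P11 + P22 - d) + m ^ 3 * (P10 + P21) + m ^ 4 * P20 = 0"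
  using assms by algebra

lemma loop_unitaryI:
  fixes B0 B1 B2 :: "complex^'n^'n"
  assumes "!!\<mu>. norm \<mu> = 1 ==> B0 + mat \<mu> ** B1 + mat (\<mu>\<^sup>2) ** B2 \<in> unitary_group"
    and 1: "B0 + B1 + B2 = mat 1"
  shows "loop_unitary B0 B1 B2"
proof -
  let ?U = "\<lambda>\<mu>. B0 + mat \<mu> ** B1 + mat (\<mu>\<^sup>2) ** B2"
  let ?T = adj
  have U1: "?U \<mu> ** ?T (?U \<mu>) = mat 1" and U2: "?T (?U \<mu>) ** ?U \<mu> = mat 1" if "norm \<mu> = 1" for \<mu>
    using assms(1)[OF that] by (auto simp: unitary_group_def)
  have mn: "\<mu> * cnj \<mu> = 1" if "norm \<mu> = 1" for \<mu> using that by (simp add: complex_norm_square[symmetric])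
  have e1: "?U \<mu> ** ?T (?U \<mu>) = B0 ** ?T B0 + mat (cnj \<mu>) ** (B0 ** ?T B1) + mat ((cnj \<mu>)\<^sup>2) ** (B0 ** ?T B2)
      + mat \<mu> ** (B1 ** ?T B0) + mat (\<mu> * cnj \<mu>) ** (B1 ** ?T B1) + mat (\<mu> * (cnj \<mu>)\<^sup>2) ** (B1 ** ?T B2)
      + mat (\<mu>\<^sup>2) ** (B2 ** ?T B0) + mat (\<mu>\<^sup>2 * cnj \<mu>) ** (B2 ** ?T B1) + mat (\<mu>\<^sup>2 * (cnj \<mu>)\<^sup>2) ** (B2 ** ?T B2)" for \<mu>
    by (simp add: ctranspose_simps matrix_distribs smul_simps mult_ac add_ac)
  have e2: "?T (?U \<mu>) ** ?U \<mu> = ?T B0 ** B0 + mat \<mu> ** (?T B0 ** B1) + mat (\<mu>\<^sup>2) ** (?T B0 ** B2)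
      + mat (cnj \<mu>) ** (?T B1 ** B0) + mat (\<mu> * cnj \<mu>) ** (?T B1 ** B1) + mat (\<mu>\<^sup>2 * cnj \<mu>) ** (?T B1 ** B2)
      + mat ((cnj \<mu>)\<^sup>2) ** (?T B2 ** B0) + mat (\<mu> * (cnj \<mu>)\<^sup>2) ** (?T B2 ** B1) + mat (\<mu>\<^sup>2 * (cnj \<mu>)\<^sup>2) ** (?T B2 ** B2)" for \<mu>
    by (simp add: ctranspose_simps matrix_distribs smul_simps mult_ac add_ac)
  have c1: "(B0 ** ?T B0) $ i $ j + (B1 ** ?T B1) $ i $ j + (B2 ** ?T B2) $ i $ j - mat 1 $ i $ j = 0 \<and>
     (B1 ** ?T B0) $ i $ j + (B2 ** ?T B1) $ i $ j = 0 \<and> (B2 ** ?T B0) $ i $ j = 0" for i j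
  proof -
    have "(B0 ** ?T B2) $ i $ j + \<mu> * ((B0 ** ?T B1) $ i $ j + (B1 ** ?T B2) $ i $ j) +
      \<mu>\<^sup>2 * ((B0 ** ?T B0) $ i $ j + (B1 ** ?T B1) $ i $ j + (B2 ** ?T B2) $ i $ j - mat 1 $ i $ j) +
      \<mu> ^ 3 * ((B1 ** ?T B0) $ i $ j + (B2 ** ?T B1) $ i $ j) + \<mu> ^ 4 * (B2 ** ?T B0) $ i $ j = 0"
      if "norm \<mu> = 1" for \<mu>
      using arg_cong[OF e1[symmetric, of \<mu>, unfolded U1[OF that]], of "\<lambda>M. M $ i $ j"]
      by (intro loop_polynomial_coefficients[OF mn[OF that]]) (simp add: mult_ac)
    then show ?thesis using circle_polynomial_zero4 by blast
  qed
  have c2: "(?T B0 ** B0) $ i $ j + (?T B1 ** B1) $ i $ j + (?T B2 ** B2) $ i $ j - mat 1 $ i $ j = 0 \<and>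
     (?T B0 ** B1) $ i $ j + (?T B1 ** B2) $ i $ j = 0 \<and> (?T B0 ** B2) $ i $ j = 0" for i j
  proof -
    have "(?T B2 ** B0) $ i $ j + \<mu> * ((?T B1 ** B0) $ i $ j + (?T B2 ** B1) $ i $ j) +
      \<mu>\<^sup>2 * ((?T B0 ** B0) $ i $ j + (?T B1 ** B1) $ i $ j + (?T B2 ** B2) $ i $ j - mat 1 $ i $ j) +
      \<mu> ^ 3 * ((?T B0 ** B1) $ i $ j + (?T B1 ** B2) $ i $ j) + \<mu> ^ 4 * (?T B0 ** B2) $ i $ j = 0"
      if "norm \<mu> = 1" for \<mu>
      using arg_cong[OF e2[symmetric, of \<mu>, unfolded U2[OF that]], of "\<lambda>M. M $ i $ j"]
      by (intro loop_polynomial_coefficients[OF mn[OF that]]) (simp add: mult_ac add_ac)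
    then show ?thesis using circle_polynomial_zero4 by blast
  qed
  show ?thesis unfolding loop_unitary_def using c1 c2 1 by (simp add: vec_eq_iff)
qed

text \<open>One direction compares the Fourier coefficients 0 and 1. Conversely the preimage of
  \<open>v\<close> is found with the adjoint of \<Psi>: its coefficients at \<mu>^-2 and \<mu>^-1
  vanish by the unitarity relations (\<open>y1\<close> and \<open>y2\<close>), so it lies in
  \<open>H_plus\<close>.\<close>

lemma X_bundle_polynomial:
  fixes \<Psi> :: "riemann_sphere => complex => complex^'n^'n"
  assumes P: "!!\<mu>. norm \<mu> = 1 ==> \<Psi> p \<mu> = B0 + mat \<mu> ** B1 + mat (\<mu>\<^sup>2) ** B2"
    and U: "loop_unitary B0 B1 B2"
    and inv: "!!\<mu>. norm \<mu> = 1 ==> \<Psi> p \<mu> \<in> unitary_group"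
  shows "(v :: complex^(2 \<times> 'n)) \<in> X_bundle \<Psi> p \<longleftrightarrow>
    (\<exists>h0 h1. vlo v = B0 *v h0 \<and> vhi v = B1 *v h0 + B0 *v h1)"
proof
  assume "v \<in> X_bundle \<Psi> p"
  then obtain f where f: "f \<in> H_plus" "!!\<mu>. norm \<mu> = 1 ==> poly_of v \<mu> = \<Psi> p \<mu> *v f \<mu>"
    by (auto simp: X_bundle_def W_bundle_def)
  have "fcoeff (\<lambda>\<mu>. vlo v $ i + \<mu> ^ 1 * vhi v $ i) k = (if k = 0 then vlo v $ i else if k = 1 then vhi v $ i else 0)" for i k
    by (subst fcoeff_add) (simp_all only: cint_const cint_shift fcoeff_const fcoeff_monomial, simp)
  then have "fourier_coeff (poly_of v) 0 = vlo v" "fourier_coeff (poly_of v) 1 = vhi v"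
    by (simp_all add: vec_eq_iff fourier_coeff_nth poly_of_2)
  then show "\<exists>h0 h1. vlo v = B0 *v h0 \<and> vhi v = B1 *v h0 + B0 *v h1"
    using fourier_polynomial_product[OF f(1), of "poly_of v" B0 B1 B2] f(2) P by metis
next
  assume "\<exists>h0 h1. vlo v = B0 *v h0 \<and> vhi v = B1 *v h0 + B0 *v h1"
  then obtain h0 h1 where h: "vlo v = B0 *v h0" "vhi v = B1 *v h0 + B0 *v h1" by blast
  define f where "f = (\<lambda>\<mu>. (adj B0 *v vlo v + adj B1 *v vhi v) + \<mu> *s (adj B0 *v vhi v))"
  have u: "adj B0 ** B2 = 0" "adj B0 ** B1 + adj B1 ** B2 = 0"
    using U by (auto simp: loop_unitary_def)
  have z1: "adj B2 ** B0 = 0"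
    using arg_cong[OF u(1), of adj] by (simp add: ctranspose_simps)
  have z2: "adj B1 ** B0 + adj B2 ** B1 = 0"
    using arg_cong[OF u(2), of adj] by (simp add: ctranspose_simps)
  have y1: "adj B2 *v vlo v = 0"
    by (simp add: h matrix_vector_mul_assoc z1)
  have y2: "adj B1 *v vlo v + adj B2 *v vhi v = 0"
    by (simp add: h vector_distribs matrix_vector_mul_assoc z1 z2 flip: matrix_vector_mult_add_rdistrib)
  have "poly_of v \<mu> = \<Psi> p \<mu> *v f \<mu>" if \<mu>: "norm \<mu> = 1" for \<mu>
  proof -
    have mn: "cnj \<mu> * \<mu> = 1" using \<mu> by (simp add: complex_norm_square[symmetric] mult.commute)
    have "adj (\<Psi> p \<mu>) *v poly_of v \<mu> = adj B0 *v vlo v + cnj \<mu> *s (adj B1 *v vlo v)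
       + (cnj \<mu>)\<^sup>2 *s (adj B2 *v vlo v) + \<mu> *s (adj B0 *v vhi v) + (cnj \<mu> * \<mu>) *s (adj B1 *v vhi v)
       + ((cnj \<mu>) * (cnj \<mu> * \<mu>)) *s (adj B2 *v vhi v)"
      by (simp add: P[OF \<mu>] poly_of_2 ctranspose_simps smul_simps vector_distribs
          vector_scalar_commute vec.scale_scale vec.scale_right_distrib power2_eq_square mult_ac add_ac)
    also have "\<dots> = f \<mu> + cnj \<mu> *s (adj B1 *v vlo v + adj B2 *v vhi v)"
      by (simp add: mn y1 f_def vec.scale_right_distrib add_ac)
    finally have "adj (\<Psi> p \<mu>) *v poly_of v \<mu> = f \<mu>" by (simp add: y2)
    then have "\<Psi> p \<mu> *v f \<mu> = (\<Psi> p \<mu> ** adj (\<Psi> p \<mu>)) *v poly_of v \<mu>"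
      by (simp add: matrix_vector_mul_assoc[symmetric])
    then show ?thesis using inv[OF \<mu>] by (simp add: unitary_group_def)
  qed
  moreover have "f \<in> H_plus" unfolding f_def by (rule H_plus_linear)
  ultimately show "v \<in> X_bundle \<Psi> p" by (auto simp: X_bundle_def W_bundle_def)
qed

text \<open>The zeroth Fourier coefficient of an element of \<open>W_bundle \<Psi> p\<close> lies in
  the range of \<open>A0 p\<close>, hence is orthogonal to \<open>c\<close>. The constant loop
  \<open>c\<close> is a combination of such elements, so \<open>c\<close> is orthogonal to
  itself.\<close>

lemma normalized_full:
  fixes \<Psi> :: "riemann_sphere => complex => complex^'n^'n"
  assumes N: "normalized_extended_solution 2 \<psi> \<Psi>"
    and P: "!!p \<mu>. norm \<mu> = 1 ==> \<Psi> p \<mu> = A0 p + mat \<mu> ** A1 p + mat (\<mu>\<^sup>2) ** A2 p"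
    and c: "!!p. adj (A0 p) *v c = 0"
  shows "c = 0"
proof -
  have "\<forall>f\<in>H_plus. \<exists>(m::nat) p g a. (\<forall>i<m. g i \<in> W_bundle \<Psi> (p i)) \<and>
        (\<forall>\<mu>. norm \<mu> = 1 --> f \<mu> = (\<Sum>i<m. a i *s g i \<mu>))"
    using N unfolding normalized_extended_solution_def by (elim conjE)
  from bspec[OF this H_plus_const[of c]]
  obtain m :: nat and p g a where g: "!!i. i < m ==> g i \<in> W_bundle \<Psi> (p i)"
    "!!\<mu>. norm \<mu> = 1 ==> c = (\<Sum>i<m. a i *s g i \<mu>)"
    by blast
  have o: "hinner (fourier_coeff (g i) 0) c = 0" and ci: "cint (\<lambda>\<mu>. g i \<mu> $ j)" if i: "i < m" for i j
  proof -
    obtain f where f: "f \<in> H_plus" "!!\<mu>. norm \<mu> = 1 ==> g i \<mu> = \<Psi> (p i) \<mu> *v f \<mu>"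
      using g(1)[OF i] by (auto simp: W_bundle_def)
    have "fourier_coeff (g i) 0 = A0 (p i) *v fourier_coeff f 0"
      using fourier_polynomial_product(1)[OF f(1), of "g i" "A0 (p i)" "A1 (p i)" "A2 (p i)"] f(2) P by metis
    then show "hinner (fourier_coeff (g i) 0) c = 0" by (simp add: hinner_matrix c)
    have "g i \<in> H_plus" using N g(1)[OF i] by (auto simp: normalized_extended_solution_def)
    then show "cint (\<lambda>\<mu>. g i \<mu> $ j)" by (intro L2_circle_cint) (simp add: H_plus_def)
  qed
  have "c = (\<Sum>i<m. a i *s fourier_coeff (g i) 0)"
  proof (subst vec_eq_iff, rule allI)
    fix j
    have "c $ j = fcoeff (\<lambda>\<mu>. c $ j) 0" by (simp add: fcoeff_const)
    also have "\<dots> = fcoeff (\<lambda>\<mu>. \<Sum>i<m. a i * g i \<mu> $ j) 0"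
    proof (rule fcoeff_cong)
      fix \<mu> :: complex assume "norm \<mu> = 1"
      from arg_cong[OF g(2)[OF this], of "\<lambda>v. v $ j"]
      show "c $ j = (\<Sum>i<m. a i * g i \<mu> $ j)" by (simp add: sum_component)
    qed
    also have "\<dots> = (\<Sum>i<m. a i * fcoeff (\<lambda>\<mu>. g i \<mu> $ j) 0)"
      by (subst fcoeff_sum) (auto intro: cint_cmult ci simp: fcoeff_cmult)
    finally show "c $ j = (\<Sum>i<m. a i *s fourier_coeff (g i) 0) $ j"
      by (simp add: sum_component fourier_coeff_nth)
  qed
  moreover have "hinner (\<Sum>i\<in>I. a i *s fourier_coeff (g i) 0) c = (\<Sum>i\<in>I. a i * hinner (fourier_coeff (g i) 0) c)"
    if "finite I" for I
    using that by (induction I rule: finite_induct) (auto simp: hinner_simps)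
  ultimately have "hinner c c = 0" using o by simp
  then show ?thesis by simp
qed

section \<open>The differential of a map into the unitary group\<close>

lemma unitary_matrix_inv: "U \<in> unitary_group ==> matrix_inv U = adj U"
  unfolding matrix_inv_def
proof (rule some_equality)
  assume U: "U \<in> unitary_group"
  then show "U ** adj U = mat 1 \<and> adj U ** U = mat 1" by (simp add: unitary_group_def)
  fix B assume "U ** B = mat 1 \<and> B ** U = mat 1"
  then show "B = adj U"
    using U by (metis (mono_tags, lifting) matrix_mul_assoc matrix_mul_lid matrix_mul_rid mem_Collect_eq unitary_group_def)
qed

lemma pd_matrix_nth:
  fixes F :: "complex => complex^'m^'l"
  assumes "F differentiable (at z)"
  shows "pd u F z $ i $ j = pd u (\<lambda>w. F w $ i $ j) z"
proof -
  have "(F has_derivative frechet_derivative F (at z)) (at z)"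
    using assms frechet_derivative_works by blast
  then have "((\<lambda>w. F w $ i) has_derivative (\<lambda>h. frechet_derivative F (at z) h $ i)) (at z)"
    by (rule bounded_linear.has_derivative[OF bounded_linear_vec_nth])
  then have "((\<lambda>w. F w $ i $ j) has_derivative (\<lambda>h. frechet_derivative F (at z) h $ i $ j)) (at z)"
    by (rule bounded_linear.has_derivative[OF bounded_linear_vec_nth])
  from frechet_derivative_at[OF this] show ?thesis by (simp add: pd_def fun_eq_iff)
qed

lemma matrix_real_scale: "(1/2) *\<^sub>R M = smul (1/2) (M :: complex^'m^'l)"
  by (simp only: vec_eq_iff vector_scaleR_component smul_nth) (simp add: scaleR_conv_of_real)

context
  fixes \<psi> :: "riemann_sphere => complex^'n^'n" and c
  assumes \<psi>: "smooth_unitary_map \<psi>" and c: "c \<in> charts"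
begin

lemma unitary_chart: "\<psi> (c z) ** adj (\<psi> (c z)) = mat 1" "adj (\<psi> (c z)) ** \<psi> (c z) = mat 1"
  "matrix_inv (\<psi> (c z)) = adj (\<psi> (c z))"
proof -
  have "\<psi> (c z) \<in> unitary_group" using \<psi> by (auto simp: smooth_unitary_map_def)
  then show "\<psi> (c z) ** adj (\<psi> (c z)) = mat 1" "adj (\<psi> (c z)) ** \<psi> (c z) = mat 1"
    "matrix_inv (\<psi> (c z)) = adj (\<psi> (c z))"
    by (auto simp: unitary_group_def unitary_matrix_inv)
qed

lemma smooth_chart: "smooth (\<lambda>w. \<psi> (c w))"
  using \<psi> c by (simp add: smooth_unitary_map_def smooth_on_sphere_def)

lemma dz_unitary: "dz_mat (\<lambda>w. \<psi> (c w)) z = smul 2 (\<psi> (c z) ** A_z \<psi> c z)"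
proof -
  have "\<psi> (c z) ** A_z \<psi> c z = smul (1/2) ((\<psi> (c z) ** adj (\<psi> (c z))) ** dz_mat (\<lambda>w. \<psi> (c w)) z)"
    by (simp add: A_z_def matrix_real_scale smul_simps unitary_chart(3) matrix_mul_assoc)
  then show ?thesis by (simp add: unitary_chart smul_simps)
qed

text \<open>Differentiating \<psi> times its adjoint, which is constant, shows that the pulled-back
  Maurer-Cartan form is skew-Hermitian; the whole differential is encoded in the single field
  \<open>A_z\<close>.\<close>

lemma A_zbar_eq: "A_zbar \<psi> c z = - adj (A_z \<psi> c z)"
proof -
  define U where "U = \<psi> (c z)"
  define P where "P = dz_mat (\<lambda>w. \<psi> (c w)) z"
  define Q where "Q = dzbar_mat (\<lambda>w. \<psi> (c w)) z"
  note d = smooth_mwd[OF smooth_chart, of z, folded P_def Q_def]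
  have "mwd (\<lambda>w. \<psi> (c w) ** adj (\<psi> (c w))) (P ** adj U + U ** adj Q) (Q ** adj U + U ** adj P) z"
    unfolding U_def by (rule mwd_mult[OF d mwd_ctranspose[OF d]])
  moreover have "mwd (\<lambda>w. \<psi> (c w) ** adj (\<psi> (c w))) 0 0 z"
    by (simp add: unitary_chart mwd_const)
  ultimately have "Q ** adj U + U ** adj P = 0" using mwd_unique by blast
  then have "adj U ** (Q ** adj U + U ** adj P) ** U = 0" by simp
  then have "adj U ** Q + adj P ** U = 0"
    by (simp add: matrix_distribs matrix_mul_assoc[symmetric] unitary_chart[of z, folded U_def])
       (simp add: matrix_mul_assoc unitary_chart[of z, folded U_def])
  then have "smul (1/2) (adj U ** Q) = - adj (smul (1/2) (adj U ** P))"
    by (simp add: ctranspose_simps ctranspose_smul eq_neg_iff_add_eq_0 flip: smul_add_right)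
  then show ?thesis
    by (simp add: A_zbar_def A_z_def matrix_real_scale unitary_chart(3) U_def P_def Q_def)
qed

lemma dzbar_unitary: "dzbar_mat (\<lambda>w. \<psi> (c w)) z = smul (-2) (\<psi> (c z) ** adj (A_z \<psi> c z))"
proof -
  have "\<psi> (c z) ** A_zbar \<psi> c z = smul (1/2) ((\<psi> (c z) ** adj (\<psi> (c z))) ** dzbar_mat (\<lambda>w. \<psi> (c w)) z)"
    by (simp add: A_zbar_def matrix_real_scale smul_simps unitary_chart(3) matrix_mul_assoc)
  then have "smul 2 (\<psi> (c z) ** A_zbar \<psi> c z) = dzbar_mat (\<lambda>w. \<psi> (c w)) z"
    by (simp add: unitary_chart smul_simps)
  then show ?thesis by (simp add: A_zbar_eq matrix_minus_right vec_eq_iff)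
qed

lemma mwd_unitary:
  "mwd (\<lambda>w. \<psi> (c w)) (smul 2 (\<psi> (c z) ** A_z \<psi> c z)) (smul (-2) (\<psi> (c z) ** adj (A_z \<psi> c z))) z"
  using smooth_mwd[OF smooth_chart, of z] by (simp add: dz_unitary dzbar_unitary)

lemma pd_unitary:
  "pd u (\<lambda>w. \<psi> (c w)) z = \<psi> (c z) ** (smul (2 * u) (A_z \<psi> c z) - smul (2 * cnj u) (adj (A_z \<psi> c z)))"
  unfolding vec_eq_iff
proof (intro allI)
  fix i j
  have "has_wd (\<lambda>w. \<psi> (c w) $ i $ j) (smul 2 (\<psi> (c z) ** A_z \<psi> c z) $ i $ j) (smul (-2) (\<psi> (c z) ** adj (A_z \<psi> c z)) $ i $ j) z"
    using mwd_unitary[of z] by (simp only: mwd_def)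
  from has_wd_pd[OF this, of u]
  show "pd u (\<lambda>w. \<psi> (c w)) z $ i $ j = (\<psi> (c z) ** (smul (2 * u) (A_z \<psi> c z) - smul (2 * cnj u) (adj (A_z \<psi> c z)))) $ i $ j"
    by (simp add: pd_matrix_nth[OF smooth_differentiable[OF smooth_chart]] matrix_distribs smul_simps mult_ac)
qed

text \<open>Each logarithmic derivative of \<psi> carries a factor 2, and the metric the factor 1/8;
  together they leave the final division by 2.\<close>

lemma induced_metric_A_z:
  "induced_metric \<psi> c z u v = Re (u * cnj v * trace (A_z \<psi> c z ** adj (A_z \<psi> c z))
     - u * v * trace (A_z \<psi> c z ** A_z \<psi> c z)
     - cnj u * cnj v * cnj (trace (A_z \<psi> c z ** A_z \<psi> c z))
     + cnj u * v * trace (A_z \<psi> c z ** adj (A_z \<psi> c z))) / 2"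
proof -
  let ?A = "A_z \<psi> c z"
  have t1: "trace (smul a M) = a * trace M" for a and M :: "complex^'n^'n"
    by (simp add: trace_def sum_distrib_left)
  have t2: "trace (M - N) = trace M - trace N" for M N :: "complex^'n^'n" by (simp add: trace_sub)
  have t6: "trace (M + N) = trace M + trace N" for M N :: "complex^'n^'n" by (simp add: trace_add)
  have t3: "trace (adj M) = cnj (trace M)" for M :: "complex^'n^'n" by (simp add: trace_def)
  have t4: "trace (adj ?A ** adj ?A) = cnj (trace (?A ** ?A))"
    by (simp add: t3[symmetric] ctranspose_mult)
  have t5: "trace (adj ?A ** ?A) = trace (?A ** adj ?A)" by (rule trace_mul_sym)
  have i: "matrix_inv (\<psi> (c z)) ** (\<psi> (c z) ** M) = M" for M
    by (simp add: unitary_chart matrix_mul_assoc)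
  have "trace ((smul (2 * u) ?A - smul (2 * cnj u) (adj ?A)) ** adj (smul (2 * v) ?A - smul (2 * cnj v) (adj ?A)))
     = 4 * (u * cnj v * trace (?A ** adj ?A) - u * v * trace (?A ** ?A)
     - cnj u * cnj v * cnj (trace (?A ** ?A)) + cnj u * v * trace (?A ** adj ?A))"
    by (simp add: ctranspose_simps ctranspose_smul matrix_distribs smul_simps t1 t2 t4 t5 t6 algebra_simps)
  then show ?thesis
    unfolding induced_metric_def h_metric_def pd_unitary i by simp
qed

lemma trace_mult_ctranspose: "trace (M ** adj M) = of_real (Re (trace (M ** adj M)))"
  for M :: "complex^'n^'n"
proof -
  have "cnj (trace (M ** adj M)) = trace (adj (M ** adj M))"
    by (simp add: trace_def)
  then have "cnj (trace (M ** adj M)) = trace (M ** adj M)" by (simp add: ctranspose_mult)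
  then show ?thesis by (metis Reals_cnj_iff of_real_Re)
qed

text \<open>The trace is, up to a factor, the (2,0)-part of the induced metric: equal lengths of the
  coordinate vectors kill its real part, their orthogonality its imaginary part.\<close>

lemma conformal_trace:
  assumes "conformal \<psi>" shows "trace (A_z \<psi> c z ** A_z \<psi> c z) = 0"
proof -
  let ?t = "trace (A_z \<psi> c z ** adj (A_z \<psi> c z))"
  have t: "Im ?t = 0" by (metis trace_mult_ctranspose Im_complex_of_real)
  have "induced_metric \<psi> c z 1 1 = induced_metric \<psi> c z \<i> \<i>" "induced_metric \<psi> c z 1 \<i> = 0"
    using assms c by (auto simp: conformal_def)
  then show ?thesis using t unfolding induced_metric_A_z by (simp add: complex_eq_iff)
qed

lemma induced_metric_conformal:
  assumes "conformal \<psi>"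
  shows "induced_metric \<psi> c z 1 1 = Re (trace (A_z \<psi> c z ** adj (A_z \<psi> c z)))"
  unfolding induced_metric_A_z conformal_trace[OF assms] by simp

lemma immersion_A_z_nonzero:
  assumes "immersion \<psi>" shows "A_z \<psi> c z ~= 0"
proof
  assume "A_z \<psi> c z = 0"
  then have "pd u (\<lambda>w. \<psi> (c w)) z = 0" for u unfolding pd_unitary by simp
  moreover have "inj (\<lambda>u. pd u (\<lambda>w. \<psi> (c w)) z)" using assms c by (simp add: immersion_def)
  ultimately show False using zero_neq_one by (metis injD)
qed

end

section \<open>The coefficients of an extended solution in a chart\<close>

text \<open>The extended solution equations compared power by power in \<mu>. The extreme powers,
  \<mu>^-1 in the \<open>dz\<close> equation and \<mu>^3 in the \<open>dzbar\<close> equation, have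
  no counterpart on the other side and give the algebraic constraints \<open>A0_A\<close> and
  \<open>A_A2\<close>.\<close>

locale loop_chart =
  fixes A0 A1 A2 A :: "complex => complex^'n^'n"
  assumes smooth_A0: "smooth A0" and smooth_A1: "smooth A1" and smooth_A2: "smooth A2" and smooth_A: "smooth A"
    and unitary: "loop_unitary (A0 z) (A1 z) (A2 z)"
    and A0_A: "A0 z ** A z = 0" and A_A2: "A z ** adj (A2 z) = 0"
    and mwd_A0: "mwd A0 (- (A1 z ** A z)) (- (A0 z ** adj (A z))) z"
    and mwd_A1: "mwd A1 ((A1 z - A2 z) ** A z) ((A0 z - A1 z) ** adj (A z)) z"
    and mwd_A2: "mwd A2 (A2 z ** A z) (A1 z ** adj (A z)) z"

lemma dz_polynomial_entry:
  assumes "!!\<mu>. norm \<mu> = 1 ==> p0 + \<mu> * p1 + \<mu>\<^sup>2 * p2 = (1 - inverse \<mu>) * (a0 + \<mu> * a1 + \<mu>\<^sup>2 * a2)"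
  shows "a0 = (0::complex) \<and> p0 = - a1 \<and> p1 = a1 - a2 \<and> p2 = a2"
proof -
  have "a0 + \<mu> * (p0 - a0 + a1) + \<mu>\<^sup>2 * (p1 - a1 + a2) + \<mu> ^ 3 * (p2 - a2) + \<mu> ^ 4 * 0 = 0" if "norm \<mu> = 1" for \<mu>
  proof -
    have "\<mu> ~= 0" using that by auto
    then have 1: "\<mu> * inverse \<mu> = 1" by simp
    show ?thesis using assms[OF that] 1 by algebra
  qed
  from circle_polynomial_zero4[OF this]
  have e: "a0 = 0" "p0 - a0 + a1 = 0" "p1 - a1 + a2 = 0" "p2 - a2 = 0" by auto
  have "p0 = - a1" "p1 = a1 - a2" "p2 = a2" using e by algebra+
  then show ?thesis using e by simp
qed

lemma dzbar_polynomial_entry: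
  assumes "!!\<mu>. norm \<mu> = 1 ==> p0 + \<mu> * p1 + \<mu>\<^sup>2 * p2 = (1 - \<mu>) * (a0 + \<mu> * a1 + \<mu>\<^sup>2 * a2)"
  shows "p0 = (a0::complex) \<and> p1 = a1 - a0 \<and> p2 = a2 - a1 \<and> a2 = 0"
proof -
  have "(p0 - a0) + \<mu> * (p1 - a1 + a0) + \<mu>\<^sup>2 * (p2 - a2 + a1) + \<mu> ^ 3 * a2 + \<mu> ^ 4 * 0 = 0" if "norm \<mu> = 1" for \<mu>
    using assms[OF that] by algebra
  from circle_polynomial_zero4[OF this]
  have e: "p0 - a0 = 0" "p1 - a1 + a0 = 0" "p2 - a2 + a1 = 0" "a2 = 0" by auto
  have "p0 = a0" "p1 = a1 - a0" "p2 = a2 - a1" using e by algebra+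
  then show ?thesis using e by simp
qed

lemma smooth_matrix_lincomb:
  fixes F G H :: "complex => complex^'m^'l"
  assumes "smooth F" "smooth G" "smooth H"
  shows "smooth (\<lambda>w. smul a (F w) + smul b (G w) + smul c (H w))"
proof (rule smooth_matI)
  fix i j
  have "smooth (\<lambda>x. a * F x $ i $ j + b * G x $ i $ j + c * H x $ i $ j)"
    by (rule smooth_add smooth_cmult smooth_vec_nth assms)+
  then show "smooth (\<lambda>x. (smul a (F x) + smul b (G x) + smul c (H x)) $ i $ j)" by simp
qed

lemma mwd_smul: "mwd F P Q z ==> mwd (\<lambda>w. smul a (F w)) (smul a P) (smul a Q) z"
proof -
  assume "mwd F P Q z"
  from mwd_mult[OF mwd_const[of "mat a"] this] show ?thesis by (simp add: mat_mult_smul)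
qed

lemma extended_solution_chart:
  fixes \<psi> :: "riemann_sphere => complex^'n^'n"
  assumes E: "extended_solution \<psi> \<Psi>" and \<psi>: "smooth_unitary_map \<psi>" and c: "c \<in> charts"
    and P: "!!p \<mu>. norm \<mu> = 1 ==> \<Psi> p \<mu> = A0 p + mat \<mu> ** A1 p + mat (\<mu>\<^sup>2) ** A2 p"
  shows "loop_chart (\<lambda>z. A0 (c z)) (\<lambda>z. A1 (c z)) (\<lambda>z. A2 (c z)) (A_z \<psi> c)"
proof -
  have L: "smooth_loop_map \<Psi>" using E by (simp add: extended_solution_def)
  have unit: "\<Psi> p \<mu> \<in> unitary_group" if "norm \<mu> = 1" for p \<mu> using L that by (simp add: smooth_loop_map_def)
  have one: "\<Psi> p 1 = mat 1" for p using L by (simp add: smooth_loop_map_def)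
  have sm: "smooth (\<lambda>w. \<Psi> (c w) (cis \<theta>))" for \<theta>
  proof -
    have "smooth (\<lambda>(z::complex, \<theta>::real). \<Psi> (c z) (cis \<theta>))"
      using L c by (simp add: smooth_loop_map_def)
    from smooth_slice[OF this, of \<theta>] show ?thesis by simp
  qed
  \<comment> \<open>A quadratic polynomial in \<mu> is determined by its values at 1, -1 and
    \<open>\<i>\<close>; interpolation expresses the coefficients by smooth functions of the
    point.\<close>
  have s1: "smooth (\<lambda>w. \<Psi> (c w) 1)" "smooth (\<lambda>w. \<Psi> (c w) (-1))" "smooth (\<lambda>w. \<Psi> (c w) \<i>)"
    using sm[of 0] sm[of pi] sm[of "pi/2"] by simp_all
  have v: "\<Psi> p 1 = A0 p + A1 p + A2 p" "\<Psi> p (-1) = A0 p - A1 p + A2 p" "\<Psi> p \<i> = A0 p + smul \<i> (A1 p) - A2 p" for p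
    by (simp_all add: P vec_eq_iff)
  have sA0: "smooth (\<lambda>w. A0 (c w))"
    using smooth_matrix_lincomb[OF s1, of "1/4 - \<i>/4" "1/4 + \<i>/4" "1/2"]
    by (rule back_subst[where P = smooth]) (simp add: v vec_eq_iff fun_eq_iff field_simps)
  have sA1: "smooth (\<lambda>w. A1 (c w))"
    using smooth_matrix_lincomb[OF s1, of "1/2" "-1/2" 0]
    by (rule back_subst[where P = smooth]) (simp add: v vec_eq_iff fun_eq_iff field_simps)
  have sA2: "smooth (\<lambda>w. A2 (c w))"
    using smooth_matrix_lincomb[OF s1, of "1/4 + \<i>/4" "1/4 - \<i>/4" "-1/2"]
    by (rule back_subst[where P = smooth]) (simp add: v vec_eq_iff fun_eq_iff field_simps)
  have unitary: "loop_unitary (A0 p) (A1 p) (A2 p)" for p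
  proof (rule loop_unitaryI)
    show "A0 p + mat \<mu> ** A1 p + mat (\<mu>\<^sup>2) ** A2 p \<in> unitary_group" if "norm \<mu> = 1" for \<mu>
      using unit[OF that, of p] P[OF that, of p] by simp
    show "A0 p + A1 p + A2 p = mat 1" using one[of p] v(1)[of p] by simp
  qed
  define A where "A = A_z \<psi> c"
  define B where "B = A_zbar \<psi> c"
  have B: "B z = - adj (A z)" for z by (simp add: A_def B_def A_zbar_eq[OF \<psi> c])
  define P0 where "P0 = dz_mat (\<lambda>w. A0 (c w))"  define Q0 where "Q0 = dzbar_mat (\<lambda>w. A0 (c w))"
  define P1 where "P1 = dz_mat (\<lambda>w. A1 (c w))"  define Q1 where "Q1 = dzbar_mat (\<lambda>w. A1 (c w))"
  define P2 where "P2 = dz_mat (\<lambda>w. A2 (c w))"  define Q2 where "Q2 = dzbar_mat (\<lambda>w. A2 (c w))"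
  have d: "mwd (\<lambda>w. A0 (c w)) (P0 z) (Q0 z) z" "mwd (\<lambda>w. A1 (c w)) (P1 z) (Q1 z) z" "mwd (\<lambda>w. A2 (c w)) (P2 z) (Q2 z) z" for z
    unfolding P0_def P1_def P2_def Q0_def Q1_def Q2_def by (rule smooth_mwd sA0 sA1 sA2)+
  have D: "mwd (\<lambda>w. \<Psi> (c w) \<mu>) (P0 z + smul \<mu> (P1 z) + smul (\<mu>\<^sup>2) (P2 z)) (Q0 z + smul \<mu> (Q1 z) + smul (\<mu>\<^sup>2) (Q2 z)) z"
    if "norm \<mu> = 1" for \<mu> z
    using mwd_add[OF mwd_add[OF d(1) mwd_smul[OF d(2)]] mwd_smul[OF d(3)]]
    by (simp add: P[OF that] mat_mult_smul)
  have inv: "\<Psi> p \<mu> ** (matrix_inv (\<Psi> p \<mu>) ** M) = M" if "norm \<mu> = 1" for p \<mu> M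
    using unit[OF that, of p] by (simp add: unitary_matrix_inv matrix_mul_assoc) (simp add: unitary_group_def)
  have rz: "P0 z + smul \<mu> (P1 z) + smul (\<mu>\<^sup>2) (P2 z) = smul (1 - inverse \<mu>) (A0 (c z) ** A z + smul \<mu> (A1 (c z) ** A z) + smul (\<mu>\<^sup>2) (A2 (c z) ** A z))"
    and rzb: "Q0 z + smul \<mu> (Q1 z) + smul (\<mu>\<^sup>2) (Q2 z) = smul (1 - \<mu>) (A0 (c z) ** B z + smul \<mu> (A1 (c z) ** B z) + smul (\<mu>\<^sup>2) (A2 (c z) ** B z))"
    if \<mu>: "norm \<mu> = 1" for \<mu> z
  proof -
    have "matrix_inv (\<Psi> (c z) \<mu>) ** dz_mat (\<lambda>w. \<Psi> (c w) \<mu>) z = mat (1 - inverse \<mu>) ** A z \<and>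
        matrix_inv (\<Psi> (c z) \<mu>) ** dzbar_mat (\<lambda>w. \<Psi> (c w) \<mu>) z = mat (1 - \<mu>) ** B z"
      using E c \<mu> unfolding extended_solution_def A_def B_def by blast
    then have "\<Psi> (c z) \<mu> ** (matrix_inv (\<Psi> (c z) \<mu>) ** dz_mat (\<lambda>w. \<Psi> (c w) \<mu>) z) = \<Psi> (c z) \<mu> ** (mat (1 - inverse \<mu>) ** A z)"
      "\<Psi> (c z) \<mu> ** (matrix_inv (\<Psi> (c z) \<mu>) ** dzbar_mat (\<lambda>w. \<Psi> (c w) \<mu>) z) = \<Psi> (c z) \<mu> ** (mat (1 - \<mu>) ** B z)"
      by simp_all
    then show "P0 z + smul \<mu> (P1 z) + smul (\<mu>\<^sup>2) (P2 z) = smul (1 - inverse \<mu>) (A0 (c z) ** A z + smul \<mu> (A1 (c z) ** A z) + smul (\<mu>\<^sup>2) (A2 (c z) ** A z))"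
      "Q0 z + smul \<mu> (Q1 z) + smul (\<mu>\<^sup>2) (Q2 z) = smul (1 - \<mu>) (A0 (c z) ** B z + smul \<mu> (A1 (c z) ** B z) + smul (\<mu>\<^sup>2) (A2 (c z) ** B z))"
      unfolding inv[OF \<mu>] mwd_dz[OF D[OF \<mu>]] mwd_dzbar[OF D[OF \<mu>]]
      by (simp_all only: P[OF \<mu>] mat_mult_smul matrix_add_rdistrib' smul_mult_left smul_mult_right)
  qed
  have z: "A0 (c z) ** A z = 0 \<and> P0 z = - (A1 (c z) ** A z) \<and> P1 z = A1 (c z) ** A z - A2 (c z) ** A z \<and> P2 z = A2 (c z) ** A z" for z
  proof -
    have "(A0 (c z) ** A z) $ i $ j = 0 \<and> P0 z $ i $ j = - (A1 (c z) ** A z) $ i $ j \<and>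
       P1 z $ i $ j = (A1 (c z) ** A z) $ i $ j - (A2 (c z) ** A z) $ i $ j \<and> P2 z $ i $ j = (A2 (c z) ** A z) $ i $ j" for i j
    proof (rule dz_polynomial_entry)
      fix \<mu> :: complex assume "norm \<mu> = 1"
      from arg_cong[OF rz[OF this, of z], of "\<lambda>M. M $ i $ j"]
      show "P0 z $ i $ j + \<mu> * P1 z $ i $ j + \<mu>\<^sup>2 * P2 z $ i $ j = (1 - inverse \<mu>) *
        ((A0 (c z) ** A z) $ i $ j + \<mu> * (A1 (c z) ** A z) $ i $ j + \<mu>\<^sup>2 * (A2 (c z) ** A z) $ i $ j)" by simp
    qed
    then show ?thesis by (simp add: vec_eq_iff)
  qed
  have zb: "Q0 z = A0 (c z) ** B z \<and> Q1 z = A1 (c z) ** B z - A0 (c z) ** B z \<and> Q2 z = A2 (c z) ** B z - A1 (c z) ** B z \<and> A2 (c z) ** B z = 0" for z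
  proof -
    have "Q0 z $ i $ j = (A0 (c z) ** B z) $ i $ j \<and> Q1 z $ i $ j = (A1 (c z) ** B z) $ i $ j - (A0 (c z) ** B z) $ i $ j \<and>
       Q2 z $ i $ j = (A2 (c z) ** B z) $ i $ j - (A1 (c z) ** B z) $ i $ j \<and> (A2 (c z) ** B z) $ i $ j = 0" for i j
    proof (rule dzbar_polynomial_entry)
      fix \<mu> :: complex assume "norm \<mu> = 1"
      from arg_cong[OF rzb[OF this, of z], of "\<lambda>M. M $ i $ j"]
      show "Q0 z $ i $ j + \<mu> * Q1 z $ i $ j + \<mu>\<^sup>2 * Q2 z $ i $ j = (1 - \<mu>) *
        ((A0 (c z) ** B z) $ i $ j + \<mu> * (A1 (c z) ** B z) $ i $ j + \<mu>\<^sup>2 * (A2 (c z) ** B z) $ i $ j)" by simp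
    qed
    then show ?thesis by (simp add: vec_eq_iff)
  qed
  have AA2: "A z ** adj (A2 (c z)) = 0" for z
  proof -
    have "A2 (c z) ** adj (A z) = 0" using zb[of z] by (simp add: B matrix_minus_right)
    from arg_cong[OF this, of adj] show ?thesis by (simp add: ctranspose_mult)
  qed
  \<comment> \<open>\<open>A1 + 2 A2\<close> is the \<mu>-derivative of \<Psi> at \<mu> = 1. Its
    \<open>dz\<close> derivative is \<open>(A1 + A2) ** A\<close>, which is \<open>A\<close> because
    \<open>A0 ** A = 0\<close> and the coefficients sum to the identity. This gives the smoothness
    of \<open>A\<close>.\<close>
  have "A z = dz_mat (\<lambda>w. smul 0 (A0 (c w)) + smul 1 (A1 (c w)) + smul 2 (A2 (c w))) z" for z
  proof -
    have "dz_mat (\<lambda>w. smul 0 (A0 (c w)) + smul 1 (A1 (c w)) + smul 2 (A2 (c w))) z = smul 0 (P0 z) + smul 1 (P1 z) + smul 2 (P2 z)"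
      by (rule mwd_dz[OF mwd_add[OF mwd_add[OF mwd_smul[OF d(1)] mwd_smul[OF d(2)]] mwd_smul[OF d(3)]]])
    also have "\<dots> = A1 (c z) ** A z + A2 (c z) ** A z"
      using z[of z] by (simp add: vec_eq_iff)
    also have "\<dots> = (A0 (c z) + A1 (c z) + A2 (c z)) ** A z"
      using z[of z] by (simp add: matrix_distribs)
    finally show ?thesis using unitary[of "c z"] by (simp add: loop_unitary_def)
  qed
  then have "A = dz_mat (\<lambda>w. smul 0 (A0 (c w)) + smul 1 (A1 (c w)) + smul 2 (A2 (c w)))" by (rule ext)
  then have sA: "smooth A" by (simp only: smooth_dz_mat[OF smooth_matrix_lincomb[OF sA0 sA1 sA2]])
  have q: "Q0 z = - (A0 (c z) ** adj (A z))" "Q1 z = (A0 (c z) - A1 (c z)) ** adj (A z)"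
    "Q2 z = A1 (c z) ** adj (A z)" "P1 z = (A1 (c z) - A2 (c z)) ** A z" for z
    using zb[of z] z[of z] by (simp_all add: B matrix_distribs)
  show ?thesis
  proof (unfold_locales, fold A_def)
    show "mwd (\<lambda>z. A0 (c z)) (- (A1 (c z) ** A z)) (- (A0 (c z) ** adj (A z))) z" for z
      using d(1)[of z] z[of z] q[of z] by simp
    show "mwd (\<lambda>z. A1 (c z)) ((A1 (c z) - A2 (c z)) ** A z) ((A0 (c z) - A1 (c z)) ** adj (A z)) z" for z
      using d(2)[of z] q[of z] by simp
    show "mwd (\<lambda>z. A2 (c z)) (A2 (c z) ** A z) (A1 (c z) ** adj (A z)) z" for z
      using d(3)[of z] z[of z] q[of z] by simp
  qed (use sA0 sA1 sA2 sA unitary AA2 z in auto)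
qed

section \<open>The second fundamental form of the Grassmannian model\<close>

definition vpack :: "complex^'n => complex^'n => complex^(2 \<times> 'n::finite)" where
  "vpack a b = (\<chi> q. if fst q = 0 then a $ snd q else b $ snd q)"

lemma vlo_vpack [simp]: "vlo (vpack a b) = a" and vhi_vpack [simp]: "vhi (vpack a b) = b"
  by (simp_all add: vlo_def vhi_def vpack_def vec_eq_iff)

lemma vpack_vlo_vhi:
  fixes v :: "complex^(2 \<times> 'n::finite)"
  shows "vpack (vlo v) (vhi v) = v"
proof -
  have "q = 0 \<or> q = 1" for q :: 2 using UNIV_2' by blast
  then have "(if fst q = 0 then v $ (0, snd q) else v $ (1, snd q)) = v $ q" for q :: "2 \<times> 'n"
    by (cases q) (metis fst_conv snd_conv)
  then show ?thesis by (subst vec_eq_iff) (simp only: vpack_def vlo_def vhi_def vec_lambda_beta simp_thms)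
qed

lemma vpack_eq_iff: "vpack a b = vpack c d \<longleftrightarrow> a = c \<and> b = d"
  by (metis vlo_vpack vhi_vpack)

lemma vpack_add: "vpack a b + vpack c d = vpack (a + c) (b + d)"
  by (simp add: vpack_def vec_eq_iff)

lemma vpack_scale: "k *s vpack a b = vpack (k *s a) (k *s b)"
  by (simp add: vpack_def vec_eq_iff)

lemma vpack_minus: "- vpack a b = vpack (- a) (- b)"
  by (simp add: vpack_def vec_eq_iff)

lemma hinner_vpack: "hinner (vpack a b) (vpack c d) = hinner a c + hinner b d"
proof -
  have "hinner (vpack a b) (vpack c d) = (\<Sum>q\<in>UNIV \<times> UNIV. vpack a b $ q * cnj (vpack c d $ q))"
    by (simp add: hinner_def)
  also have "\<dots> = (\<Sum>i\<in>UNIV. \<Sum>j\<in>UNIV. vpack a b $ (i, j) * cnj (vpack c d $ (i, j)))"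
    by (simp only: sum.cartesian_product) (simp add: split_beta)
  also have "\<dots> = hinner a c + hinner b d"
    by (simp add: UNIV_2' hinner_def vpack_def)
  finally show ?thesis .
qed

context loop_chart
begin

lemma unitary_relations:
  "adj (A0 z) ** A0 z + adj (A1 z) ** A1 z + adj (A2 z) ** A2 z = mat 1"
  "adj (A0 z) ** A1 z + adj (A1 z) ** A2 z = 0" "adj (A0 z) ** A2 z = 0"
  "A0 z ** adj (A0 z) + A1 z ** adj (A1 z) + A2 z ** adj (A2 z) = mat 1"
  "A1 z ** adj (A0 z) + A2 z ** adj (A1 z) = 0" "A2 z ** adj (A0 z) = 0"
  "A0 z + A1 z + A2 z = mat 1"
  "adj (A1 z) ** A0 z + adj (A2 z) ** A1 z = 0" "adj (A2 z) ** A0 z = 0"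
  "A0 z ** adj (A1 z) + A1 z ** adj (A2 z) = 0" "A0 z ** adj (A2 z) = 0"
proof -
  have u: "loop_unitary (A0 z) (A1 z) (A2 z)" by (rule unitary)
  then show "adj (A0 z) ** A0 z + adj (A1 z) ** A1 z + adj (A2 z) ** A2 z = mat 1"
    and 1: "adj (A0 z) ** A1 z + adj (A1 z) ** A2 z = 0" and 2: "adj (A0 z) ** A2 z = 0"
    and "A0 z ** adj (A0 z) + A1 z ** adj (A1 z) + A2 z ** adj (A2 z) = mat 1"
    and 3: "A1 z ** adj (A0 z) + A2 z ** adj (A1 z) = 0" and 4: "A2 z ** adj (A0 z) = 0"
    and "A0 z + A1 z + A2 z = mat 1"
    by (simp_all add: loop_unitary_def)
  show "adj (A1 z) ** A0 z + adj (A2 z) ** A1 z = 0"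
    using arg_cong[OF 1, of adj] by (simp add: ctranspose_simps)
  show "adj (A2 z) ** A0 z = 0"
    using arg_cong[OF 2, of adj] by (simp add: ctranspose_simps)
  show "A0 z ** adj (A1 z) + A1 z ** adj (A2 z) = 0"
    using arg_cong[OF 3, of adj] by (simp add: ctranspose_simps)
  show "A0 z ** adj (A2 z) = 0"
    using arg_cong[OF 4, of adj] by (simp add: ctranspose_simps)
qed

lemma smooth_lift_section: "smooth (\<lambda>w. vpack (A0 w *v h0) (A1 w *v h0 + A0 w *v h1))"
proof (rule smooth_vecI)
  fix q :: "2 \<times> 'n"
  have m: "smooth (\<lambda>w. (M w *v h) $ i)" if M: "smooth M" for M :: "complex => complex^'n^'n" and h i
  proof -
    have "smooth (\<lambda>w. \<Sum>j\<in>UNIV. h $ j * M w $ i $ j)"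
      by (rule smooth_sum, simp, rule smooth_cmult, rule smooth_vec_nth, rule smooth_vec_nth, rule M)
    then show ?thesis by (simp add: matrix_vector_mult_def mult.commute)
  qed
  have "smooth (\<lambda>w. (A1 w *v h0) $ i + (A0 w *v h1) $ i)" for i
    by (rule smooth_add; rule m; rule smooth_A0 smooth_A1)
  then show "smooth (\<lambda>w. vpack (A0 w *v h0) (A1 w *v h0 + A0 w *v h1) $ q)"
    using m[OF smooth_A0, of h0 "snd q"] by (cases "fst q = 0") (simp_all add: vpack_def)
qed

lemma dz_lift_section:
  "dz_vec (\<lambda>w. vpack (A0 w *v h0) (A1 w *v h0 + A0 w *v h1)) z =
    vpack (- (A1 z *v (A z *v h0))) ((A1 z - A2 z) *v (A z *v h0) - A1 z *v (A z *v h1))"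
proof -
  have d0: "vwd (\<lambda>w. A0 w *v h) (- (A1 z *v (A z *v h))) (- (A0 z *v (adj (A z) *v h))) z" for h
    using mwd_mult_vec[OF mwd_A0[of z] vwd_const[of h]]
    by (simp add: matrix_minus_vec matrix_vector_mul_assoc)
  have d1: "vwd (\<lambda>w. A1 w *v h) ((A1 z - A2 z) *v (A z *v h)) ((A0 z - A1 z) *v (adj (A z) *v h)) z" for h
    using mwd_mult_vec[OF mwd_A1[of z] vwd_const[of h]]
    by (simp add: matrix_vector_mul_assoc)
  have "\<exists>q. vwd (\<lambda>w. vpack (A0 w *v h0) (A1 w *v h0 + A0 w *v h1))
     (vpack (- (A1 z *v (A z *v h0))) ((A1 z - A2 z) *v (A z *v h0) - A1 z *v (A z *v h1))) q z"
  proof (rule exI)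
    show "vwd (\<lambda>w. vpack (A0 w *v h0) (A1 w *v h0 + A0 w *v h1))
     (vpack (- (A1 z *v (A z *v h0))) ((A1 z - A2 z) *v (A z *v h0) - A1 z *v (A z *v h1)))
     (vpack (- (A0 z *v (adj (A z) *v h0))) ((A0 z - A1 z) *v (adj (A z) *v h0) + - (A0 z *v (adj (A z) *v h1)))) z"
      unfolding vwd_def
    proof
      fix q :: "2 \<times> 'n"
      have e1: "has_wd (\<lambda>w. (A0 w *v h0) $ snd q) ((- (A1 z *v (A z *v h0))) $ snd q) ((- (A0 z *v (adj (A z) *v h0))) $ snd q) z"
        using d0[of h0] by (simp only: vwd_def)
      have e2: "has_wd (\<lambda>w. (A1 w *v h0) $ snd q + (A0 w *v h1) $ snd q)
         (((A1 z - A2 z) *v (A z *v h0)) $ snd q + (- (A1 z *v (A z *v h1))) $ snd q)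
         (((A0 z - A1 z) *v (adj (A z) *v h0)) $ snd q + (- (A0 z *v (adj (A z) *v h1))) $ snd q) z"
        by (rule has_wd_add; rule d0[of h1, unfolded vwd_def, rule_format] d1[of h0, unfolded vwd_def, rule_format])
      show "has_wd (\<lambda>w. vpack (A0 w *v h0) (A1 w *v h0 + A0 w *v h1) $ q)
          (vpack (- (A1 z *v (A z *v h0))) ((A1 z - A2 z) *v (A z *v h0) - A1 z *v (A z *v h1)) $ q)
          (vpack (- (A0 z *v (adj (A z) *v h0))) ((A0 z - A1 z) *v (adj (A z) *v h0) + - (A0 z *v (adj (A z) *v h1))) $ q) z"
        using e1 e2
        by (cases "fst q = 0") (simp_all add: vpack_def)
    qed
  qed
  then show ?thesis using vwd_dz by blast
qed

text \<open>Up to a vector of the fibre, the derivative of the section with parameters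
  \<open>h0\<close> and \<open>h1\<close> is \<open>L (A z *v h0)\<close>, and this vector is
  orthogonal to the fibre. So the second fundamental form of X is \<open>A\<close> followed by
  \<open>L\<close>, and \<open>L\<close> is injective on the range of \<open>A\<close>: there
  \<open>A0\<close> vanishes, while the three coefficients sum to the identity.\<close>

lemma second_ff_image:
  fixes Y :: "riemann_sphere => (complex^(2 \<times> 'n)) set"
  assumes c: "c \<in> charts" and Y: "smooth_subbundle k Y"
    and X: "!!z v. v \<in> Y (c z) \<longleftrightarrow> (\<exists>h0 h1. vlo v = A0 z *v h0 \<and> vhi v = A1 z *v h0 + A0 z *v h1)"
  shows "vec.dim ((\<lambda>v. second_ff c Y z *v v) ` Y (c z)) = vec.dim (range ((*v) (A z)))"
proof -
  have sub: "vec.subspace (Y (c z))" using Y by (simp add: smooth_subbundle_def)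
  have A0A: "A0 z *v (A z *v h) = 0" for h by (simp add: matrix_vector_mul_assoc A0_A)
  define L where "L = (\<lambda>y. vpack (- (A1 z *v y)) (- (A2 z *v y)))"
  have orth: "hinner (L (A z *v h)) u = 0" if "u \<in> Y (c z)" for h u
  proof -
    from X[of u z] that obtain k0 k1 where "vlo u = A0 z *v k0" "vhi u = A1 z *v k0 + A0 z *v k1" by blast
    then have u: "u = vpack (A0 z *v k0) (A1 z *v k0 + A0 z *v k1)" using vpack_vlo_vhi[of u] by simp
    define y where "y = A z *v h"
    have 1: "hinner (A1 z *v y) (A0 z *v k0) + hinner (A2 z *v y) (A1 z *v k0) = 0"
    proof -
      have "hinner (A1 z *v y) (A0 z *v k0) + hinner (A2 z *v y) (A1 z *v k0) =
         hinner ((adj (A0 z) ** A1 z + adj (A1 z) ** A2 z) *v y) k0"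
        by (simp add: hinner_matrix_right vector_distribs hinner_simps matrix_vector_mul_assoc)
      then show ?thesis by (simp add: unitary_relations)
    qed
    have 2: "hinner (A2 z *v y) (A0 z *v k1) = 0"
    proof -
      have "hinner (A2 z *v y) (A0 z *v k1) = hinner ((adj (A0 z) ** A2 z) *v y) k1"
        by (simp add: hinner_matrix_right matrix_vector_mul_assoc)
      then show ?thesis by (simp add: unitary_relations)
    qed
    have "hinner (L y) u = - (hinner (A1 z *v y) (A0 z *v k0) + hinner (A2 z *v y) (A1 z *v k0)) - hinner (A2 z *v y) (A0 z *v k1)"
      by (simp add: L_def u hinner_vpack hinner_simps)
    then have "hinner (L y) u = 0" unfolding 1 2 by simp
    then show ?thesis by (simp only: y_def)
  qed
  have img: "second_ff c Y z *v vpack (A0 z *v h0) (A1 z *v h0 + A0 z *v h1) = L (A z *v h0)" for h0 h1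
  proof -
    let ?s = "\<lambda>w. vpack (A0 w *v h0) (A1 w *v h0 + A0 w *v h1)"
    have s: "?s \<in> sections c Y"
      using X by (auto simp: sections_def smooth_lift_section)
    \<comment> \<open>The fibre element with parameter \<open>A z *v h0 - A z *v h1\<close>. Its
      first component vanishes because \<open>A0 ** A = 0\<close>; its second one is the part of the
      derivative that is not in the image of \<open>L\<close>.\<close>
    define x where "x = vpack (A0 z *v (A z *v h0 - A z *v h1)) (A1 z *v (A z *v h0 - A z *v h1) + A0 z *v 0)"
    have x: "x \<in> Y (c z)"
      unfolding x_def X by (intro exI[of _ "A z *v h0 - A z *v h1"] exI[of _ 0]) simp
    have "dz_vec ?s z = L (A z *v h0) + x"
      unfolding dz_lift_section L_def x_def vpack_add
      by (simp add: vpack_eq_iff vector_distribs A0A)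
    then have "second_ff c Y z *v ?s z = proj_perp (Y (c z)) *v (L (A z *v h0)) + proj_perp (Y (c z)) *v x"
      using second_ff_section[OF Y c s, of z] by (simp add: vector_distribs)
    moreover have "proj_perp (Y (c z)) *v x = 0"
      by (simp add: proj_perp_def vector_distribs proj_fix[OF sub x])
    moreover have "proj_perp (Y (c z)) *v L (A z *v h0) = L (A z *v h0)"
      using proj_orthogonal[OF sub, of "L (A z *v h0)"] orth by (simp add: proj_perp_def vector_distribs)
    ultimately show ?thesis by (simp only: add_0_right)
  qed
  have "(\<lambda>v. second_ff c Y z *v v) ` Y (c z) = L ` range ((*v) (A z))"
  proof safe
    fix v assume "v \<in> Y (c z)"
    with X[of v z] obtain h0 h1 where "vlo v = A0 z *v h0" "vhi v = A1 z *v h0 + A0 z *v h1" by blast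
    then have "v = vpack (A0 z *v h0) (A1 z *v h0 + A0 z *v h1)" using vpack_vlo_vhi[of v] by simp
    then have "second_ff c Y z *v v = L (A z *v h0)" by (simp only: img)
    then show "second_ff c Y z *v v \<in> L ` range ((*v) (A z))" by blast
  next
    fix h
    have "vpack (A0 z *v h) (A1 z *v h + A0 z *v 0) \<in> Y (c z)"
      unfolding X by (intro exI[of _ h] exI[of _ 0]) simp
    then show "L (A z *v h) \<in> (\<lambda>v. second_ff c Y z *v v) ` Y (c z)"
      by (rule rev_image_eqI) (rule img[of h 0, symmetric])
  qed
  moreover have "vec.dim (L ` range ((*v) (A z))) = vec.dim (range ((*v) (A z)))"
  proof (rule vec.dim_image_eq)
    show "Vector_Spaces.linear (*s) (*s) L"
      by unfold_locales (simp_all add: L_def vector_distribs vpack_add vpack_scale vpack_minus vector_scalar_commute)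
    have s: "vec.span (range ((*v) (A z))) = range ((*v) (A z))"
      using vec.subspace_image[OF vec.subspace_UNIV, of "A z"] vec.span_eq_iff by blast
    show "inj_on L (vec.span (range ((*v) (A z))))"
      unfolding s
    proof (rule inj_onI)
      fix x y assume xy: "x \<in> range ((*v) (A z))" "y \<in> range ((*v) (A z))" "L x = L y"
      have "A0 z *v (x - y) = 0" using xy(1,2) A0A by (auto simp: vector_distribs)
      moreover have "A1 z *v (x - y) = 0" "A2 z *v (x - y) = 0"
        using xy(3) by (simp_all add: L_def vpack_eq_iff vector_distribs)
      moreover have "(A0 z + A1 z + A2 z) *v (x - y) = x - y" by (simp add: unitary_relations)
      ultimately have "x - y = 0" by (simp add: matrix_vector_mult_add_rdistrib)
      then show "x = y" by simp
    qed
  qed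
  ultimately show ?thesis by simp
qed

end

section \<open>Rank of the second fundamental form and its normal form at a point\<close>

section \<open>The complex cross product\<close>

definition vcnj :: "complex^'m => complex^'m" where
  "vcnj v = (\<chi> i. cnj (v $ i))"

text \<open>Bilinear rather than sesquilinear, so the cross product of holomorphic curves is
  holomorphic. The Hermitian normal of the plane of \<open>v\<close> and \<open>w\<close> is its
  conjugate, and \<open>hinner x (vcnj (ccross v w))\<close> is the determinant of \<open>x\<close>,
  \<open>v\<close>, \<open>w\<close>.\<close>

definition ccross :: "complex^3 => complex^3 => complex^3" where
  "ccross v w = vector [v$2 * w$3 - v$3 * w$2, v$3 * w$1 - v$1 * w$3, v$1 * w$2 - v$2 * w$1]"

lemma ccross_nth [simp]:
  "ccross v w $ 1 = v$2 * w$3 - v$3 * w$2" "ccross v w $ 2 = v$3 * w$1 - v$1 * w$3"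
  "ccross v w $ 3 = v$1 * w$2 - v$2 * w$1"
  by (simp_all add: ccross_def vector_3)

lemma vcnj_nth [simp]: "vcnj v $ i = cnj (v $ i)"
  by (simp add: vcnj_def)

lemma vcnj_vcnj [simp]: "vcnj (vcnj v) = v"
  by (simp add: vec_eq_iff)

lemma vcnj_zero_iff [simp]: "vcnj v = 0 \<longleftrightarrow> v = 0"
  by (simp add: vec_eq_iff)

lemma vcnj_scale: "vcnj (c *s v) = cnj c *s vcnj v"
  by (simp add: vec_eq_iff)

lemma hinner_3: "hinner v w = v$1 * cnj (w$1) + v$2 * cnj (w$2) + v$3 * cnj (w$3)"
  for v :: "complex^3"
  by (simp only: hinner_def sum_3)

lemma hinner_vcnj: "hinner (vcnj v) (vcnj w) = hinner w v"
  by (simp add: hinner_def mult.commute)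

lemma vec3_eq_iff: "v = w \<longleftrightarrow> v$1 = w$1 \<and> v$2 = w$2 \<and> v$3 = w$3"
  for v :: "'a^3"
  by (simp add: vec_eq_iff forall_3)

lemma ccross_parallel:
  assumes "ccross v w = 0" "v ~= 0" shows "\<exists>t. w = t *s v"
proof -
  have e: "v$2 * w$3 = v$3 * w$2" "v$3 * w$1 = v$1 * w$3" "v$1 * w$2 = v$2 * w$1"
    using assms(1) by (simp_all add: vec3_eq_iff)
  consider "v$1 ~= 0" | "v$2 ~= 0" | "v$3 ~= 0" using assms(2) by (auto simp: vec3_eq_iff)
  then show ?thesis
  proof cases
    case 1 then show ?thesis using e by (intro exI[of _ "w$1 / v$1"]) (simp add: vec3_eq_iff field_simps)
  next
    case 2 then show ?thesis using e by (intro exI[of _ "w$2 / v$2"]) (simp add: vec3_eq_iff field_simps)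
  next
    case 3 then show ?thesis using e by (intro exI[of _ "w$3 / v$3"]) (simp add: vec3_eq_iff field_simps)
  qed
qed

lemma ccross_orthogonal: "hinner v (vcnj (ccross v w)) = 0" "hinner w (vcnj (ccross v w)) = 0"
  by (simp_all add: hinner_3 algebra_simps)

lemma orthogonal_ccross:
  assumes v: "hinner x v = 0" and w: "hinner x w = 0" and n: "ccross v w ~= 0"
  shows "\<exists>t. x = t *s vcnj (ccross v w)"
proof -
  have e: "hinner v x = 0" "hinner w x = 0" using v w hinner_swap_zero by blast+
  have "ccross (ccross v w) (vcnj x) = 0"
    unfolding vec3_eq_iff using e unfolding hinner_3 ccross_nth vcnj_nth zero_index by algebra
  then obtain t where "vcnj x = t *s ccross v w" using ccross_parallel n by blast
  then have "x = cnj t *s vcnj (ccross v w)" using vcnj_scale by (metis vcnj_vcnj)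
  then show ?thesis by blast
qed

lemma ccross_lagrange:
  "hinner (ccross v w) (ccross v w) = hinner v v * hinner w w - hinner v w * hinner w v"
  by (simp add: hinner_3) algebra

lemma dim_range_le_1:
  assumes "!!x. \<exists>t. M *v x = t *s b" shows "vec.dim (range ((*v) M)) \<le> 1"
proof -
  have "range ((*v) M) \<subseteq> vec.span {b}"
    using assms by (auto simp: vec.span_singleton)
  then have "vec.dim (range ((*v) M)) \<le> vec.dim (vec.span {b})" by (rule vec.dim_subset)
  then have "vec.dim (range ((*v) M)) \<le> vec.dim {b}" by (simp only: vec.dim_span)
  then show ?thesis using vec.dim_le_card'[of "{b}"] by simp
qed

lemma dim_range_ge_2:
  fixes M :: "complex^3^3"
  assumes "2 \<le> vec.dim (range ((*v) M))"
  obtains x y where "ccross (M *v x) (M *v y) ~= 0"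
proof (rule ccontr)
  assume n: "\<not> thesis"
  obtain x where "M *v x ~= 0"
  proof (rule ccontr)
    assume "\<not> thesis"
    then have "\<exists>t. M *v x = t *s (0 :: complex^3)" for x using that by force
    from dim_range_le_1[OF this] assms show False by simp
  qed
  then have "\<exists>t. M *v y = t *s (M *v x)" for y
    using n that ccross_parallel by metis
  from dim_range_le_1[OF this] assms show False by simp
qed

section \<open>Matrices of rank one\<close>

lemma outer_of_parallel:
  assumes "!!x. \<exists>t. M *v x = t *s b" shows "\<exists>u. M = outer b u"
proof -
  obtain t where t: "!!x. M *v x = t x *s b" using assms by metis
  have "M = outer b (\<chi> j. cnj (t (axis j 1)))"
  proof -
    have "M $ i $ j = (M *v axis j 1) $ i" for i j
      by (simp add: matrix_vector_mult_def axis_def if_distrib cong: if_cong)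
    then show ?thesis by (simp add: vec_eq_iff t mult.commute)
  qed
  then show ?thesis by blast
qed

lemma outer_of_ccross:
  assumes "!!x y. ccross (M *v x) (M *v y) = 0" shows "\<exists>b u. M = outer b u"
proof (cases "\<exists>x. M *v x ~= 0")
  case True
  then obtain x where "M *v x ~= 0" by blast
  then have "\<exists>t. M *v y = t *s (M *v x)" for y using assms ccross_parallel by blast
  from outer_of_parallel[OF this] show ?thesis by blast
next
  case False
  then have "\<exists>t. M *v y = t *s 0" for y by simp
  from outer_of_parallel[OF this] show ?thesis by blast
qed

lemma matrix_zero_iff: "M = 0 \<longleftrightarrow> (\<forall>x. M *v x = 0)" for M :: "complex^'m^'l"
  by (metis matrix_eq matrix_vector_mult_0)

lemma range_span_of_orthogonal:
  assumes b: "!!y. \<exists>k. T *v y = k *s b" and p: "!!c. (!!y. hinner (T *v y) c = 0) ==> hinner p c = 0"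
    and nz: "b ~= 0"
  shows "\<exists>s. p = s *s b"
proof -
  define s where "s = hinner p b / hinner b b"
  define r where "r = p - s *s b"
  have rb: "hinner r b = 0" using nz by (simp add: r_def s_def hinner_simps)
  then have br: "hinner b r = 0" by (rule hinner_swap_zero)
  have "hinner (T *v y) r = 0" for y
  proof -
    obtain k where "T *v y = k *s b" using b by blast
    then show ?thesis by (simp add: hinner_simps br)
  qed
  then have "hinner p r = 0" by (rule p)
  then have "hinner r r = 0" using br by (simp add: r_def[THEN arg_cong[of _ _ "\<lambda>v. hinner v r"]] hinner_simps)
  then show ?thesis unfolding r_def by auto
qed

text \<open>Take a column of \<open>T\<close> with an entry that does not vanish near
  \<open>z0\<close>. The hypothesis on \<open>P\<close> and \<open>Q\<close> says that the
  derivatives of the column stay in its own line, so the ratios of its entries have derivative zero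
  and the line is constant.\<close>

lemma rank_one_locally_constant_range:
  fixes T P Q :: "complex => complex^'m^'l"
  assumes S: "open S" "z0 \<in> S" and d: "!!z. z \<in> S ==> mwd T (P z) (Q z) z"
    and r: "!!z. z \<in> S ==> \<exists>a u. T z = outer a u"
    and PQ: "!!z x c. z \<in> S ==> (!!y. hinner (T z *v y) c = 0) ==>
      hinner (P z *v x) c = 0 \<and> hinner (Q z *v x) c = 0"
    and nz: "T z0 ~= 0"
  obtains e t where "e > 0" "ball z0 e \<subseteq> S" "t ~= 0"
    "!!z. z \<in> ball z0 e ==> T z ~= 0 \<and> (\<forall>x. \<exists>k. T z *v x = k *s t)"
proof -
  obtain i j where ij: "T z0 $ i $ j ~= 0" using nz by (auto simp: vec_eq_iff)
  have wd: "has_wd (\<lambda>w. T w $ k $ l) (P z $ k $ l) (Q z $ k $ l) z" if "z \<in> S" for z k l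
    using d[OF that] by (simp add: mwd_def)
  have "isCont (\<lambda>w. T w $ i $ j) z0" using wd[OF S(2)] by (rule has_wd_isCont)
  then obtain e1 where e1: "e1 > 0" "!!y. dist z0 y < e1 ==> T y $ i $ j ~= 0"
    using continuous_at_avoid[of z0 "\<lambda>w. T w $ i $ j" 0] ij by blast
  obtain e2 where e2: "e2 > 0" "ball z0 e2 \<subseteq> S" using S open_contains_ball by metis
  define e where "e = min e1 e2"
  have e: "e > 0" "ball z0 e \<subseteq> S" and nzb: "T z $ i $ j ~= 0" if "z \<in> ball z0 e" for z
    using e1 e2 that by (auto simp: e_def)
  have e0: "e > 0" using e1 e2 by (simp add: e_def)
  have eS: "ball z0 e \<subseteq> S" using e2 by (auto simp: e_def)
  define b where "b = (\<lambda>z. \<chi> k. T z $ k $ j)"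
  have bc: "T z *v axis j 1 = b z" "P z *v axis j 1 = (\<chi> k. P z $ k $ j)" "Q z *v axis j 1 = (\<chi> k. Q z $ k $ j)" for z
    by (simp_all add: b_def vec_eq_iff matrix_vector_mult_def axis_def if_distrib cong: if_cong)
  have bT: "\<exists>k. T z *v x = k *s b z" and b0: "b z ~= 0" if z: "z \<in> ball z0 e" for z x
  proof -
    obtain a u where au: "T z = outer a u" using r z eS by blast
    show b0: "b z ~= 0" using nzb[OF z] by (auto simp: b_def vec_eq_iff)
    have bz: "b z = hinner (axis j 1) u *s a" using bc(1)[of z] by (simp add: au outer_vec)
    then have h: "hinner (axis j 1) u ~= 0" using b0 by auto
    then show "\<exists>k. T z *v x = k *s b z"
      by (intro exI[of _ "hinner x u / hinner (axis j 1) u"]) (simp add: bz au outer_vec vec.scale_scale)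
  qed
  have par: "P z $ k $ j * T z $ i $ j = T z $ k $ j * P z $ i $ j"
    "Q z $ k $ j * T z $ i $ j = T z $ k $ j * Q z $ i $ j" if z: "z \<in> ball z0 e" for z k
  proof -
    have zS: "z \<in> S" using z eS by blast
    have "hinner (P z *v axis j 1) c = 0" if "!!y. hinner (T z *v y) c = 0" for c
      using PQ[OF zS that] by blast
    from range_span_of_orthogonal[OF bT[OF z] this b0[OF z]]
    obtain s where "(\<chi> k. P z $ k $ j) = s *s b z" unfolding bc by blast
    then have "!!k. P z $ k $ j = s * T z $ k $ j" by (simp add: vec_eq_iff b_def)
    then show "P z $ k $ j * T z $ i $ j = T z $ k $ j * P z $ i $ j" by simp
    have "hinner (Q z *v axis j 1) c = 0" if "!!y. hinner (T z *v y) c = 0" for c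
      using PQ[OF zS that] by blast
    from range_span_of_orthogonal[OF bT[OF z] this b0[OF z]]
    obtain s where "(\<chi> k. Q z $ k $ j) = s *s b z" unfolding bc by blast
    then have "!!k. Q z $ k $ j = s * T z $ k $ j" by (simp add: vec_eq_iff b_def)
    then show "Q z $ k $ j * T z $ i $ j = T z $ k $ j * Q z $ i $ j" by simp
  qed
  have const: "T z $ k $ j / T z $ i $ j = T z0 $ k $ j / T z0 $ i $ j" if z: "z \<in> ball z0 e" for z k
  proof -
    have "((\<lambda>w. T w $ k $ j / T w $ i $ j) has_field_derivative 0) (at w)" if w: "w \<in> ball z0 e" for w
    proof -
      have "w \<in> S" using w eS by blast
      from has_wd_divide[OF wd[OF this] wd[OF this] nzb[OF w], of k j] show ?thesis
        by (simp add: par[OF w] has_wd_field_derivative)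
    qed
    then obtain c where "\<forall>w\<in>ball z0 e. T w $ k $ j / T w $ i $ j = c"
      using has_field_derivative_zero_constant[OF convex_ball[of z0 e], of "\<lambda>w. T w $ k $ j / T w $ i $ j"]
        has_field_derivative_at_within by blast
    then show ?thesis using z e0 by simp
  qed
  define t where "t = (\<chi> k. T z0 $ k $ j / T z0 $ i $ j)"
  show ?thesis
  proof (rule that[OF e0 eS])
    have "t $ i = 1" using ij by (simp add: t_def)
    then show "t ~= 0" by auto
    fix z assume z: "z \<in> ball z0 e"
    have "b z = T z $ i $ j *s t"
    proof -
      have "T z $ k $ j = T z $ i $ j * (T z0 $ k $ j / T z0 $ i $ j)" for k
        unfolding const[OF z, of k, symmetric] using nzb[OF z] by simp
      then show ?thesis
        by (subst vec_eq_iff, unfold b_def t_def vec_lambda_beta vector_smult_component) (rule allI)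
    qed
    have "\<exists>k. T z *v x = k *s t" for x
    proof -
      obtain k where "T z *v x = k *s b z" using bT[OF z] by blast
      then have "T z *v x = (k * T z $ i $ j) *s t"
        using \<open>b z = T z $ i $ j *s t\<close> by (simp add: vec.scale_scale)
      then show ?thesis by blast
    qed
    moreover have "T z ~= 0" using nzb[OF z] by auto
    ultimately show "T z ~= 0 \<and> (\<forall>x. \<exists>k. T z *v x = k *s t)" by blast
  qed
qed

lemma trace_mult_ctranspose_sum:
  "Re (trace (M ** adj M)) = (\<Sum>i\<in>UNIV. \<Sum>j\<in>UNIV. (norm (M $ i $ j))\<^sup>2)"
proof -
  have "z * cnj z = of_real ((norm z)\<^sup>2)" for z by (rule complex_norm_square[symmetric])
  then show ?thesis by (simp add: trace_def matrix_matrix_mult_def)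
qed

lemma trace_mult_ctranspose_pos:
  assumes "M ~= 0" shows "Re (trace (M ** adj M)) > 0"
proof -
  obtain i j where ij: "M $ i $ j ~= 0" using assms by (auto simp: vec_eq_iff)
  have "0 < (norm (M $ i $ j))\<^sup>2" using ij by simp
  also have "\<dots> \<le> (\<Sum>j\<in>UNIV. (norm (M $ i $ j))\<^sup>2)"
    by (rule member_le_sum) auto
  also have "\<dots> \<le> (\<Sum>i\<in>UNIV. \<Sum>j\<in>UNIV. (norm (M $ i $ j))\<^sup>2)"
    by (rule member_le_sum[where f = "\<lambda>i. \<Sum>j\<in>UNIV. (norm (M $ i $ j))\<^sup>2"]) (auto intro: sum_nonneg)
  finally show ?thesis by (simp only: trace_mult_ctranspose_sum)
qed

section \<open>Continuity of matrix expressions\<close>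

lemma continuous_on_matrix_vec:
  fixes M :: "complex => complex^'m^'l"
  assumes "continuous_on S M" "continuous_on S v"
  shows "continuous_on S (\<lambda>z. M z *v v z)"
  unfolding matrix_vector_mult_def
  by (intro continuous_on_vec_lambda continuous_on_sum continuous_on_mult continuous_on_component assms)

lemma continuous_on_matrix_mult:
  fixes M :: "complex => complex^'m^'l"
  assumes "continuous_on S M" "continuous_on S N"
  shows "continuous_on S (\<lambda>z. M z ** N z)"
  unfolding matrix_matrix_mult_def
  by (intro continuous_on_vec_lambda continuous_on_sum continuous_on_mult continuous_on_component assms)

lemma continuous_on_ctranspose:
  fixes M :: "complex => complex^'m^'l"
  assumes "continuous_on S M"
  shows "continuous_on S (\<lambda>z. adj (M z))"
  unfolding ctranspose_def
  by (intro continuous_on_vec_lambda continuous_on_cnj continuous_on_component assms)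

lemma continuous_on_ccross:
  fixes v w :: "complex => complex^3"
  assumes v: "continuous_on S v" and w: "continuous_on S w"
  shows "continuous_on S (\<lambda>z. ccross (v z) (w z))"
proof -
  have "continuous_on S (\<lambda>z. \<chi> i. ccross (v z) (w z) $ i)"
  proof (rule continuous_on_vec_lambda)
    fix i :: 3
    show "continuous_on S (\<lambda>z. ccross (v z) (w z) $ i)"
      using exhaust_3[of i]
      by (elim disjE; simp) (intro continuous_on_diff continuous_on_mult continuous_on_component v w)+
  qed
  then show ?thesis by simp
qed

lemma continuous_zero_off_finite:
  fixes f :: "complex => 'b::real_normed_vector"
  assumes f: "continuous_on UNIV f" and F: "finite F" "!!z. z \<notin> F ==> f z = 0"
  shows "f z = 0"
proof -
  have "open {z. f z ~= 0}" using f by (intro open_Collect_neq) (auto intro: continuous_on_const)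
  moreover have "finite {z. f z ~= 0}" by (rule finite_subset[OF _ F(1)]) (use F(2) in blast)
  ultimately have "{z. f z ~= 0} = {}" using finite_imp_not_open by blast
  then show ?thesis by blast
qed

context loop_chart
begin

text \<open>Couples the zeros of \<open>A0\<close> and \<open>A2\<close>. The \<open>dz\<close>
  derivatives of the two squared norms are \<open>- trace (A1 ** A ** adj A0)\<close> and
  \<open>trace (A2 ** A ** adj A1)\<close>, which agree by
  \<open>adj A0 ** A1 + adj A1 ** A2 = 0\<close>.\<close>

lemma trace_difference_constant:
  "trace (A0 z ** adj (A0 z)) - trace (A2 z ** adj (A2 z)) =
   trace (A0 w ** adj (A0 w)) - trace (A2 w ** adj (A2 w))"
proof (rule has_wd_zero_imp_constant[where f = "\<lambda>z. trace (A0 z ** adj (A0 z)) - trace (A2 z ** adj (A2 z))"])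
  fix z
  note u = unitary_relations[of z]
  have a: "A2 z ** adj (A z) = 0"
    using arg_cong[OF A_A2[of z], of adj] by (simp add: ctranspose_mult)
  have aa: "M ** A0 z ** A z = 0" "M ** A z ** adj (A2 z) = 0" "M ** A2 z ** adj (A z) = 0" for M :: "complex^'n^'n"
    by (simp_all add: matrix_mul_assoc[symmetric] A0_A A_A2 a)
  have ta: "trace (M + N) = trace M + trace N" "trace (- M) = - trace M" for M N :: "complex^'n^'n"
    by (simp_all add: trace_def sum.distrib sum_negf)
  have c1: "trace (A1 z ** A z ** adj (A0 z)) = - trace (A2 z ** A z ** adj (A1 z))"
  proof -
    have "trace (A1 z ** A z ** adj (A0 z)) + trace (A2 z ** A z ** adj (A1 z)) =
       trace (adj (A0 z) ** (A1 z ** A z)) + trace (adj (A1 z) ** (A2 z ** A z))"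
      by (simp only: trace_mul_sym[of _ "adj (A0 z)"] trace_mul_sym[of _ "adj (A1 z)"])
    also have "\<dots> = trace ((adj (A0 z) ** A1 z + adj (A1 z) ** A2 z) ** A z)"
      by (simp only: matrix_distribs matrix_mul_assoc ta)
    also have "\<dots> = 0" by (simp only: u(2)) (simp add: trace_def)
    finally show ?thesis by (simp add: eq_neg_iff_add_eq_0)
  qed
  have c2: "trace (A0 z ** adj (A z) ** adj (A1 z)) = - trace (A1 z ** adj (A z) ** adj (A2 z))"
  proof -
    have "trace (A0 z ** adj (A z) ** adj (A1 z)) + trace (A1 z ** adj (A z) ** adj (A2 z)) =
       trace (adj (A1 z) ** (A0 z ** adj (A z))) + trace (adj (A2 z) ** (A1 z ** adj (A z)))"
      by (simp only: trace_mul_sym[of _ "adj (A1 z)"] trace_mul_sym[of _ "adj (A2 z)"])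
    also have "\<dots> = trace ((adj (A1 z) ** A0 z + adj (A2 z) ** A1 z) ** adj (A z))"
      by (simp only: matrix_distribs matrix_mul_assoc ta)
    also have "\<dots> = 0" by (simp only: u(8)) (simp add: trace_def)
    finally show ?thesis by (simp add: eq_neg_iff_add_eq_0)
  qed
  have aa2: "A0 z ** adj (A z) ** adj (A0 z) = 0"
  proof -
    have "A0 z ** adj (A z) ** adj (A0 z) = A0 z ** adj (A0 z ** A z)"
      by (simp add: ctranspose_mult matrix_mul_assoc)
    then show ?thesis by (simp add: A0_A)
  qed
  have z0: "trace (0 :: complex^'n^'n) = 0" by (simp add: trace_def)
  have w0: "has_wd (\<lambda>z. trace (A0 z ** adj (A0 z)))
     (- trace (A1 z ** A z ** adj (A0 z))) (- trace (A0 z ** adj (A z) ** adj (A1 z))) z"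
    by (rule has_wd_eq[OF mwd_trace[OF mwd_mult[OF mwd_A0[of z] mwd_ctranspose[OF mwd_A0[of z]]]]])
       (simp_all add: ctranspose_simps matrix_distribs matrix_mul_assoc ta aa aa2 A0_A z0)
  have w2: "has_wd (\<lambda>z. trace (A2 z ** adj (A2 z)))
     (trace (A2 z ** A z ** adj (A1 z))) (trace (A1 z ** adj (A z) ** adj (A2 z))) z"
    by (rule has_wd_eq[OF mwd_trace[OF mwd_mult[OF mwd_A2[of z] mwd_ctranspose[OF mwd_A2[of z]]]]])
       (simp_all add: ctranspose_simps matrix_distribs matrix_mul_assoc ta aa a z0)
  show "has_wd (\<lambda>z. trace (A0 z ** adj (A0 z)) - trace (A2 z ** adj (A2 z))) 0 0 z"
    by (rule has_wd_eq[OF has_wd_diff[OF w0 w2]]) (simp_all add: c1 c2)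
qed

lemma continuous_coefficients:
  "continuous_on S A0" "continuous_on S A1" "continuous_on S A2" "continuous_on S A"
  by (rule smooth_continuous smooth_A0 smooth_A1 smooth_A2 smooth_A)+

end

section \<open>The second fundamental form has rank two\<close>

locale loop_chart3 = loop_chart A0 A1 A2 A for A0 A1 A2 A :: "complex => complex^3^3"
begin

lemma A2_A_adjoint: "A2 z ** adj (A z) = 0"
  using arg_cong[OF A_A2[of z], of adj] by (simp add: ctranspose_mult)

text \<open>The independent vectors \<open>p\<close> and \<open>q\<close> confine the ranges of
  \<open>A2\<close> and of \<open>dzbar A2 = A1 ** adj A\<close> to one common line, and
  \<open>dz A2 = A2 ** A\<close> stays in it trivially. So the range of \<open>A2\<close> is a
  locally constant line, and \<open>adj A0 ** A2 = 0\<close> makes its direction an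
  annihilator.\<close>

lemma constant_annihilator_of_frame:
  fixes p q :: "complex => complex^3"
  assumes S: "open S" "z1 \<in> S" and nz: "A2 z1 ~= 0"
    and n: "!!z. z \<in> S ==> ccross (p z) (q z) ~= 0"
    and o2: "!!z x. z \<in> S ==> hinner (A2 z *v x) (p z) = 0 \<and> hinner (A2 z *v x) (q z) = 0"
    and o1: "!!z x. z \<in> S ==> hinner (A1 z *v (adj (A z) *v x)) (p z) = 0 \<and>
      hinner (A1 z *v (adj (A z) *v x)) (q z) = 0"
  obtains c S' where "open S'" "S' ~= {}" "c ~= 0" "!!z. z \<in> S' ==> adj (A0 z) *v c = 0"
proof -
  have par: "\<exists>k. A2 z *v x = k *s vcnj (ccross (p z) (q z))"
    and par1: "\<exists>k. A1 z *v (adj (A z) *v x) = k *s vcnj (ccross (p z) (q z))" if "z \<in> S" for z x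
    using o2[OF that, of x] o1[OF that, of x] n[OF that] orthogonal_ccross by blast+
  have S1: "open (S \<inter> {z. A2 z ~= 0})" "z1 \<in> S \<inter> {z. A2 z ~= 0}"
    using S nz continuous_coefficients(3) by (auto intro!: open_Int open_Collect_neq continuous_on_const)
  obtain e t where e: "e > 0" "ball z1 e \<subseteq> S \<inter> {z. A2 z ~= 0}" "t ~= 0"
    "!!z. z \<in> ball z1 e ==> A2 z ~= 0 \<and> (\<forall>x. \<exists>k. A2 z *v x = k *s t)"
  proof (rule rank_one_locally_constant_range[OF S1, of A2 "\<lambda>z. A2 z ** A z" "\<lambda>z. A1 z ** adj (A z)"])
    show "mwd A2 (A2 z ** A z) (A1 z ** adj (A z)) z" for z by (rule mwd_A2)
    show "\<exists>a u. A2 z = outer a u" if "z \<in> S \<inter> {z. A2 z ~= 0}" for z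
      using outer_of_parallel[OF par] that by blast
    show "hinner ((A2 z ** A z) *v x) c = 0 \<and> hinner ((A1 z ** adj (A z)) *v x) c = 0"
      if z: "z \<in> S \<inter> {z. A2 z ~= 0}" and c: "!!y. hinner (A2 z *v y) c = 0" for z x c
    proof
      show "hinner ((A2 z ** A z) *v x) c = 0"
        unfolding matrix_vector_mul_assoc[symmetric] by (rule c)
      obtain y where y: "A2 z *v y ~= 0" using z matrix_zero_iff by blast
      obtain k where k: "A2 z *v y = k *s vcnj (ccross (p z) (q z))" using par z by blast
      have "k ~= 0" using y k by auto
      then have nc: "hinner (vcnj (ccross (p z) (q z))) c = 0" using c[of y] by (simp add: k hinner_simps)
      obtain k' where "A1 z *v (adj (A z) *v x) = k' *s vcnj (ccross (p z) (q z))" using par1 z by blast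
      then show "hinner ((A1 z ** adj (A z)) *v x) c = 0"
        unfolding matrix_vector_mul_assoc[symmetric] by (simp add: nc hinner_simps)
    qed
    show "A2 z1 ~= 0" by (rule nz)
  qed blast
  show ?thesis
  proof (rule that[of "ball z1 e" t])
    fix z assume z: "z \<in> ball z1 e"
    obtain y where y: "A2 z *v y ~= 0" using e(4)[OF z] matrix_zero_iff by blast
    obtain k where k: "A2 z *v y = k *s t" using e(4)[OF z] by blast
    have "k ~= 0" using y k by auto
    have "adj (A0 z) *v (A2 z *v y) = 0" by (simp add: matrix_vector_mul_assoc unitary_relations)
    then show "adj (A0 z) *v t = 0" using \<open>k ~= 0\<close> by (simp add: k vector_scalar_commute)
  qed (use e in auto)
qed

lemma open_ccross_neq:
  fixes M N :: "complex => complex^3^3"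
  assumes "continuous_on UNIV M" "continuous_on UNIV N"
  shows "open {z. ccross (M z *v x) (N z *v y) ~= 0}"
  by (rule open_Collect_neq[OF continuous_on_ccross[OF continuous_on_matrix_vec[OF assms(1) continuous_on_const]
        continuous_on_matrix_vec[OF assms(2) continuous_on_const]] continuous_on_const])

lemma A1_Astar_orthogonal:
  "hinner (A1 z *v (adj (A z) *v x)) (A0 z *v y) = 0"
proof -
  have "adj (A0 z) ** A1 z = - (adj (A1 z) ** A2 z)"
    using unitary_relations(2)[of z] by (simp add: eq_neg_iff_add_eq_0)
  then have "adj (A0 z) ** A1 z ** adj (A z) = - (adj (A1 z) ** (A2 z ** adj (A z)))"
    by (simp add: matrix_minus_left matrix_mul_assoc)
  then have "adj (A0 z) ** A1 z ** adj (A z) = 0" by (simp add: A2_A_adjoint)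
  moreover have "hinner (A1 z *v (adj (A z) *v x)) (A0 z *v y) =
     hinner ((adj (A0 z) ** A1 z ** adj (A z)) *v x) y"
    by (simp add: hinner_matrix_right matrix_vector_mul_assoc matrix_mul_assoc)
  ultimately show ?thesis by simp
qed

lemma A2_A0_orthogonal: "hinner (A2 z *v x) (A0 z *v y) = 0"
proof -
  have "hinner (A2 z *v x) (A0 z *v y) = hinner ((adj (A0 z) ** A2 z) *v x) y"
    by (simp add: hinner_matrix_right matrix_vector_mul_assoc)
  then show ?thesis by (simp add: unitary_relations)
qed

lemma A2_A1A_orthogonal: "hinner (A2 z *v x) (A1 z *v (A z *v y)) = 0"
proof -
  have "adj (A2 z) ** A1 z = - (adj (A1 z) ** A0 z)"
    using unitary_relations(8)[of z] by (simp add: eq_neg_iff_add_eq_0 add.commute)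
  then have "adj (A2 z) ** A1 z ** A z = - (adj (A1 z) ** (A0 z ** A z))"
    by (simp add: matrix_minus_left matrix_mul_assoc)
  then have "adj (A2 z) ** A1 z ** A z = 0" by (simp add: A0_A)
  moreover have "hinner (A1 z *v (A z *v y)) (A2 z *v x) = hinner ((adj (A2 z) ** A1 z ** A z) *v y) x"
    by (simp add: hinner_matrix_right matrix_vector_mul_assoc matrix_mul_assoc)
  ultimately have "hinner (A1 z *v (A z *v y)) (A2 z *v x) = 0" by simp
  then show ?thesis by (rule hinner_swap_zero)
qed

lemma A1_isometry:
  "adj (A1 z) ** A1 z = mat 1 - adj (A0 z) ** A0 z - adj (A2 z) ** A2 z"
  using unitary_relations(1)[of z] by (simp add: algebra_simps)

text \<open>Two independent vectors orthogonal to the ranges of \<open>A2\<close> and of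
  \<open>A1 ** adj A\<close> are looked for: two vectors of the range of \<open>A0\<close> if its
  rank exceeds one somewhere, otherwise one vector of that range and one of the range of
  \<open>A1 ** A\<close>. If neither pair exists, the range of \<open>A0\<close> itself is locally
  constant and any vector orthogonal to it will do.\<close>

lemma square_zero_annihilator:
  assumes sq: "!!z. A z ** A z = 0" and nz: "A0 z1 ~= 0" "A2 z1 ~= 0"
  obtains c S where "open S" "S ~= {}" "c ~= 0" "!!z. z \<in> S ==> adj (A0 z) *v c = 0"
proof -
  define S0 where "S0 = {z. A0 z ~= 0} \<inter> {z. A2 z ~= 0}"
  have S0: "open S0" "z1 \<in> S0"
    unfolding S0_def using nz continuous_coefficients
    by (auto intro!: open_Int open_Collect_neq continuous_on_const)
  note cc = continuous_coefficients
  show ?thesis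
  proof (cases "\<exists>z\<in>S0. \<exists>x y. ccross (A0 z *v x) (A0 z *v y) ~= 0")
    case True
    then obtain z2 x y where z2: "z2 \<in> S0" "ccross (A0 z2 *v x) (A0 z2 *v y) ~= 0" by blast
    let ?S = "S0 \<inter> {z. ccross (A0 z *v x) (A0 z *v y) ~= 0}"
    have o: "open ?S" by (rule open_Int[OF S0(1) open_ccross_neq[OF cc(1) cc(1)]])
    show ?thesis
      by (rule constant_annihilator_of_frame[OF o, of z2 "\<lambda>z. A0 z *v x" "\<lambda>z. A0 z *v y"])
         (use z2 that in \<open>auto simp: A2_A0_orthogonal A1_Astar_orthogonal S0_def\<close>)
  next
    case False
    then have r1: "\<exists>a u. A0 z = outer a u" if "z \<in> S0" for z using outer_of_ccross that by blast
    show ?thesis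
    proof (cases "\<exists>z\<in>S0. \<exists>x y. ccross (A0 z *v x) (A1 z *v (A z *v y)) ~= 0")
      case True
      then obtain z2 x y where z2: "z2 \<in> S0" "ccross (A0 z2 *v x) (A1 z2 *v (A z2 *v y)) ~= 0" by blast
      let ?S = "S0 \<inter> {z. ccross (A0 z *v x) ((A1 z ** A z) *v y) ~= 0}"
      have o: "open ?S" by (rule open_Int[OF S0(1) open_ccross_neq[OF cc(1) continuous_on_matrix_mult[OF cc(2) cc(4)]]])
      \<comment> \<open>Here \<open>A ** A = 0\<close> enters: substituting
        \<open>adj A1 ** A1 = mat 1 - adj A0 ** A0 - adj A2 ** A2\<close> leaves
        \<open>adj (A ** A)\<close> and terms with the factors \<open>A0 ** A\<close> and
        \<open>A2 ** adj A\<close>.\<close>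
      have orth: "hinner (A1 z *v (adj (A z) *v h)) (A1 z *v (A z *v y)) = 0" for z h
      proof -
        have "adj (A z) ** adj (A1 z) ** A1 z ** adj (A z) =
           adj (A z) ** (adj (A1 z) ** A1 z) ** adj (A z)" by (simp add: matrix_mul_assoc)
        also have "\<dots> = adj (A z ** A z) - adj (A0 z ** A z) ** (A0 z ** adj (A z))
            - adj (A z) ** adj (A2 z) ** (A2 z ** adj (A z))"
          unfolding A1_isometry by (simp add: matrix_distribs ctranspose_mult matrix_mul_assoc)
        also have "\<dots> = 0" by (simp add: sq A0_A A2_A_adjoint)
        finally have "adj (A z) ** adj (A1 z) ** A1 z ** adj (A z) = 0" .
        moreover have "hinner (A1 z *v (adj (A z) *v h)) (A1 z *v (A z *v y)) =
           hinner ((adj (A z) ** adj (A1 z) ** A1 z ** adj (A z)) *v h) y"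
          by (simp add: hinner_matrix_right matrix_vector_mul_assoc matrix_mul_assoc ctranspose_mult)
        ultimately show ?thesis by simp
      qed
      show ?thesis
        by (rule constant_annihilator_of_frame[OF o, of z2 "\<lambda>z. A0 z *v x" "\<lambda>z. (A1 z ** A z) *v y"])
           (use z2 that in \<open>auto simp: A2_A0_orthogonal A1_Astar_orthogonal A2_A1A_orthogonal orth S0_def
              matrix_vector_mul_assoc[symmetric]\<close>)
    next
      case False
      \<comment> \<open>Now \<open>dz A0 = - (A1 ** A)\<close> has its values in the line of
        \<open>A0\<close>, and \<open>dzbar A0\<close> does so in any case.\<close>
      obtain e t where e: "e > 0" "ball z1 e \<subseteq> S0" "t ~= 0"
        "!!z. z \<in> ball z1 e ==> A0 z ~= 0 \<and> (\<forall>x. \<exists>k. A0 z *v x = k *s t)"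
      proof (rule rank_one_locally_constant_range[OF S0, of A0 "\<lambda>z. - (A1 z ** A z)" "\<lambda>z. - (A0 z ** adj (A z))"])
        show "mwd A0 (- (A1 z ** A z)) (- (A0 z ** adj (A z))) z" for z by (rule mwd_A0)
        show "\<exists>a u. A0 z = outer a u" if "z \<in> S0" for z using r1[OF that] .
        show "hinner (- (A1 z ** A z) *v x) c = 0 \<and> hinner (- (A0 z ** adj (A z)) *v x) c = 0"
          if z: "z \<in> S0" and c: "!!y. hinner (A0 z *v y) c = 0" for z x c
        proof
          show "hinner (- (A0 z ** adj (A z)) *v x) c = 0"
            by (simp add: matrix_minus_vec hinner_simps matrix_vector_mul_assoc[symmetric] c)
          obtain y where y: "A0 z *v y ~= 0" using z matrix_zero_iff unfolding S0_def by blast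
          have "ccross (A0 z *v y) (A1 z *v (A z *v x)) = 0" using False z by blast
          then obtain k where "A1 z *v (A z *v x) = k *s (A0 z *v y)" using ccross_parallel y by blast
          then show "hinner (- (A1 z ** A z) *v x) c = 0"
            by (simp add: matrix_minus_vec hinner_simps matrix_vector_mul_assoc[symmetric] c)
        qed
        show "A0 z1 ~= 0" by (rule nz)
      qed blast
      obtain c where c: "c ~= 0" "hinner t c = 0"
      proof (cases "t$1 = 0 \<and> t$2 = 0")
        case True
        show ?thesis by (rule that[of "axis 1 1"]) (use True in \<open>simp_all add: hinner_3 axis_def vec3_eq_iff\<close>)
      next
        case False
        show ?thesis
          by (rule that[of "\<chi> i. if i = 1 then cnj (t$2) else if i = 2 then - cnj (t$1) else 0"])
             (use False in \<open>auto simp: hinner_3 vec3_eq_iff\<close>)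
      qed
      show ?thesis
      proof (rule that[of "ball z1 e" c])
        fix z assume z: "z \<in> ball z1 e"
        show "adj (A0 z) *v c = 0"
        proof (rule hinner_eqI)
          fix w
          obtain k where "A0 z *v w = k *s t" using e(4)[OF z] by blast
          then have "hinner (A0 z *v w) c = 0" by (simp add: hinner_simps c)
          then have "hinner c (A0 z *v w) = 0" by (rule hinner_swap_zero)
          then show "hinner (adj (A0 z) *v c) w = hinner 0 w" by (simp add: hinner_matrix)
        qed
      qed (use e c in auto)
    qed
  qed
qed

end

text \<open>The hypotheses in the form used below: \<open>not_one\<close> prevents \<open>A2\<close>
  from vanishing identically, and the fullness of the normalized solution does the same for
  \<open>A0\<close>.\<close>

locale uniton_two =
  fixes \<psi> :: "riemann_sphere => complex^3^3" and \<Psi> and A0 A1 A2 :: "riemann_sphere => complex^3^3"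
  assumes minimal: "minimal_immersion \<psi>"
    and normalized: "normalized_extended_solution 2 \<psi> \<Psi>"
    and polynomial: "!!p \<mu>. norm \<mu> = 1 ==> \<Psi> p \<mu> = A0 p + mat \<mu> ** A1 p + mat (\<mu>\<^sup>2) ** A2 p"
    and unramified: "totally_unramified (X_bundle \<Psi> :: riemann_sphere => (complex^(2 \<times> 3)) set)"
    and not_one: "\<not> has_polynomial_extended_solution \<psi> 1"
begin

lemma extended: "extended_solution \<psi> \<Psi>"
  using normalized by (simp add: normalized_extended_solution_def)

lemma unitary_map: "smooth_unitary_map \<psi>" and immersion: "immersion \<psi>" and conformal: "conformal \<psi>"
  using minimal by (auto simp: minimal_immersion_def harmonic_def)

lemma chart: "c \<in> charts ==> loop_chart3 (\<lambda>z. A0 (c z)) (\<lambda>z. A1 (c z)) (\<lambda>z. A2 (c z)) (A_z \<psi> c)"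
  unfolding loop_chart3_def by (rule extended_solution_chart[OF extended unitary_map _ polynomial])

lemma X_bundle_iff: "v \<in> X_bundle \<Psi> p \<longleftrightarrow> (\<exists>h0 h1. vlo v = A0 p *v h0 \<and> vhi v = A1 p *v h0 + A0 p *v h1)"
  for v :: "complex^(2 \<times> 3)"
proof (rule X_bundle_polynomial)
  obtain c z where c: "c \<in> charts" "p = c z" by (rule sphere_chart)
  interpret loop_chart3 "\<lambda>z. A0 (c z)" "\<lambda>z. A1 (c z)" "\<lambda>z. A2 (c z)" "A_z \<psi> c" by (rule chart[OF c(1)])
  show "loop_unitary (A0 p) (A1 p) (A2 p)" unfolding c(2) by (rule unitary)
  show "\<Psi> p \<mu> \<in> unitary_group" if "norm \<mu> = 1" for \<mu>
    using extended that by (simp add: extended_solution_def smooth_loop_map_def)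
qed (rule polynomial)

lemma A2_nonzero: "\<exists>p. A2 p ~= 0"
proof (rule ccontr)
  assume n: "\<nexists>p. A2 p ~= 0"
  have "\<Psi> p \<mu> = (\<Sum>i\<le>1. mat (\<mu> ^ i) ** (\<lambda>i. if i = 0 then A0 else A1) i p)" if "norm \<mu> = 1" for p \<mu>
    using polynomial[OF that, of p] n by simp
  then have "has_polynomial_extended_solution \<psi> 1"
    unfolding has_polynomial_extended_solution_def using extended
    by (intro exI[of _ \<Psi>] exI[of _ "\<lambda>i. if i = 0 then A0 else A1"]) simp
  then show False using not_one by contradiction
qed

lemma full: "(!!p. adj (A0 p) *v c = 0) ==> c = 0"
  by (rule normalized_full[OF normalized polynomial])

lemma A0_nonzero: "\<exists>p. A0 p ~= 0"
proof (rule ccontr)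
  assume n: "\<nexists>p. A0 p ~= 0"
  have "axis 1 1 = (0 :: complex^3)" by (rule full) (use n in simp)
  then show False by (simp add: axis_eq_0_iff)
qed

lemma trace_difference_constant:
  "trace (A0 p ** adj (A0 p)) - trace (A2 p ** adj (A2 p)) =
   trace (A0 q ** adj (A0 q)) - trace (A2 q ** adj (A2 q))"
proof -
  define d where "d = (\<lambda>p. trace (A0 p ** adj (A0 p)) - trace (A2 p ** adj (A2 p)))"
  have "d (c z) = d (c w)" if "c \<in> charts" for c z w
  proof -
    interpret loop_chart3 "\<lambda>z. A0 (c z)" "\<lambda>z. A1 (c z)" "\<lambda>z. A2 (c z)" "A_z \<psi> c" by (rule chart[OF that])
    show ?thesis unfolding d_def by (rule trace_difference_constant)
  qed
  moreover have "chart1 1 = chart0 1" by (simp add: chart0_def chart1_def)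
  moreover have "chart0 \<in> charts" "chart1 \<in> charts" by (auto simp: charts_def)
  ultimately have "d p = d (chart0 1)" for p by (metis sphere_cases)
  then show ?thesis unfolding d_def by metis
qed

text \<open>If \<open>A0\<close> and \<open>A2\<close> never were nonzero at the same point, the
  constant \<open>|A0|\<^sup>2 - |A2|\<^sup>2\<close> would be positive at one point and negative at
  another.\<close>

lemma both_nonzero: "\<exists>p. A0 p ~= 0 \<and> A2 p ~= 0"
proof (rule ccontr)
  assume n: "\<nexists>p. A0 p ~= 0 \<and> A2 p ~= 0"
  obtain p q where pq: "A0 p ~= 0" "A2 q ~= 0" using A0_nonzero A2_nonzero by blast
  then have "A2 p = 0" "A0 q = 0" using n by blast+
  then have "Re (trace (A0 p ** adj (A0 p))) = - Re (trace (A2 q ** adj (A2 q)))"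
    using arg_cong[OF trace_difference_constant[of p q], of Re] by (simp add: trace_def)
  then show False using trace_mult_ctranspose_pos pq by (smt (verit))
qed

lemma chart_mem [simp]: "chart0 \<in> charts" "chart1 \<in> charts"
  by (auto simp: charts_def)

text \<open>Unique continuation. \<open>A0\<close> itself is not holomorphic, but X has local
  holomorphic frames, and the range of \<open>A0\<close> consists of the lower components of X.
  Pairing these components with the constant \<open>c\<close> gives holomorphic functions, so the
  interior of the annihilation set is closed and open in the chart; continuity adds the point at
  infinity, and fullness ends the proof.\<close>

lemma no_annihilator_on_open:
  assumes S: "open S" "S ~= {}" and c: "!!z. z \<in> S ==> adj (A0 (chart0 z)) *v c = 0"
  shows "c = 0"
proof -
  interpret c0: loop_chart3 "\<lambda>z. A0 (chart0 z)" "\<lambda>z. A1 (chart0 z)" "\<lambda>z. A2 (chart0 z)" "A_z \<psi> chart0" by (rule chart) simp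
  interpret c1: loop_chart3 "\<lambda>z. A0 (chart1 z)" "\<lambda>z. A1 (chart1 z)" "\<lambda>z. A2 (chart1 z)" "A_z \<psi> chart1" by (rule chart) simp
  let ?Z = "{z. adj (A0 (chart0 z)) *v c = 0}"
  obtain k where k: "holomorphic_subbundle k (X_bundle \<Psi> :: riemann_sphere => (complex^(2 \<times> 3)) set)"
    using unramified unfolding totally_unramified_def by blast
  have key: "\<exists>e>0. ball z0 e \<subseteq> ?Z" if z0: "z0 \<in> closure (interior ?Z)" for z0
  proof -
    have "\<forall>c\<in>charts. \<forall>z0. \<exists>U (f :: nat => complex => complex^(2 \<times> 3)). open U \<and> z0 \<in> U \<and>
        (\<forall>i<k. \<forall>j. (\<lambda>z. f i z $ j) holomorphic_on U) \<and>
        (\<forall>z\<in>U. X_bundle \<Psi> (c z) = vec.span ((\<lambda>i. f i z) ` {..<k}))"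
      using k unfolding holomorphic_subbundle_def by (rule conjunct2)
    from spec[OF bspec[OF this chart_mem(1)], of z0]
    obtain U and f :: "nat => complex => complex^(2 \<times> 3)" where U: "open U" "z0 \<in> U"
      and hol: "!!i j. i < k ==> (\<lambda>z. f i z $ j) holomorphic_on U"
      and X: "!!z. z \<in> U ==> X_bundle \<Psi> (chart0 z) = vec.span ((\<lambda>i. f i z) ` {..<k})"
      by blast
    obtain e where e: "e > 0" "ball z0 e \<subseteq> U" using U open_contains_ball by metis
    have "interior ?Z \<inter> ball z0 e ~= {}"
      using z0 e(1) unfolding closure_iff_nhds_not_empty by (metis Int_commute centre_in_ball open_ball order_refl)
    then have V: "open (interior ?Z \<inter> ball z0 e)" "interior ?Z \<inter> ball z0 e ~= {}" by auto
    have g: "hinner (vlo (f i z)) c = 0" if i: "i < k" and z: "z \<in> ball z0 e" for i z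
    proof -
      have h: "(\<lambda>z. hinner (vlo (f i z)) c) holomorphic_on ball z0 e"
        unfolding hinner_def vlo_def vec_lambda_beta
        using hol[OF i] e(2) by (intro holomorphic_intros) (auto intro: holomorphic_on_subset)
      have z': "hinner (vlo (f i w)) c = 0" if w: "w \<in> interior ?Z \<inter> ball z0 e" for w
      proof -
        have "f i w \<in> X_bundle \<Psi> (chart0 w)"
        proof -
          have "w \<in> U" using w e(2) by blast
          then show ?thesis unfolding X[OF \<open>w \<in> U\<close>] by (rule_tac vec.span_base) (use i in blast)
        qed
        then obtain h0 where "vlo (f i w) = A0 (chart0 w) *v h0" unfolding X_bundle_iff by blast
        moreover have "adj (A0 (chart0 w)) *v c = 0" using w interior_subset by blast
        ultimately show ?thesis by (simp add: hinner_matrix)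
      qed
      show ?thesis
        by (rule analytic_continuation_open[OF V(1) open_ball V(2) connected_ball _ h holomorphic_on_const _ z])
           (use z' in auto)
    qed
    have "adj (A0 (chart0 z)) *v c = 0" if z: "z \<in> ball z0 e" for z
    proof (rule hinner_eqI)
      fix h
      have "vpack (A0 (chart0 z) *v h) (A1 (chart0 z) *v h + A0 (chart0 z) *v 0) \<in> X_bundle \<Psi> (chart0 z)"
        unfolding X_bundle_iff by (intro exI[of _ h] exI[of _ 0]) simp
      then have "vpack (A0 (chart0 z) *v h) (A1 (chart0 z) *v h + A0 (chart0 z) *v 0) \<in> vec.span ((\<lambda>i. f i z) ` {..<k})"
        using X z e(2) by blast
      moreover have "hinner (vlo v) c = 0" if "v \<in> vec.span ((\<lambda>i. f i z) ` {..<k})" for v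
        using that
      proof (induction rule: vec.span_induct_alt)
        case base
        then show ?case by (simp add: vlo_def hinner_def)
      next
        case (step a x y)
        have "vlo (a *s x + y) = a *s vlo x + vlo y" by (simp add: vlo_def vec_eq_iff)
        then show ?case using step g[OF _ z] by (auto simp: hinner_simps)
      qed
      ultimately have "hinner (A0 (chart0 z) *v h) c = 0" by (metis vlo_vpack)
      then have "hinner c (A0 (chart0 z) *v h) = 0" by (rule hinner_swap_zero)
      then show "hinner (adj (A0 (chart0 z)) *v c) h = hinner 0 h" by (simp add: hinner_matrix)
    qed
    then show ?thesis using e(1) by blast
  qed
  have "closed (interior ?Z)"
  proof -
    have "closure (interior ?Z) \<subseteq> interior ?Z"
    proof
      fix z0 assume "z0 \<in> closure (interior ?Z)"
      from key[OF this] show "z0 \<in> interior ?Z" by (auto simp: mem_interior)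
    qed
    then show ?thesis using closure_subset_eq by blast
  qed
  moreover have "interior ?Z ~= {}" using S c interior_maximal[of S ?Z] by auto
  ultimately have "interior ?Z = UNIV" using connected_clopen[of "UNIV :: complex set"] open_interior by auto
  then have z0: "adj (A0 (chart0 z)) *v c = 0" for z using interior_subset[of ?Z] by auto
  have z1: "adj (A0 (chart1 w)) *v c = 0" for w
  proof (rule continuous_zero_off_finite[where F = "{0}"])
    show "continuous_on UNIV (\<lambda>w. adj (A0 (chart1 w)) *v c)"
      by (intro continuous_on_matrix_vec continuous_on_ctranspose continuous_on_const c1.continuous_coefficients)
    show "adj (A0 (chart1 w)) *v c = 0" if "w \<notin> {0}" for w
      using z0[of "1 / w"] that by (simp add: chart0_def chart1_def)
  qed simp
  show ?thesis by (rule full) (metis sphere_cases z0 z1)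
qed

lemma A_square_nonzero: "\<exists>z. A_z \<psi> chart0 z ** A_z \<psi> chart0 z ~= 0"
proof (rule ccontr)
  assume "\<nexists>z. A_z \<psi> chart0 z ** A_z \<psi> chart0 z ~= 0"
  then have sq: "A_z \<psi> chart0 z ** A_z \<psi> chart0 z = 0" for z by blast
  interpret c0: loop_chart3 "\<lambda>z. A0 (chart0 z)" "\<lambda>z. A1 (chart0 z)" "\<lambda>z. A2 (chart0 z)" "A_z \<psi> chart0" by (rule chart) simp
  interpret c1: loop_chart3 "\<lambda>z. A0 (chart1 z)" "\<lambda>z. A1 (chart1 z)" "\<lambda>z. A2 (chart1 z)" "A_z \<psi> chart1" by (rule chart) simp
  have "\<exists>z1. A0 (chart0 z1) ~= 0 \<and> A2 (chart0 z1) ~= 0"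
  proof (rule ccontr)
    assume n: "\<nexists>z1. A0 (chart0 z1) ~= 0 \<and> A2 (chart0 z1) ~= 0"
    obtain p where p: "A0 p ~= 0" "A2 p ~= 0" using both_nonzero by blast
    then have "p = chart1 0" using n by (metis sphere_cases)
    \<comment> \<open>If infinity were the only point with both coefficients nonzero, this open set
      would be contained in a single point.\<close>
    let ?O = "{w. A0 (chart1 w) ~= 0} \<inter> {w. A2 (chart1 w) ~= 0}"
    have "open ?O"
      by (intro open_Int open_Collect_neq c1.continuous_coefficients continuous_on_const)
    moreover have "0 \<in> ?O" using p \<open>p = chart1 0\<close> by simp
    moreover have "?O \<subseteq> {0}"
    proof
      fix w assume w: "w \<in> ?O"
      show "w \<in> {0}"
      proof (rule ccontr)
        assume "w \<notin> {0}"
        then have "chart1 w = chart0 (1 / w)" by (simp add: chart0_def chart1_def)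
        then show False using w n by auto
      qed
    qed
    ultimately show False using finite_imp_not_open[of ?O] finite_subset[of ?O "{0}"] by auto
  qed
  then obtain z1 where z1: "A0 (chart0 z1) ~= 0" "A2 (chart0 z1) ~= 0" by blast
  obtain c S where "open S" "S ~= {}" "c ~= 0" "!!z. z \<in> S ==> adj (A0 (chart0 z)) *v c = 0"
    by (rule c0.square_zero_annihilator[OF sq z1]) (rule that)
  then show False using no_annihilator_on_open[of S c] by simp
qed

text \<open>The generic rank \<open>k\<close> is a lower bound everywhere once it is nonzero. Rank 0
  contradicts the immersion. In rank 1, \<open>A_z = outer b u\<close>, and conformality gives
  \<open>hinner b u = 0\<close>, hence a vanishing square, first off a finite set and then
  everywhere by continuity.\<close>

lemma rank_two:
  assumes c: "c \<in> charts" shows "2 \<le> vec.dim (range ((*v) (A_z \<psi> c z)))"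
proof -
  obtain r where r: "smooth_subbundle r (X_bundle \<Psi> :: riemann_sphere => (complex^(2 \<times> 3)) set)"
    using unramified unfolding totally_unramified_def holomorphic_subbundle_def by blast
  have img: "vec.dim ((\<lambda>v. second_ff c (X_bundle \<Psi> :: riemann_sphere => (complex^(2 \<times> 3)) set) z *v v) ` X_bundle \<Psi> (c z)) =
     vec.dim (range ((*v) (A_z \<psi> c z)))" if "c \<in> charts" for c z
  proof -
    interpret loop_chart3 "\<lambda>z. A0 (c z)" "\<lambda>z. A1 (c z)" "\<lambda>z. A2 (c z)" "A_z \<psi> c" by (rule chart[OF that])
    show ?thesis by (rule second_ff_image[OF that r]) (rule X_bundle_iff)
  qed
  let ?X = "X_bundle \<Psi> :: riemann_sphere => (complex^(2 \<times> 3)) set"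
  obtain k F where kF: "finite F"
    "!!c z. c \<in> charts ==> c z \<notin> F ==> vec.dim ((\<lambda>v. second_ff c ?X z *v v) ` ?X (c z)) = k"
    "!!c z. k ~= 0 ==> c \<in> charts ==> k \<le> vec.dim ((\<lambda>v. second_ff c ?X z *v v) ` ?X (c z))"
    by (rule totally_unramified_rank[OF unramified]) (rule that)
  have F: "finite F" "!!c z. c \<in> charts ==> c z \<notin> F ==> vec.dim (range ((*v) (A_z \<psi> c z))) = k"
    "!!c z. k ~= 0 ==> c \<in> charts ==> k \<le> vec.dim (range ((*v) (A_z \<psi> c z)))"
  proof -
    show "finite F" by (rule kF)
    show "vec.dim (range ((*v) (A_z \<psi> c z))) = k" if "c \<in> charts" "c z \<notin> F" for c z
      using kF(2)[OF that] img[OF that(1), of z] by simp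
    show "k \<le> vec.dim (range ((*v) (A_z \<psi> c z)))" if "k ~= 0" "c \<in> charts" for c z
      using kF(3)[OF that] unfolding img[OF that(2)] .
  qed
  interpret c0: loop_chart3 "\<lambda>z. A0 (chart0 z)" "\<lambda>z. A1 (chart0 z)" "\<lambda>z. A2 (chart0 z)" "A_z \<psi> chart0" by (rule chart) simp
  define F0 where "F0 = chart0 -` F"
  have F0: "finite F0" unfolding F0_def by (rule finite_vimageI[OF F(1)]) (auto simp: inj_on_def chart0_def)
  have d: "vec.dim (range ((*v) (A_z \<psi> chart0 z))) = k" if "z \<notin> F0" for z
    using F(2)[of chart0 z] that by (simp add: F0_def)
  have "k ~= 0"
  proof
    assume "k = 0"
    obtain z where "z \<notin> F0" using ex_new_if_finite[OF infinite_UNIV_char_0 F0] by blast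
    then have "vec.dim (range ((*v) (A_z \<psi> chart0 z))) = 0" using d \<open>k = 0\<close> by simp
    then have "range ((*v) (A_z \<psi> chart0 z)) \<subseteq> {0}" by (simp only: vec.dim_eq_0)
    then have "\<forall>x. A_z \<psi> chart0 z *v x = 0" by (simp add: image_subset_iff)
    then have "A_z \<psi> chart0 z = 0" by (rule matrix_zero_iff[THEN iffD2])
    then show False using immersion_A_z_nonzero[OF unitary_map _ immersion] by simp
  qed
  moreover have "k ~= 1"
  proof
    assume "k = 1"
    have "A_z \<psi> chart0 z ** A_z \<psi> chart0 z = 0" if z: "z \<notin> F0" for z
    proof -
      let ?A = "A_z \<psi> chart0 z"
      have "ccross (?A *v x) (?A *v y) = 0" for x y
      proof (rule ccontr)
        assume n: "ccross (?A *v x) (?A *v y) ~= 0"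
        have "vec.dim (range ((*v) ?A)) \<le> 1" using d[OF z] \<open>k = 1\<close> by simp
        obtain B where B: "range ((*v) ?A) \<subseteq> vec.span B" "card B = vec.dim (range ((*v) ?A))"
          by (rule vec.basis_exists[of "range ((*v) ?A)"])
        then have "card B = 1" using d[OF z] \<open>k = 1\<close> by simp
        then obtain b where "B = {b}" by (rule card_1_singletonE)
        then have b: "range ((*v) ?A) \<subseteq> vec.span {b}" using B by simp
        have "?A *v v \<in> range (\<lambda>k. k *s b)" for v
          using b unfolding vec.span_singleton by blast
        then obtain s t where "?A *v x = s *s b" "?A *v y = t *s b" by blast
        then show False using n by (simp add: vec3_eq_iff)
      qed
      then obtain b u where bu: "?A = outer b u" using outer_of_ccross by blast
      have "trace (?A ** ?A) = 0" by (rule conformal_trace[OF unitary_map _ conformal]) simp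
      then have "hinner b u * hinner b u = 0"
        by (simp add: bu matrix_mult_outer outer_vec trace_outer hinner_simps)
      then show ?thesis by (simp add: bu matrix_mult_outer outer_vec) (simp add: vec_eq_iff)
    qed
    from continuous_zero_off_finite[OF continuous_on_matrix_mult[OF c0.continuous_coefficients(4,4)] F0 this]
    have "A_z \<psi> chart0 z ** A_z \<psi> chart0 z = 0" for z by blast
    then show False using A_square_nonzero by blast
  qed
  ultimately show ?thesis using F(3)[OF _ c, of z] by linarith
qed

end

section \<open>Adapted frames at a point\<close>

lemma orthonormal_expansion:
  fixes u w :: "complex^3"
  assumes u: "hinner u u = 1" and w: "hinner w w = 1" and uw: "hinner u w = 0"
    and m: "m = vcnj (ccross u w)"
  shows "hinner m m = 1" "hinner u m = 0" "hinner w m = 0"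
    "x = hinner x u *s u + hinner x m *s m + hinner x w *s w"
proof -
  have wu: "hinner w u = 0" using uw by (rule hinner_swap_zero)
  have cc: "hinner (ccross u w) (ccross u w) = 1" by (simp add: ccross_lagrange u w uw)
  then show mm: "hinner m m = 1" by (simp add: m hinner_vcnj)
  show um: "hinner u m = 0" and wm: "hinner w m = 0" unfolding m by (rule ccross_orthogonal)+
  have mu: "hinner m u = 0" "hinner m w = 0" using um wm by (auto intro: hinner_swap_zero)
  define r where "r = x - hinner x u *s u - hinner x m *s m - hinner x w *s w"
  have ru: "hinner r u = 0" and rw: "hinner r w = 0" and rm: "hinner r m = 0"
    by (simp_all add: r_def hinner_simps u w mm um wm mu uw wu)
  have "ccross u w ~= 0" using cc by auto
  then obtain t where "r = t *s m" using orthogonal_ccross[OF ru rw] m by blast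
  then have "r = 0" using rm mm by (simp add: hinner_simps)
  then show "x = hinner x u *s u + hinner x m *s m + hinner x w *s w" by (simp add: r_def algebra_simps)
qed

lemma normalize_vector:
  assumes "v ~= 0" obtains c where "c ~= 0" "hinner (c *s v) (c *s v) = 1"
proof -
  define c where "c = complex_of_real (1 / norm v)"
  have n: "norm v ~= 0" using assms by simp
  have "hinner (c *s v) (c *s v) = c * (cnj c * hinner v v)"
    by (simp only: hinner_scale_left hinner_scale_right mult.left_commute)
  also have "\<dots> = complex_of_real ((1 / norm v) * (1 / norm v) * (norm v)\<^sup>2)"
    by (simp only: hinner_self c_def complex_cnj_complex_of_real of_real_mult mult.assoc)
  also have "(1 / norm v) * (1 / norm v) * (norm v)\<^sup>2 = 1" using n by (simp add: power2_eq_square)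
  finally show ?thesis using n by (intro that[of c]) (simp_all add: c_def)
qed

lemma ccross_scale_same: "ccross (s *s b) (t *s b) = 0"
  by (simp add: vec3_eq_iff)

text \<open>Two independent kernel vectors, completed to an orthonormal basis, would let
  \<open>M\<close> factor through the single remaining coordinate.\<close>

lemma kernel_parallel:
  fixes M :: "complex^3^3"
  assumes n: "ccross (M *v x) (M *v y) ~= 0" and p: "M *v p = 0" and q: "M *v q = 0"
  shows "ccross p q = 0"
proof (rule ccontr)
  assume pq: "ccross p q ~= 0"
  then have "p ~= 0" by (auto simp: vec3_eq_iff)
  then obtain c where c: "c ~= 0" "hinner (c *s p) (c *s p) = 1" by (rule normalize_vector)
  define p1 where "p1 = c *s p"
  have p1: "hinner p1 p1 = 1" "M *v p1 = 0" using c p by (auto simp: p1_def vector_scalar_commute)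
  define q0 where "q0 = q - hinner q p1 *s p1"
  have "q0 ~= 0"
  proof
    assume "q0 = 0"
    then have "q = (hinner q p1 * c) *s p" by (simp add: q0_def p1_def vec.scale_scale)
    then show False using pq by (simp add: vec3_eq_iff)
  qed
  then obtain d where d: "d ~= 0" "hinner (d *s q0) (d *s q0) = 1" by (rule normalize_vector)
  define q1 where "q1 = d *s q0"
  have q1: "hinner q1 q1 = 1" using d by (simp add: q1_def)
  have Mq: "M *v q1 = 0" by (simp add: q1_def q0_def vector_scalar_commute vector_distribs q p1)
  have "hinner p1 q0 = 0"
    using p1(1) by (simp add: q0_def hinner_simps hinner_cnj)
  then have o: "hinner p1 q1 = 0" by (simp add: q1_def hinner_simps)
  define m where "m = vcnj (ccross p1 q1)"
  have Mv: "M *v v = hinner v m *s (M *v m)" for v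
  proof -
    have "M *v v = M *v (hinner v p1 *s p1 + hinner v m *s m + hinner v q1 *s q1)"
      using orthonormal_expansion(4)[OF p1(1) q1 o m_def, of v] by (rule arg_cong)
    then show ?thesis by (simp add: vector_distribs vector_scalar_commute p1 Mq)
  qed
  have "ccross (M *v x) (M *v y) = ccross (hinner x m *s (M *v m)) (hinner y m *s (M *v m))"
    using Mv[of x] Mv[of y] by (rule arg_cong2)
  then show False using n by (simp add: ccross_scale_same)
qed

text \<open>Normal form at one point. In the orthonormal basis \<open>u\<close>, \<open>m\<close>,
  \<open>w\<close> the matrix \<open>M\<close> is strictly triangular, moving \<open>u\<close> to
  \<open>m\<close> and \<open>m\<close> to \<open>w\<close> with entries \<alpha> and \<delta>, and
  \<gamma> from \<open>u\<close> to \<open>w\<close>. \<open>B0\<close> lives on \<open>u\<close>,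
  \<open>B2\<close> on \<open>w\<close>, with orthogonal values \<open>a\<close>, \<open>b\<close>
  of common squared length \<open>d\<close>; \<open>B1\<close> sends \<open>m\<close> to the unit
  vector \<open>e\<close> and exchanges the outer directions, \<open>u\<close> to a multiple of
  \<open>b\<close> and \<open>w\<close> to a multiple of \<open>a\<close>. The number \<nu> measures
  the failure of \<open>B1 ** adj B0 = 0\<close>.\<close>

definition loop_frame where
  "loop_frame B0 B1 B2 M u m w a b e \<alpha> \<gamma> \<delta> \<nu> d \<longleftrightarrow>
    hinner u u = 1 \<and> hinner m m = 1 \<and> hinner w w = 1 \<and> hinner u m = 0 \<and> hinner w m = 0 \<and> hinner u w = 0 \<and>
    B0 = outer a u \<and> B2 = outer b w \<and> a ~= 0 \<and> b ~= 0 \<and>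
    M = outer (\<alpha> *s m + \<gamma> *s w) u + outer (\<delta> *s w) m \<and> \<alpha> ~= 0 \<and> \<delta> ~= 0 \<and>
    M *v u = \<alpha> *s m + \<gamma> *s w \<and> M *v m = \<delta> *s w \<and> M *v w = 0 \<and>
    e = B1 *v m \<and> hinner e e = 1 \<and> hinner e a = 0 \<and> hinner e b = 0 \<and> hinner a b = 0 \<and>
    adj B1 *v e = m \<and> B1 *v u = \<nu> *s b \<and> (\<exists>\<omega>. B1 *v w = \<omega> *s a) \<and> (\<exists>\<omega>. adj B1 *v a = \<omega> *s w) \<and>
    hinner a a = of_real d \<and> hinner b b = of_real d \<and> 0 < d \<and> (norm \<nu>)\<^sup>2 * d = 1 - d"

text \<open>\<open>B0 ** M = 0\<close> puts \<open>u\<close> orthogonal to the two-dimensional range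
  of \<open>M\<close>, \<open>M ** adj B2 = 0\<close> puts \<open>w\<close> in its kernel, and
  \<open>B2 ** adj B0 = 0\<close> makes \<open>u\<close> and \<open>w\<close> orthogonal. The
  remaining diagonal entry of \<open>M\<close> is killed by the trace condition. The shape of
  \<open>B1\<close> is then read off from the unitarity relations.\<close>

lemma loop_frame_exists:
  fixes B0 B1 B2 M :: "complex^3^3"
  assumes U: "loop_unitary B0 B1 B2" and B0M: "B0 ** M = 0" and MB2: "M ** adj B2 = 0"
    and tr: "trace (M ** M) = 0" and n: "ccross (M *v x) (M *v y) ~= 0"
    and B0: "B0 ~= 0" and B2: "B2 ~= 0"
  obtains u m w a b e \<alpha> \<gamma> \<delta> \<nu> d where "loop_frame B0 B1 B2 M u m w a b e \<alpha> \<gamma> \<delta> \<nu> d"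
proof -
  have r: "adj B0 ** B0 + adj B1 ** B1 + adj B2 ** B2 = mat 1"
    "adj B0 ** B1 + adj B1 ** B2 = 0" "adj B0 ** B2 = 0"
    "B0 ** adj B0 + B1 ** adj B1 + B2 ** adj B2 = mat 1" "B2 ** adj B0 = 0"
    using U by (auto simp: loop_unitary_def)
  have r8: "adj B1 ** B0 + adj B2 ** B1 = 0"
    using arg_cong[OF r(2), of adj] by (simp add: ctranspose_simps)
  have B0v: "B0 *v (M *v v) = 0" for v by (simp add: matrix_vector_mul_assoc B0M)
  have "\<exists>t. adj B0 *v p = t *s vcnj (ccross (M *v x) (M *v y))" for p
  proof (rule orthogonal_ccross[OF _ _ n])
    show "hinner (adj B0 *v p) (M *v x) = 0" "hinner (adj B0 *v p) (M *v y) = 0"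
      by (simp_all add: hinner_matrix B0v)
  qed
  from outer_of_parallel[OF this] obtain a0 where "adj B0 = outer (vcnj (ccross (M *v x) (M *v y))) a0" by blast
  then have B0a: "B0 = outer a0 (vcnj (ccross (M *v x) (M *v y)))" by (metis ctranspose_ctranspose ctranspose_outer)
  have "vcnj (ccross (M *v x) (M *v y)) ~= 0" using n by simp
  then obtain c where c: "c ~= 0" "hinner (c *s vcnj (ccross (M *v x) (M *v y))) (c *s vcnj (ccross (M *v x) (M *v y))) = 1"
    by (rule normalize_vector)
  define u where "u = c *s vcnj (ccross (M *v x) (M *v y))"
  define a where "a = (1 / cnj c) *s a0"
  have u1: "hinner u u = 1" using c by (simp add: u_def)
  have B0e: "B0 = outer a u" using c(1) by (simp add: B0a a_def u_def vec_eq_iff)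
  have a0: "a ~= 0" using B0 by (auto simp: B0e vec_eq_iff)
  have "adj B2 ~= 0" using B2 by (metis ctranspose_ctranspose ctranspose_zero)
  then obtain p0 where p0: "adj B2 *v p0 ~= 0" using matrix_zero_iff by blast
  define w0 where "w0 = adj B2 *v p0"
  have Mw: "M *v (adj B2 *v p) = 0" for p by (simp add: matrix_vector_mul_assoc MB2)
  have "\<exists>t. adj B2 *v p = t *s w0" for p
    using ccross_parallel[OF kernel_parallel[OF n Mw[of p0] Mw[of p]] p0] unfolding w0_def .
  from outer_of_parallel[OF this] obtain b0 where "adj B2 = outer w0 b0" by blast
  then have B2b: "B2 = outer b0 w0" by (metis ctranspose_ctranspose ctranspose_outer)
  have "w0 ~= 0" using p0 by (simp add: w0_def)
  then obtain c' where c': "c' ~= 0" "hinner (c' *s w0) (c' *s w0) = 1" by (rule normalize_vector)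
  define w where "w = c' *s w0"
  define b where "b = (1 / cnj c') *s b0"
  have w1: "hinner w w = 1" using c' by (simp add: w_def)
  have B2e: "B2 = outer b w" using c'(1) by (simp add: B2b b_def w_def vec_eq_iff)
  have b0: "b ~= 0" using B2 by (auto simp: B2e vec_eq_iff)
  have Mw0: "M *v w = 0" using Mw[of p0] by (simp add: w_def w0_def vector_scalar_commute)
  have "outer b w ** outer u a = 0" using r(5) by (simp add: B0e B2e)
  then have "outer (hinner u w *s b) a *v a = 0" by (simp add: matrix_mult_outer outer_vec)
  then have uw: "hinner u w = 0" using a0 b0 by (simp add: outer_vec vec.scale_scale)
  have wu: "hinner w u = 0" by (rule hinner_swap_zero[OF uw])
  have "outer u a ** outer b w = 0" using r(3) by (simp add: B0e B2e)
  then have "outer (hinner b a *s u) w *v w = 0" by (simp add: matrix_mult_outer outer_vec)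
  then have ba: "hinner b a = 0" using u1 w1 by (auto simp: outer_vec vec.scale_scale)
  have ab: "hinner a b = 0" by (rule hinner_swap_zero[OF ba])
  define m where "m = vcnj (ccross u w)"
  note oe = orthonormal_expansion[OF u1 w1 uw m_def]
  have mu: "hinner m u = 0" "hinner m w = 0" using oe(2,3) by (auto intro: hinner_swap_zero)
  have Mu: "hinner (M *v v) u = 0" for v
  proof -
    have "hinner (M *v v) u *s a = 0" using B0v[of v] by (simp add: B0e outer_vec)
    then show ?thesis using a0 by simp
  qed
  define \<alpha> where "\<alpha> = hinner (M *v u) m"  define \<gamma> where "\<gamma> = hinner (M *v u) w"
  define \<beta> where "\<beta> = hinner (M *v m) m"  define \<delta> where "\<delta> = hinner (M *v m) w"
  have Muu: "M *v u = \<alpha> *s m + \<gamma> *s w" using oe(4)[of "M *v u"] by (simp add: Mu \<alpha>_def \<gamma>_def)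
  have Mmm': "M *v m = \<beta> *s m + \<delta> *s w" using oe(4)[of "M *v m"] by (simp add: Mu \<beta>_def \<delta>_def)
  have Mexp: "M *v v = hinner v u *s (M *v u) + hinner v m *s (M *v m)" for v
  proof -
    have "M *v v = M *v (hinner v u *s u + hinner v m *s m + hinner v w *s w)"
      using oe(4)[of v] by (rule arg_cong)
    then show ?thesis by (simp add: vector_distribs vector_scalar_commute Mw0)
  qed
  have Me: "M = outer (M *v u) u + outer (M *v m) m"
    by (rule matrix_eqI) (simp add: vector_distribs outer_vec Mexp[symmetric])
  \<comment> \<open>Of the diagonal only the entry \<beta> at \<open>m\<close> is left, and the
    trace of the square is its square.\<close>
  have "trace (M ** M) = trace (M ** (outer (M *v u) u + outer (M *v m) m))" using Me by simp
  also have "\<dots> = hinner (M *v (M *v u)) u + hinner (M *v (M *v m)) m"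
    by (simp add: matrix_distribs matrix_mult_outer trace_add trace_outer)
  also have "\<dots> = \<beta> * \<beta>"
    by (simp add: Mu) (simp add: Mmm' vector_distribs vector_scalar_commute Mw0 hinner_simps oe mu)
  finally have "\<beta> = 0" using tr by simp
  then have Mmm: "M *v m = \<delta> *s w" using Mmm' by simp
  have "\<alpha> ~= 0"
  proof
    assume "\<alpha> = 0"
    have "M *v v = (hinner v u * \<gamma> + hinner v m * \<delta>) *s w" for v
      by (subst Mexp) (simp add: Muu Mmm \<open>\<alpha> = 0\<close> vec.scale_scale vec.scale_left_distrib)
    note k = this
    show False using n unfolding k[of x] k[of y] ccross_scale_same by simp
  qed
  have "\<delta> ~= 0"
  proof
    assume "\<delta> = 0"
    have "M *v v = hinner v u *s (M *v u)" for v by (subst Mexp) (simp add: Mmm \<open>\<delta> = 0\<close>)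
    note k = this
    have "ccross (M *v x) (M *v y) = ccross (hinner x u *s (M *v u)) (hinner y u *s (M *v u))"
      using k[of x] k[of y] by (rule arg_cong2)
    then show False using n by (simp add: ccross_scale_same)
  qed
  define e where "e = B1 *v m"
  have app: "adj B0 *v (B0 *v v) + adj B1 *v (B1 *v v) + adj B2 *v (B2 *v v) = v"
    "adj B0 *v (B1 *v v) + adj B1 *v (B2 *v v) = 0"
    "adj B1 *v (B0 *v v) + adj B2 *v (B1 *v v) = 0"
    "B0 *v (adj B0 *v v) + B1 *v (adj B1 *v v) + B2 *v (adj B2 *v v) = v" for v
    by (simp_all only: matrix_vector_mul_assoc matrix_vector_mult_add_rdistrib[symmetric] r r8
        matrix_vector_mul_lid matrix_vector_mult_0)
  have v0: "B0 *v v = hinner v u *s a" "B2 *v v = hinner v w *s b" "adj B0 *v v = hinner v a *s u"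
    "adj B2 *v v = hinner v b *s w" for v by (simp_all add: B0e B2e outer_vec)
  have B1e: "adj B1 *v e = m" using app(1)[of m] by (simp add: v0 mu e_def)
  have ee: "hinner e e = 1"
    using B1e oe(1) unfolding e_def by (simp add: hinner_matrix)
  have B1a: "adj B1 *v a = - (hinner (B1 *v u) b *s w)"
    using app(3)[of u] by (simp add: v0 u1 eq_neg_iff_add_eq_0)
  have B1b: "adj B1 *v b = - (hinner (B1 *v w) a *s u)"
    using app(2)[of w] by (simp add: v0 w1 eq_neg_iff_add_eq_0 add.commute)
  have ea: "hinner e a = 0" and eb: "hinner e b = 0"
    unfolding e_def
    by (simp_all only: hinner_matrix[of B1 m] B1a B1b hinner_minus_right hinner_scale_right mu mult_zero_right minus_zero)
  have "hinner (B1 *v u) a *s u = 0" using app(2)[of u] by (simp add: v0 uw)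
  then have ua: "hinner (B1 *v u) a = 0" using u1 by auto
  have "hinner (B1 *v w) b *s w = 0" using app(3)[of w] by (simp add: v0 wu)
  then have wb: "hinner (B1 *v w) b = 0" using w1 by auto
  have ue: "hinner (B1 *v u) e = 0" "hinner (B1 *v w) e = 0"
    by (simp_all only: hinner_matrix[of B1 u] hinner_matrix[of B1 w] B1e oe)
  have crs: "ccross p e ~= 0" if "p ~= 0" "hinner e p = 0" for p
  proof
    assume "ccross p e = 0"
    then have "hinner p p * hinner e e - hinner p e * hinner e p = 0" unfolding ccross_lagrange[symmetric] by simp
    then show False using that ee by simp
  qed
  have be: "hinner b e = 0" "hinner a e = 0" using ea eb by (auto intro: hinner_swap_zero)
  \<comment> \<open>The vectors orthogonal to both \<open>r\<close> and \<open>e\<close> form a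
    line; with \<open>r\<close> one of \<open>a\<close>, \<open>b\<close>, the other one spans
    it.\<close>
  have par: "\<exists>k. p = k *s q" if h: "hinner p r = 0" "hinner p e = 0" "hinner q r = 0" "hinner q e = 0" "r ~= 0" "hinner e r = 0" "q ~= 0" for p q r
  proof -
    obtain s t where "p = s *s vcnj (ccross r e)" "q = t *s vcnj (ccross r e)"
      using orthogonal_ccross[OF h(1,2) crs[OF h(5,6)]] orthogonal_ccross[OF h(3,4) crs[OF h(5,6)]] by blast
    then show ?thesis using h(7) by (intro exI[of _ "s / t"]) (auto simp: vec.scale_scale)
  qed
  obtain \<nu> where \<nu>: "B1 *v u = \<nu> *s b" using par[OF ua ue(1) ba be(1) a0 ea b0] by blast
  obtain \<omega> where \<omega>: "B1 *v w = \<omega> *s a" using par[OF wb ue(2) ab be(2) b0 eb a0] by blast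
  define s where "s = (norm a)\<^sup>2"  define t where "t = (norm b)\<^sup>2"
  have aa: "hinner a a = of_real s" and bb: "hinner b b = of_real t" by (simp_all add: s_def t_def hinner_self)
  have nn: "z * cnj z = of_real ((norm z)\<^sup>2)" for z by (rule complex_norm_square[symmetric])
  have nu: "(norm \<nu>)\<^sup>2 * t = 1 - s"
  proof -
    have "hinner (adj B0 *v (B0 *v u) + adj B1 *v (B1 *v u) + adj B2 *v (B2 *v u)) u = 1"
      by (simp only: app u1)
    then have "of_real s + (\<nu> * cnj \<nu>) * of_real t = (1 :: complex)"
      by (simp add: hinner_simps hinner_matrix v0 u1 uw aa \<nu> bb mult_ac)
    then have "complex_of_real (s + (norm \<nu>)\<^sup>2 * t) = of_real 1" unfolding nn by (simp only: of_real_add of_real_mult of_real_1)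
    then show ?thesis unfolding of_real_eq_iff by simp
  qed
  have om: "(norm \<omega>)\<^sup>2 * s = 1 - t"
  proof -
    have "hinner (adj B0 *v (B0 *v w) + adj B1 *v (B1 *v w) + adj B2 *v (B2 *v w)) w = 1"
      by (simp only: app w1)
    then have "of_real t + (\<omega> * cnj \<omega>) * of_real s = (1 :: complex)"
      by (simp add: hinner_simps hinner_matrix v0 w1 wu bb \<omega> aa mult_ac add.commute)
    then have "complex_of_real (t + (norm \<omega>)\<^sup>2 * s) = of_real 1" unfolding nn by (simp only: of_real_add of_real_mult of_real_1)
    then show ?thesis unfolding of_real_eq_iff by simp
  qed
  have B1a': "adj B1 *v a = - ((\<nu> * of_real t) *s w)" unfolding B1a \<nu> by (simp add: hinner_simps bb)
  have B1b': "adj B1 *v b = - ((\<omega> * of_real s) *s u)" unfolding B1b \<omega> by (simp add: hinner_simps aa)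
  have e1: "s * s + (norm \<nu>)\<^sup>2 * t * t = s"
  proof -
    have "hinner (B0 *v (adj B0 *v a) + B1 *v (adj B1 *v a) + B2 *v (adj B2 *v a)) a = of_real s"
      by (simp only: app aa)
    then have "of_real s * of_real s + (\<nu> * cnj \<nu>) * of_real t * of_real t = complex_of_real s"
      by (simp add: hinner_simps hinner_matrix v0 aa ab B1a' u1 w1 mult_ac)
    then have "complex_of_real (s * s + (norm \<nu>)\<^sup>2 * t * t) = of_real s" unfolding nn by (simp only: of_real_add of_real_mult)
    then show ?thesis unfolding of_real_eq_iff .
  qed
  have e2: "t * t + (norm \<omega>)\<^sup>2 * s * s = t"
  proof -
    have "hinner (B0 *v (adj B0 *v b) + B1 *v (adj B1 *v b) + B2 *v (adj B2 *v b)) b = of_real t"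
      by (simp only: app bb)
    then have "of_real t * of_real t + (\<omega> * cnj \<omega>) * of_real s * of_real s = complex_of_real t"
      by (simp add: hinner_simps hinner_matrix v0 bb ba B1b' u1 w1 mult_ac add.commute)
    then have "complex_of_real (t * t + (norm \<omega>)\<^sup>2 * s * s) = of_real t" unfolding nn by (simp only: of_real_add of_real_mult)
    then show ?thesis unfolding of_real_eq_iff .
  qed
  have "s * s + (1 - s) * t = s" using e1 unfolding nu .
  \<comment> \<open>Here s = |a|^2 and t = |b|^2. Together with the symmetric equation
    \<open>f2\<close>, different values would both have to be 1; hence s = t.\<close>
  then have f1: "(s - 1) * (s - t) = 0" by (simp add: algebra_simps)
  have "t * t + (1 - t) * s = t" using e2 unfolding om .
  then have f2: "(t - 1) * (t - s) = 0" by (simp add: algebra_simps)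
  have st: "t = s" using f1 f2 by auto
  have "s > 0" using a0 by (simp add: s_def)
  have "adj B1 *v a = (- (\<nu> * of_real t)) *s w" unfolding B1a' by (simp add: vec_eq_iff)
  then have ex: "\<exists>\<omega>. adj B1 *v a = \<omega> *s w" "\<exists>\<omega>. B1 *v w = \<omega> *s a" using \<omega> by blast+
  have Me': "M = outer (\<alpha> *s m + \<gamma> *s w) u + outer (\<delta> *s w) m" using Me unfolding Muu Mmm .
  have nu': "(norm \<nu>)\<^sup>2 * s = 1 - s" and bb': "hinner b b = of_real s" using nu bb st by simp_all
  show ?thesis
    by (rule that[of u m w a b e \<alpha> \<gamma> \<delta> \<nu> s], unfold loop_frame_def, intro conjI)
       (fact u1 oe w1 uw B0e B2e a0 b0 Me' Muu Mmm \<open>\<alpha> ~= 0\<close> \<open>\<delta> ~= 0\<close> Mw0 e_def ee ea eb ab B1e \<nu> ex aa bb' nu' \<open>s > 0\<close>)+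
qed

section \<open>The energy density in terms of a holomorphic lift\<close>

section \<open>Holomorphic lifts of the bottom line bundle\<close>

lemma has_wd_vwd_nth: "vwd F p q z ==> has_wd (\<lambda>w. F w $ i) (p $ i) (q $ i) z"
  by (simp add: vwd_def)

lemma vwd_ccross:
  assumes "vwd F p q z" "vwd G r s z"
  shows "vwd (\<lambda>w. ccross (F w) (G w)) (ccross p (G z) + ccross (F z) r) (ccross q (G z) + ccross (F z) s) z"
proof -
  have c: "has_wd (\<lambda>w. F w $ i) (p $ i) (q $ i) z" "has_wd (\<lambda>w. G w $ i) (r $ i) (s $ i) z" for i
    using assms by (simp_all add: vwd_def)
  have "has_wd (\<lambda>w. ccross (F w) (G w) $ i) ((ccross p (G z) + ccross (F z) r) $ i) ((ccross q (G z) + ccross (F z) s) $ i) z" for i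
  proof -
    have 1: "has_wd (\<lambda>w. ccross (F w) (G w) $ 1) ((ccross p (G z) + ccross (F z) r) $ 1) ((ccross q (G z) + ccross (F z) s) $ 1) z"
      unfolding ccross_nth vector_add_component
      by (rule has_wd_eq[OF has_wd_diff[OF has_wd_mult[OF c(1)[of 2] c(2)[of 3]] has_wd_mult[OF c(1)[of 3] c(2)[of 2]]]])
         (simp_all add: algebra_simps)
    have 2: "has_wd (\<lambda>w. ccross (F w) (G w) $ 2) ((ccross p (G z) + ccross (F z) r) $ 2) ((ccross q (G z) + ccross (F z) s) $ 2) z"
      unfolding ccross_nth vector_add_component
      by (rule has_wd_eq[OF has_wd_diff[OF has_wd_mult[OF c(1)[of 3] c(2)[of 1]] has_wd_mult[OF c(1)[of 1] c(2)[of 3]]]])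
         (simp_all add: algebra_simps)
    have 3: "has_wd (\<lambda>w. ccross (F w) (G w) $ 3) ((ccross p (G z) + ccross (F z) r) $ 3) ((ccross q (G z) + ccross (F z) s) $ 3) z"
      unfolding ccross_nth vector_add_component
      by (rule has_wd_eq[OF has_wd_diff[OF has_wd_mult[OF c(1)[of 1] c(2)[of 2]] has_wd_mult[OF c(1)[of 2] c(2)[of 1]]]])
         (simp_all add: algebra_simps)
    show ?thesis using exhaust_3[of i] by (elim disjE) (simp_all only: 1 2 3)
  qed
  then show ?thesis by (simp only: vwd_def simp_thms)
qed

lemma vcnj_0 [simp]: "vcnj 0 = 0"
  by simp

lemma ccross_diff_left: "ccross (u - v) w = ccross u w - ccross v w"
  by (simp add: vec3_eq_iff algebra_simps)
lemma ccross_diff_right: "ccross w (u - v) = ccross w u - ccross w v"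
  by (simp add: vec3_eq_iff algebra_simps)
lemma ccross_add_left: "ccross (u + v) w = ccross u w + ccross v w"
  by (simp add: vec3_eq_iff algebra_simps)
lemma ccross_add_right: "ccross w (u + v) = ccross w u + ccross w v"
  by (simp add: vec3_eq_iff algebra_simps)
lemma ccross_scale_left: "ccross (c *s u) w = c *s ccross u w"
  by (simp add: vec3_eq_iff algebra_simps)
lemma ccross_scale_right: "ccross w (c *s u) = c *s ccross w u"
  by (simp add: vec3_eq_iff algebra_simps)
lemma ccross_minus_left: "ccross (- u) w = - ccross u w"
  by (simp add: vec3_eq_iff algebra_simps)
lemma ccross_minus_right: "ccross w (- u) = - ccross w u"
  by (simp add: vec3_eq_iff algebra_simps)
lemma ccross_self [simp]: "ccross w w = 0"
  by (simp add: vec3_eq_iff)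
lemma ccross_swap: "ccross v w = - ccross w v"
  by (simp add: vec3_eq_iff)
lemma ccross_zero [simp]: "ccross 0 w = 0" "ccross w 0 = 0"
  by (simp_all add: vec3_eq_iff)

lemmas ccross_simps = ccross_add_left ccross_add_right ccross_scale_left ccross_scale_right
  ccross_minus_left ccross_minus_right ccross_diff_left ccross_diff_right

lemma has_wd_hinner:
  assumes "vwd F p q z" "vwd G r s z"
  shows "has_wd (\<lambda>w. hinner (F w) (G w)) (hinner p (G z) + hinner (F z) s) (hinner q (G z) + hinner (F z) r) z"
proof -
  have "has_wd (\<lambda>w. \<Sum>i\<in>UNIV. F w $ i * cnj (G w $ i)) (\<Sum>i\<in>UNIV. p $ i * cnj (G z $ i) + F z $ i * cnj (s $ i))
     (\<Sum>i\<in>UNIV. q $ i * cnj (G z $ i) + F z $ i * cnj (r $ i)) z"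
    by (rule has_wd_sum, simp, rule has_wd_mult, rule has_wd_vwd_nth[OF assms(1)], rule has_wd_cnj, rule has_wd_vwd_nth[OF assms(2)])
  then show ?thesis by (simp add: hinner_def sum.distrib)
qed

lemma vwd_vcnj: "vwd F p q z ==> vwd (\<lambda>w. vcnj (F w)) (vcnj q) (vcnj p) z"
  by (simp add: vwd_def has_wd_cnj)

lemma outer_scale_both: "outer (s *s b) (t *s a) = smul (s * cnj t) (outer b a)"
  by (simp add: vec_eq_iff)

text \<open>\<open>F\<close> and \<open>G\<close> are the squared norms of f and f x f', a prime
  marks a mixed second derivative, and the two hypotheses are the Frenet relations F^2 dz dzbar ln F
  = G and G^2 dz dzbar ln G = k F, with k the squared modulus of the Wronskian. The right side is
  e^2 dz dzbar ln e; the left side is e^2 times the sum of the squared moduli of the three entries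
  of \<open>A\<close>.\<close>

lemma curvature_identity:
  fixes F G e :: complex
  assumes F: "F * Fzb' = G + Fz * Fzb" and G: "G * Gzb' = k * F + Gz * Gzb" and nz: "F ~= 0" "G ~= 0"
    and e: "e = F * G + q * qb"
  shows "e * G\<^sup>2 / F + e * k * F\<^sup>2 / G + (q1 * (F * G) - q * (Fz * G + F * Gz)) * (q1b * (F * G) - qb * (Fzb * G + F * Gzb)) / (F * G)
    = e * ((Fzb' * G + Fz * Gzb + Fzb * Gz + F * Gzb') + q1 * q1b)
      - ((Fz * G + F * Gz) + q1 * qb) * ((Fzb * G + F * Gzb) + q * q1b)"
proof -
  \<comment> \<open>Passing to the logarithmic derivatives of \<open>F\<close> and \<open>G\<close>
    removes the denominators and leaves a polynomial identity.\<close>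
  define X where "X = Fz / F" define Xb where "Xb = Fzb / F"
  define Y where "Y = Gz / G" define Yb where "Yb = Gzb / G"
  have s: "Fz = X * F" "Fzb = Xb * F" "Gz = Y * G" "Gzb = Yb * G" using nz by (simp_all add: X_def Xb_def Y_def Yb_def)
  have f: "Fzb' = G / F + X * Xb * F" using F nz unfolding s by (simp add: field_simps)
  have g: "Gzb' = k * F / G + Y * Yb * G" using G nz unfolding s by (simp add: field_simps)
  have 1: "(q1 * (F * G) - q * (Fz * G + F * Gz)) * (q1b * (F * G) - qb * (Fzb * G + F * Gzb)) / (F * G)
     = (q1 - q * (X + Y)) * (q1b - qb * (Xb + Yb)) * (F * G)"
    using nz unfolding s by (simp add: field_simps)
  have 2: "Fzb' * G = G\<^sup>2 / F + X * Xb * F * G" "F * Gzb' = k * F\<^sup>2 / G + Y * Yb * F * G"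
    using nz unfolding f g by (simp_all add: field_simps power2_eq_square)
  show ?thesis unfolding 1 2 unfolding s e by (simp add: algebra_simps)
qed

text \<open>Frames are only asserted pointwise; no smooth choice is claimed. Everything that is
  differentiated later is built from the coefficient matrices and a holomorphic lift, and frames
  serve to evaluate the result at one point.\<close>

locale framed_chart = loop_chart3 +
  assumes frame: "\<exists>u m w a b e \<alpha> \<gamma> \<delta> \<nu> d. loop_frame (A0 z) (A1 z) (A2 z) (A z) u m w a b e \<alpha> \<gamma> \<delta> \<nu> d"

context framed_chart
begin

lemma get_frame:
  obtains u m w a b e \<alpha> \<gamma> \<delta> \<nu> d where "loop_frame (A0 z) (A1 z) (A2 z) (A z) u m w a b e \<alpha> \<gamma> \<delta> \<nu> d"
  using frame[of z] by (elim exE)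

end

text \<open>A nowhere vanishing holomorphic curve \<open>f\<close> spanning the range of
  \<open>A0\<close>, with its first two derivatives. Membership in the range is written as a
  vanishing cross product, an equation that can be differentiated.\<close>

locale lifted_chart = framed_chart +
  fixes U and f f1 f2 :: "complex => complex^3"
  assumes open_U: "open U"
    and vwd_f: "!!z. z \<in> U ==> vwd f (f1 z) 0 z" and vwd_f1: "!!z. z \<in> U ==> vwd f1 (f2 z) 0 z"
    and f_nonzero: "!!z. z \<in> U ==> f z ~= 0"
    and f_lift: "!!z x. z \<in> U ==> ccross (f z) (A0 z *v x) = 0"
begin

lemma f_parallel:
  assumes z: "z \<in> U" and l: "loop_frame (A0 z) (A1 z) (A2 z) (A z) u m w a b e \<alpha> \<gamma> \<delta> \<nu> d"
  obtains t where "f z = t *s a" "t ~= 0"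
proof -
  have a: "A0 z *v u = a" "a ~= 0" using l by (auto simp: loop_frame_def outer_vec)
  then have "ccross a (f z) = 0" using f_lift[OF z, of u] ccross_swap[of a "f z"] by simp
  then obtain t where t: "f z = t *s a" using ccross_parallel a by blast
  moreover have "t ~= 0" using t f_nonzero[OF z] by auto
  ultimately show ?thesis by (rule that)
qed

lemma A2_f: "z \<in> U ==> adj (A2 z) *v f z = 0" and A_A1_f: "z \<in> U ==> A z *v (adj (A1 z) *v f z) = 0"
proof -
  assume z: "z \<in> U"
  obtain u m w a b e \<alpha> \<gamma> \<delta> \<nu> d where l: "loop_frame (A0 z) (A1 z) (A2 z) (A z) u m w a b e \<alpha> \<gamma> \<delta> \<nu> d"
    by (rule get_frame)
  obtain t where t: "f z = t *s a" by (rule f_parallel[OF z l])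
  show "adj (A2 z) *v f z = 0" using l by (simp add: loop_frame_def t outer_vec hinner_simps)
  have "A z *v w = 0" using l unfolding loop_frame_def by blast
  obtain \<omega> where "adj (A1 z) *v a = \<omega> *s w" using l by (auto simp: loop_frame_def)
  then show "A z *v (adj (A1 z) *v f z) = 0"
    using \<open>A z *v w = 0\<close> by (simp add: t vector_scalar_commute)
qed

lemma mwd_A2_adjoint: "mwd (\<lambda>w. adj (A2 w)) (A z ** adj (A1 z)) (adj (A z) ** adj (A2 z)) z"
  using mwd_ctranspose[OF mwd_A2[of z]] by (simp add: ctranspose_mult)

lemma A2_f1: assumes z: "z \<in> U" shows "adj (A2 z) *v f1 z = 0"
proof -
  note d = mwd_mult_vec[OF mwd_A2_adjoint vwd_f[OF z]]
  have "vwd (\<lambda>w. adj (A2 w) *v f w) 0 0 z"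
    by (rule vwd_transform[OF vwd_const[of 0] open_U z]) (simp add: A2_f)
  from vwd_unique[OF d this] have "(A z ** adj (A1 z)) *v f z + adj (A2 z) *v f1 z = 0" by blast
  then show ?thesis using A_A1_f[OF z] by (simp add: matrix_vector_mul_assoc[symmetric])
qed

text \<open>Second derivative of \<open>adj A2 *v f = 0\<close>. It determines the pairing of f''
  with the direction \<open>b\<close>, and so connects the Wronskian with the entry \<delta> of
  \<open>A\<close>.\<close>

lemma A2_f2: assumes z: "z \<in> U" shows "adj (A2 z) *v f2 z = - (A z *v (adj (A1 z) *v f1 z))"
proof -
  note d = mwd_mult_vec[OF mwd_A2_adjoint vwd_f1[OF z]]
  have "vwd (\<lambda>w. adj (A2 w) *v f1 w) 0 0 z"
    by (rule vwd_transform[OF vwd_const[of 0] open_U z]) (simp add: A2_f1)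
  from vwd_unique[OF d this] have "(A z ** adj (A1 z)) *v f1 z + adj (A2 z) *v f2 z = 0" by blast
  then show ?thesis by (simp add: matrix_vector_mul_assoc[symmetric] eq_neg_iff_add_eq_0 add.commute)
qed

text \<open>Differentiating the vanishing cross product of \<open>f\<close> with
  \<open>A0 w *v u\<close> shows that f' is \<open>- (\<alpha> * t) *s e\<close> modulo
  \<open>a\<close>. The cross product of f and f' is therefore a multiple of that of
  \<open>a\<close> and \<open>e\<close>, whose conjugate points along \<open>b\<close>.\<close>

lemma lift_frame:
  assumes z: "z \<in> U" and l: "loop_frame (A0 z) (A1 z) (A2 z) (A z) u m w a b e \<alpha> \<gamma> \<delta> \<nu> d"
  obtains t \<sigma> where "f z = t *s a" "t ~= 0" "vcnj (ccross (f z) (f1 z)) = \<sigma> *s b" "\<sigma> ~= 0"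
    "hinner (f2 z) b = \<alpha> * t * \<delta>" "hinner (ccross (f z) (f1 z)) (ccross (f z) (f1 z)) = \<alpha> * cnj \<alpha> * (t * cnj t)\<^sup>2 * of_real d"
proof -
  obtain t where t: "f z = t *s a" "t ~= 0" by (rule f_parallel[OF z l])
  have L: "A0 z *v u = a" "A z *v u = \<alpha> *s m + \<gamma> *s w" "A z *v m = \<delta> *s w" "A z *v w = 0" "A1 z *v m = e" "adj (A1 z) *v e = m"
    "hinner e e = 1" "hinner e a = 0" "hinner e b = 0" "hinner a b = 0" "hinner a a = of_real d" "a ~= 0" "b ~= 0" "\<alpha> ~= 0" "hinner w w = 1"
    using l by (auto simp: loop_frame_def outer_vec)
  obtain \<omega> \<omega>' where om: "A1 z *v w = \<omega> *s a" "adj (A1 z) *v a = \<omega>' *s w" using l by (auto simp: loop_frame_def)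
  \<comment> \<open>The vector \<open>u\<close> belongs to the frame at \<open>z\<close> and is kept
    constant while the base point varies.\<close>
  have "vwd (\<lambda>w. A0 w *v u) (- (A1 z ** A z) *v u + A0 z *v 0) (- (A0 z ** adj (A z)) *v u + A0 z *v 0) z"
    by (rule mwd_mult_vec[OF mwd_A0 vwd_const])
  from vwd_ccross[OF vwd_f[OF z] this]
  have "vwd (\<lambda>w. ccross (f w) (A0 w *v u)) (ccross (f1 z) a + ccross (f z) (- (A1 z *v (A z *v u))))
      (ccross (f z) (- (A0 z *v (adj (A z) *v u)))) z"
    by (simp add: L(1) matrix_minus_vec matrix_vector_mul_assoc)
  moreover have "vwd (\<lambda>w. ccross (f w) (A0 w *v u)) 0 0 z"
    by (rule vwd_transform[OF vwd_const[of 0] open_U z]) (simp add: f_lift)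
  ultimately have "ccross (f1 z) a + ccross (f z) (- (A1 z *v (A z *v u))) = 0" using vwd_unique by blast
  then have "ccross (f1 z) a = ccross (f z) (A1 z *v (A z *v u))" by (simp add: ccross_minus_right)
  then have c: "ccross (f1 z) a = (t * \<alpha>) *s ccross a e"
    by (simp add: L t vector_distribs vector_scalar_commute om ccross_simps vec.scale_scale)
  have "ccross a (f1 z + (\<alpha> * t) *s e) = 0"
    using c ccross_swap[of a "f1 z"] by (simp add: ccross_simps mult.commute)
  then obtain x where x: "f1 z + (\<alpha> * t) *s e = x *s a" using ccross_parallel L by blast
  then have f1: "f1 z = x *s a - (\<alpha> * t) *s e" by (simp add: eq_diff_eq)
  have cr: "ccross (f z) (f1 z) = (- (\<alpha> * t\<^sup>2)) *s ccross a e"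
    unfolding t(1) f1 by (simp add: ccross_simps power2_eq_square vec_eq_iff mult_ac)
  have ae: "hinner a e = 0" by (rule hinner_swap_zero[OF L(8)])
  have cc: "hinner (ccross a e) (ccross a e) = of_real d" by (simp add: ccross_lagrange L ae)
  have d0: "of_real d ~= (0 :: complex)" using L(11,12) by (metis hinner_self_zero)
  then have cn: "ccross a e ~= 0" using cc by auto
  have ba: "hinner b a = 0" "hinner b e = 0" using L(9,10) hinner_swap_zero by blast+
  obtain s where s: "b = s *s vcnj (ccross a e)" using orthogonal_ccross[OF ba cn] by blast
  have s0: "s ~= 0" using s L(13) by auto
  define \<sigma> where "\<sigma> = - cnj (\<alpha> * t\<^sup>2) / s"
  have 1: "vcnj (ccross (f z) (f1 z)) = \<sigma> *s b"
    using s0 unfolding cr vcnj_scale s by (simp add: \<sigma>_def vec.scale_scale)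
  have 2: "\<sigma> ~= 0" using s0 L(14) t by (simp add: \<sigma>_def)
  have e1: "adj (A2 z) *v f2 z = (\<alpha> * t * \<delta>) *s w"
    unfolding A2_f2[OF z] f1 by (simp add: vector_distribs vector_scalar_commute om L vec.scale_scale)
  have e2: "adj (A2 z) *v f2 z = hinner (f2 z) b *s w" using l by (simp add: loop_frame_def outer_vec)
  have "hinner (f2 z) b *s w = (\<alpha> * t * \<delta>) *s w" using e1 by (simp only: e2)
  then have "hinner (f2 z) b = \<alpha> * t * \<delta> \<or> w = 0" by simp
  then have 3: "hinner (f2 z) b = \<alpha> * t * \<delta>" using L(15) by auto
  have 4: "hinner (ccross (f z) (f1 z)) (ccross (f z) (f1 z)) = \<alpha> * cnj \<alpha> * (t * cnj t)\<^sup>2 * of_real d"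
    unfolding cr by (simp add: hinner_simps cc power2_eq_square mult_ac)
  show ?thesis by (rule that[OF t 1 2 3 4])
qed

text \<open>The Wronskian of the lift is, up to nonzero factors, the product of \<alpha> and
  \<delta>, both nonzero since \<open>A\<close> has rank two: the curve has no inflection
  points.\<close>

lemma unramified_lift: assumes z: "z \<in> U" shows "hinner (f2 z) (vcnj (ccross (f z) (f1 z))) ~= 0"
proof -
  obtain u m w a b e \<alpha> \<gamma> \<delta> \<nu> d where l: "loop_frame (A0 z) (A1 z) (A2 z) (A z) u m w a b e \<alpha> \<gamma> \<delta> \<nu> d"
    by (rule get_frame)
  obtain t \<sigma> where t: "t ~= 0" "vcnj (ccross (f z) (f1 z)) = \<sigma> *s b" "\<sigma> ~= 0" "hinner (f2 z) b = \<alpha> * t * \<delta>"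
    by (rule lift_frame[OF z l])
  moreover have "\<alpha> ~= 0" "\<delta> ~= 0" using l by (auto simp: loop_frame_def)
  ultimately show ?thesis by (simp add: hinner_simps)
qed

text \<open>The class of the extension of the bottom line bundle in the quotient by its first osculating bundle.\<close>

definition ext :: "complex => complex" where
  "ext z = hinner (A1 z *v (adj (A0 z) *v f z)) (vcnj (ccross (f z) (f1 z))) / trace (A0 z ** adj (A0 z))"

definition normF :: "complex => complex" where "normF z = hinner (f z) (f z)"
definition normG :: "complex => complex" where
  "normG z = hinner (ccross (f z) (f1 z)) (ccross (f z) (f1 z))"
definition pot :: "complex => complex" where "pot z = normF z * normG z + ext z * cnj (ext z)"

text \<open>The potential collapses to a single factor \<open>d\<close>: the product of the two
  norms contains d^2, the squared modulus of \<open>ext\<close> contains d^2 |\<nu>|^2 = d (1 - d),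
  and both share the remaining factor |t|^2 |\<sigma>|^2.\<close>

lemma lift_values:
  assumes z: "z \<in> U" and l: "loop_frame (A0 z) (A1 z) (A2 z) (A z) u m w a b e \<alpha> \<gamma> \<delta> \<nu> d"
    and t: "f z = t *s a" and s: "vcnj (ccross (f z) (f1 z)) = \<sigma> *s b"
  shows "trace (A0 z ** adj (A0 z)) = of_real d" "ext z = t * \<nu> * cnj \<sigma> * of_real d"
    "normF z = t * cnj t * of_real d" "normG z = \<sigma> * cnj \<sigma> * of_real d"
    "pot z = t * cnj t * \<sigma> * cnj \<sigma> * of_real d" "pot z * of_real d = normF z * normG z"
proof -
  have L: "hinner a a = of_real d" "hinner b b = of_real d" "hinner u u = 1" "A0 z = outer a u" "A1 z *v u = \<nu> *s b" "0 < d"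
    "(norm \<nu>)\<^sup>2 * d = 1 - d"
    using l by (auto simp: loop_frame_def)
  have dn: "complex_of_real d ~= 0" using L(6) by simp
  show D: "trace (A0 z ** adj (A0 z)) = of_real d"
    by (simp add: L matrix_mult_outer outer_vec trace_outer hinner_simps)
  have "adj (A0 z) *v f z = (t * of_real d) *s u" by (simp add: L t outer_vec hinner_simps)
  then have "A1 z *v (adj (A0 z) *v f z) = (t * of_real d * \<nu>) *s b"
    by (simp add: vector_scalar_commute L vec.scale_scale)
  then have "ext z = hinner ((t * of_real d * \<nu>) *s b) (\<sigma> *s b) / of_real d" unfolding ext_def D s by simp
  then show q: "ext z = t * \<nu> * cnj \<sigma> * of_real d"
    using dn by (simp add: hinner_simps L(2))
  show F: "normF z = t * cnj t * of_real d" by (simp add: normF_def t hinner_simps L)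
  have "normG z = hinner (vcnj (ccross (f z) (f1 z))) (vcnj (ccross (f z) (f1 z)))"
    by (simp add: normG_def hinner_vcnj)
  then show G: "normG z = \<sigma> * cnj \<sigma> * of_real d" by (simp add: s hinner_simps L)
  have n: "\<nu> * cnj \<nu> * of_real d = 1 - of_real d"
  proof -
    have "\<nu> * cnj \<nu> * of_real d = complex_of_real ((norm \<nu>)\<^sup>2 * d)" by (simp add: complex_norm_square[symmetric])
    then show ?thesis unfolding L by simp
  qed
  have "pot z = t * cnj t * \<sigma> * cnj \<sigma> * of_real d * (of_real d + \<nu> * cnj \<nu> * of_real d)"
    by (simp add: pot_def q F G algebra_simps)
  then show P: "pot z = t * cnj t * \<sigma> * cnj \<sigma> * of_real d" unfolding n by simp
  then show "pot z * of_real d = normF z * normG z" by (simp add: F G mult_ac)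
qed

text \<open>Conceptually, \<open>ext\<close> is the determinant of f, f' and the second component of
  a lift of f into the holomorphic bundle X; the ambiguity of that lift lies in the span of f and
  f'. The proof evaluates the quotient rule directly: the \<open>dzbar\<close> derivatives of
  numerator and denominator are both multiples of \<open>cnj \<gamma>\<close>, and they cancel
  because of \<open>cnj \<omega> = - \<nu>\<close>.\<close>

lemma ext_holomorphic: assumes z: "z \<in> U" shows "\<exists>q1. has_wd ext q1 0 z"
proof -
  obtain u m w a b e \<alpha> \<gamma> \<delta> \<nu> d where l: "loop_frame (A0 z) (A1 z) (A2 z) (A z) u m w a b e \<alpha> \<gamma> \<delta> \<nu> d"
    by (rule get_frame)
  obtain t \<sigma> where t: "f z = t *s a" "t ~= 0" "vcnj (ccross (f z) (f1 z)) = \<sigma> *s b" "\<sigma> ~= 0"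
    by (rule lift_frame[OF z l])
  have L: "hinner a a = of_real d" "hinner b b = of_real d" "hinner u u = 1" "A0 z = outer a u" "A1 z *v u = \<nu> *s b" "0 < d"
     "A z *v u = \<alpha> *s m + \<gamma> *s w" "hinner u m = 0" "hinner w m = 0" "hinner u w = 0" "hinner w w = 1" "A1 z *v m = e" "hinner e a = 0"
    using l by (auto simp: loop_frame_def)
  obtain \<omega> \<omega>' where om: "A1 z *v w = \<omega> *s a" "adj (A1 z) *v a = \<omega>' *s w" using l by (auto simp: loop_frame_def)
  have wu: "hinner w u = 0" by (rule hinner_swap_zero[OF L(10)])
  have dn: "complex_of_real d ~= 0" using L(6) by simp
  have B1a: "\<omega>' = - (\<nu> * of_real d)"
  proof -
    have "(adj (A1 z) ** A0 z + adj (A2 z) ** A1 z) *v u = 0" by (simp only: unitary_relations matrix_vector_mult_0)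
    then have "\<omega>' *s w + hinner (\<nu> *s b) b *s w = 0"
      using l by (simp add: loop_frame_def matrix_vector_mult_add_rdistrib matrix_vector_mul_assoc[symmetric] outer_vec om)
    then have "hinner (\<omega>' *s w + hinner (\<nu> *s b) b *s w) w = 0" by simp
    then show ?thesis by (simp add: hinner_simps L eq_neg_iff_add_eq_0)
  qed
  have om1: "\<omega> * of_real d = cnj \<omega>'"
  proof -
    have "hinner (A1 z *v w) a = hinner w (adj (A1 z) *v a)" by (rule hinner_matrix)
    then show ?thesis by (simp add: om hinner_simps L)
  qed
  have om2: "cnj \<omega> = - \<nu>"
  proof -
    have "cnj \<omega> * of_real d = - \<nu> * of_real d" using arg_cong[OF om1, of cnj] B1a by simp
    then show ?thesis using dn by (metis mult_right_cancel)
  qed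
  define R where "R = (\<lambda>z. A1 z ** adj (A0 z))"
  have dR: "mwd R (((A1 z - A2 z) ** A z) ** adj (A0 z) + A1 z ** adj (- (A0 z ** adj (A z))))
     (((A0 z - A1 z) ** adj (A z)) ** adj (A0 z) + A1 z ** adj (- (A1 z ** A z))) z" (is "mwd R ?Rz ?Rzb z")
    unfolding R_def by (rule mwd_mult[OF mwd_A1 mwd_ctranspose[OF mwd_A0]])
  have dv: "vwd (\<lambda>w. R w *v f w) (?Rz *v f z + R z *v f1 z) (?Rzb *v f z + R z *v 0) z"
    by (rule mwd_mult_vec[OF dR vwd_f[OF z]])
  have dk: "vwd (\<lambda>w. vcnj (ccross (f w) (f1 w))) (vcnj (ccross 0 (f1 z) + ccross (f z) 0)) (vcnj (ccross (f1 z) (f1 z) + ccross (f z) (f2 z))) z"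
    by (rule vwd_vcnj[OF vwd_ccross[OF vwd_f[OF z] vwd_f1[OF z]]])
  have "has_wd (\<lambda>w. hinner (R w *v f w) (vcnj (ccross (f w) (f1 w))))
    (hinner (?Rz *v f z + R z *v f1 z) (vcnj (ccross (f z) (f1 z))) + hinner (R z *v f z) (vcnj (ccross (f1 z) (f1 z) + ccross (f z) (f2 z))))
    (hinner (?Rzb *v f z + R z *v 0) (vcnj (ccross (f z) (f1 z))) + hinner (R z *v f z) (vcnj (ccross 0 (f1 z) + ccross (f z) 0))) z"
    by (rule has_wd_hinner[OF dv dk])
  moreover have "vcnj (0 :: complex^3) = 0" by simp
  ultimately have dN: "has_wd (\<lambda>w. hinner (R w *v f w) (vcnj (ccross (f w) (f1 w))))
    (hinner (?Rz *v f z + R z *v f1 z) (vcnj (ccross (f z) (f1 z))) + hinner (R z *v f z) (vcnj (ccross (f1 z) (f1 z) + ccross (f z) (f2 z))))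
    (hinner (?Rzb *v f z) (vcnj (ccross (f z) (f1 z)))) z" (is "has_wd ?N ?Nz ?Nzb z")
    by simp
  have dD: "has_wd (\<lambda>w. trace (A0 w ** adj (A0 w)))
     (trace (- (A1 z ** A z) ** adj (A0 z) + A0 z ** adj (- (A0 z ** adj (A z)))))
     (trace (- (A0 z ** adj (A z)) ** adj (A0 z) + A0 z ** adj (- (A1 z ** A z)))) z" (is "has_wd ?D ?Dz ?Dzb z")
    by (rule mwd_trace[OF mwd_mult[OF mwd_A0 mwd_ctranspose[OF mwd_A0]]])
  have Dz: "?D z = of_real d" by (rule lift_values[OF z l t(1,3)])
  have e: "ext = (\<lambda>w. ?N w / ?D w)" by (simp add: ext_def[abs_def] R_def matrix_vector_mul_assoc)
  have a0: "A0 z ** adj (A z) ** adj (A0 z) = 0"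
  proof -
    have "A0 z ** adj (A z) ** adj (A0 z) = A0 z ** adj (A0 z ** A z)"
      by (simp add: ctranspose_mult matrix_mul_assoc)
    then show ?thesis by (simp add: A0_A)
  qed
  have Dzb: "?Dzb = - (cnj \<gamma> * cnj \<omega> * of_real d)"
  proof -
    have "?Dzb = - trace (A0 z ** adj (A1 z ** A z))"
      using a0 by (simp add: matrix_minus_left matrix_minus_right ctranspose_minus trace_def sum_negf)
    also have "A0 z ** adj (A1 z ** A z) = outer a (A1 z *v (A z *v u))"
      by (simp add: L(4) outer_matrix_mult matrix_vector_mul_assoc)
    also have "trace (outer a (A1 z *v (A z *v u))) = cnj (hinner (A1 z *v (A z *v u)) a)"
      by (simp add: trace_outer hinner_cnj)
    also have "hinner (A1 z *v (A z *v u)) a = \<gamma> * \<omega> * of_real d"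
      by (simp add: L vector_distribs vector_scalar_commute om hinner_simps mult_ac)
    finally show ?thesis by simp
  qed
  have Nzb: "?Nzb = - (t * \<omega>' * cnj \<sigma> * \<nu> * of_real d * cnj \<gamma>)"
  proof -
    have 1: "A0 z *v (adj (A z) *v (adj (A0 z) *v f z)) = 0"
      using a0 by (simp add: matrix_vector_mul_assoc matrix_mul_assoc)
    have "?Rzb *v f z = A0 z *v (adj (A z) *v (adj (A0 z) *v f z)) - A1 z *v (adj (A z) *v (adj (A0 z) *v f z))
       - A1 z *v (adj (A z) *v (adj (A1 z) *v f z))"
      by (simp add: matrix_distribs ctranspose_minus ctranspose_mult vector_distribs matrix_vector_mul_assoc[symmetric])
    then have nz1: "?Nzb = - hinner (A1 z *v (adj (A z) *v (adj (A0 z) *v f z))) (\<sigma> *s b)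
        - hinner (A1 z *v (adj (A z) *v (adj (A1 z) *v f z))) (\<sigma> *s b)"
      by (simp only: 1 t(3) hinner_diff_left) simp
    have B1b: "adj (A1 z) *v b = (cnj \<nu> * of_real d) *s u"
    proof -
      have bb: "(adj (A0 z) ** A1 z + adj (A1 z) ** A2 z) *v w = 0" by (simp only: unitary_relations matrix_vector_mult_0)
      then have "hinner (\<omega> *s a) a *s u + adj (A1 z) *v b = 0"
        using l by (simp add: loop_frame_def matrix_vector_mult_add_rdistrib matrix_vector_mul_assoc[symmetric] outer_vec om)
      then have "adj (A1 z) *v b = (- (\<omega> * of_real d)) *s u"
        by (simp add: hinner_simps L eq_neg_iff_add_eq_0 add.commute)
      moreover have "- \<omega> = cnj \<nu>" using arg_cong[OF om2, of cnj] by simp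
      ultimately show ?thesis by (metis mult_minus_left)
    qed
    have h: "hinner (A1 z *v (adj (A z) *v v)) (\<sigma> *s b) = cnj \<sigma> * \<nu> * of_real d * hinner v (\<alpha> *s m + \<gamma> *s w)" for v
    proof -
      have "hinner (A1 z *v (adj (A z) *v v)) (\<sigma> *s b) = cnj \<sigma> * hinner (adj (A z) *v v) (adj (A1 z) *v b)"
        by (simp add: hinner_simps hinner_matrix)
      also have "\<dots> = cnj \<sigma> * \<nu> * of_real d * hinner (adj (A z) *v v) u"
        unfolding B1b by (simp add: hinner_simps mult_ac)
      also have "hinner (adj (A z) *v v) u = hinner v (\<alpha> *s m + \<gamma> *s w)" by (simp add: hinner_matrix L)
      finally show ?thesis .
    qed
    have f0: "adj (A0 z) *v f z = (t * of_real d) *s u" by (simp add: L t outer_vec hinner_simps)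
    have f1: "adj (A1 z) *v f z = (t * \<omega>') *s w" by (simp add: t vector_scalar_commute om vec.scale_scale)
    show ?thesis unfolding nz1 f0 f1 h by (simp add: hinner_simps L wu mult_ac)
  qed
  have "?N z = ext z * of_real d" using dn by (simp add: e Dz)
  also have "ext z = t * \<nu> * cnj \<sigma> * of_real d" by (rule lift_values[OF z l t(1,3)])
  finally have Nz: "?N z = t * \<nu> * cnj \<sigma> * of_real d * of_real d" .
  have "?Nzb * ?D z - ?N z * ?Dzb = 0"
    unfolding Nzb Nz Dz Dzb B1a om2 by (simp add: algebra_simps)
  moreover have "has_wd ext ((?Nz * ?D z - ?N z * ?Dz) / (?D z)\<^sup>2) ((?Nzb * ?D z - ?N z * ?Dzb) / (?D z)\<^sup>2) z"
    unfolding e by (rule has_wd_divide[OF dN dD]) (use Dz L(6) in simp)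
  ultimately show ?thesis by auto
qed

text \<open>In a frame the matrix is \<nu> times \<open>outer b a\<close>. Rewriting it by f, its
  derivative and \<open>ext\<close> gives an expression that holds on all of \<open>U\<close>, so
  that it can be differentiated to obtain \<gamma>. It also shows that \<open>ext = 0\<close> is the
  same as \<open>A1 ** adj A0 = 0\<close>.\<close>

lemma A1_A0_adjoint:
  assumes z: "z \<in> U"
  shows "A1 z ** adj (A0 z) = smul (ext z / pot z) (outer (vcnj (ccross (f z) (f1 z))) (f z))" "pot z ~= 0"
    "normF z ~= 0" "normG z ~= 0"
proof -
  obtain u m w a b e \<alpha> \<gamma> \<delta> \<nu> d where l: "loop_frame (A0 z) (A1 z) (A2 z) (A z) u m w a b e \<alpha> \<gamma> \<delta> \<nu> d"
    by (rule get_frame)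
  obtain t \<sigma> where t: "f z = t *s a" "t ~= 0" "vcnj (ccross (f z) (f1 z)) = \<sigma> *s b" "\<sigma> ~= 0"
    by (rule lift_frame[OF z l])
  note v = lift_values[OF z l t(1,3)]
  have L: "A0 z = outer a u" "A1 z *v u = \<nu> *s b" "0 < d" using l by (auto simp: loop_frame_def)
  show "pot z ~= 0" "normF z ~= 0" "normG z ~= 0" unfolding v using t L by simp_all
  have "A1 z ** adj (A0 z) = smul \<nu> (outer b a)"
    by (simp add: L matrix_mult_outer vec_eq_iff)
  moreover have "ext z / pot z * (\<sigma> * cnj t) = \<nu>" unfolding v using t L by (simp add: field_simps)
  ultimately show "A1 z ** adj (A0 z) = smul (ext z / pot z) (outer (vcnj (ccross (f z) (f1 z))) (f z))"
    unfolding t(3) unfolding t(1) outer_scale_both smul_smul by simp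
qed

text \<open>The trace is |\<alpha>|^2 + |\<gamma>|^2 + |\<delta>|^2. The outer two entries come from
  the norms of f, f x f' and the Wronskian; \<gamma> comes from the \<open>dz\<close> derivative of
  \<open>A1 ** adj A0\<close>. The sum is matched with \<open>curvature_identity\<close>, so that
  the energy density becomes dz dzbar ln of \<open>pot\<close>.\<close>

lemma energy_identity:
  assumes z: "z \<in> U" and q: "has_wd ext q1 0 z"
  defines "k1 \<equiv> ccross (f z) (f2 z)" and "k \<equiv> ccross (f z) (f1 z)"
  defines "Bz \<equiv> hinner (f1 z) (f z) * normG z + normF z * hinner k1 k"
    and "Bzb \<equiv> hinner (f z) (f1 z) * normG z + normF z * hinner k k1"
  shows "has_wd pot (Bz + q1 * cnj (ext z)) (Bzb + ext z * cnj q1) z"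
    "trace (A z ** adj (A z)) * (pot z)\<^sup>2 =
      pot z * ((hinner (f1 z) (f1 z) * normG z + hinner (f1 z) (f z) * hinner k k1 + hinner (f z) (f1 z) * hinner k1 k
        + normF z * hinner k1 k1) + q1 * cnj q1) - (Bz + q1 * cnj (ext z)) * (Bzb + ext z * cnj q1)"
proof -
  obtain u m w a b e \<alpha> \<gamma> \<delta> \<nu> d where l: "loop_frame (A0 z) (A1 z) (A2 z) (A z) u m w a b e \<alpha> \<gamma> \<delta> \<nu> d"
    by (rule get_frame)
  obtain t \<sigma> where t: "f z = t *s a" "t ~= 0" "vcnj (ccross (f z) (f1 z)) = \<sigma> *s b" "\<sigma> ~= 0"
    "hinner (f2 z) b = \<alpha> * t * \<delta>"
    "hinner (ccross (f z) (f1 z)) (ccross (f z) (f1 z)) = \<alpha> * cnj \<alpha> * (t * cnj t)\<^sup>2 * of_real d"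
    by (rule lift_frame[OF z l])
  note v = lift_values[OF z l t(1,3)]
  have L: "A0 z = outer a u" "A2 z = outer b w" "A z = outer (\<alpha> *s m + \<gamma> *s w) u + outer (\<delta> *s w) m"
    "A z *v u = \<alpha> *s m + \<gamma> *s w" "hinner u u = 1" "hinner m m = 1" "hinner w w = 1" "hinner u m = 0" "hinner w m = 0" "hinner u w = 0"
    "a ~= 0" "b ~= 0" "0 < d"
    using l by (auto simp: loop_frame_def)
  have o: "hinner m u = 0" "hinner m w = 0" "hinner w u = 0" using L hinner_swap_zero by blast+
  have dn: "complex_of_real d ~= 0" using L by simp
  have nz: "pot z ~= 0" "normF z ~= 0" "normG z ~= 0" by (rule A1_A0_adjoint[OF z])+
  have dk: "vwd (\<lambda>w. ccross (f w) (f1 w)) k1 0 z"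
    using vwd_ccross[OF vwd_f[OF z] vwd_f1[OF z]] by (simp add: k1_def)
  have dF: "has_wd normF (hinner (f1 z) (f z)) (hinner (f z) (f1 z)) z"
    using has_wd_hinner[OF vwd_f[OF z] vwd_f[OF z]] by (simp add: normF_def[abs_def])
  have dG: "has_wd normG (hinner k1 k) (hinner k k1) z"
    using has_wd_hinner[OF dk dk] by (simp add: normG_def[abs_def] k_def)
  have "has_wd pot ((hinner (f1 z) (f z) * normG z + normF z * hinner k1 k) + (q1 * cnj (ext z) + ext z * cnj 0))
     ((hinner (f z) (f1 z) * normG z + normF z * hinner k k1) + (0 * cnj (ext z) + ext z * cnj q1)) z"
    unfolding pot_def[abs_def] by (rule has_wd_add[OF has_wd_mult[OF dF dG] has_wd_mult[OF q has_wd_cnj[OF q]]])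
  then show dP: "has_wd pot (Bz + q1 * cnj (ext z)) (Bzb + ext z * cnj q1) z" by (simp add: Bz_def Bzb_def)
  define n where "n = (\<lambda>w. vcnj (ccross (f w) (f1 w)))"
  have dn1: "vwd n 0 (vcnj k1) z" using vwd_vcnj[OF dk] by (simp add: n_def[abs_def])
  define P1 where "P1 = Bz + q1 * cnj (ext z)"
  have dS: "has_wd (\<lambda>w. ext w / pot w) ((q1 * pot z - ext z * P1) / (pot z)\<^sup>2) ((0 * pot z - ext z * (Bzb + ext z * cnj q1)) / (pot z)\<^sup>2) z"
    unfolding P1_def by (rule has_wd_divide[OF q dP nz(1)])
  have "has_wd (\<lambda>w. smul (ext w / pot w) (outer (n w) (f w)) $ i $ j)
      ((q1 * pot z - ext z * P1) / (pot z)\<^sup>2 * outer (n z) (f z) $ i $ j)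
      (dzbar (\<lambda>w. smul (ext w / pot w) (outer (n w) (f w)) $ i $ j) z) z" for i j
  proof -
    have "has_wd (\<lambda>w. ext w / pot w * (n w $ i * cnj (f w $ j)))
       ((q1 * pot z - ext z * P1) / (pot z)\<^sup>2 * (n z $ i * cnj (f z $ j)) + ext z / pot z * (0 $ i * cnj (f z $ j) + n z $ i * cnj (0 $ j)))
       ((0 * pot z - ext z * (Bzb + ext z * cnj q1)) / (pot z)\<^sup>2 * (n z $ i * cnj (f z $ j))
          + ext z / pot z * (vcnj k1 $ i * cnj (f z $ j) + n z $ i * cnj (f1 z $ j))) z"
      by (rule has_wd_mult[OF dS has_wd_mult[OF has_wd_vwd_nth[OF dn1] has_wd_cnj[OF has_wd_vwd_nth[OF vwd_f[OF z]]]]])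
    then have h: "has_wd (\<lambda>w. smul (ext w / pot w) (outer (n w) (f w)) $ i $ j)
       ((q1 * pot z - ext z * P1) / (pot z)\<^sup>2 * outer (n z) (f z) $ i $ j)
       ((0 * pot z - ext z * (Bzb + ext z * cnj q1)) / (pot z)\<^sup>2 * (n z $ i * cnj (f z $ j))
          + ext z / pot z * (vcnj k1 $ i * cnj (f z $ j) + n z $ i * cnj (f1 z $ j))) z"
      by simp
    then show ?thesis using has_wd_dzbar[OF h] by simp
  qed
  then have "mwd (\<lambda>w. smul (ext w / pot w) (outer (n w) (f w))) (smul ((q1 * pot z - ext z * P1) / (pot z)\<^sup>2) (outer (n z) (f z)))
     (dzbar_mat (\<lambda>w. smul (ext w / pot w) (outer (n w) (f w))) z) z"
    unfolding mwd_def dzbar_mat_def by simp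
  then have "mwd (\<lambda>w. A1 w ** adj (A0 w)) (smul ((q1 * pot z - ext z * P1) / (pot z)\<^sup>2) (outer (n z) (f z)))
     (dzbar_mat (\<lambda>w. smul (ext w / pot w) (outer (n w) (f w))) z) z"
    by (rule mwd_transform[OF _ open_U z]) (simp add: A1_A0_adjoint n_def)
  moreover have "mwd (\<lambda>w. A1 w ** adj (A0 w)) (((A1 z - A2 z) ** A z) ** adj (A0 z) + A1 z ** adj (- (A0 z ** adj (A z))))
     (((A0 z - A1 z) ** adj (A z)) ** adj (A0 z) + A1 z ** adj (- (A1 z ** A z))) z"
    by (rule mwd_mult[OF mwd_A1 mwd_ctranspose[OF mwd_A0]])
  \<comment> \<open>The two computations of the derivative of \<open>A1 ** adj A0\<close> are
    compared. On the matrix side the terms with \<open>A1 ** A\<close> cancel, and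
    \<open>- (A2 ** A ** adj A0)\<close> picks out the entry \<gamma>.\<close>
  ultimately have "smul ((q1 * pot z - ext z * P1) / (pot z)\<^sup>2) (outer (n z) (f z)) =
      ((A1 z - A2 z) ** A z) ** adj (A0 z) + A1 z ** adj (- (A0 z ** adj (A z)))"
    using mwd_unique by blast
  also have "\<dots> = - (A2 z ** A z ** adj (A0 z))"
    by (simp add: matrix_distribs ctranspose_minus ctranspose_mult matrix_mul_assoc)
  also have "\<dots> = smul (- \<gamma>) (outer b a)"
  proof -
    have "(A2 z ** A z) *v u = \<gamma> *s b"
      unfolding matrix_vector_mul_assoc[symmetric] L(4) unfolding L(2) outer_vec by (simp add: hinner_simps L(7) o)
    then show ?thesis by (simp add: L(1) matrix_mult_outer vec_eq_iff)
  qed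
  finally have "smul ((q1 * pot z - ext z * P1) / (pot z)\<^sup>2 * (\<sigma> * cnj t)) (outer b a) = smul (- \<gamma>) (outer b a)"
    unfolding n_def t(3) unfolding t(1) outer_scale_both smul_smul .
  then have "smul ((q1 * pot z - ext z * P1) / (pot z)\<^sup>2 * (\<sigma> * cnj t)) (outer b a) *v a = smul (- \<gamma>) (outer b a) *v a" by simp
  then have "((q1 * pot z - ext z * P1) / (pot z)\<^sup>2 * (\<sigma> * cnj t) * hinner a a) *s b = (- \<gamma> * hinner a a) *s b"
    by (simp add: smul_vec outer_vec vec.scale_scale)
  then have gam: "(q1 * pot z - ext z * P1) / (pot z)\<^sup>2 * (\<sigma> * cnj t) = - \<gamma>"
  proof -
    assume "((q1 * pot z - ext z * P1) / (pot z)\<^sup>2 * (\<sigma> * cnj t) * hinner a a) *s b = (- \<gamma> * hinner a a) *s b"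
    then have "(q1 * pot z - ext z * P1) / (pot z)\<^sup>2 * (\<sigma> * cnj t) * hinner a a = - \<gamma> * hinner a a"
      using L(12) by (simp only: vec.scale_cancel_right) simp
    moreover have "hinner a a ~= 0" using L(11) by simp
    ultimately show ?thesis by (rule mult_right_cancel[THEN iffD1, rotated])
  qed
  define B where "B = normF z * normG z"
  have Pe: "pot z = B + ext z * cnj (ext z)" by (simp add: pot_def B_def)
  \<comment> \<open>The contribution of |q|^2 to the derivative of the potential cancels, so that
    only the product \<open>B\<close> of the two norms is differentiated here.\<close>
  have qq: "q1 * pot z - ext z * P1 = q1 * B - ext z * Bz"
    unfolding Pe P1_def by (simp add: algebra_simps)
  define X where "X = (q1 * B - ext z * Bz)"
  define Xb where "Xb = (cnj q1 * B - cnj (ext z) * Bzb)"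
  have cB: "cnj B = B" "cnj Bz = Bzb"
    by (simp_all add: B_def Bz_def Bzb_def normF_def normG_def hinner_cnj)
  have cX: "cnj X = Xb" by (simp add: X_def Xb_def cB)
  have cpot: "cnj (pot z) = pot z" by (simp add: Pe cB mult.commute)
  have gg: "\<gamma> * cnj \<gamma> * (pot z)\<^sup>2 = X * Xb / B"
  proof -
    have "\<gamma> = - (X / (pot z)\<^sup>2 * (\<sigma> * cnj t))" using gam unfolding qq X_def by simp
    then have g1: "\<gamma> * cnj \<gamma> = (X * Xb) * (\<sigma> * cnj \<sigma> * (t * cnj t)) / ((pot z)\<^sup>2 * (pot z)\<^sup>2)"
      by (simp add: cX cpot mult_ac)
    have g2: "\<sigma> * cnj \<sigma> * (t * cnj t) * B = (pot z)\<^sup>2"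
      by (simp add: B_def v(3,4) v(5) power2_eq_square mult_ac)
    have B0: "B ~= 0" using nz by (simp add: B_def)
    have p0: "(pot z)\<^sup>2 ~= 0" using nz(1) by simp
    have cancel: "x = (c :: complex) / B" if "y = c * s / (p * p)" "s * B = p" "p ~= 0" "x = y * p" for x y c s p
    proof -
      have "x = c * s / p" unfolding that(4,1) using that(3) by simp
      also have "\<dots> = c * (s * B) / (p * B)" using B0 by simp
      finally show ?thesis unfolding that(2) using that(3) by simp
    qed
    show ?thesis by (rule cancel[OF g1 g2 p0 refl])
  qed
  have G': "normG z = \<alpha> * cnj \<alpha> * (t * cnj t)\<^sup>2 * of_real d" using t(6) by (simp add: normG_def)
  have aa: "\<alpha> * cnj \<alpha> * (pot z)\<^sup>2 = pot z * (normG z)\<^sup>2 / normF z"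
  proof -
    have "normF z * (\<alpha> * cnj \<alpha>) * pot z = (\<alpha> * cnj \<alpha> * (t * cnj t)\<^sup>2 * of_real d) * (\<sigma> * cnj \<sigma> * of_real d)"
      by (simp add: v power2_eq_square mult_ac)
    also have "\<dots> = (normG z)\<^sup>2" unfolding G'[symmetric] v(4)[symmetric] by (simp add: power2_eq_square)
    finally show ?thesis using nz by (simp add: field_simps power2_eq_square)
  qed
  \<comment> \<open>The squared modulus of the Wronskian of \<open>f\<close>, the factor
    \<open>k\<close> of \<open>curvature_identity\<close>.\<close>
  define \<kappa> where "\<kappa> = hinner (f2 z) (vcnj k) * cnj (hinner (f2 z) (vcnj k))"
  have kap: "\<kappa> = \<sigma> * cnj \<sigma> * (\<alpha> * cnj \<alpha>) * (t * cnj t) * (\<delta> * cnj \<delta>)"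
    unfolding \<kappa>_def k_def t(3) hinner_simps t(5) by (simp add: mult_ac)
  have dd: "\<delta> * cnj \<delta> * (pot z)\<^sup>2 = pot z * \<kappa> * (normF z)\<^sup>2 / normG z"
  proof -
    have "normG z * (\<delta> * cnj \<delta>) * pot z = \<kappa> * (normF z)\<^sup>2"
      unfolding kap G' v(3) v(5) by (simp add: power2_eq_square mult_ac)
    then show ?thesis using nz by (simp add: field_simps power2_eq_square)
  qed
  have tr: "trace (A z ** adj (A z)) = \<alpha> * cnj \<alpha> + \<gamma> * cnj \<gamma> + \<delta> * cnj \<delta>"
  proof -
    have "A z ** adj (A z) = outer (\<alpha> *s m + \<gamma> *s w) (\<alpha> *s m + \<gamma> *s w) + outer (\<delta> *s w) (\<delta> *s w)"
      unfolding L(3) ctranspose_add ctranspose_outer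
      by (simp add: matrix_distribs matrix_mult_outer matrix_vector_mult_add_rdistrib outer_vec L o)
    then show ?thesis by (simp add: trace_add trace_outer hinner_simps L o mult_ac)
  qed
  \<comment> \<open>Lagrange's identity for f and f'. The next relation is the same identity for f x
    f' and f x f'', whose cross product is the Wronskian times f.\<close>
  have I1: "normF z * hinner (f1 z) (f1 z) = normG z + hinner (f1 z) (f z) * hinner (f z) (f1 z)"
    unfolding normF_def normG_def ccross_lagrange by simp
  have I2: "normG z * hinner k1 k1 = \<kappa> * normF z + hinner k1 k * hinner k k1"
  proof -
    have "ccross k k1 = hinner (f2 z) (vcnj k) *s f z"
      unfolding k_def k1_def vec3_eq_iff hinner_3 vector_smult_component ccross_nth vcnj_nth complex_cnj_cnj by algebra
    then have "hinner (ccross k k1) (ccross k k1) = \<kappa> * normF z" by (simp add: hinner_simps \<kappa>_def normF_def mult_ac)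
    then show ?thesis unfolding ccross_lagrange by (simp add: normG_def k_def algebra_simps)
  qed
  have "trace (A z ** adj (A z)) * (pot z)\<^sup>2 = pot z * (normG z)\<^sup>2 / normF z + pot z * \<kappa> * (normF z)\<^sup>2 / normG z + X * Xb / B"
    unfolding tr distrib_right aa gg dd by simp
  also have "\<dots> = pot z * ((hinner (f1 z) (f1 z) * normG z + hinner (f1 z) (f z) * hinner k k1 + hinner (f z) (f1 z) * hinner k1 k
        + normF z * hinner k1 k1) + q1 * cnj q1) - (Bz + q1 * cnj (ext z)) * (Bzb + ext z * cnj q1)"
    unfolding X_def Xb_def B_def Bz_def Bzb_def
    by (rule curvature_identity[OF I1 I2 nz(2,3)]) (simp add: pot_def)
  finally show "trace (A z ** adj (A z)) * (pot z)\<^sup>2 = pot z * ((hinner (f1 z) (f1 z) * normG z + hinner (f1 z) (f z) * hinner k k1 + hinner (f z) (f1 z) * hinner k1 k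
        + normF z * hinner k1 k1) + q1 * cnj q1) - (Bz + q1 * cnj (ext z)) * (Bzb + ext z * cnj q1)" .
qed

end

section \<open>A global polynomial lift and its degree\<close>

section \<open>The bottom line bundle is a rational normal curve\<close>

text \<open>\<Phi> has been normalized by one coordinate and may have poles in \<open>Z\<close>.
  Near such a point a nonvanishing local lift is \<Phi> times a power of \<open>z - z0\<close> and a
  unit, so multiplying by the polynomial with exactly these orders gives an entire curve without
  zeros.\<close>

lemma holomorphic_patch:
  fixes \<Phi> :: "complex => complex^3"
  assumes Z: "finite Z"
    and hol: "!!k. (\<lambda>z. \<Phi> z $ k) holomorphic_on - Z" and nz: "!!z. z \<notin> Z ==> \<Phi> z ~= 0"
    and loc: "!!z0. z0 \<in> Z ==> \<exists>e>0. \<exists>\<phi> h (n::nat). (\<forall>k. (\<lambda>z. \<phi> z $ k) holomorphic_on ball z0 e) \<and> \<phi> z0 ~= 0 \<and>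
      h holomorphic_on ball z0 e \<and> (\<forall>z\<in>ball z0 e. h z ~= 0) \<and>
      (\<forall>z\<in>ball z0 e - {z0}. z \<notin> Z \<and> \<phi> z = ((z - z0) ^ n * h z) *s \<Phi> z)"
  obtains n :: "complex => nat" and g :: "complex => complex^3" where "!!k. (\<lambda>z. g z $ k) holomorphic_on UNIV"
    "!!z. g z ~= 0" "!!z. z \<notin> Z ==> g z = (\<Prod>z0\<in>Z. (z - z0) ^ n z0) *s \<Phi> z"
proof -
  from loc have "\<forall>z0. \<exists>e \<phi> h n. z0 \<in> Z --> e > 0 \<and> (\<forall>k. (\<lambda>z. \<phi> z $ k) holomorphic_on ball z0 e) \<and> \<phi> z0 ~= 0 \<and>
      h holomorphic_on ball z0 e \<and> (\<forall>z\<in>ball z0 e. h z ~= 0) \<and>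
      (\<forall>z\<in>ball z0 e - {z0}. z \<notin> Z \<and> \<phi> z = ((z - z0) ^ n * h z) *s \<Phi> z)" by blast
  then obtain e \<phi> h and n :: "complex => nat" where L: "!!z0. z0 \<in> Z ==> e z0 > 0 \<and> (\<forall>k. (\<lambda>z. \<phi> z0 z $ k) holomorphic_on ball z0 (e z0)) \<and> \<phi> z0 z0 ~= 0 \<and>
      h z0 holomorphic_on ball z0 (e z0) \<and> (\<forall>z\<in>ball z0 (e z0). h z0 z ~= 0) \<and>
      (\<forall>z\<in>ball z0 (e z0) - {z0}. z \<notin> Z \<and> \<phi> z0 z = ((z - z0) ^ n z0 * h z0 z) *s \<Phi> z)" by metis
  define p where "p = (\<lambda>z. \<Prod>z0\<in>Z. (z - z0) ^ n z0)"
  define r where "r = (\<lambda>z1 z. \<Prod>z0\<in>Z - {z1}. (z - z0) ^ n z0)"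
  have pr: "p z = (z - z1) ^ n z1 * r z1 z" if "z1 \<in> Z" for z z1
    unfolding p_def r_def using Z that by (simp add: prod.remove)
  have holr: "r z1 holomorphic_on S" for z1 S unfolding r_def by (intro holomorphic_intros)
  \<comment> \<open>At a point of \<open>Z\<close> the value is taken from the local lift, with the
    other factors of the polynomial and the unit \<open>h\<close> accounted for; \<open>gl\<close>
    shows that this agrees with the formula nearby.\<close>
  define g where "g = (\<lambda>z. if z \<in> Z then (r z z / h z z) *s \<phi> z z else p z *s \<Phi> z)"
  have gl: "g z = (r z1 z / h z1 z) *s \<phi> z1 z" if z1: "z1 \<in> Z" and z: "z \<in> ball z1 (e z1)" for z z1
  proof (cases "z = z1")
    case True
    then show ?thesis using z1 by (simp add: g_def)
  next
    case False
    then have "z \<notin> Z" "\<phi> z1 z = ((z - z1) ^ n z1 * h z1 z) *s \<Phi> z" "h z1 z ~= 0" using L[OF z1] z by auto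
    then show ?thesis by (simp add: g_def pr[OF z1] vec.scale_scale mult_ac)
  qed
  have "(\<lambda>z. g z $ k) holomorphic_on UNIV" for k
  proof -
    have o: "open (- Z)" using Z by (simp add: finite_imp_closed open_Compl)
    have "p holomorphic_on - Z" unfolding p_def by (intro holomorphic_intros)
    then have "(\<lambda>z. p z * \<Phi> z $ k) holomorphic_on - Z" by (intro holomorphic_on_mult hol)
    then have 1: "(\<lambda>z. g z $ k) holomorphic_on - Z" by (rule holomorphic_transform) (simp add: g_def)
    have 2: "(\<lambda>z. g z $ k) holomorphic_on ball z1 (e z1)" if "z1 \<in> Z" for z1
    proof -
      have "(\<lambda>z. r z1 z / h z1 z * \<phi> z1 z $ k) holomorphic_on ball z1 (e z1)"
        using L[OF that] by (intro holomorphic_on_mult holomorphic_on_divide holr) auto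
      then show ?thesis by (rule holomorphic_transform) (simp add: gl[OF that])
    qed
    have "(\<lambda>z. g z $ k) field_differentiable at z" for z
    proof (cases "z \<in> Z")
      case True
      then show ?thesis using 2[OF True] L[OF True] holomorphic_on_imp_differentiable_at[of _ "ball z (e z)" z] by simp
    next
      case False
      then show ?thesis using 1 o holomorphic_on_imp_differentiable_at[of _ "- Z" z] by simp
    qed
    then show ?thesis by (simp add: holomorphic_on_def field_differentiable_at_within)
  qed
  moreover have "g z ~= 0" for z
  proof (cases "z \<in> Z")
    case True
    then have "r z z ~= 0" "h z z ~= 0" "\<phi> z z ~= 0" using L[OF True] Z by (auto simp: r_def)
    then show ?thesis using True by (simp add: g_def)
  next
    case False
    then have "p z ~= 0" using Z by (auto simp: p_def)
    then show ?thesis using False nz by (simp add: g_def)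
  qed
  moreover have "g z = (\<Prod>z0\<in>Z. (z - z0) ^ n z0) *s \<Phi> z" if "z \<notin> Z" for z
    using that by (simp add: g_def p_def)
  ultimately show ?thesis by (rule that)
qed

lemma finite_compact_isolated:
  fixes Z :: "complex set"
  assumes "compact Z" "!!z0. z0 \<in> Z ==> \<exists>e>0. \<forall>z\<in>ball z0 e - {z0}. z \<notin> Z"
  shows "finite Z"
proof (rule ccontr)
  assume "infinite Z"
  then obtain x where x: "x \<in> Z" "x islimpt Z" using assms(1) unfolding compact_eq_Bolzano_Weierstrass by blast
  obtain e where e: "e > 0" "\<forall>z\<in>ball x e - {x}. z \<notin> Z" using assms(2)[OF x(1)] by blast
  then show False using x(2) unfolding islimpt_approachable by (metis Diff_iff dist_commute mem_ball singletonD)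
qed

lemma ccross_common:
  assumes "ccross p v = 0" "ccross q v = 0" "v ~= 0" "p $ i = q $ i" "q $ i ~= 0" shows "p = q"
proof -
  have "ccross v p = 0" "ccross v q = 0" using assms(1,2) ccross_swap[of v] by simp_all
  then obtain s t where st: "p = s *s v" "q = t *s v" using ccross_parallel assms(3) by metis
  then have "s = t" using assms(4,5) by auto
  then show ?thesis using st by simp
qed

context framed_chart
begin

lemma frame_outer: obtains a u where "A0 z = outer a u" "a ~= 0" "hinner u u = 1"
proof -
  obtain u m w a b e \<alpha> \<gamma> \<delta> \<nu> d where "loop_frame (A0 z) (A1 z) (A2 z) (A z) u m w a b e \<alpha> \<gamma> \<delta> \<nu> d"
    by (rule get_frame)
  then show ?thesis by (intro that[of a u]) (auto simp: loop_frame_def)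
qed

text \<open>The columns of \<open>A0\<close> satisfy \<open>dzbar A0 = - A0 A\<^sup>*\<close>, so ratios of entries of one column are holomorphic.\<close>

lemma column_ratio:
  assumes "A0 z $ i $ j ~= 0"
  shows "\<exists>a. has_wd (\<lambda>w. A0 w $ k $ j / A0 w $ i $ j) a 0 z"
proof -
  obtain a u where au: "A0 z = outer a u" by (rule frame_outer)
  have d: "has_wd (\<lambda>w. A0 w $ k $ j) (- (A1 z ** A z) $ k $ j) (- (A0 z ** adj (A z)) $ k $ j) z" for k
    using mwd_A0[of z] by (simp add: mwd_def)
  have c: "(A0 z ** adj (A z)) $ k $ j = a $ k * cnj ((A z *v u) $ j)" for k
    by (simp add: au outer_matrix_mult)
  have "- (A0 z ** adj (A z)) $ k $ j * A0 z $ i $ j - A0 z $ k $ j * (- (A0 z ** adj (A z)) $ i $ j) = 0"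
    unfolding c by (simp add: c au)
  then show ?thesis using has_wd_divide[OF d d assms, of k] by auto
qed

text \<open>A column of \<open>A0\<close> divided by one of its entries that is nonzero at
  \<open>z0\<close>. The entries are not holomorphic, but their ratios are, and the rank one of
  \<open>A0\<close> makes the column span its range.\<close>

lemma local_lift:
  obtains e \<phi> where "e > 0" "!!k. (\<lambda>z. \<phi> z $ k) holomorphic_on ball z0 e" "!!z. z \<in> ball z0 e ==> \<phi> z ~= 0"
    "!!z x. z \<in> ball z0 e ==> ccross (\<phi> z) (A0 z *v x) = 0"
proof -
  obtain a u where "A0 z0 = outer a u" "a ~= 0" "hinner u u = 1" by (rule frame_outer)
  then have "A0 z0 *v u ~= 0" by (simp add: outer_vec)
  then have "A0 z0 ~= 0" by auto
  then obtain i j where ij: "A0 z0 $ i $ j ~= 0" by (auto simp: vec_eq_iff)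
  have "open {z. A0 z $ i $ j ~= 0}"
    by (intro open_Collect_neq continuous_on_component continuous_coefficients continuous_on_const)
  then obtain e where e: "e > 0" "ball z0 e \<subseteq> {z. A0 z $ i $ j ~= 0}" using ij open_contains_ball by blast
  define \<phi> where "\<phi> = (\<lambda>z. \<chi> k. A0 z $ k $ j / A0 z $ i $ j)"
  show ?thesis
  proof (rule that[OF e(1), of \<phi>])
    show "(\<lambda>z. \<phi> z $ k) holomorphic_on ball z0 e" for k
      unfolding holomorphic_on_open[OF open_ball]
    proof
      fix z assume "z \<in> ball z0 e"
      then have "A0 z $ i $ j ~= 0" using e by auto
      from column_ratio[OF this, of k] show "\<exists>f'. ((\<lambda>z. \<phi> z $ k) has_field_derivative f') (at z)"
        by (simp add: \<phi>_def has_wd_field_derivative)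
    qed
    fix z assume z: "z \<in> ball z0 e"
    then have nz: "A0 z $ i $ j ~= 0" using e by auto
    then have "\<phi> z $ i = 1" by (simp add: \<phi>_def)
    then show "\<phi> z ~= 0" by auto
    fix x
    obtain a u where au: "A0 z = outer a u" by (rule frame_outer)
    have "\<phi> z = (1 / a $ i) *s a" using nz by (simp add: \<phi>_def au vec_eq_iff)
    then show "ccross (\<phi> z) (A0 z *v x) = 0" by (simp add: au outer_vec ccross_scale_same)
  qed
qed

end

context uniton_two
begin

lemma rank_witness: "c \<in> charts ==> \<exists>x y. ccross (A_z \<psi> c z *v x) (A_z \<psi> c z *v y) ~= 0"
  using dim_range_ge_2[OF rank_two] by metis

lemma frame_at:
  assumes c: "c \<in> charts" and nz: "A0 (c z) ~= 0" "A2 (c z) ~= 0"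
  shows "\<exists>u m w a b e \<alpha> \<gamma> \<delta> \<nu> d. loop_frame (A0 (c z)) (A1 (c z)) (A2 (c z)) (A_z \<psi> c z) u m w a b e \<alpha> \<gamma> \<delta> \<nu> d"
proof -
  interpret loop_chart3 "\<lambda>z. A0 (c z)" "\<lambda>z. A1 (c z)" "\<lambda>z. A2 (c z)" "A_z \<psi> c" by (rule chart[OF c])
  obtain x y where xy: "ccross (A_z \<psi> c z *v x) (A_z \<psi> c z *v y) ~= 0" using rank_witness[OF c] by blast
  show ?thesis
    by (rule loop_frame_exists[OF unitary A0_A A_A2 conformal_trace[OF unitary_map c conformal] xy nz]) blast
qed

text \<open>The constant is evaluated at a point where both coefficients are nonzero; there the
  frame gives \<open>a\<close> and \<open>b\<close> the same length.\<close>

lemma trace_difference_zero: "trace (A0 p ** adj (A0 p)) = trace (A2 p ** adj (A2 p))"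
proof -
  obtain p0 where p0: "A0 p0 ~= 0" "A2 p0 ~= 0" using both_nonzero by blast
  obtain c z where c: "c \<in> charts" "p0 = c z" by (rule sphere_chart)
  obtain u m w a b e \<alpha> \<gamma> \<delta> \<nu> d where l: "loop_frame (A0 (c z)) (A1 (c z)) (A2 (c z)) (A_z \<psi> c z) u m w a b e \<alpha> \<gamma> \<delta> \<nu> d"
    using frame_at[OF c(1) p0[unfolded c(2)]] by (elim exE)
  then have L: "A0 p0 = outer a u" "A2 p0 = outer b w" "hinner u u = 1" "hinner w w = 1" "hinner a a = hinner b b"
    unfolding c(2) by (simp_all add: loop_frame_def)
  have "trace (A0 p0 ** adj (A0 p0)) - trace (A2 p0 ** adj (A2 p0)) = 0"
    by (simp add: L matrix_mult_outer outer_vec trace_outer hinner_simps)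
  then show ?thesis using trace_difference_constant[of p p0] by simp
qed

text \<open>By equality of norms the two can only vanish together. Then \<open>A1 = mat 1\<close>,
  and the \<open>dz\<close> derivative of \<open>A ** adj A2 = 0\<close> reduces to
  \<open>A ** A = 0\<close>, which a 3 by 3 matrix of rank two cannot satisfy: its kernel is
  one-dimensional.\<close>

lemma A0_A2_nonzero: assumes c: "c \<in> charts" shows "A0 (c z) ~= 0 \<and> A2 (c z) ~= 0"
proof -
  interpret loop_chart3 "\<lambda>z. A0 (c z)" "\<lambda>z. A1 (c z)" "\<lambda>z. A2 (c z)" "A_z \<psi> c" by (rule chart[OF c])
  have iff: "A0 (c z) = 0 \<longleftrightarrow> A2 (c z) = 0"
  proof -
    have t0: "M = 0 \<longleftrightarrow> trace (M ** adj M) = 0" for M :: "complex^3^3"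
    proof (cases "M = 0")
      case False
      then show ?thesis using trace_mult_ctranspose_pos[of M] by (metis less_irrefl zero_complex.sel(1))
    qed (simp add: trace_def)
    show ?thesis unfolding t0[of "A0 (c z)"] t0[of "A2 (c z)"] trace_difference_zero ..
  qed
  moreover have False if z0: "A0 (c z) = 0" "A2 (c z) = 0"
  proof -
    have "mwd (\<lambda>z. A_z \<psi> c z ** adj (A2 (c z)))
       (dz_mat (A_z \<psi> c) z ** adj (A2 (c z)) + A_z \<psi> c z ** adj (A1 (c z) ** adj (A_z \<psi> c z)))
       (dzbar_mat (A_z \<psi> c) z ** adj (A2 (c z)) + A_z \<psi> c z ** adj (A2 (c z) ** A_z \<psi> c z)) z"
      by (rule mwd_mult[OF smooth_mwd[OF smooth_A] mwd_ctranspose[OF mwd_A2]])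
    moreover have "mwd (\<lambda>z. A_z \<psi> c z ** adj (A2 (c z))) 0 0 z" by (simp add: A_A2 mwd_const)
    ultimately have "A_z \<psi> c z ** adj (A1 (c z) ** adj (A_z \<psi> c z)) = 0"
      using mwd_unique z0 by fastforce
    then have "A_z \<psi> c z ** A_z \<psi> c z ** adj (A1 (c z)) = 0" by (simp add: ctranspose_mult matrix_mul_assoc)
    moreover have "A1 (c z) = mat 1" using unitary_relations(7)[of z] z0 by simp
    ultimately have AA: "A_z \<psi> c z ** A_z \<psi> c z = 0" by simp
    obtain x y where xy: "ccross (A_z \<psi> c z *v x) (A_z \<psi> c z *v y) ~= 0" using rank_witness[OF c] by blast
    have "A_z \<psi> c z *v (A_z \<psi> c z *v v) = 0" for v by (simp add: matrix_vector_mul_assoc AA)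
    then show False using kernel_parallel[OF xy] xy by blast
  qed
  ultimately show ?thesis by blast
qed

lemma framed: "c \<in> charts ==> framed_chart (\<lambda>z. A0 (c z)) (\<lambda>z. A1 (c z)) (\<lambda>z. A2 (c z)) (A_z \<psi> c)"
  using chart frame_at A0_A2_nonzero unfolding framed_chart_def framed_chart_axioms_def by blast

text \<open>The line bundle is normalized by one coordinate \<open>i\<close>, which gives a
  meromorphic curve; \<open>holomorphic_patch\<close> removes its poles. In the coordinate
  \<open>1 / z\<close> the comparison with a local lift at infinity bounds the growth, so the entire
  lift is polynomial, and the reversed polynomial is a lift in the other chart.\<close>

lemma polynomial_lift:
  obtains N and f :: "complex => complex^3" and a :: "nat => complex^3" where
    "!!z. f z = (\<Sum>j\<le>N. z ^ j *s a j)" "!!z. f z ~= 0" "a N ~= 0"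
    "!!z x. ccross (f z) (A0 (chart0 z) *v x) = 0"
    "!!w x. ccross (\<Sum>j\<le>N. w ^ (N - j) *s a j) (A0 (chart1 w) *v x) = 0"
proof -
  interpret c0: framed_chart "\<lambda>z. A0 (chart0 z)" "\<lambda>z. A1 (chart0 z)" "\<lambda>z. A2 (chart0 z)" "A_z \<psi> chart0" by (rule framed) simp
  interpret c1: framed_chart "\<lambda>z. A0 (chart1 z)" "\<lambda>z. A1 (chart1 z)" "\<lambda>z. A2 (chart1 z)" "A_z \<psi> chart1" by (rule framed) simp
  have c10: "chart1 w = chart0 (1 / w)" if "w ~= 0" for w using that by (simp add: chart0_def chart1_def)
  obtain e1 \<phi>1 where e1: "e1 > 0" "!!k. (\<lambda>z. \<phi>1 z $ k) holomorphic_on ball 0 e1" "!!z. z \<in> ball 0 e1 ==> \<phi>1 z ~= 0"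
    "!!z x. z \<in> ball 0 e1 ==> ccross (\<phi>1 z) (A0 (chart1 z) *v x) = 0" using c1.local_lift[of 0] by blast
  have "\<phi>1 0 ~= 0" using e1 by simp
  \<comment> \<open>The coordinate is chosen to be nonzero at infinity, so that the points where it
    vanishes stay in a bounded region.\<close>
  then obtain i where i: "\<phi>1 0 $ i ~= 0" by (auto simp: vec_eq_iff)
  have co1: "continuous_on (ball 0 e1) (\<lambda>w. \<phi>1 w $ k)" for k by (rule holomorphic_on_imp_continuous_on[OF e1(2)])
  have "isCont (\<lambda>w. \<phi>1 w $ i) 0" using co1[of i] e1(1) by (simp add: continuous_on_eq_continuous_at)
  then obtain e2 where e2: "e2 > 0" "!!y. dist 0 y < e2 ==> \<phi>1 y $ i ~= 0" using continuous_at_avoid[of 0 "\<lambda>w. \<phi>1 w $ i" 0] i by blast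
  define \<epsilon> where "\<epsilon> = min e1 e2 / 2"
  have \<epsilon>: "\<epsilon> > 0" "!!w. norm w \<le> \<epsilon> ==> w \<in> ball 0 e1 \<and> \<phi>1 w $ i ~= 0" using e1(1) e2 by (auto simp: \<epsilon>_def min_def split: if_splits)
  \<comment> \<open>The zeros of the \<open>i\<close>-th coordinate of the line, expressed without a
    lift by the vanishing of the whole \<open>i\<close>-th row of \<open>A0\<close>.\<close>
  define Z where "Z = {z. \<forall>j. A0 (chart0 z) $ i $ j = 0}"
  have rowZ: "z \<notin> Z \<longleftrightarrow> (\<exists>j. A0 (chart0 z) $ i $ j ~= 0)" for z by (auto simp: Z_def)
  have liftZ: "\<phi> $ i ~= 0 \<longleftrightarrow> z \<notin> Z" if "!!x. ccross \<phi> (A0 (chart0 z) *v x) = 0" "\<phi> ~= 0" for \<phi> z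
  proof -
    obtain a u where au: "A0 (chart0 z) = outer a u" "a ~= 0" "hinner u u = 1" by (rule c0.frame_outer)
    have "ccross a \<phi> = 0" using that(1)[of u] ccross_swap[of a \<phi>] by (simp add: au outer_vec)
    then obtain t where t: "\<phi> = t *s a" using ccross_parallel au(2) by blast
    have "t ~= 0" using t that(2) by auto
    moreover have "u ~= 0" using au(3) by auto
    then obtain j where "u $ j ~= 0" by (auto simp: vec_eq_iff)
    ultimately show ?thesis unfolding rowZ by (auto simp: t au)
  qed
  have Zb: "Z \<subseteq> cball 0 (1 / \<epsilon>)"
  proof
    fix z assume z: "z \<in> Z"
    show "z \<in> cball 0 (1 / \<epsilon>)"
    proof (rule ccontr)
      assume "z \<notin> cball 0 (1 / \<epsilon>)"
      then have n: "norm z > 1 / \<epsilon>" by simp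
      then have zn: "z ~= 0" using \<epsilon>(1) by (auto simp: not_less)
      have "norm (1 / z) \<le> \<epsilon>" using n \<epsilon>(1) zn by (simp add: norm_divide field_simps)
      then have w: "1 / z \<in> ball 0 e1" "\<phi>1 (1 / z) $ i ~= 0" using \<epsilon>(2) by blast+
      have "ccross (\<phi>1 (1 / z)) (A0 (chart0 z) *v x) = 0" for x
        using e1(4)[OF w(1), of x] c10[of "1 / z"] zn by simp
      from liftZ[OF this e1(3)[OF w(1)]] w z show False by simp
    qed
  qed
  have "closed Z"
    unfolding Z_def by (intro closed_Collect_all closed_Collect_eq continuous_on_component c0.continuous_coefficients continuous_on_const)
  then have Zc: "compact Z" using Zb by (metis bounded_cball bounded_subset compact_eq_bounded_closed)
  have loc: "\<exists>e>0. \<exists>\<phi> h (n::nat). (\<forall>k. (\<lambda>z. \<phi> z $ k) holomorphic_on ball z0 e) \<and> (\<forall>z\<in>ball z0 e. \<phi> z ~= 0 \<and> (\<forall>x. ccross (\<phi> z) (A0 (chart0 z) *v x) = 0)) \<and>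
      h holomorphic_on ball z0 e \<and> (\<forall>z\<in>ball z0 e. h z ~= 0 \<and> \<phi> z $ i = (z - z0) ^ n * h z)" if z0: "z0 \<in> Z" for z0
  proof -
    obtain e \<phi> where e: "e > 0" "!!k. (\<lambda>z. \<phi> z $ k) holomorphic_on ball z0 e" "!!z. z \<in> ball z0 e ==> \<phi> z ~= 0"
      "!!z x. z \<in> ball z0 e ==> ccross (\<phi> z) (A0 (chart0 z) *v x) = 0" using c0.local_lift[of z0] by blast
    have z: "\<phi> z0 $ i = 0" using liftZ[of "\<phi> z0" z0] e z0 by auto
    \<comment> \<open>If the coordinate vanished on a disc, the basis vector \<open>axis i 1\<close>
      would be annihilated by \<open>adj A0\<close> there, against fullness.\<close>
    have nc: "\<not> (\<lambda>z. \<phi> z $ i) constant_on ball z0 e"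
    proof
      assume "(\<lambda>z. \<phi> z $ i) constant_on ball z0 e"
      then have c: "\<phi> z $ i = 0" if "z \<in> ball z0 e" for z using that z e(1) unfolding constant_on_def by (metis centre_in_ball)
      have "axis i 1 = (0 :: complex^3)"
      proof (rule no_annihilator_on_open[of "ball z0 e"])
        show "adj (A0 (chart0 z)) *v axis i 1 = 0" if "z \<in> ball z0 e" for z
        proof -
          have "z \<in> Z" using liftZ[of "\<phi> z" z] e(3,4)[OF that] c[OF that] by auto
          then show ?thesis
            by (simp add: Z_def vec_eq_iff matrix_vector_mult_def axis_def if_distrib cong: if_cong)
        qed
      qed (use e in auto)
      then show False by (simp add: axis_eq_0_iff)
    qed
    have z0b: "z0 \<in> ball z0 e" using e(1) by simp
    obtain h r n where h: "0 < n" "0 < r" "ball z0 r \<subseteq> ball z0 e" "h holomorphic_on ball z0 r"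
      "!!w. w \<in> ball z0 r ==> \<phi> w $ i = (w - z0) ^ n * h w" "!!w. w \<in> ball z0 r ==> h w ~= 0"
      by (rule holomorphic_factor_zero_nonconstant[OF e(2) open_ball connected_ball z0b z nc]) blast
    show ?thesis
      by (rule exI[of _ r], rule conjI, rule h(2), rule exI[of _ \<phi>], rule exI[of _ h], rule exI[of _ n])
         (use h e holomorphic_on_subset[OF e(2) h(3)] in blast)
  qed
  have fin: "finite Z"
  proof (rule finite_compact_isolated[OF Zc])
    fix z0 assume "z0 \<in> Z"
    from loc[OF this] obtain e \<phi> h and n :: nat where e: "e > 0" "\<forall>z\<in>ball z0 e. \<phi> z ~= 0 \<and> (\<forall>x. ccross (\<phi> z) (A0 (chart0 z) *v x) = 0)"
      "\<forall>z\<in>ball z0 e. h z ~= 0 \<and> \<phi> z $ i = (z - z0) ^ n * h z" by blast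
    have "z \<notin> Z" if "z \<in> ball z0 e - {z0}" for z
      using liftZ[of "\<phi> z" z] e that by auto
    then show "\<exists>e>0. \<forall>z\<in>ball z0 e - {z0}. z \<notin> Z" using e(1) by blast
  qed
  \<comment> \<open>The chosen column may jump with \<open>z\<close>, but \<Phi> does not: in a
    matrix of rank one the ratios within a column are the same for all columns.\<close>
  define J where "J = (\<lambda>z. SOME j. A0 (chart0 z) $ i $ j ~= 0)"
  have J: "A0 (chart0 z) $ i $ J z ~= 0" if "z \<notin> Z" for z using that unfolding rowZ J_def by (rule someI_ex)
  define \<Phi> where "\<Phi> = (\<lambda>z. \<chi> k. A0 (chart0 z) $ k $ J z / A0 (chart0 z) $ i $ J z)"
  have \<Phi>i: "\<Phi> z $ i = 1" if "z \<notin> Z" for z using J[OF that] by (simp add: \<Phi>_def)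
  have \<Phi>l: "ccross (\<Phi> z) (A0 (chart0 z) *v x) = 0" if "z \<notin> Z" for z x
  proof -
    obtain a u where au: "A0 (chart0 z) = outer a u" by (rule c0.frame_outer)
    have "\<Phi> z = (1 / a $ i) *s a" using J[OF that] by (simp add: \<Phi>_def au vec_eq_iff)
    then show ?thesis by (simp add: au outer_vec ccross_scale_same)
  qed
  have \<Phi>u: "\<phi> = \<phi> $ i *s \<Phi> z" if "z \<notin> Z" "!!x. ccross \<phi> (A0 (chart0 z) *v x) = 0" "\<phi> $ i ~= 0" for \<phi> z
  proof -
    obtain a u where au: "A0 (chart0 z) = outer a u" "a ~= 0" "hinner u u = 1" by (rule c0.frame_outer)
    have v: "A0 (chart0 z) *v u = a" by (simp add: au outer_vec)
    show ?thesis
      by (rule ccross_common[of _ a _ i])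
         (use that \<Phi>l[OF that(1), of u] that(2)[of u] au(2) \<Phi>i[OF that(1)] v in \<open>simp_all add: ccross_simps\<close>)
  qed
  have open_mZ: "open (- Z)" using \<open>closed Z\<close> by (simp add: open_Compl)
  have \<Phi>hol: "(\<lambda>z. \<Phi> z $ k) holomorphic_on - Z" for k
    unfolding holomorphic_on_open[OF open_mZ]
  proof
    fix z1 assume "z1 \<in> - Z"
    then have z1: "z1 \<notin> Z" by simp
    define j where "j = J z1"
    have op: "open {z. A0 (chart0 z) $ i $ j ~= 0}"
      by (intro open_Collect_neq continuous_on_component c0.continuous_coefficients continuous_on_const)
    have eq: "A0 (chart0 z) $ k $ j / A0 (chart0 z) $ i $ j = \<Phi> z $ k" if "A0 (chart0 z) $ i $ j ~= 0" for z
    proof -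
      have zZ: "z \<notin> Z" using that rowZ by blast
      obtain a u where au: "A0 (chart0 z) = outer a u" by (rule c0.frame_outer)
      have "a $ i ~= 0" using that au by auto
      then show ?thesis using that J[OF zZ] by (simp add: \<Phi>_def au)
    qed
    have Jn: "A0 (chart0 z1) $ i $ j ~= 0" using J[OF z1] by (simp add: j_def)
    from c0.column_ratio[OF Jn, of k] obtain a where
      a: "has_wd (\<lambda>w. A0 (chart0 w) $ k $ j / A0 (chart0 w) $ i $ j) a 0 z1" by (rule exE)
    have "has_wd (\<lambda>z. \<Phi> z $ k) a 0 z1"
      by (rule has_wd_transform[OF a op]) (use Jn eq in simp_all)
    then show "\<exists>f'. ((\<lambda>z. \<Phi> z $ k) has_field_derivative f') (at z1)" by (auto simp: has_wd_field_derivative)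
  qed
  have \<Phi>nz: "\<Phi> z ~= 0" if "z \<notin> Z" for z using \<Phi>i[OF that] by auto
  have patch: "\<exists>e>0. \<exists>\<phi> h (n::nat). (\<forall>k. (\<lambda>z. \<phi> z $ k) holomorphic_on ball z0 e) \<and> \<phi> z0 ~= 0 \<and>
      h holomorphic_on ball z0 e \<and> (\<forall>z\<in>ball z0 e. h z ~= 0) \<and>
      (\<forall>z\<in>ball z0 e - {z0}. z \<notin> Z \<and> \<phi> z = ((z - z0) ^ n * h z) *s \<Phi> z)" if z0: "z0 \<in> Z" for z0
  proof -
    from loc[OF z0] obtain e \<phi> h and n :: nat where e: "e > 0" "\<forall>k. (\<lambda>z. \<phi> z $ k) holomorphic_on ball z0 e"
      "\<forall>z\<in>ball z0 e. \<phi> z ~= 0 \<and> (\<forall>x. ccross (\<phi> z) (A0 (chart0 z) *v x) = 0)" "h holomorphic_on ball z0 e"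
      "\<forall>z\<in>ball z0 e. h z ~= 0 \<and> \<phi> z $ i = (z - z0) ^ n * h z" by blast
    have "z \<notin> Z \<and> \<phi> z = ((z - z0) ^ n * h z) *s \<Phi> z" if z: "z \<in> ball z0 e - {z0}" for z
    proof -
      have ni: "\<phi> z $ i ~= 0" using e z by auto
      then have zZ: "z \<notin> Z" using liftZ[of "\<phi> z" z] e z by auto
      have ph: "\<phi> z $ i = (z - z0) ^ n * h z" using e z by auto
      have "\<phi> z = \<phi> z $ i *s \<Phi> z" by (rule \<Phi>u[OF zZ _ ni]) (use e z in auto)
      then show ?thesis unfolding ph using zZ by blast
    qed
    moreover have "\<phi> z0 ~= 0" using e by simp
    ultimately show ?thesis
      using e by (intro exI[of _ e] conjI exI[of _ \<phi>] exI[of _ h] exI[of _ n]) auto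
  qed
  obtain n g where g: "!!k. (\<lambda>z. g z $ k) holomorphic_on UNIV" "!!z. g z ~= 0"
    "!!z. z \<notin> Z ==> g z = (\<Prod>z0\<in>Z. (z - z0) ^ n z0) *s \<Phi> z"
    by (rule holomorphic_patch[OF fin \<Phi>hol \<Phi>nz patch]) (assumption | rule that)+
  define p where "p = (\<lambda>z. \<Prod>z0\<in>Z. (z - z0) ^ n z0)"
  \<comment> \<open>The total order of the zeros removed; it is the degree of the polynomial factor
    \<open>p\<close> and hence the growth order of the lift.\<close>
  define N where "N = (\<Sum>z0\<in>Z. n z0)"
  have plim: "((\<lambda>w. w ^ N * p (1 / w)) \<longlongrightarrow> 1) (at 0)"
  proof -
    have l1: "((\<lambda>w. \<Prod>z0\<in>Z. (1 - z0 * w) ^ n z0) \<longlongrightarrow> (\<Prod>z0\<in>Z. (1 - z0 * 0) ^ n z0)) (at 0)"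
      by (intro tendsto_intros)
    have eq: "w ^ N * p (1 / w) = (\<Prod>z0\<in>Z. (1 - z0 * w) ^ n z0)" if "w ~= 0" for w
    proof -
      have "w ^ N * p (1 / w) = (\<Prod>z0\<in>Z. w ^ n z0 * (1 / w - z0) ^ n z0)"
        by (simp add: N_def p_def power_sum prod.distrib)
      also have "\<dots> = (\<Prod>z0\<in>Z. (1 - z0 * w) ^ n z0)"
        by (rule prod.cong) (use that in \<open>simp_all add: power_mult_distrib[symmetric] right_diff_distrib mult.commute\<close>)
      finally show ?thesis .
    qed
    have "\<forall>\<^sub>F w in at 0. (\<Prod>z0\<in>Z. (1 - z0 * w) ^ n z0) = w ^ N * p (1 / w)"
      unfolding eventually_at by (rule exI[of _ 1]) (simp add: eq)
    from Lim_transform_eventually[OF l1 this] show ?thesis by simp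
  qed
  have glim: "((\<lambda>w. w ^ N * g (1 / w) $ k) \<longlongrightarrow> \<phi>1 0 $ k / \<phi>1 0 $ i) (at 0)" for k
  proof -
    have c0: "isCont (\<lambda>w. \<phi>1 w $ k) 0" for k using co1[of k] e1(1) by (simp add: continuous_on_eq_continuous_at)
    have "isCont (\<lambda>w. \<phi>1 w $ k / \<phi>1 w $ i) 0" by (rule isCont_divide[OF c0 c0 i])
    then have "((\<lambda>w. \<phi>1 w $ k / \<phi>1 w $ i) \<longlongrightarrow> \<phi>1 0 $ k / \<phi>1 0 $ i) (at 0)" by (simp add: isCont_def)
    from tendsto_mult[OF plim this]
    have l1: "((\<lambda>w. w ^ N * p (1 / w) * (\<phi>1 w $ k / \<phi>1 w $ i)) \<longlongrightarrow> \<phi>1 0 $ k / \<phi>1 0 $ i) (at 0)" by simp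
    have eq: "w ^ N * p (1 / w) * (\<phi>1 w $ k / \<phi>1 w $ i) = w ^ N * g (1 / w) $ k" if w: "w ~= 0" "norm w < \<epsilon>" for w
    proof -
      have wb: "w \<in> ball 0 e1" "\<phi>1 w $ i ~= 0" using \<epsilon>(2)[of w] w by auto
      have l: "ccross (\<phi>1 w) (A0 (chart0 (1 / w)) *v x) = 0" for x using e1(4)[OF wb(1), of x] c10[OF w(1)] by simp
      have zZ: "1 / w \<notin> Z" using liftZ[OF l e1(3)[OF wb(1)]] wb by simp
      have "\<phi>1 w $ k = \<phi>1 w $ i * \<Phi> (1 / w) $ k" using arg_cong[OF \<Phi>u[OF zZ l wb(2)], of "\<lambda>v. v $ k"] by simp
      then have "\<Phi> (1 / w) $ k = \<phi>1 w $ k / \<phi>1 w $ i" using wb(2) by simp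
      then show ?thesis using g(3)[OF zZ] by (simp add: p_def)
    qed
    have "\<forall>\<^sub>F w in at 0. w ^ N * p (1 / w) * (\<phi>1 w $ k / \<phi>1 w $ i) = w ^ N * g (1 / w) $ k"
      unfolding eventually_at by (rule exI[of _ \<epsilon>]) (use \<epsilon>(1) eq in \<open>auto simp: dist_norm\<close>)
    from Lim_transform_eventually[OF l1 this] show ?thesis .
  qed
  \<comment> \<open>The limit at infinity bounds the entire coordinate functions by a multiple of
    |z|^N, and Liouville's theorem for polynomial growth applies.\<close>
  have poly: "\<exists>c. \<forall>z. g z $ k = (\<Sum>j\<le>N. c j * z ^ j)" for k
  proof -
    define l where "l = \<phi>1 0 $ k / \<phi>1 0 $ i"
    have "\<forall>\<^sub>F w in at 0. norm (w ^ N * g (1 / w) $ k) < norm l + 1"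
      using tendsto_norm[OF glim[of k]] by (rule order_tendstoD) (simp add: l_def)
    then obtain r where r: "r > 0" "!!w. w ~= 0 ==> norm w < r ==> norm (w ^ N * g (1 / w) $ k) < norm l + 1"
      unfolding eventually_at by (auto simp: dist_norm)
    have "norm (g z $ k) \<le> (norm l + 1) * norm z ^ N" if z: "2 / r \<le> norm z" for z
    proof -
      have zn: "z ~= 0" using z r(1) by auto
      have "norm (1 / z) < r" using z r(1) zn by (simp add: norm_divide field_simps)
      then have "norm ((1 / z) ^ N * g z $ k) < norm l + 1" using r(2)[of "1 / z"] zn by simp
      then show ?thesis using zn by (simp add: norm_mult norm_power norm_divide power_divide divide_less_eq mult.commute)
    qed
    from Liouville_polynomial[OF g(1)[of k] this]
    have gz: "g z $ k = (\<Sum>j\<le>N. (deriv ^^ j) (\<lambda>z. g z $ k) 0 / fact j * z ^ j)" for z by blast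
    show ?thesis by (rule exI, rule allI, rule gz)
  qed
  then obtain c where c: "!!k z. g z $ k = (\<Sum>j\<le>N. c k j * z ^ j)" by metis
  define a where "a = (\<lambda>j. \<chi> k. c k j)"
  have ga: "g z = (\<Sum>j\<le>N. z ^ j *s a j)" for z
    unfolding vec_eq_iff sum_component a_def by (simp add: c mult.commute)
  have rev: "(\<Sum>j\<le>N. w ^ (N - j) *s a j) = w ^ N *s g (1 / w)" if "w ~= 0" for w
  proof -
    have "w ^ (N - j) = w ^ N * (1 / w) ^ j" if "j \<le> N" for j
      using that \<open>w ~= 0\<close> by (simp add: power_diff power_one_over divide_inverse power_inverse)
    then show ?thesis unfolding ga vec.scale_sum_right by (intro sum.cong) (auto simp: vec.scale_scale)
  qed
  have at0: "(\<Sum>j\<le>N. 0 ^ (N - j) *s a j) = a N"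
  proof -
    have "(\<Sum>j\<le>N. (0::complex) ^ (N - j) *s a j) = (\<Sum>j\<in>{N}. 0 ^ (N - j) *s a j)"
      by (rule sum.mono_neutral_right) auto
    then show ?thesis by simp
  qed
  have cont: "continuous_on UNIV (\<lambda>w. \<Sum>j\<le>N. w ^ (N - j) *s a j)"
  proof -
    have c: "continuous_on UNIV (\<lambda>w. \<chi> k. (\<Sum>j\<le>N. w ^ (N - j) * a j $ k))" by (intro continuous_intros)
    have e: "(\<lambda>w. \<chi> k. (\<Sum>j\<le>N. w ^ (N - j) * a j $ k)) = (\<lambda>w. \<Sum>j\<le>N. w ^ (N - j) *s a j)"
      by (auto simp: vec_eq_iff sum_component)
    show ?thesis by (rule c[unfolded e])
  qed
  have g_lift: "ccross (g z) (A0 (chart0 z) *v x) = 0" for z x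
  proof -
    have c: "continuous_on UNIV (\<lambda>z. ccross (g z) (A0 (chart0 z) *v x))"
    proof (intro continuous_on_ccross continuous_on_matrix_vec c0.continuous_coefficients continuous_on_const)
      have "continuous_on UNIV (\<lambda>z. \<chi> k. g z $ k)" by (intro continuous_on_vec_lambda holomorphic_on_imp_continuous_on g(1))
      then show "continuous_on UNIV g" by simp
    qed
    show ?thesis by (rule continuous_zero_off_finite[OF c fin]) (simp add: g(3) ccross_scale_left \<Phi>l)
  qed
  show ?thesis
  proof (rule that[where f = g and N = N and a = a])
    show "a N ~= 0"
    proof -
      have "((\<lambda>w. \<Sum>j\<le>N. w ^ (N - j) *s a j) \<longlongrightarrow> (\<Sum>j\<le>N. 0 ^ (N - j) *s a j)) (at 0)"
        using cont by (simp add: continuous_on_eq_continuous_at isCont_def)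
      then have "((\<lambda>w. (\<Sum>j\<le>N. w ^ (N - j) *s a j) $ i) \<longlongrightarrow> a N $ i) (at 0)" unfolding at0 by (intro tendsto_vec_nth)
      moreover have "\<forall>\<^sub>F w in at 0. (\<Sum>j\<le>N. w ^ (N - j) *s a j) $ i = w ^ N * g (1 / w) $ i"
        unfolding eventually_at by (rule exI[of _ 1]) (auto simp: rev)
      ultimately have "((\<lambda>w. w ^ N * g (1 / w) $ i) \<longlongrightarrow> a N $ i) (at 0)" by (rule Lim_transform_eventually)
      from tendsto_unique[OF _ this glim[of i]] have "a N $ i = 1" using i by simp
      then show ?thesis by auto
    qed
    show "ccross (\<Sum>j\<le>N. w ^ (N - j) *s a j) (A0 (chart1 w) *v x) = 0" for w x
    proof (rule continuous_zero_off_finite[where F = "{0}"])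
      show "continuous_on UNIV (\<lambda>w. ccross (\<Sum>j\<le>N. w ^ (N - j) *s a j) (A0 (chart1 w) *v x))"
        by (intro continuous_on_ccross cont continuous_on_matrix_vec c1.continuous_coefficients continuous_on_const)
      show "ccross (\<Sum>j\<le>N. w ^ (N - j) *s a j) (A0 (chart1 w) *v x) = 0" if "w \<notin> {0}" for w
        using that rev[of w] c10[of w] by (simp add: ccross_scale_left g_lift)
    qed simp
  qed (use ga g(2) g_lift in auto)
qed

end

lemma vwd_polynomial:
  assumes "!!j. j \<le> N ==> (h j has_field_derivative h' j z) (at z)"
  shows "vwd (\<lambda>z. \<Sum>j\<le>(N::nat). h j z *s a j) (\<Sum>j\<le>N. h' j z *s a j) 0 z"
proof -
  have "has_wd (\<lambda>z. \<Sum>j\<le>N. h j z * a j $ i) (\<Sum>j\<le>N. h' j z * a j $ i) 0 z" for i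
    unfolding has_wd_field_derivative by (intro DERIV_sum DERIV_cmult_right assms) auto
  then show ?thesis by (simp add: vwd_def sum_component)
qed

lemma det3_change:
  "hinner (x *s p + y *s q + v *s r) (vcnj (ccross (c *s p) (s *s p + t *s q))) = c * t * v * hinner r (vcnj (ccross p q))"
  by (simp add: hinner_3 ccross_nth vcnj_nth algebra_simps)

text \<open>The hypotheses make W grow at least linearly at infinity; without zeros, 1 / W would be
  entire and tend to 0.\<close>

lemma entire_bounded_below_vanishes:
  fixes W V :: "complex => complex"
  assumes W: "W holomorphic_on UNIV" and V: "isCont V 0" "V 0 ~= 0" and n: "n > 0"
    and r: "!!z. z ~= 0 ==> norm (W z) = norm z ^ n * norm (V (1 / z))"
  shows "\<exists>z. W z = 0"
proof (rule Liouville_weak_inverse[OF W])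
  fix B :: real
  obtain d where d: "d > 0" "!!w. dist w 0 < d ==> dist (V w) (V 0) < norm (V 0) / 2"
    using V unfolding continuous_at_eps_delta by (metis half_gt_zero zero_less_norm_iff)
  define c where "c = norm (V 0) / 2"
  have c: "c > 0" using V by (simp add: c_def)
  show "\<forall>\<^sub>F z in at_infinity. B \<le> norm (W z)"
    unfolding eventually_at_infinity
  proof (intro exI[of _ "max 1 (max (2 / d) (\<bar>B\<bar> / c))"] allI impI)
    fix z :: complex assume z: "max 1 (max (2 / d) (\<bar>B\<bar> / c)) \<le> norm z"
    then have zn: "z ~= 0" "1 \<le> norm z" "2 / d \<le> norm z" "\<bar>B\<bar> / c \<le> norm z" by auto
    have "norm (1 / z) < d" using zn d(1) by (simp add: norm_divide field_simps)
    then have "dist (V (1 / z)) (V 0) < c" using d(2)[of "1 / z"] by (simp add: c_def)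
    then have "c \<le> norm (V (1 / z))" using norm_triangle_ineq3[of "V (1 / z)" "V 0"] by (simp add: dist_norm c_def)
    moreover have "norm z \<le> norm z ^ n" using zn(2) n by (simp add: self_le_power)
    ultimately have "norm z * c \<le> norm (W z)" unfolding r[OF zn(1)] using c zn(2) by (intro mult_mono) auto
    moreover have "\<bar>B\<bar> \<le> norm z * c" using zn(4) c by (simp add: divide_le_eq)
    ultimately show "B \<le> norm (W z)" by linarith
  qed
qed blast

context uniton_two
begin

lemma lifted:
  assumes c: "c \<in> charts" and "!!z. vwd f (f1 z) 0 z" "!!z. vwd f1 (f2 z) 0 z" "!!z. f z ~= 0"
    "!!z x. ccross (f z) (A0 (c z) *v x) = 0"
  shows "lifted_chart (\<lambda>z. A0 (c z)) (\<lambda>z. A1 (c z)) (\<lambda>z. A2 (c z)) (A_z \<psi> c) UNIV f f1 f2"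
  using framed[OF c] assms unfolding lifted_chart_def lifted_chart_axioms_def by blast

text \<open>In a polynomial lift of degree \<open>N\<close> the Wronskian has no zeros in the affine chart, and it grows like
  \<open>z\<^sup>3\<^sup>N\<^sup>-\<^sup>6\<close> since the reversed polynomial is unramified at infinity.\<close>

lemma quadratic_lift:
  obtains a0 a1 a2 where
    "lifted_chart (\<lambda>z. A0 (chart0 z)) (\<lambda>z. A1 (chart0 z)) (\<lambda>z. A2 (chart0 z)) (A_z \<psi> chart0) UNIV
      (\<lambda>z. a0 + z *s a1 + z\<^sup>2 *s a2) (\<lambda>z. a1 + (2 * z) *s a2) (\<lambda>z. 2 *s a2)"
    "lifted_chart (\<lambda>z. A0 (chart1 z)) (\<lambda>z. A1 (chart1 z)) (\<lambda>z. A2 (chart1 z)) (A_z \<psi> chart1) UNIV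
      (\<lambda>z. a2 + z *s a1 + z\<^sup>2 *s a0) (\<lambda>z. a1 + (2 * z) *s a0) (\<lambda>z. 2 *s a0)"
proof -
  obtain N f and a :: "nat => complex^3" where fa: "!!z. f z = (\<Sum>j\<le>N. z ^ j *s a j)" and fn: "!!z. f z ~= 0" and aN: "a N ~= 0"
    and l0: "!!z x. ccross (f z) (A0 (chart0 z) *v x) = 0"
    and l1: "!!w x. ccross (\<Sum>j\<le>N. w ^ (N - j) *s a j) (A0 (chart1 w) *v x) = 0" by (rule polynomial_lift) blast
  define f1 where "f1 = (\<lambda>z::complex. \<Sum>j\<le>N. (of_nat j * z ^ (j - 1)) *s a j)"
  define f2 where "f2 = (\<lambda>z::complex. \<Sum>j\<le>N. (of_nat j * (of_nat (j - 1) * z ^ (j - 1 - 1))) *s a j)"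
  define g where "g = (\<lambda>w::complex. \<Sum>j\<le>N. w ^ (N - j) *s a j)"
  define g1 where "g1 = (\<lambda>w::complex. \<Sum>j\<le>N. (of_nat (N - j) * w ^ (N - j - 1)) *s a j)"
  define g2 where "g2 = (\<lambda>w::complex. \<Sum>j\<le>N. (of_nat (N - j) * (of_nat (N - j - 1) * w ^ (N - j - 1 - 1))) *s a j)"
  have pw: "((\<lambda>z::complex. z ^ j) has_field_derivative of_nat j * z ^ (j - 1)) (at z)" for j z
    by (auto intro!: derivative_eq_intros)
  have ff: "f = (\<lambda>z. \<Sum>j\<le>N. z ^ j *s a j)" using fa by auto
  have d: "vwd f (f1 z) 0 z" "vwd f1 (f2 z) 0 z" "vwd g (g1 z) 0 z" "vwd g1 (g2 z) 0 z" for z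
    unfolding ff f1_def f2_def g_def g1_def g2_def by (rule vwd_polynomial, rule pw DERIV_cmult, (rule pw)?)+
  have rev: "g w = w ^ N *s f (1 / w)" if "w ~= 0" for w
  proof -
    have "w ^ (N - j) = w ^ N * (1 / w) ^ j" if "j \<le> N" for j
      using that \<open>w ~= 0\<close> by (simp add: power_diff power_one_over divide_inverse power_inverse)
    then show ?thesis unfolding g_def fa vec.scale_sum_right by (intro sum.cong) (auto simp: vec.scale_scale)
  qed
  have gn: "g w ~= 0" for w
  proof (cases "w = 0")
    case True
    have "g 0 = (\<Sum>j\<in>{N}. (0::complex) ^ (N - j) *s a j)" unfolding g_def by (rule sum.mono_neutral_right) auto
    then show ?thesis using True aN by simp
  qed (simp add: rev fn)
  interpret c0: lifted_chart "\<lambda>z. A0 (chart0 z)" "\<lambda>z. A1 (chart0 z)" "\<lambda>z. A2 (chart0 z)" "A_z \<psi> chart0" UNIV f f1 f2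
    by (rule lifted[OF _ d(1,2) fn l0]) simp
  interpret c1: lifted_chart "\<lambda>z. A0 (chart1 z)" "\<lambda>z. A1 (chart1 z)" "\<lambda>z. A2 (chart1 z)" "A_z \<psi> chart1" UNIV g g1 g2
    by (rule lifted[OF _ d(3,4) gn]) (simp_all add: g_def l1)
  define W where "W = (\<lambda>z. hinner (f2 z) (vcnj (ccross (f z) (f1 z))))"
  define V where "V = (\<lambda>z. hinner (g2 z) (vcnj (ccross (g z) (g1 z))))"
  have Wn: "W z ~= 0" "V z ~= 0" for z using c0.unramified_lift c1.unramified_lift by (simp_all add: W_def V_def)
  \<comment> \<open>The transformation of the Wronskian under w = 1 / z. Each of the three vectors
    contributes w^N, the first and second derivatives contribute w^-2 and w^-4, and the sign comes
    from the derivative of 1 / w.\<close>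
  have WV: "V w * w ^ 6 = - (w ^ (3 * N)) * W (1 / w)" if w: "w ~= 0" for w
  proof -
    define z where "z = 1 / w"
    have zw: "z * w = 1" "w * z = 1" using w by (simp_all add: z_def)
    have zf1: "z *s f1 z = (\<Sum>j\<le>N. (of_nat j * z ^ j) *s a j)"
    proof -
      have "z * (of_nat j * z ^ (j - 1)) = of_nat j * z ^ j" for j by (cases j) auto
      then show ?thesis unfolding f1_def vec.scale_sum_right vec.scale_scale by (simp only:)
    qed
    have zf2: "z\<^sup>2 *s f2 z = (\<Sum>j\<le>N. (of_nat j * (of_nat j - 1) * z ^ j) *s a j)"
    proof -
      have "z\<^sup>2 * (of_nat j * (of_nat (j - 1) * z ^ (j - 1 - 1))) = of_nat j * (of_nat j - 1) * z ^ j" for j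
      proof (cases j)
        case (Suc k)
        then show ?thesis by (cases k) (auto simp: power2_eq_square algebra_simps)
      qed simp
      then show ?thesis unfolding f2_def vec.scale_sum_right vec.scale_scale by (simp only:)
    qed
    have e: "w ^ (N - j) = w ^ N * z ^ j" if "j \<le> N" for j
      using that w by (simp add: z_def power_diff power_one_over divide_inverse power_inverse)
    have 0: "g w = w ^ N *s f z" using rev[OF w] by (simp add: z_def)
    have 1: "w *s g1 w = w ^ N *s (of_nat N *s f z - z *s f1 z)"
    proof -
      have "w * (of_nat (N - j) * w ^ (N - j - 1)) = w ^ N * (of_nat N * z ^ j - of_nat j * z ^ j)" if "j \<le> N" for j
      proof -
        have "w * (of_nat (N - j) * w ^ (N - j - 1)) = of_nat (N - j) * w ^ (N - j)" by (cases "N - j") auto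
        then show ?thesis unfolding e[OF that] using that by (simp add: of_nat_diff algebra_simps)
      qed
      then have H: "w *s g1 w = (\<Sum>j\<le>N. (w ^ N * (of_nat N * z ^ j - of_nat j * z ^ j)) *s a j)"
        unfolding g1_def vec.scale_sum_right vec.scale_scale by (intro sum.cong) auto
      show ?thesis unfolding H zf1 unfolding fa
        by (simp add: vec_eq_iff sum_component algebra_simps sum_subtractf sum.distrib sum_distrib_left)
    qed
    have 2: "w\<^sup>2 *s g2 w = w ^ N *s ((of_nat N * (of_nat N - 1)) *s f z - (2 * (of_nat N - 1)) *s (z *s f1 z) + z\<^sup>2 *s f2 z)"
    proof -
      have "w\<^sup>2 * (of_nat (N - j) * (of_nat (N - j - 1) * w ^ (N - j - 1 - 1)))
          = w ^ N * (of_nat N * (of_nat N - 1) * z ^ j - 2 * (of_nat N - 1) * (of_nat j * z ^ j) + of_nat j * (of_nat j - 1) * z ^ j)" if "j \<le> N" for j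
      proof -
        have "w\<^sup>2 * (of_nat k * (of_nat (k - 1) * w ^ (k - 1 - 1))) = of_nat k * (of_nat k - 1) * w ^ k" for k
        proof (cases k)
          case (Suc l)
          then show ?thesis by (cases l) (auto simp: power2_eq_square algebra_simps)
        qed simp
        note K = this
        show ?thesis unfolding K e[OF that] using that by (simp add: of_nat_diff algebra_simps)
      qed
      then have H: "w\<^sup>2 *s g2 w = (\<Sum>j\<le>N. (w ^ N * (of_nat N * (of_nat N - 1) * z ^ j - 2 * (of_nat N - 1) * (of_nat j * z ^ j) + of_nat j * (of_nat j - 1) * z ^ j)) *s a j)"
        unfolding g2_def vec.scale_sum_right vec.scale_scale by (intro sum.cong) auto
      show ?thesis unfolding H zf1 zf2 unfolding fa
        by (simp add: vec_eq_iff sum_component algebra_simps sum_subtractf sum.distrib sum_distrib_left)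
    qed
    have "hinner (w\<^sup>2 *s g2 w) (vcnj (ccross (g w) (w *s g1 w))) = w ^ 3 * V w"
      by (simp add: V_def hinner_3 ccross_nth vcnj_nth algebra_simps power2_eq_square power3_eq_cube)
    moreover have "hinner (w\<^sup>2 *s g2 w) (vcnj (ccross (g w) (w *s g1 w)))
      = w ^ N * (w ^ N * - z) * (w ^ N * z\<^sup>2) * W z"
    proof -
      have "w\<^sup>2 *s g2 w = (w ^ N * (of_nat N * (of_nat N - 1))) *s f z + (- (w ^ N * (2 * (of_nat N - 1)) * z)) *s f1 z + (w ^ N * z\<^sup>2) *s f2 z"
        unfolding 2 by (simp add: vec_eq_iff algebra_simps)
      moreover have "w *s g1 w = (w ^ N * of_nat N) *s f z + (w ^ N * - z) *s f1 z"
        unfolding 1 by (simp add: vec_eq_iff algebra_simps)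
      ultimately show ?thesis unfolding 0 by (simp only: det3_change W_def)
    qed
    ultimately have "w ^ 3 * V w = - (w ^ N * w ^ N * w ^ N) * z ^ 3 * W z" by (simp add: power2_eq_square power3_eq_cube mult_ac)
    then have "w ^ 3 * (w ^ 3 * V w) = - (w ^ N * w ^ N * w ^ N) * (w * z) ^ 3 * W z" by (simp add: power_mult_distrib mult_ac)
    then show ?thesis by (simp add: zw z_def[symmetric] mult.commute[of 3] power_mult power3_eq_cube[of "w ^ N"] mult_ac flip: power_add)
  qed
  have hol: "W holomorphic_on UNIV"
  proof -
    have "(\<lambda>z. f z $ k) holomorphic_on UNIV" "(\<lambda>z. f1 z $ k) holomorphic_on UNIV" "(\<lambda>z. f2 z $ k) holomorphic_on UNIV" for k
      unfolding fa f1_def f2_def sum_component vector_smult_component by (intro holomorphic_intros)+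
    then show ?thesis unfolding W_def hinner_3 vcnj_nth complex_cnj_cnj ccross_nth by (intro holomorphic_intros)
  qed
  have Vc: "isCont V 0"
  proof -
    have cg: "isCont (\<lambda>z. g z $ k) 0" "isCont (\<lambda>z. g1 z $ k) 0" "isCont (\<lambda>z. g2 z $ k) 0" for k
      unfolding g_def g1_def g2_def sum_component vector_smult_component by (intro continuous_intros)+
    show ?thesis unfolding V_def hinner_3 vcnj_nth complex_cnj_cnj ccross_nth by (intro isCont_add isCont_mult isCont_diff cg)
  qed
  \<comment> \<open>The exponent 3N - 6 is then positive, so the Wronskian would have a zero in the
    affine chart.\<close>
  have "\<not> N > 2"
  proof
    assume N: "N > 2"
    have rW: "norm (W z) = norm z ^ (3 * N - 6) * norm (V (1 / z))" if z: "z ~= 0" for z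
    proof -
      have "norm (V (1 / z)) * (1 / norm z) ^ 6 = (1 / norm z) ^ (3 * N) * norm (W z)"
        using arg_cong[OF WV[of "1 / z"], of norm] z by (simp add: norm_mult norm_power norm_divide)
      then have "norm (V (1 / z)) / norm z ^ 6 = norm (W z) / norm z ^ (3 * N)"
        by (simp add: power_one_over divide_inverse mult_ac power_inverse)
      moreover have "norm z ^ (3 * N) = norm z ^ (3 * N - 6) * norm z ^ 6" using N by (simp flip: power_add)
      ultimately show ?thesis using z by (simp add: field_simps)
    qed
    have "\<exists>z. W z = 0" by (rule entire_bounded_below_vanishes[OF hol Vc Wn(2) _ rW]) (use N in auto)
    then show False using Wn by blast
  qed
  \<comment> \<open>A curve of degree at most one has f'' = 0, and the Wronskian vanishes.\<close>
  moreover have "\<not> N < 2"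
  proof
    assume "N < 2"
    then have zf: "of_nat j * (of_nat (j - 1) * z ^ (j - 1 - 1)) = (0::complex)" if "j \<le> N" for j z using that by (cases j) auto
    have "f2 0 = 0" unfolding f2_def by (rule sum.neutral, intro ballI, subst zf) (auto simp: vec_eq_iff)
    then show False using Wn(1)[of 0] by (simp add: W_def)
  qed
  ultimately have N: "N = 2" by simp
  have "f = (\<lambda>z. a 0 + z *s a 1 + z\<^sup>2 *s a 2)" "f1 = (\<lambda>z. a 1 + (2 * z) *s a 2)" "f2 = (\<lambda>z. 2 *s a 2)"
    "g = (\<lambda>z. a 2 + z *s a 1 + z\<^sup>2 *s a 0)" "g1 = (\<lambda>z. a 1 + (2 * z) *s a 0)" "g2 = (\<lambda>z. 2 *s a 0)"
    unfolding ff f1_def f2_def g_def g1_def g2_def N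
    by (auto simp: numeral_2_eq_2 fun_eq_iff vec_eq_iff algebra_simps)
  then show ?thesis using that[of "a 0" "a 1" "a 2"] c0.lifted_chart_axioms c1.lifted_chart_axioms by simp
qed

end

section \<open>Liouville arguments for the metric and its potential\<close>

section \<open>Metrics of constant curvature and growth at infinity\<close>

text \<open>The second difference over a square does not depend on the order of the two variables,
  while the mean value theorem, applied in either order, turns it into a mixed partial derivative at
  some point of the square. This is the source of the symmetry of mixed partials below.\<close>

lemma mixed_difference:
  fixes u :: "real => real => real"
  assumes x: "!!s t. ((\<lambda>s. u s t) has_real_derivative ux s t) (at s)"
    and xy: "!!s t. ((\<lambda>t. ux s t) has_real_derivative uxy s t) (at t)" and h: "h > 0"
  shows "\<exists>s t. a < s \<and> s < a + h \<and> b < t \<and> t < b + h \<and>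
    u (a + h) (b + h) - u a (b + h) - u (a + h) b + u a b = h * h * uxy s t"
proof -
  have d: "((\<lambda>s. u s (b + h) - u s b) has_real_derivative ux s (b + h) - ux s b) (at s)" for s
    by (intro DERIV_diff x)
  have "\<exists>s. a < s \<and> s < a + h \<and> (u (a + h) (b + h) - u (a + h) b) - (u a (b + h) - u a b) = (a + h - a) * (ux s (b + h) - ux s b)"
    using MVT2[OF _ d, of a "a + h"] h by auto
  then obtain s where s: "a < s" "s < a + h" "(u (a + h) (b + h) - u (a + h) b) - (u a (b + h) - u a b) = h * (ux s (b + h) - ux s b)"
    by auto
  have "\<exists>t. b < t \<and> t < b + h \<and> ux s (b + h) - ux s b = (b + h - b) * uxy s t"
    using MVT2[OF _ xy, of b "b + h" s] h by auto
  then obtain t where t: "b < t" "t < b + h" "ux s (b + h) - ux s b = h * uxy s t" by auto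
  have "u (a + h) (b + h) - u a (b + h) - u (a + h) b + u a b = h * (ux s (b + h) - ux s b)" using s(3) by linarith
  then have "u (a + h) (b + h) - u a (b + h) - u (a + h) b + u a b = h * h * uxy s t" unfolding t(3) by (simp only: mult.assoc)
  then show ?thesis using s t by blast
qed

lemma mixed_partials_real:
  fixes u :: "complex => real"
  assumes u: "smooth u"
  shows "pd \<i> (pd 1 u) z = pd 1 (pd \<i> u) z"
proof -
  have 1: "((\<lambda>s. v (Complex s t)) has_real_derivative pd 1 v (Complex s t)) (at s)" if v: "smooth v" for v :: "complex => real" and s t
  proof -
    have "(v has_derivative frechet_derivative v (at (Complex s t))) (at (Complex s t))"
      using smooth_differentiable[OF v] by (simp add: frechet_derivative_works)
    moreover have "((\<lambda>s. Complex s t) has_derivative (\<lambda>h. of_real h)) (at s)"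
    proof -
      have "((\<lambda>s. of_real s + \<i> * of_real t) has_derivative (\<lambda>h. of_real h)) (at s)"
        by (auto intro!: derivative_eq_intros)
      then show ?thesis by (simp add: Complex_eq)
    qed
    ultimately have d: "((\<lambda>s. v (Complex s t)) has_derivative (\<lambda>h. frechet_derivative v (at (Complex s t)) (of_real h))) (at s)"
      using has_derivative_compose by blast
    have "frechet_derivative v (at w) (complex_of_real h) = frechet_derivative v (at w) 1 * h" for w h
      using linear_cmul[OF linear_frechet_derivative[OF smooth_differentiable[OF v]], of w h 1] by (simp add: scaleR_conv_of_real)
    then show ?thesis using d by (simp add: has_field_derivative_def pd_def)
  qed
  have 2: "((\<lambda>t. v (Complex s t)) has_real_derivative pd \<i> v (Complex s t)) (at t)" if v: "smooth v" for v :: "complex => real" and s t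
  proof -
    have "(v has_derivative frechet_derivative v (at (Complex s t))) (at (Complex s t))"
      using smooth_differentiable[OF v] by (simp add: frechet_derivative_works)
    moreover have "((\<lambda>t. Complex s t) has_derivative (\<lambda>h. \<i> * of_real h)) (at t)"
    proof -
      have "((\<lambda>t. of_real s + \<i> * of_real t) has_derivative (\<lambda>h. \<i> * of_real h)) (at t)"
        by (auto intro!: derivative_eq_intros)
      then show ?thesis by (simp add: Complex_eq)
    qed
    ultimately have d: "((\<lambda>t. v (Complex s t)) has_derivative (\<lambda>h. frechet_derivative v (at (Complex s t)) (\<i> * of_real h))) (at t)"
      using has_derivative_compose by blast
    have "frechet_derivative v (at w) (\<i> * complex_of_real h) = frechet_derivative v (at w) \<i> * h" for w h
      using linear_cmul[OF linear_frechet_derivative[OF smooth_differentiable[OF v]], of w h \<i>]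
      by (simp add: scaleR_conv_of_real mult.commute)
    then show ?thesis using d by (simp add: has_field_derivative_def pd_def)
  qed
  define p where "p = pd \<i> (pd 1 u)"
  define q where "q = pd 1 (pd \<i> u)"
  have sm: "smooth (pd 1 u)" "smooth (pd \<i> u)" using u by (simp_all add: smooth_pd_basis)
  have cont: "isCont p z" "isCont q z"
    using smooth_continuous[OF smooth_pd_basis(2)[OF sm(1)], of UNIV] smooth_continuous[OF smooth_pd_basis(1)[OF sm(2)], of UNIV]
    by (simp_all add: p_def q_def continuous_on_eq_continuous_at)
  show ?thesis
  proof (rule ccontr)
    assume "\<not> ?thesis"
    then have e: "\<bar>p z - q z\<bar> / 2 > 0" by (simp add: p_def q_def)
    define e where "e = \<bar>p z - q z\<bar> / 2"
    obtain d1 where d1: "d1 > 0" "!!w. dist w z < d1 ==> dist (p w) (p z) < e"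
      using cont(1) e unfolding e_def[symmetric] continuous_at_eps_delta by metis
    obtain d2 where d2: "d2 > 0" "!!w. dist w z < d2 ==> dist (q w) (q z) < e"
      using cont(2) e unfolding e_def[symmetric] continuous_at_eps_delta by metis
    define h where "h = min d1 d2 / 2"
    have h: "h > 0" using d1 d2 by (simp add: h_def)
    define a b where "a = Re z" and "b = Im z"
    obtain s t where st: "a < s" "s < a + h" "b < t" "t < b + h"
      "u (Complex (a + h) (b + h)) - u (Complex a (b + h)) - u (Complex (a + h) b) + u (Complex a b) = h * h * p (Complex s t)"
      using mixed_difference[of "\<lambda>s t. u (Complex s t)" "\<lambda>s t. pd 1 u (Complex s t)" "\<lambda>s t. p (Complex s t)" h a b]
        1[OF u] 2[OF sm(1)] h unfolding p_def by blast
    obtain s' t' where st': "b < s'" "s' < b + h" "a < t'" "t' < a + h"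
      "u (Complex (a + h) (b + h)) - u (Complex (a + h) b) - u (Complex a (b + h)) + u (Complex a b) = h * h * q (Complex t' s')"
      using mixed_difference[of "\<lambda>s t. u (Complex t s)" "\<lambda>s t. pd \<i> u (Complex t s)" "\<lambda>s t. q (Complex t s)" h b a]
        2[OF u] 1[OF sm(2)] h unfolding q_def by blast
    have "h * h * p (Complex s t) = h * h * q (Complex t' s')" using st(5) st'(5) by linarith
    then have pq: "p (Complex s t) = q (Complex t' s')" using h by simp
    have near: "dist (Complex x y) z < 2 * h" if "a < x" "x < a + h" "b < y" "y < b + h" for x y
    proof -
      have "norm (Complex x y - z) \<le> \<bar>Re (Complex x y - z)\<bar> + \<bar>Im (Complex x y - z)\<bar>" by (rule cmod_le)
      also have "\<dots> < 2 * h" using that by (simp add: a_def b_def)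
      finally show ?thesis by (simp add: dist_norm)
    qed
    have h2: "2 * h \<le> d1" "2 * h \<le> d2" by (simp_all add: h_def)
    have "dist (p (Complex s t)) (p z) < e" "dist (q (Complex t' s')) (q z) < e"
      using d1(2) d2(2) near[OF st(1-4)] near[OF st'(3,4,1,2)] h2 by (meson less_le_trans)+
    then have "\<bar>p z - q z\<bar> < 2 * e" unfolding pq dist_real_def by linarith
    then show False by (simp add: e_def)
  qed
qed

lemma pd_ReIm:
  fixes f :: "complex => complex"
  assumes "f differentiable (at z)"
  shows "Re (pd t f z) = pd t (\<lambda>w. Re (f w)) z" "Im (pd t f z) = pd t (\<lambda>w. Im (f w)) z"
proof -
  have d: "(f has_derivative frechet_derivative f (at z)) (at z)" using assms by (simp add: frechet_derivative_works)
  show "Re (pd t f z) = pd t (\<lambda>w. Re (f w)) z" "Im (pd t f z) = pd t (\<lambda>w. Im (f w)) z"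
    unfolding pd_def using frechet_derivative_at[OF has_derivative_Re[OF d]] frechet_derivative_at[OF has_derivative_Im[OF d]]
    by (simp_all flip: frechet_derivative_at[OF has_derivative_Re[OF d]] frechet_derivative_at[OF has_derivative_Im[OF d]])
qed

lemma mixed_partials:
  fixes f :: "complex => complex"
  assumes f: "smooth f"
  shows "pd \<i> (pd 1 f) z = pd 1 (pd \<i> f) z"
proof -
  have R: "smooth (\<lambda>w. Re (f w))" "smooth (\<lambda>w. Im (f w))"
    using smooth_bounded_linear[OF bounded_linear_Re f] smooth_bounded_linear[OF bounded_linear_Im f] by auto
  have d: "f differentiable (at w)" "pd 1 f differentiable (at w)" "pd \<i> f differentiable (at w)" for w
    using f by (auto intro: smooth_differentiable smooth_pd_basis)
  have e: "(\<lambda>w. Re (pd t f w)) = pd t (\<lambda>w. Re (f w))" "(\<lambda>w. Im (pd t f w)) = pd t (\<lambda>w. Im (f w))" for t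
    using pd_ReIm[OF d(1)] by auto
  show ?thesis
    by (rule complex_eqI) (simp_all add: pd_ReIm d e mixed_partials_real R)
qed

lemma dz_dzbar_commute:
  assumes f: "smooth f"
  shows "dzbar (dz f) z = dz (dzbar f) z" "4 * dzbar (dz f) z = pd 1 (pd 1 f) z + pd \<i> (pd \<i> f) z"
proof -
  have D: "(pd 1 f has_derivative frechet_derivative (pd 1 f) (at z)) (at z)" "(pd \<i> f has_derivative frechet_derivative (pd \<i> f) (at z)) (at z)"
    using f by (auto simp: frechet_derivative_works[symmetric] intro: smooth_differentiable smooth_pd_basis)
  have 1: "pd t (dz f) z = (pd t (pd 1 f) z - \<i> * pd t (pd \<i> f) z) / 2" for t
  proof -
    have d: "(dz f has_derivative (\<lambda>t. (frechet_derivative (pd 1 f) (at z) t - \<i> * frechet_derivative (pd \<i> f) (at z) t) / 2)) (at z)"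
      unfolding dz_def[abs_def] divide_inverse by (rule has_derivative_mult_left[OF has_derivative_diff[OF D(1) has_derivative_mult_right[OF D(2)]]])
    show ?thesis unfolding pd_def frechet_derivative_at[OF d, symmetric] ..
  qed
  have 2: "pd t (dzbar f) z = (pd t (pd 1 f) z + \<i> * pd t (pd \<i> f) z) / 2" for t
  proof -
    have d: "(dzbar f has_derivative (\<lambda>t. (frechet_derivative (pd 1 f) (at z) t + \<i> * frechet_derivative (pd \<i> f) (at z) t) / 2)) (at z)"
      unfolding dzbar_def[abs_def] divide_inverse by (rule has_derivative_mult_left[OF has_derivative_add[OF D(1) has_derivative_mult_right[OF D(2)]]])
    show ?thesis unfolding pd_def frechet_derivative_at[OF d, symmetric] ..
  qed
  have "((a - \<i> * b) / 2 + \<i> * ((b - \<i> * d) / 2)) / 2 = ((a + \<i> * b) / 2 - \<i> * ((b + \<i> * d) / 2)) / 2"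
    "4 * (((a - \<i> * b) / 2 + \<i> * ((b - \<i> * d) / 2)) / 2) = a + d" for a b d
    by (simp_all add: complex_eq_iff field_simps)
  then show "dzbar (dz f) z = dz (dzbar f) z" "4 * dzbar (dz f) z = pd 1 (pd 1 f) z + pd \<i> (pd \<i> f) z"
    unfolding dz_def[of "dzbar f"] dzbar_def[of "dz f"] 1 2 mixed_partials[OF f] by blast+
qed

lemma bounded_chart_infinity:
  fixes g :: "complex => real"
  assumes "continuous_on UNIV g"
  obtains C where "C > 0" "!!z. 1 \<le> norm z ==> \<bar>g (1 / z)\<bar> \<le> C"
proof -
  have "compact (g ` cball 0 1)" by (rule compact_continuous_image) (auto intro: continuous_on_subset[OF assms])
  then have "bounded (g ` cball 0 1)" by (rule compact_imp_bounded)
  then have "\<exists>C. \<forall>w\<in>cball 0 1. \<bar>g w\<bar> \<le> C" unfolding bounded_iff by simp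
  then obtain C where C: "\<forall>w\<in>cball 0 1. \<bar>g w\<bar> \<le> C" by (rule exE)
  show ?thesis
  proof (rule that[of "\<bar>C\<bar> + 1"])
    show "\<bar>g (1 / z)\<bar> \<le> \<bar>C\<bar> + 1" if z: "1 \<le> norm z" for z
    proof -
      have "norm (1 / z) \<le> 1" using z by (auto simp: norm_divide intro: divide_le_eq_1[THEN iffD2])
      then show ?thesis using bspec[OF C, of "1 / z"] by simp
    qed
  qed simp
qed

lemma entire_bounded_off_disc_constant:
  assumes f: "f holomorphic_on UNIV" and b: "!!z. 1 \<le> norm z ==> norm (f z) \<le> C"
  shows "f z = f w"
proof -
  have "compact (f ` cball 0 1)"
    by (rule compact_continuous_image) (auto intro: continuous_on_subset[OF holomorphic_on_imp_continuous_on[OF f]])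
  then have "bounded (f ` cball 0 1)" by (rule compact_imp_bounded)
  then have "\<exists>C. \<forall>w\<in>cball 0 1. norm (f w) \<le> C" unfolding bounded_iff by simp
  then obtain C' where C': "\<forall>w\<in>cball 0 1. norm (f w) \<le> C'" by (rule exE)
  have "norm (f z) \<le> max C C'" for z using b[of z] bspec[OF C', of z] by (cases "1 \<le> norm z") auto
  then have "bounded (range f)" unfolding bounded_iff by blast
  then obtain c where "!!z. f z = c" using Liouville_theorem[OF f] by (metis constant_on_def UNIV_I)
  then show ?thesis by simp
qed

text \<open>The harmonic function \<open>\<ell>\<close> is twice the real part of an entire function \<open>H\<close>; by Liouville one of
  \<open>exp (2 H)\<close> and \<open>exp (- 2 H)\<close> is constant.\<close>

lemma harmonic_log_growth_constant:
  fixes l :: "complex => real"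
  assumes l: "!!z. has_wd (\<lambda>z. of_real (l z)) (h z) (cnj (h z)) z" and h: "!!z. \<exists>a. has_wd h a 0 z"
    and g: "!!z. 1 \<le> norm z ==> \<bar>l z - m * ln (norm z)\<bar> \<le> C"
  shows "l z = l w" "m = 0"
proof -
  have "h holomorphic_on UNIV" unfolding holomorphic_on_open[OF open_UNIV] using h by (auto simp: has_wd_field_derivative)
  then obtain H where H: "!!z. (H has_field_derivative h z) (at z)"
    using holomorphic_convex_primitive'[of UNIV h] by auto
  have Hh: "H holomorphic_on UNIV" unfolding holomorphic_on_open[OF open_UNIV] using H by blast
  have "has_wd (\<lambda>z. of_real (l z) - (H z + cnj (H z))) 0 0 z" for z
  proof -
    have "has_wd H (h z) 0 z" using H by (simp add: has_wd_field_derivative)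
    from has_wd_diff[OF l has_wd_add[OF this has_wd_cnj[OF this]]] show ?thesis by simp
  qed
  from has_wd_zero_imp_constant[OF this]
  have c: "of_real (l z) - (H z + cnj (H z)) = of_real (l 0) - (H 0 + cnj (H 0))" for z by blast
  define c0 where "c0 = l 0 - 2 * Re (H 0)"
  have lH: "l z = 2 * Re (H z) + c0" for z using arg_cong[OF c[of z], of Re] by (simp add: c0_def)
  \<comment> \<open>The sign that makes \<open>s * m * ln (norm z)\<close> nonpositive outside the
    unit disc, so that \<open>exp (2 * s * H)\<close> is bounded.\<close>
  define s :: real where "s = (if m \<le> 0 then 1 else -1)"
  have "exp (of_real (2 * s) * H z) = exp (of_real (2 * s) * H w)" for z w
  proof (rule entire_bounded_off_disc_constant[where f = "\<lambda>z. exp (of_real (2 * s) * H z)"])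
    show "(\<lambda>z. exp (of_real (2 * s) * H z)) holomorphic_on UNIV" by (intro holomorphic_intros Hh)
    show "norm (exp (of_real (2 * s) * H z)) \<le> exp (C + \<bar>c0\<bar>)" if z: "1 \<le> norm z" for z
    proof -
      have n: "0 \<le> ln (norm z)" using z by simp
      have "s * (m * ln (norm z)) \<le> 0" using n by (auto simp: s_def mult_nonpos_nonneg)
      moreover have "s * (l z - m * ln (norm z)) \<le> C" using g[OF z] by (auto simp: s_def)
      ultimately have "s * l z \<le> C" by (simp add: right_diff_distrib)
      moreover have "s * c0 \<ge> - \<bar>c0\<bar>" by (auto simp: s_def)
      ultimately have "2 * s * Re (H z) \<le> C + \<bar>c0\<bar>" unfolding lH by (simp add: algebra_simps)
      then show ?thesis by simp
    qed
  qed
  from arg_cong[OF this, of norm] have "s * Re (H z) = s * Re (H w)" for z w by simp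
  moreover have "s ~= 0" by (simp add: s_def)
  ultimately have "Re (H z) = Re (H w)" for z w by simp
  then have cl: "l z = l w" for z w unfolding lH by simp
  then show "l z = l w" .
  show "m = 0"
  proof (rule ccontr)
    assume m: "m ~= 0"
    \<comment> \<open>A radius \<open>exp y\<close> at which the logarithmic term alone exceeds what
      the bound \<open>C\<close> and the constant value of \<open>l\<close> allow.\<close>
    define y where "y = (C + \<bar>l 0\<bar> + 1) / \<bar>m\<bar>"
    have C: "C \<ge> 0" using g[of 1] by simp
    then have y: "y \<ge> 0" by (simp add: y_def)
    have "norm (complex_of_real (exp y)) = exp y" by simp
    then have "\<bar>l 0 - m * y\<bar> \<le> C" using g[of "of_real (exp y)"] y cl[of "of_real (exp y)" 0] by simp
    moreover have "\<bar>m * y\<bar> = C + \<bar>l 0\<bar> + 1" using m C by (simp add: y_def abs_mult)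
    ultimately show False by linarith
  qed
qed

lemma has_wd_ln:
  fixes E :: "complex => real"
  assumes E: "has_wd (\<lambda>w. of_real (E w)) a b z" and pos: "E z > 0"
  shows "has_wd (\<lambda>w. of_real (ln (E w))) (a / of_real (E z)) (b / of_real (E z)) z" "b = cnj a"
proof -
  have "has_wd (\<lambda>w. of_real (ln (E w))) (of_real (1 / E z) * a) (of_real (1 / E z) * b) z"
    by (rule has_wd_real_fun[OF E]) (use pos in \<open>auto intro!: derivative_eq_intros\<close>)
  then show "has_wd (\<lambda>w. of_real (ln (E w))) (a / of_real (E z)) (b / of_real (E z)) z" by simp
  have "has_wd (\<lambda>w. of_real (E w)) (cnj b) (cnj a) z" using has_wd_cnj[OF E] by simp
  from has_wd_unique[OF E this] show "b = cnj a" by (rule conjunct2)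
qed

text \<open>The Schwarzian-type expression \<open>P' - P\<^sup>2 / 2\<close> with \<open>P = E'/E\<close> is an entire function vanishing at
  infinity; its vanishing says that \<open>E\<^sup>-\<^sup>1\<^sup>/\<^sup>2\<close> is annihilated by \<open>\<partial>\<^sub>z\<^sup>2\<close>.\<close>

lemma constant_curvature_metric:
  fixes E E1 :: "complex => real" and \<kappa> :: real
  assumes sE: "smooth (\<lambda>z. complex_of_real (E z))" and sE1: "smooth (\<lambda>z. complex_of_real (E1 z))"
    and pos: "!!z. E z > 0" "!!z. E1 z > 0"
    and trans: "!!z. z ~= 0 ==> E z * (norm z) ^ 4 = E1 (1 / z)"
    and curv: "!!z. \<exists>a. has_wd (\<lambda>w. dz (\<lambda>z. of_real (E z)) w / of_real (E w)) a (- of_real (\<kappa> * E z)) z"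
  obtains \<alpha> \<gamma> :: real and \<beta> :: complex where "!!z. E z * (\<alpha> + 2 * Re (\<beta> * z) + \<gamma> * (norm z)\<^sup>2)\<^sup>2 = 1"
    "!!z. \<alpha> + 2 * Re (\<beta> * z) + \<gamma> * (norm z)\<^sup>2 > 0"
proof -
  define D where "D = dz (\<lambda>z. of_real (E z))"
  define D2 where "D2 = dz D"
  define P where "P = (\<lambda>z. D z / of_real (E z))"
  have sD: "smooth D" "smooth D2" using sE by (simp_all add: D_def D2_def smooth_dz)
  have dE: "has_wd (\<lambda>z. of_real (E z)) (D z) (cnj (D z)) z" for z
    using smooth_has_wd[OF sE, of z] has_wd_ln(2)[OF smooth_has_wd[OF sE] pos(1), of z] by (simp add: D_def)
  define E' where "E' = (\<lambda>z. complex_of_real (E z))"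
  have nE: "E' z ~= 0" for z using pos(1)[of z] by (simp add: E'_def)
  have cE: "cnj (E' z) = E' z" for z by (simp add: E'_def)
  have dE': "has_wd E' (D z) (cnj (D z)) z" for z using dE by (simp add: E'_def)
  \<comment> \<open>\<open>R\<close> is the \<open>dz\<close> derivative of \<open>P\<close>; its
    \<open>dzbar\<close> derivative is prescribed by the curvature equation.\<close>
  define R where "R = (\<lambda>z. D2 z / E' z - P z * P z)"
  have dP: "has_wd P (R z) (- of_real (\<kappa> * E z)) z" for z
  proof -
    from has_wd_divide[OF smooth_has_wd[OF sD(1)] dE' nE]
    have "\<exists>b. has_wd (\<lambda>w. D w / E' w) ((D2 z * E' z - D z * D z) / (E' z)\<^sup>2) b z" unfolding D2_def by blast
    moreover have "(D2 z * E' z - D z * D z) / (E' z)\<^sup>2 = R z" using nE by (simp add: R_def P_def E'_def field_simps power2_eq_square)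
    moreover obtain a where "has_wd P a (- of_real (\<kappa> * E z)) z" using curv[of z] unfolding P_def D_def by blast
    ultimately show ?thesis unfolding P_def E'_def using has_wd_unique by metis
  qed
  have D2bar: "dzbar D2 z = dz (dzbar D) z" for z unfolding D2_def by (rule dz_dzbar_commute(1)[OF sD(1)])
  have dbarD: "dzbar D z = E' z * (P z * cnj (P z) - of_real \<kappa> * E' z)" for z
  proof -
    have "D = (\<lambda>z. P z * E' z)" using nE by (auto simp: P_def E'_def)
    then show ?thesis using has_wd_dzbar[OF has_wd_mult[OF dP[of z] dE'[of z]]] nE[of z]
      by (simp add: E'_def P_def algebra_simps)
  qed
  have dbarD2: "dzbar D2 z = D z * (P z * cnj (P z) - of_real \<kappa> * E' z) + E' z * (R z * cnj (P z) + P z * (- of_real \<kappa> * E' z) - of_real \<kappa> * D z)" for z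
  proof -
    have cP: "has_wd (\<lambda>z. cnj (P z)) (- of_real \<kappa> * E' z) (cnj (R z)) z" using has_wd_cnj[OF dP[of z]] by (simp add: E'_def)
    have "has_wd (\<lambda>z. E' z * (P z * cnj (P z) - of_real \<kappa> * E' z))
       (D z * (P z * cnj (P z) - of_real \<kappa> * E' z) + E' z * ((R z * cnj (P z) + P z * (- of_real \<kappa> * E' z)) - (0 * E' z + of_real \<kappa> * D z)))
       (cnj (D z) * (P z * cnj (P z) - of_real \<kappa> * E' z) + E' z * (((- of_real (\<kappa> * E z)) * cnj (P z) + P z * cnj (R z)) - (0 * E' z + of_real \<kappa> * cnj (D z)))) z"
      by (intro has_wd_mult has_wd_diff dE' dP cP has_wd_const)
    from has_wd_dz[OF this] show ?thesis unfolding D2bar dbarD[abs_def] by (simp add: algebra_simps)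
  qed
  \<comment> \<open>With \<open>\<phi> = 1 / sqrt E\<close> one has
    \<open>dz (dz \<phi>) = - \<Theta> \<phi> / 2\<close>. Holomorphy of \<Theta>:
    \<open>dzbar (dz P) = dz (- \<kappa> E) = - \<kappa> E P\<close>, which is also the
    \<open>dzbar\<close> derivative of \<open>P\<^sup>2 / 2\<close>.\<close>
  define \<Theta> where "\<Theta> = (\<lambda>z. R z - P z * P z / 2)"
  have \<Theta>h: "has_wd \<Theta> (dz \<Theta> z) 0 z" for z
  proof -
    have d2: "has_wd D2 (dz D2 z) (dzbar D2 z) z" by (rule smooth_has_wd[OF sD(2)])
    have "\<exists>a. has_wd \<Theta> a ((dzbar D2 z * E' z - D2 z * cnj (D z)) / (E' z)\<^sup>2 - ((- of_real (\<kappa> * E z)) * P z + P z * (- of_real (\<kappa> * E z)))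
        - (((- of_real (\<kappa> * E z)) * P z + P z * (- of_real (\<kappa> * E z))) * 2 - P z * P z * 0) / 2\<^sup>2) z"
      unfolding \<Theta>_def R_def by (rule exI) (rule has_wd_diff has_wd_divide has_wd_mult d2 dE' dP nE has_wd_const | simp)+
    then obtain a where a: "has_wd \<Theta> a ((dzbar D2 z * E' z - D2 z * cnj (D z)) / (E' z)\<^sup>2 - ((- of_real (\<kappa> * E z)) * P z + P z * (- of_real (\<kappa> * E z)))
        - (((- of_real (\<kappa> * E z)) * P z + P z * (- of_real (\<kappa> * E z))) * 2 - P z * P z * 0) / 2\<^sup>2) z" by blast
    have e: "D z = P z * E' z" "cnj (D z) = cnj (P z) * E' z" "D2 z = (R z + P z * P z) * E' z" "complex_of_real (E z) = E' z"
      using nE[of z] by (simp_all add: P_def E'_def R_def)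
    have "(dzbar D2 z * E' z - D2 z * cnj (D z)) / (E' z)\<^sup>2 - ((- of_real (\<kappa> * E z)) * P z + P z * (- of_real (\<kappa> * E z)))
        - (((- of_real (\<kappa> * E z)) * P z + P z * (- of_real (\<kappa> * E z))) * 2 - P z * P z * 0) / 2\<^sup>2 = 0"
      unfolding dbarD2 of_real_mult e(4) unfolding e(1,2,3) using nE[of z] by (simp add: field_simps power2_eq_square cE)
    then have "has_wd \<Theta> a 0 z" using a by simp
    then show ?thesis using has_wd_dz by fastforce
  qed
  define D1 where "D1 = dz (\<lambda>z. of_real (E1 z))"
  define E1' where "E1' = (\<lambda>z. complex_of_real (E1 z))"
  define P1 where "P1 = (\<lambda>z. D1 z / E1' z)"
  define R1 where "R1 = (\<lambda>z. dz D1 z / E1' z - P1 z * P1 z)"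
  have nE1: "E1' z ~= 0" for z using pos(2)[of z] by (simp add: E1'_def)
  have sD1: "smooth D1" "smooth (dz D1)" "smooth E1'" using sE1 by (simp_all add: D1_def E1'_def smooth_dz)
  have dE1: "has_wd E1' (D1 z) (dzbar E1' z) z" for z using smooth_has_wd[OF sD1(3), of z] by (simp add: D1_def E1'_def)
  have dP1: "\<exists>b. has_wd P1 (R1 z) b z" for z
  proof -
    from has_wd_divide[OF smooth_has_wd[OF sD1(1)] dE1 nE1]
    have "\<exists>b. has_wd (\<lambda>w. D1 w / E1' w) ((dz D1 z * E1' z - D1 z * D1 z) / (E1' z)\<^sup>2) b z" by blast
    moreover have "(dz D1 z * E1' z - D1 z * D1 z) / (E1' z)\<^sup>2 = R1 z" using nE1 by (simp add: R1_def P1_def field_simps power2_eq_square)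
    ultimately show ?thesis unfolding P1_def by simp
  qed
  have inv: "((\<lambda>z. 1 / z) has_field_derivative (- 1 / z\<^sup>2)) (at z)" if "z ~= 0" for z :: complex
    using that by (auto intro!: derivative_eq_intros simp: power2_eq_square)
  \<comment> \<open>\<open>P\<close> transforms like a connection under z to 1 / z: the factor |z|^4
    of the metric contributes the inhomogeneous term.\<close>
  have Pz: "P z = - 2 / z - P1 (1 / z) / z\<^sup>2" if z: "z ~= 0" for z
  proof -
    define Q Qb where "Q = D z * (z * z * (cnj z * cnj z)) + E' z * ((1 * z + z * 1) * (cnj z * cnj z) + z * z * (0 * cnj z + cnj z * 0))"
      and "Qb = cnj (D z) * (z * z * (cnj z * cnj z)) + E' z * ((0 * z + z * 0) * (cnj z * cnj z) + z * z * (cnj 1 * cnj z + cnj z * cnj 1))"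
    have i: "has_wd (\<lambda>z. z) 1 0 z" "has_wd cnj 0 (cnj 1) z" using has_wd_ident has_wd_cnj[OF has_wd_ident] by auto
    have 1: "has_wd (\<lambda>z. E' z * (z * z * (cnj z * cnj z))) Q Qb z" unfolding Q_def Qb_def
      by (rule has_wd_mult[OF dE' has_wd_mult[OF has_wd_mult[OF i(1) i(1)] has_wd_mult[OF i(2) i(2)]]])
    have eq: "E' w * (w * w * (cnj w * cnj w)) = E1' (1 / w)" if w: "w \<in> - {0}" for w
    proof -
      have "complex_of_real (E w * (norm w) ^ 4) = E1' (1 / w)" using trans[of w] w by (simp add: E1'_def)
      moreover have "complex_of_real ((norm w) ^ 4) = w * w * (cnj w * cnj w)"
      proof -
        have "(norm w) ^ 4 = ((norm w)\<^sup>2)\<^sup>2" by (simp flip: power_mult)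
        then have "complex_of_real ((norm w) ^ 4) = (complex_of_real ((norm w)\<^sup>2))\<^sup>2" by (simp only: of_real_power)
        then show ?thesis unfolding complex_norm_square by (simp add: power2_eq_square mult_ac)
      qed
      ultimately show "E' w * (w * w * (cnj w * cnj w)) = E1' (1 / w)" by (simp add: E'_def)
    qed
    have zz: "z \<in> - {0}" using z by simp
    have 2: "has_wd (\<lambda>z. E1' (1 / z)) Q Qb z" by (rule has_wd_transform[OF 1 _ zz eq]) auto
    have 3: "has_wd (\<lambda>z. E1' (1 / z)) (D1 (1 / z) * (- 1 / z\<^sup>2)) (dzbar E1' (1 / z) * cnj (- 1 / z\<^sup>2)) z"
      by (rule has_wd_compose_holo[OF inv[OF z] dE1])
    have "Q = D1 (1 / z) * (- 1 / z\<^sup>2)" using has_wd_unique[OF 2 3] by (rule conjunct1)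
    then have "D z * (z * z * (cnj z * cnj z)) + E' z * (2 * z * (cnj z * cnj z)) = - D1 (1 / z) / z\<^sup>2" by (simp add: Q_def)
    moreover have "E1' (1 / z) = E' z * (z * z * (cnj z * cnj z))" by (rule eq[OF zz, symmetric])
    moreover have "D z = P z * E' z" "D1 (1 / z) = P1 (1 / z) * E1' (1 / z)" using nE nE1 by (simp_all add: P_def E'_def P1_def)
    ultimately have "(P z * z + 2) * (E' z * z * (cnj z * cnj z)) = (- P1 (1 / z) / z) * (E' z * z * (cnj z * cnj z))"
      using z by (simp add: power2_eq_square algebra_simps)
    moreover have "E' z * z * (cnj z * cnj z) ~= 0" using nE[of z] z by simp
    ultimately have "P z * z + 2 = - P1 (1 / z) / z" by (rule mult_right_cancel[THEN iffD1, rotated])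
    then have "P z = (- P1 (1 / z) / z - 2) / z" using z by (metis add_diff_cancel_right' nonzero_mult_div_cancel_right)
    then show ?thesis using z by (simp only:) (simp add: field_simps power2_eq_square)
  qed
  \<comment> \<open>In \<Theta> the inhomogeneous terms cancel and it transforms as a quadratic
    differential, which gives the decay of order z^-4 at infinity.\<close>
  have \<Theta>z: "\<Theta> z = (R1 (1 / z) - P1 (1 / z) * P1 (1 / z) / 2) / z ^ 4" if z: "z ~= 0" for z
  proof -
    obtain b where b: "has_wd P1 (R1 (1 / z)) b (1 / z)" using dP1 by blast
    have c: "has_wd (\<lambda>z. P1 (1 / z)) (R1 (1 / z) * (- 1 / z\<^sup>2)) (b * cnj (- 1 / z\<^sup>2)) z"
      by (rule has_wd_compose_holo[OF inv[OF z] b])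
    have d: "has_wd (\<lambda>z. 1 / z) (- 1 / z\<^sup>2) 0 z" using inv[OF z] by (simp add: has_wd_field_derivative)
    have "has_wd (\<lambda>z. - 2 * (1 / z) - P1 (1 / z) * ((1 / z) * (1 / z)))
       ((0 * (1 / z) + - 2 * (- 1 / z\<^sup>2)) - (R1 (1 / z) * (- 1 / z\<^sup>2) * ((1 / z) * (1 / z)) + P1 (1 / z) * ((- 1 / z\<^sup>2) * (1 / z) + (1 / z) * (- 1 / z\<^sup>2))))
       ((0 * (1 / z) + - 2 * 0) - (b * cnj (- 1 / z\<^sup>2) * ((1 / z) * (1 / z)) + P1 (1 / z) * (0 * (1 / z) + (1 / z) * 0))) z"
      by (intro has_wd_diff has_wd_mult has_wd_const c d)
    then have "has_wd P ((0 * (1 / z) + - 2 * (- 1 / z\<^sup>2)) - (R1 (1 / z) * (- 1 / z\<^sup>2) * ((1 / z) * (1 / z)) + P1 (1 / z) * ((- 1 / z\<^sup>2) * (1 / z) + (1 / z) * (- 1 / z\<^sup>2))))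
       ((0 * (1 / z) + - 2 * 0) - (b * cnj (- 1 / z\<^sup>2) * ((1 / z) * (1 / z)) + P1 (1 / z) * (0 * (1 / z) + (1 / z) * 0))) z"
      by (rule has_wd_transform[of _ _ _ z "- {0}"]) (use z Pz in \<open>auto simp: power2_eq_square\<close>)
    with dP[of z] have Rz: "R z = (0 * (1 / z) + - 2 * (- 1 / z\<^sup>2)) - (R1 (1 / z) * (- 1 / z\<^sup>2) * ((1 / z) * (1 / z)) + P1 (1 / z) * ((- 1 / z\<^sup>2) * (1 / z) + (1 / z) * (- 1 / z\<^sup>2)))"
      by (rule has_wd_unique[THEN conjunct1])
    show ?thesis unfolding \<Theta>_def Pz[OF z] Rz using z by (simp add: field_simps power2_eq_square power4_eq_xxxx)
  qed
  have c1: "continuous_on UNIV (\<lambda>w. norm (R1 w - P1 w * P1 w / 2))"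
    unfolding R1_def P1_def using nE1 by (intro continuous_intros smooth_continuous sD1) auto
  obtain C where C: "C > 0" "!!z. 1 \<le> norm z ==> norm (R1 (1 / z) - P1 (1 / z) * P1 (1 / z) / 2) \<le> C"
    using bounded_chart_infinity[OF c1] by auto
  have \<Theta>0: "\<Theta> z = 0" for z
  proof (rule Liouville_weak[of \<Theta> 0 z])
    show "\<Theta> holomorphic_on UNIV" unfolding holomorphic_on_open[OF open_UNIV] using \<Theta>h by (auto simp: has_wd_field_derivative)
    show "(\<Theta> \<longlongrightarrow> 0) at_infinity"
    proof (rule Lim_null_comparison)
      show "\<forall>\<^sub>F z in at_infinity. norm (\<Theta> z) \<le> C * norm (inverse z)"
        unfolding eventually_at_infinity
      proof (intro exI[of _ 1] allI impI)
        fix z :: complex assume z: "1 \<le> norm z"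
        then have zn: "z ~= 0" by auto
        have "norm z \<le> norm z ^ 4" using z by (simp add: self_le_power)
        then have "norm (\<Theta> z) \<le> C / norm z"
          unfolding \<Theta>z[OF zn] norm_divide norm_power using C z zn by (intro frac_le) auto
        then show "norm (\<Theta> z) \<le> C * norm (inverse z)" by (simp add: norm_inverse divide_inverse)
      qed
      show "((\<lambda>z::complex. C * norm (inverse z)) \<longlongrightarrow> 0) at_infinity"
        using tendsto_mult_right_zero[OF tendsto_norm_zero[OF tendsto_inverse_0]] by auto
    qed
  qed
  define \<phi> where "\<phi> = (\<lambda>z. 1 / sqrt (E z))"
  have \<phi>: "\<phi> z > 0" "E z * (\<phi> z)\<^sup>2 = 1" for z using pos(1)[of z] by (auto simp: \<phi>_def power_divide)
  define \<phi>' where "\<phi>' = (\<lambda>z. complex_of_real (\<phi> z))"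
  have d\<phi>: "has_wd \<phi>' (- (P z * \<phi>' z) / 2) (- (cnj (P z) * \<phi>' z) / 2) z" for z
  proof -
    have d: "((\<lambda>x. 1 / sqrt x) has_real_derivative (- (1 / (2 * E z * sqrt (E z))))) (at (E z))"
      using pos(1)[of z] by (auto intro!: derivative_eq_intros simp: field_simps)
    have alg: "complex_of_real (- (1 / (2 * E z * sqrt (E z)))) * x = - (x / of_real (E z) * of_real (1 / sqrt (E z))) / 2" for x
      by simp
    show ?thesis unfolding \<phi>'_def \<phi>_def
      by (rule has_wd_eq[OF has_wd_real_fun[OF dE d]]) (simp_all only: alg P_def complex_cnj_divide complex_cnj_complex_of_real)
  qed
  \<comment> \<open>The derivatives of \<phi>: \<open>\<beta>'\<close> is \<open>dz \<phi>\<close>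
    and \<open>\<gamma>'\<close> is \<open>dzbar (dz \<phi>)\<close>, both written through
    \<open>P\<close> and \<open>E\<close>.\<close>
  define \<beta>' where "\<beta>' = (\<lambda>z. - (P z * \<phi>' z) / 2)"
  define \<gamma>' where "\<gamma>' = (\<lambda>z. of_real (\<kappa> * E z) * \<phi>' z / 2 + P z * cnj (P z) * \<phi>' z / 4)"
  have d\<beta>: "has_wd \<beta>' 0 (\<gamma>' z) z" for z
  proof -
    have h: "has_wd (\<lambda>z. (- 1 / 2) * (P z * \<phi>' z)) (0 * (P z * \<phi>' z) + (- 1 / 2) * (R z * \<phi>' z + P z * (- (P z * \<phi>' z) / 2)))
       (0 * (P z * \<phi>' z) + (- 1 / 2) * ((- of_real (\<kappa> * E z)) * \<phi>' z + P z * (- (cnj (P z) * \<phi>' z) / 2))) z"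
      by (intro has_wd_mult has_wd_const dP d\<phi>)
    have Rz: "R z = P z * P z / 2" using \<Theta>0[of z] by (simp add: \<Theta>_def)
    have fe: "\<beta>' = (\<lambda>z. (- 1 / 2) * (P z * \<phi>' z))" by (simp add: \<beta>'_def fun_eq_iff)
    show ?thesis unfolding fe by (rule has_wd_eq[OF h]) (simp_all add: Rz \<gamma>'_def field_simps)
  qed
  \<comment> \<open>\<open>cnj \<beta>'\<close> is entire, so its derivative
    \<open>cnj \<gamma>'\<close> is holomorphic; being real as well, \<open>\<gamma>'\<close> is
    constant. Integrating twice yields the Hermitian form.\<close>
  have "has_wd \<gamma>' 0 0 z" for z
  proof -
    have "has_wd (\<lambda>z. cnj (\<beta>' z)) (cnj (\<gamma>' w)) 0 w" for w using has_wd_cnj[OF d\<beta>[of w]] by simp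
    then have "!!w. ((\<lambda>z. cnj (\<beta>' z)) has_field_derivative cnj (\<gamma>' w)) (at w)" by (simp add: has_wd_field_derivative)
    then have "deriv (\<lambda>z. cnj (\<beta>' z)) = (\<lambda>w. cnj (\<gamma>' w))" "(\<lambda>z. cnj (\<beta>' z)) holomorphic_on UNIV"
      unfolding holomorphic_on_open[OF open_UNIV] by (auto intro: DERIV_imp_deriv)
    then have "(\<lambda>w. cnj (\<gamma>' w)) holomorphic_on UNIV" using holomorphic_deriv[OF _ open_UNIV] by metis
    then obtain a where "((\<lambda>w. cnj (\<gamma>' w)) has_field_derivative a) (at z)"
      unfolding holomorphic_on_open[OF open_UNIV] by blast
    then have 1: "has_wd (\<lambda>w. cnj (\<gamma>' w)) a 0 z" by (simp add: has_wd_field_derivative)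
    have "cnj (\<gamma>' w) = \<gamma>' w" for w by (simp add: \<gamma>'_def \<phi>'_def mult_ac)
    then have 2: "has_wd \<gamma>' a 0 z" "has_wd \<gamma>' 0 (cnj a) z" using 1 has_wd_cnj[OF 1] by auto
    from has_wd_unique[OF this] 2 show ?thesis by simp
  qed
  from has_wd_zero_imp_constant[OF this] have g0: "\<gamma>' z = \<gamma>' 0" for z .
  define \<gamma> where "\<gamma> = Re (\<gamma>' 0)"
  have g: "\<gamma>' z = of_real \<gamma>" for z
  proof -
    have "cnj (\<gamma>' 0) = \<gamma>' 0" by (simp add: \<gamma>'_def \<phi>'_def mult_ac)
    then show ?thesis unfolding g0[of z] \<gamma>_def by (simp add: complex_eq_iff)
  qed
  have di: "has_wd (\<lambda>z. z) 1 0 z" "has_wd cnj 0 1 z" for z using has_wd_ident has_wd_cnj[OF has_wd_ident] by auto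
  have "has_wd (\<lambda>z. \<beta>' z - of_real \<gamma> * cnj z) (0 - (0 * cnj z + of_real \<gamma> * 0)) (\<gamma>' z - (0 * cnj z + of_real \<gamma> * 1)) z" for z
    by (intro has_wd_diff has_wd_mult has_wd_const d\<beta> di)
  then have "has_wd (\<lambda>z. \<beta>' z - of_real \<gamma> * cnj z) 0 0 z" for z by (simp add: g)
  from has_wd_zero_imp_constant[OF this] have b0: "\<beta>' z - of_real \<gamma> * cnj z = \<beta>' 0 - of_real \<gamma> * cnj 0" for z .
  define \<beta> where "\<beta> = \<beta>' 0"
  have b: "\<beta>' z = \<beta> + of_real \<gamma> * cnj z" for z using b0[of z] by (simp add: \<beta>_def algebra_simps)
  define \<eta> where "\<eta> = (\<lambda>z. \<phi>' z - (\<beta> * z + cnj \<beta> * cnj z + of_real \<gamma> * (z * cnj z)))"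
  have "has_wd \<eta> 0 0 z" for z
  proof -
    have "has_wd \<eta> (\<beta>' z - ((0 * z + \<beta> * 1) + (0 * cnj z + cnj \<beta> * 0) + (0 * (z * cnj z) + of_real \<gamma> * (1 * cnj z + z * 0))))
      (cnj (\<beta>' z) - ((0 * z + \<beta> * 0) + (0 * cnj z + cnj \<beta> * 1) + (0 * (z * cnj z) + of_real \<gamma> * (0 * cnj z + z * 1)))) z"
      unfolding \<eta>_def
      by (intro has_wd_diff has_wd_add has_wd_mult has_wd_const di has_wd_eq[OF d\<phi>]) (simp_all add: \<beta>'_def \<phi>'_def)
    then show ?thesis by (simp add: b)
  qed
  from has_wd_zero_imp_constant[OF this] have c0: "\<eta> z = \<eta> 0" for z .
  have "\<phi> z = \<phi> 0 + 2 * Re (\<beta> * z) + \<gamma> * (norm z)\<^sup>2" for z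
  proof -
    have "\<phi>' z = \<phi>' 0 + (\<beta> * z + cnj \<beta> * cnj z + of_real \<gamma> * (z * cnj z))"
      using c0[of z] by (simp add: \<eta>_def algebra_simps)
    from arg_cong[OF this, of Re] show ?thesis by (simp add: \<phi>'_def cmod_power2) (simp add: power2_eq_square)
  qed
  then show ?thesis using that[of "\<phi> 0" \<beta> \<gamma>] \<phi> by metis
qed

text \<open>The function \<open>E e\<^sup>\<kappa>\<close> has harmonic logarithm of logarithmic growth, so it is constant and
  \<open>\<kappa> = 1/2\<close>.\<close>

lemma constant_curvature_potential:
  fixes E E1 e e1 :: "complex => real" and \<kappa> :: real
  assumes sE: "smooth (\<lambda>z. complex_of_real (E z))"
    and pos: "!!z. E z > 0" "!!z. E1 z > 0" "!!z. e z > 0" "!!z. e1 z > 0"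
    and cont: "continuous_on UNIV E1" "continuous_on UNIV e1"
    and trans: "!!z. z ~= 0 ==> E z * (norm z) ^ 4 = E1 (1 / z)" "!!z. z ~= 0 ==> e z = (norm z) ^ 8 * e1 (1 / z)"
    and curv: "!!z. \<exists>a. has_wd (\<lambda>w. dz (\<lambda>z. of_real (E z)) w / of_real (E w)) a (- of_real (\<kappa> * E z)) z"
    and e: "!!z. has_wd (\<lambda>z. of_real (e z)) (ez z) (cnj (ez z)) z" "!!z. has_wd ez (ezz z) (ezzb z) z"
    and pot: "!!z. of_real (E z * (e z)\<^sup>2) = of_real (e z) * ezzb z - ez z * cnj (ez z)"
  obtains C where "C > 0" "!!z. (E z)\<^sup>2 * e z = C"
proof -
  define l where "l = (\<lambda>z. ln (E z) + \<kappa> * ln (e z))"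
  define h where "h = (\<lambda>z. dz (\<lambda>z. of_real (E z)) z / of_real (E z) + of_real \<kappa> * (ez z / of_real (e z)))"
  define D where "D = dz (\<lambda>z. of_real (E z))"
  have dE: "has_wd (\<lambda>z. of_real (E z)) (D z) (cnj (D z)) z" for z
    using smooth_has_wd[OF sE, of z] has_wd_ln(2)[OF smooth_has_wd[OF sE] pos(1), of z] by (simp add: D_def)
  have lh: "has_wd (\<lambda>z. of_real (l z)) (h z) (cnj (h z)) z" for z
  proof -
    have "has_wd (\<lambda>z. of_real (ln (E z)) + of_real \<kappa> * of_real (ln (e z)))
      (D z / of_real (E z) + (0 * of_real (ln (e z)) + of_real \<kappa> * (ez z / of_real (e z))))
      (cnj (D z) / of_real (E z) + (0 * of_real (ln (e z)) + of_real \<kappa> * (cnj (ez z) / of_real (e z)))) z"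
      by (intro has_wd_add has_wd_mult has_wd_const has_wd_ln(1)[OF dE pos(1)] has_wd_ln(1)[OF e(1) pos(3)])
    then show ?thesis by (simp add: l_def h_def D_def)
  qed
  \<comment> \<open>The \<open>dzbar\<close> derivative of the first term is
    \<open>- \<kappa> E\<close>; the equation for the potential says that the second contributes
    \<open>\<kappa> E\<close>.\<close>
  have hh: "\<exists>a. has_wd h a 0 z" for z
  proof -
    obtain a where a: "has_wd (\<lambda>w. dz (\<lambda>z. of_real (E z)) w / of_real (E w)) a (- of_real (\<kappa> * E z)) z" using curv by blast
    have ne: "complex_of_real (e z) ~= 0" using pos(3)[of z] by simp
    note has_wd_add[OF a has_wd_mult[OF has_wd_const[of "of_real \<kappa>"] has_wd_divide[OF e(2) e(1) ne]]]
    moreover have "(ezzb z * of_real (e z) - ez z * cnj (ez z)) / (of_real (e z))\<^sup>2 = of_real (E z)"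
      using pot[of z] ne by (simp add: field_simps)
    ultimately show ?thesis unfolding h_def by auto
  qed
  have cn: "continuous_on UNIV (\<lambda>w. ln (E1 w) + \<kappa> * ln (e1 w))"
    by (intro continuous_intros cont) (use pos in \<open>auto simp: less_le\<close>)
  obtain C where C: "!!z. 1 \<le> norm z ==> \<bar>ln (E1 (1 / z)) + \<kappa> * ln (e1 (1 / z))\<bar> \<le> C"
    by (rule bounded_chart_infinity[OF cn]) (assumption | rule that)+
  \<comment> \<open>The exponent combines |z|^-4 of \<open>E\<close> with |z|^8 of \<open>e\<close>,
    the latter weighted by \<kappa>; that it must vanish gives \<kappa> = 1/2.\<close>
  have "\<bar>l z - (8 * \<kappa> - 4) * ln (norm z)\<bar> \<le> C" if z: "1 \<le> norm z" for z
  proof -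
    have zn: "z ~= 0" "norm z > 0" using z by auto
    have "ln (E1 (1 / z)) = ln (E z) + 4 * ln (norm z)"
      using zn pos(1)[of z] by (simp add: trans(1)[OF zn(1), symmetric] ln_mult ln_realpow)
    moreover have "ln (e z) = 8 * ln (norm z) + ln (e1 (1 / z))"
      using zn pos(4)[of "1 / z"] by (simp add: trans(2)[OF zn(1)] ln_mult ln_realpow)
    ultimately have "l z - (8 * \<kappa> - 4) * ln (norm z) = ln (E1 (1 / z)) + \<kappa> * ln (e1 (1 / z))"
      by (simp add: l_def algebra_simps)
    then show ?thesis using C[OF z] by simp
  qed
  note con = harmonic_log_growth_constant[OF lh hh this]
  have k: "\<kappa> = 1 / 2" using con(2) by simp
  show ?thesis
  proof (rule that[of "exp (2 * l 0)"])
    show "(E z)\<^sup>2 * e z = exp (2 * l 0)" for z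
    proof -
      have lz: "l 0 = l z" by (rule con(1))
      have ln2: "2 * l 0 = ln ((E z)\<^sup>2 * e z)" unfolding lz using pos(1)[of z] pos(3)[of z] by (simp add: l_def k ln_mult ln_realpow)
      show ?thesis unfolding ln2 using pos(1)[of z] pos(3)[of z] by simp
    qed
  qed simp
qed

section \<open>Coefficient comparison and reduction by Moebius transformations\<close>

section \<open>Comparison of coefficients\<close>

lemma poly5_eq:
  fixes a0 a1 a2 a3 a4 c0 c1 c2 c3 c4 :: complex
  assumes "!!z. a0 + a1 * z + a2 * z ^ 2 + a3 * z ^ 3 + a4 * z ^ 4 = c0 + c1 * z + c2 * z ^ 2 + c3 * z ^ 3 + c4 * z ^ 4"
  shows "a0 = c0" "a1 = c1" "a2 = c2" "a3 = c3" "a4 = c4"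
proof -
  have e: "poly [:x0, x1, x2, x3, x4:] z = x0 + x1 * z + x2 * z ^ 2 + x3 * z ^ 3 + x4 * z ^ 4" for x0 x1 x2 x3 x4 z :: complex
    by (simp add: algebra_simps power2_eq_square power3_eq_cube power4_eq_xxxx)
  have "poly [:a0, a1, a2, a3, a4:] = poly [:c0, c1, c2, c3, c4:]" unfolding fun_eq_iff e using assms by blast
  then have "[:a0, a1, a2, a3, a4:] = [:c0, c1, c2, c3, c4:]" by (simp only: poly_eq_poly_eq_iff)
  then show "a0 = c0" "a1 = c1" "a2 = c2" "a3 = c3" "a4 = c4" by simp_all
qed

lemma constant_product:
  fixes p0 p1 p2 r0 r1 r2 C :: complex
  assumes "!!z. (p0 + p1 * z + p2 * z ^ 2) * (r0 + r1 * z + r2 * z ^ 2) = C" "C ~= 0"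
  shows "p1 = 0" "p2 = 0" "r1 = 0" "r2 = 0"
proof -
  have e: "poly [:x0, x1, x2:] z = x0 + x1 * z + x2 * z ^ 2" for x0 x1 x2 z :: complex
    by (simp add: algebra_simps power2_eq_square)
  have "poly ([:p0, p1, p2:] * [:r0, r1, r2:]) = poly [:C:]" unfolding fun_eq_iff poly_mult e using assms(1) by simp
  then have pr: "[:p0, p1, p2:] * [:r0, r1, r2:] = [:C:]" by (simp only: poly_eq_poly_eq_iff)
  then have "[:p0, p1, p2:] * [:r0, r1, r2:] ~= 0" using assms(2) by simp
  then have n: "[:p0, p1, p2:] ~= 0" "[:r0, r1, r2:] ~= 0" by (metis mult_zero_left, metis mult_zero_right)
  have "degree ([:p0, p1, p2:] * [:r0, r1, r2:]) = 0" unfolding pr by simp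
  then have "degree [:p0, p1, p2:] = 0" "degree [:r0, r1, r2:] = 0" unfolding degree_mult_eq[OF n] by simp_all
  then show "p1 = 0" "p2 = 0" "r1 = 0" "r2 = 0" by (auto split: if_splits)
qed

lemma entire_zero_on_reals:
  assumes f: "f holomorphic_on UNIV" and r: "!!r. f (complex_of_real r) = 0"
  shows "f z = 0"
proof (rule analytic_continuation[OF f open_UNIV connected_UNIV subset_UNIV UNIV_I _ _ UNIV_I, of 0 "range complex_of_real"])
  show "0 islimpt range complex_of_real"
    unfolding islimpt_approachable
  proof (intro allI impI)
    fix e :: real assume e: "0 < e"
    then show "\<exists>x'\<in>range complex_of_real. x' ~= 0 \<and> dist x' 0 < e"
      by (intro bexI[OF _ rangeI[of complex_of_real "e / 2"]]) simp
  qed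
qed (use r in auto)

text \<open>Write z = x + i y and w = x - i y with complex x and y. The hypothesis covers the real
  values of both, and the identity theorem is applied in one variable after the other.\<close>

lemma polarize:
  fixes P :: "complex => complex => complex"
  assumes x: "!!y. (\<lambda>x. P (x + \<i> * y) (x - \<i> * y)) holomorphic_on UNIV"
    and y: "!!x. (\<lambda>y. P (x + \<i> * y) (x - \<i> * y)) holomorphic_on UNIV"
    and z: "!!z. P z (cnj z) = 0"
  shows "P z w = 0"
proof -
  have "P (of_real s + \<i> * of_real t) (of_real s - \<i> * of_real t) = 0" for s t
    using z[of "of_real s + \<i> * of_real t"] by simp
  then have 1: "P (x + \<i> * of_real t) (x - \<i> * of_real t) = 0" for x t
    using entire_zero_on_reals[OF x[of "of_real t"], of x] by blast
  have 2: "P (x + \<i> * y) (x - \<i> * y) = 0" for x y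
    using entire_zero_on_reals[OF y[of x], of y] 1 by blast
  have "(z + w) / 2 + \<i> * ((z - w) / (2 * \<i>)) = z" "(z + w) / 2 - \<i> * ((z - w) / (2 * \<i>)) = w"
    by (simp_all add: field_simps)
  then show ?thesis using 2[of "(z + w) / 2" "(z - w) / (2 * \<i>)"] by simp
qed

text \<open>At most one of the numbers \<open>m\<^sub>k\<close>, the squared moduli of the coefficients of \<open>q\<close>, is nonzero; the
  symmetric equations \<open>m\<^sub>1 = m\<^sub>3\<close> and \<open>m\<^sub>4 = 0\<close> then force all of them to vanish.\<close>

lemma quartic_norm_equations:
  fixes f0 f1 f2 C m1 m2 m3 m4 :: real
  assumes nn: "f0 \<ge> 0" "f1 \<ge> 0" "f2 \<ge> 0" "C > 0" and C: "f0\<^sup>2 * f1 = C"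
    and m: "m1 = 4 * C - (f0 * f1\<^sup>2 + 4 * f0\<^sup>2 * f2)" "m2 = 6 * C - 6 * f0 * f1 * f2"
      "m3 = 4 * C - (f1\<^sup>2 * f2 + 4 * f0 * f2\<^sup>2)" "m4 = C - f1 * f2\<^sup>2"
    and o: "m1 * m3 = 0" "m2 * m4 = 0"
  shows "f1 = 2 * f0" "f2 = f0" "f0 > 0"
proof -
  have p: "f0 > 0" "f1 > 0" using nn C by (auto simp: less_le)
  show f2: "f2 = f0"
  proof (cases "m2 = 0")
    case True
    then have "f0 * f1 * f2 = f0 * f1 * f0" unfolding m(2) C[symmetric] by (auto simp: power2_eq_square)
    then show ?thesis using p by simp
  next
    case False
    then have "m4 = 0" using o by simp
    then have "f1 * f2\<^sup>2 = f1 * f0\<^sup>2" unfolding m(4) C[symmetric] by auto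
    then have "f2\<^sup>2 = f0\<^sup>2" using p by simp
    then show ?thesis using nn p by (simp add: power2_eq_iff_nonneg)
  qed
  have "m1 = - (f0 * (f1 - 2 * f0)\<^sup>2)" "m3 = - (f0 * (f1 - 2 * f0)\<^sup>2)"
    unfolding m C[symmetric] f2 by (simp_all add: power2_eq_square algebra_simps)
  then have "(f0 * (f1 - 2 * f0)\<^sup>2) * (f0 * (f1 - 2 * f0)\<^sup>2) = 0" using o(1) by simp
  then show "f1 = 2 * f0" using p by simp
  show "f0 > 0" by (rule p)
qed

lemma hinner_real: "hinner v v = of_real (Re (hinner v v))" "Re (hinner v v) \<ge> 0" for v :: "complex^3"
  by (simp_all add: hinner_3 complex_eq_iff)

lemma ccross_binet_cauchy:
  "hinner (ccross u v) (ccross w x) = hinner u w * hinner v x - hinner u x * hinner v w"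
  by (simp add: hinner_3) algebra

text \<open>Since q has no constant term, the polarized identity at u = 0 is a product of two
  quadratics equal to a nonzero constant, which makes the coefficients of \<open>b\<close>
  orthogonal. What remains depends only on \<open>z * cnj u\<close>, so \<open>q\<close> is a single
  monomial or zero, and the equations between squared norms exclude the monomial.\<close>

lemma veronese_coefficients:
  fixes b0 b1 b2 :: "complex^3" and q1 q2 q3 q4 :: complex and C :: real
  defines "b \<equiv> \<lambda>z. b0 + z *s b1 + z\<^sup>2 *s b2"
    and "k \<equiv> \<lambda>z. ccross b0 b1 + (2 * z) *s ccross b0 b2 + z\<^sup>2 *s ccross b1 b2"
    and "q \<equiv> \<lambda>z. q1 * z + q2 * z ^ 2 + q3 * z ^ 3 + q4 * z ^ 4"
  assumes C: "C > 0"
    and id: "!!z. hinner (b z) (b z) * hinner (k z) (k z) + q z * cnj (q z) = of_real C * (1 + z * cnj z) ^ 4"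
  shows "hinner b0 b1 = 0" "hinner b0 b2 = 0" "hinner b1 b2 = 0" "Re (hinner b1 b1) = 2 * Re (hinner b0 b0)"
    "Re (hinner b2 b2) = Re (hinner b0 b0)" "Re (hinner b0 b0) > 0" "q1 = 0" "q2 = 0" "q3 = 0" "q4 = 0"
proof -
  have "hinner (b z) (b (cnj w)) * hinner (k z) (k (cnj w)) + q z * cnj (q (cnj w)) - of_real C * (1 + z * w) ^ 4 = 0" for z w
  proof (rule polarize[where P = "\<lambda>z w. hinner (b z) (b (cnj w)) * hinner (k z) (k (cnj w)) + q z * cnj (q (cnj w)) - of_real C * (1 + z * w) ^ 4"])
    show "(\<lambda>x. hinner (b (x + \<i> * y)) (b (cnj (x - \<i> * y))) * hinner (k (x + \<i> * y)) (k (cnj (x - \<i> * y))) + q (x + \<i> * y) * cnj (q (cnj (x - \<i> * y))) - of_real C * (1 + (x + \<i> * y) * (x - \<i> * y)) ^ 4) holomorphic_on UNIV" for y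
      unfolding b_def k_def q_def hinner_3 vector_add_component vector_smult_component complex_cnj_add complex_cnj_mult complex_cnj_power complex_cnj_cnj
      by (intro holomorphic_intros)
    show "(\<lambda>y. hinner (b (x + \<i> * y)) (b (cnj (x - \<i> * y))) * hinner (k (x + \<i> * y)) (k (cnj (x - \<i> * y))) + q (x + \<i> * y) * cnj (q (cnj (x - \<i> * y))) - of_real C * (1 + (x + \<i> * y) * (x - \<i> * y)) ^ 4) holomorphic_on UNIV" for x
      unfolding b_def k_def q_def hinner_3 vector_add_component vector_smult_component complex_cnj_add complex_cnj_mult complex_cnj_power complex_cnj_cnj
      by (intro holomorphic_intros)
  qed (simp add: id)
  from this[of _ "cnj _"]
  have pol: "hinner (b z) (b u) * hinner (k z) (k u) + q z * cnj (q u) = of_real C * (1 + z * cnj u) ^ 4" for z u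
    using \<open>!!z w. hinner (b z) (b (cnj w)) * hinner (k z) (k (cnj w)) + q z * cnj (q (cnj w)) - of_real C * (1 + z * w) ^ 4 = 0\<close>[of z "cnj u"] by simp
  have Cn: "complex_of_real C ~= 0" using C by simp
  \<comment> \<open>The polarized identity at u = 0. The q-term is gone because
    \<open>q 0 = 0\<close>.\<close>
  have "(hinner b0 b0 + hinner b1 b0 * z + hinner b2 b0 * z ^ 2) *
      (hinner (ccross b0 b1) (ccross b0 b1) + (2 * hinner (ccross b0 b2) (ccross b0 b1)) * z + hinner (ccross b1 b2) (ccross b0 b1) * z ^ 2) = of_real C" for z
    using pol[of z 0] by (simp add: b_def k_def q_def hinner_simps algebra_simps)
  note c = constant_product[OF this Cn]
  have s: "hinner y x = 0" if "hinner x y = 0" for x y :: "complex^3" using that by (metis hinner_cnj complex_cnj_zero)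
  show o1: "hinner b0 b1 = 0" and o2: "hinner b0 b2 = 0" using c(1,2) by (auto intro: s)
  have CC: "hinner b0 b0 * hinner (ccross b0 b1) (ccross b0 b1) = of_real C"
    using pol[of 0 0] by (simp add: b_def k_def q_def)
  then have F0: "hinner b0 b0 ~= 0" using Cn by auto
  have "hinner b0 b0 * hinner b2 b1 = 0" using c(3) o1 unfolding ccross_binet_cauchy by simp
  then have o3': "hinner b2 b1 = 0" using F0 by simp
  then show o3: "hinner b1 b2 = 0" by (rule s)
  note oo = o1 o2 o3 o3' c(1,2)
  define f0 f1 f2 where "f0 = Re (hinner b0 b0)" and "f1 = Re (hinner b1 b1)" and "f2 = Re (hinner b2 b2)"
  have ff: "hinner b0 b0 = of_real f0" "hinner b1 b1 = of_real f1" "hinner b2 b2 = of_real f2"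
    unfolding f0_def f1_def f2_def by (rule hinner_real)+
  have bb: "hinner (b z) (b u) = of_real f0 + of_real f1 * (z * cnj u) + of_real f2 * (z * cnj u)\<^sup>2" for z u
    by (simp add: b_def hinner_simps oo ff power_mult_distrib)
  have kk: "hinner (k z) (k u) = of_real (f0 * f1) + of_real (4 * f0 * f2) * (z * cnj u) + of_real (f1 * f2) * (z * cnj u)\<^sup>2" for z u
    by (simp add: k_def hinner_simps ccross_binet_cauchy oo ff power_mult_distrib)
  define m1 where "m1 = 4 * C - (f0 * f1\<^sup>2 + 4 * f0\<^sup>2 * f2)"
  define m2 where "m2 = 6 * C - 6 * f0 * f1 * f2"
  define m3 where "m3 = 4 * C - (f1\<^sup>2 * f2 + 4 * f0 * f2\<^sup>2)"
  define m4 where "m4 = C - f1 * f2\<^sup>2"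
  have fC: "f0\<^sup>2 * f1 = C"
  proof -
    have "complex_of_real (f0\<^sup>2 * f1) = of_real C" using CC unfolding ccross_binet_cauchy by (simp add: ff oo power2_eq_square mult.assoc)
    then show ?thesis by (simp only: of_real_eq_iff)
  qed
  \<comment> \<open>After orthogonality both norms are quadratic in the product
    \<open>z * cnj u\<close>. The numbers \<open>m1\<close> to \<open>m4\<close> are the differences
    of the binomial coefficients times C and the coefficients of the product; the one of order zero
    vanishes by \<open>fC\<close>.\<close>
  have qq: "q z * cnj (q u) = of_real m1 * (z * cnj u) + of_real m2 * (z * cnj u) ^ 2 + of_real m3 * (z * cnj u) ^ 3 + of_real m4 * (z * cnj u) ^ 4" for z u
  proof -
    have "q z * cnj (q u) = of_real C * (1 + z * cnj u) ^ 4 - hinner (b z) (b u) * hinner (k z) (k u)" using pol[of z u] by (simp add: algebra_simps)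
    also have "\<dots> = of_real (C - f0\<^sup>2 * f1) + of_real m1 * (z * cnj u) + of_real m2 * (z * cnj u) ^ 2 + of_real m3 * (z * cnj u) ^ 3 + of_real m4 * (z * cnj u) ^ 4"
    proof -
      have "c * (1 + s) ^ 4 - (x + y * s + w * s\<^sup>2) * (x * y + 4 * x * w * s + y * w * s\<^sup>2) = (c - x\<^sup>2 * y) + (4 * c - (x * y\<^sup>2 + 4 * x\<^sup>2 * w)) * s
         + (6 * c - 6 * x * y * w) * s ^ 2 + (4 * c - (y\<^sup>2 * w + 4 * x * w\<^sup>2)) * s ^ 3 + (c - y * w\<^sup>2) * s ^ 4" for c s x y w :: complex
        by algebra
      from this[of "of_real C" "z * cnj u" "of_real f0" "of_real f1" "of_real f2"]
      show ?thesis unfolding bb kk m1_def m2_def m3_def m4_def by simp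
    qed
    finally show ?thesis using fC by simp
  qed
  have 1: "q1 * cnj (q u) = of_real m1 * cnj u" "q2 * cnj (q u) = of_real m2 * (cnj u) ^ 2" "q3 * cnj (q u) = of_real m3 * (cnj u) ^ 3" "q4 * cnj (q u) = of_real m4 * (cnj u) ^ 4" for u
  proof -
    have "0 + (q1 * cnj (q u)) * z + (q2 * cnj (q u)) * z ^ 2 + (q3 * cnj (q u)) * z ^ 3 + (q4 * cnj (q u)) * z ^ 4
      = 0 + (of_real m1 * cnj u) * z + (of_real m2 * (cnj u) ^ 2) * z ^ 2 + (of_real m3 * (cnj u) ^ 3) * z ^ 3 + (of_real m4 * (cnj u) ^ 4) * z ^ 4" for z
      using qq[of z u] by (simp add: q_def[of] algebra_simps power_mult_distrib)
    note p = poly5_eq[OF this]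
    show "q1 * cnj (q u) = of_real m1 * cnj u" "q2 * cnj (q u) = of_real m2 * (cnj u) ^ 2" "q3 * cnj (q u) = of_real m3 * (cnj u) ^ 3" "q4 * cnj (q u) = of_real m4 * (cnj u) ^ 4"
      by (rule p)+
  qed
  have 2: "cnj q1 * q u = of_real m1 * u" "cnj q2 * q u = of_real m2 * u ^ 2" "cnj q3 * q u = of_real m3 * u ^ 3" "cnj q4 * q u = of_real m4 * u ^ 4" for u
    using 1[of u, THEN arg_cong[where f = cnj]] by simp_all
  \<comment> \<open>Comparing coefficients in \<open>cnj q1 * q u = m1 * u\<close> shows both that
    \<open>m1\<close> is a squared modulus and that different coefficients of q cannot be nonzero
    together.\<close>
  have A: "cnj q1 * q1 = of_real m1" "cnj q1 * q3 = 0"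
  proof -
    have "0 + (cnj q1 * q1) * z + (cnj q1 * q2) * z ^ 2 + (cnj q1 * q3) * z ^ 3 + (cnj q1 * q4) * z ^ 4 = 0 + of_real m1 * z + 0 * z ^ 2 + 0 * z ^ 3 + 0 * z ^ 4" for z
      using 2(1)[of z] by (simp add: q_def algebra_simps)
    from poly5_eq[OF this] show "cnj q1 * q1 = of_real m1" "cnj q1 * q3 = 0" by blast+
  qed
  have B: "cnj q2 * q2 = of_real m2" "cnj q2 * q4 = 0"
  proof -
    have "0 + (cnj q2 * q1) * z + (cnj q2 * q2) * z ^ 2 + (cnj q2 * q3) * z ^ 3 + (cnj q2 * q4) * z ^ 4 = 0 + 0 * z + of_real m2 * z ^ 2 + 0 * z ^ 3 + 0 * z ^ 4" for z
      using 2(2)[of z] by (simp add: q_def algebra_simps)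
    from poly5_eq[OF this] show "cnj q2 * q2 = of_real m2" "cnj q2 * q4 = 0" by blast+
  qed
  have D: "cnj q3 * q3 = of_real m3"
  proof -
    have "0 + (cnj q3 * q1) * z + (cnj q3 * q2) * z ^ 2 + (cnj q3 * q3) * z ^ 3 + (cnj q3 * q4) * z ^ 4 = 0 + 0 * z + 0 * z ^ 2 + of_real m3 * z ^ 3 + 0 * z ^ 4" for z
      using 2(3)[of z] by (simp add: q_def algebra_simps)
    from poly5_eq[OF this] show ?thesis by blast
  qed
  have E: "cnj q4 * q4 = of_real m4"
  proof -
    have "0 + (cnj q4 * q1) * z + (cnj q4 * q2) * z ^ 2 + (cnj q4 * q3) * z ^ 3 + (cnj q4 * q4) * z ^ 4 = 0 + 0 * z + 0 * z ^ 2 + 0 * z ^ 3 + of_real m4 * z ^ 4" for z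
      using 2(4)[of z] by (simp add: q_def algebra_simps)
    from poly5_eq[OF this] show ?thesis by blast
  qed
  have mm: "m1 * m3 = 0" "m2 * m4 = 0"
    using A B D E by auto
  have nn: "f0 \<ge> 0" "f1 \<ge> 0" "f2 \<ge> 0" unfolding f0_def f1_def f2_def by (rule hinner_real)+
  note fin = quartic_norm_equations[OF nn C fC m1_def m2_def m3_def m4_def mm]
  show "Re (hinner b1 b1) = 2 * Re (hinner b0 b0)" "Re (hinner b2 b2) = Re (hinner b0 b0)" "Re (hinner b0 b0) > 0"
    using fin by (simp_all add: f0_def f1_def f2_def)
  have "C = 2 * f0 ^ 3" using fC fin by (simp add: power2_eq_square power3_eq_cube)
  then have "m1 = 0" "m2 = 0" "m3 = 0" "m4 = 0" unfolding m1_def m2_def m3_def m4_def fin(1,2)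
    by (simp_all add: power2_eq_square power3_eq_cube)
  then show "q1 = 0" "q2 = 0" "q3 = 0" "q4 = 0" using A B D E by auto
qed

text \<open>A binary quartic form has a zero on the sphere; a vanishing top coefficient means the
  zero (1, 0) at infinity.\<close>

lemma homogeneous_root:
  fixes Q0 Q1 Q2 Q3 Q4 :: complex
  obtains x y where "x ~= 0 \<or> y ~= 0" "Q0 * y ^ 4 + Q1 * x * y ^ 3 + Q2 * x ^ 2 * y ^ 2 + Q3 * x ^ 3 * y + Q4 * x ^ 4 = 0"
proof (cases "Q4 = 0")
  case True
  then show ?thesis using that[of 1 0] by simp
next
  case False
  then have "\<exists>z. poly [:Q0, Q1, Q2, Q3, Q4:] z = 0" by (intro fundamental_theorem_of_algebra) (simp add: constant_degree)
  then obtain z where "poly [:Q0, Q1, Q2, Q3, Q4:] z = 0" by blast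
  then show ?thesis using that[of z 1] by (simp add: algebra_simps power2_eq_square power3_eq_cube power4_eq_xxxx)
qed

text \<open>Gram-Schmidt in the plane for a positive Hermitian form: (b, d) is the given direction
  normalized, and (a, c) a unit vector orthogonal to it. In these coordinates the form is the
  standard one.\<close>

lemma hermitian_form_frame:
  fixes \<alpha> \<gamma> :: real and \<beta> x0 y0 :: complex
  assumes g: "\<gamma> > 0" and dt: "\<alpha> * \<gamma> > (norm \<beta>)\<^sup>2" and n0: "x0 ~= 0 \<or> y0 ~= 0"
  obtains s a b c d where "b = s * x0" "d = s * y0" "a * d - b * c ~= 0"
    "!!\<zeta>. of_real \<gamma> * ((a * \<zeta> + b) * cnj (a * \<zeta> + b)) + \<beta> * ((a * \<zeta> + b) * cnj (c * \<zeta> + d)) + cnj \<beta> * ((c * \<zeta> + d) * cnj (a * \<zeta> + b))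
      + of_real \<alpha> * ((c * \<zeta> + d) * cnj (c * \<zeta> + d)) = 1 + \<zeta> * cnj \<zeta>"
proof -
  define \<Phi> where "\<Phi> = (\<lambda>x y x' y'. of_real \<gamma> * (x * cnj x') + \<beta> * (x * cnj y') + cnj \<beta> * (y * cnj x') + of_real \<alpha> * (y * cnj y'))"
  have pos: "\<exists>r>0. \<Phi> x y x y = of_real r" if n: "x ~= 0 \<or> y ~= 0" for x y
  proof -
    \<comment> \<open>Completing the square; positivity of \<gamma> and of the determinant makes the
      form positive definite.\<close>
    have "of_real \<gamma> * \<Phi> x y x y = (of_real \<gamma> * x + cnj \<beta> * y) * cnj (of_real \<gamma> * x + cnj \<beta> * y) + (of_real (\<alpha> * \<gamma>) - \<beta> * cnj \<beta>) * (y * cnj y)"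
      by (simp add: \<Phi>_def algebra_simps)
    also have "\<dots> = of_real ((norm (of_real \<gamma> * x + cnj \<beta> * y))\<^sup>2 + (\<alpha> * \<gamma> - (norm \<beta>)\<^sup>2) * (norm y)\<^sup>2)"
      by (simp only: complex_norm_square[symmetric] of_real_add of_real_mult of_real_diff)
    finally have e: "of_real \<gamma> * \<Phi> x y x y = of_real ((norm (of_real \<gamma> * x + cnj \<beta> * y))\<^sup>2 + (\<alpha> * \<gamma> - (norm \<beta>)\<^sup>2) * (norm y)\<^sup>2)" .
    define R where "R = (norm (of_real \<gamma> * x + cnj \<beta> * y))\<^sup>2 + (\<alpha> * \<gamma> - (norm \<beta>)\<^sup>2) * (norm y)\<^sup>2"
    have Rp: "R > 0"
    proof (cases "y = 0")
      case True
      then show ?thesis using n g by (simp add: R_def norm_mult)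
    next
      case False
      then have "0 < (\<alpha> * \<gamma> - (norm \<beta>)\<^sup>2) * (norm y)\<^sup>2" using dt by simp
      then show ?thesis unfolding R_def by (simp add: add_nonneg_pos)
    qed
    have "of_real \<gamma> * \<Phi> x y x y = of_real R" unfolding R_def by (rule e)
    then have "\<Phi> x y x y = of_real (R / \<gamma>)" using g by (simp add: field_simps)
    then show ?thesis using g Rp by (intro exI[of _ "R / \<gamma>"]) simp
  qed
  have scale: "\<exists>s. s ~= 0 \<and> \<Phi> (s * x) (s * y) (s * x) (s * y) = 1" if n: "x ~= 0 \<or> y ~= 0" for x y
  proof -
    obtain r where r: "r > 0" "\<Phi> x y x y = of_real r" using pos[OF n] by blast
    have "\<Phi> (of_real t * x) (of_real t * y) (of_real t * x) (of_real t * y) = of_real (t * t) * \<Phi> x y x y" for t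
      by (simp add: \<Phi>_def algebra_simps)
    moreover have "1 / sqrt r * (1 / sqrt r) * r = 1" using r(1) by simp
    ultimately have "\<Phi> (of_real (1 / sqrt r) * x) (of_real (1 / sqrt r) * y) (of_real (1 / sqrt r) * x) (of_real (1 / sqrt r) * y) = 1"
      unfolding r(2) by (metis of_real_1 of_real_mult)
    moreover have "complex_of_real (1 / sqrt r) ~= 0" using r(1) by simp
    ultimately show ?thesis by blast
  qed
  obtain s where s: "s ~= 0" "\<Phi> (s * x0) (s * y0) (s * x0) (s * y0) = 1" using scale[OF n0] by blast
  define b d where "b = s * x0" and "d = s * y0"
  define p r where "p = of_real \<gamma> * cnj b + \<beta> * cnj d" and "r = cnj \<beta> * cnj b + of_real \<alpha> * cnj d"
  have lin: "\<Phi> x y b d = x * p + y * r" for x y by (simp add: \<Phi>_def p_def r_def algebra_simps)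
  have bd: "\<Phi> b d b d = 1" using s(2) by (simp add: b_def d_def)
  then have "r ~= 0 \<or> - p ~= 0" unfolding lin by auto
  from scale[OF this] obtain t where t: "t ~= 0" "\<Phi> (t * r) (t * - p) (t * r) (t * - p) = 1" by blast
  \<comment> \<open>Pairing with (b, d) is the linear functional with coefficients \<open>p\<close>,
    \<open>r\<close>, and (r, -p) is its kernel vector; \<open>t\<close> normalizes it.\<close>
  define a c where "a = t * r" and "c = t * - p"
  have ac: "\<Phi> a c a c = 1" "\<Phi> a c b d = 0" unfolding lin using t(2) by (simp_all add: a_def c_def)
  have sym: "\<Phi> b d a c = cnj (\<Phi> a c b d)" by (simp add: \<Phi>_def algebra_simps)
  have "a * d - b * c = t * \<Phi> b d b d" unfolding lin by (simp add: a_def c_def algebra_simps)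
  then have det: "a * d - b * c ~= 0" using t(1) bd by simp
  show ?thesis
  proof (rule that[OF b_def d_def det])
    fix \<zeta>
    have "of_real \<gamma> * ((a * \<zeta> + b) * cnj (a * \<zeta> + b)) + \<beta> * ((a * \<zeta> + b) * cnj (c * \<zeta> + d)) + cnj \<beta> * ((c * \<zeta> + d) * cnj (a * \<zeta> + b))
      + of_real \<alpha> * ((c * \<zeta> + d) * cnj (c * \<zeta> + d)) = \<zeta> * cnj \<zeta> * \<Phi> a c a c + \<zeta> * \<Phi> a c b d + cnj \<zeta> * \<Phi> b d a c + \<Phi> b d b d"
      by (simp add: \<Phi>_def algebra_simps)
    then show "of_real \<gamma> * ((a * \<zeta> + b) * cnj (a * \<zeta> + b)) + \<beta> * ((a * \<zeta> + b) * cnj (c * \<zeta> + d)) + cnj \<beta> * ((c * \<zeta> + d) * cnj (a * \<zeta> + b))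
      + of_real \<alpha> * ((c * \<zeta> + d) * cnj (c * \<zeta> + d)) = 1 + \<zeta> * cnj \<zeta>"
      unfolding sym ac bd by simp
  qed
qed

section \<open>Moebius transformations\<close>

text \<open>Homogeneous coordinates [x : y] with y = 0 at infinity; in them Moebius transformations
  are linear and need no separate formula at the poles.\<close>

definition sphere_point :: "complex => complex => riemann_sphere" where
  "sphere_point x y = (if y = 0 then Infty else Affine (x / y))"

fun moebius :: "complex => complex => complex => complex => riemann_sphere => riemann_sphere" where
  "moebius a b c d (Affine z) = sphere_point (a * z + b) (c * z + d)"
| "moebius a b c d Infty = sphere_point a c"

lemma sphere_point_scale: "s ~= 0 ==> sphere_point (s * x) (s * y) = sphere_point x y"
  by (simp add: sphere_point_def)

lemma sphere_point_chart: "chart0 z = sphere_point z 1" "chart1 w = sphere_point 1 w"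
  by (simp_all add: sphere_point_def chart0_def chart1_def)

lemma sphere_point_cases: obtains x y where "x ~= 0 \<or> y ~= 0" "p = sphere_point x y"
proof (cases p)
  case (Affine z)
  then show ?thesis using that[of z 1] by (simp add: sphere_point_def)
next
  case Infty
  then show ?thesis using that[of 1 0] by (simp add: sphere_point_def)
qed

lemma moebius_point:
  assumes "x ~= 0 \<or> y ~= 0"
  shows "moebius a b c d (sphere_point x y) = sphere_point (a * x + b * y) (c * x + d * y)"
proof (cases "y = 0")
  case True
  then have "x ~= 0" using assms by simp
  then show ?thesis using sphere_point_scale[of x a c] True by (simp add: sphere_point_def mult.commute)
next
  case False
  have "sphere_point (y * (a * (x / y) + b)) (y * (c * (x / y) + d)) = sphere_point (a * (x / y) + b) (c * (x / y) + d)"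
    by (rule sphere_point_scale[OF False])
  moreover have "y * (a * (x / y) + b) = a * x + b * y" "y * (c * (x / y) + d) = c * x + d * y"
    using False by (simp_all add: field_simps)
  ultimately show ?thesis using False by (simp add: sphere_point_def[of x y])
qed

lemma sphere_point_in_chart:
  assumes "x ~= 0 \<or> y ~= 0"
  shows "sphere_point x y \<in> range chart0 \<longleftrightarrow> y ~= 0" "sphere_point x y \<in> range chart1 \<longleftrightarrow> x ~= 0"
    "y ~= 0 ==> inv chart0 (sphere_point x y) = x / y" "x ~= 0 ==> inv chart1 (sphere_point x y) = y / x"
proof -
  have i0: "inj chart0" by (auto simp: inj_def chart0_def)
  have i1: "inj chart1" by (auto simp: inj_def chart1_def split: if_splits)
  have p0: "sphere_point x y = chart0 (x / y)" if "y ~= 0" using that by (simp add: sphere_point_def chart0_def)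
  have p1: "sphere_point x y = chart1 (y / x)" if "x ~= 0" using that by (simp add: sphere_point_def chart1_def)
  show "sphere_point x y \<in> range chart0 \<longleftrightarrow> y ~= 0" using p0 by (auto simp: sphere_point_def chart0_def)
  show "sphere_point x y \<in> range chart1 \<longleftrightarrow> x ~= 0"
  proof
    assume "sphere_point x y \<in> range chart1"
    then show "x ~= 0" using assms by (auto simp: sphere_point_def chart1_def split: if_splits)
  qed (use p1 in auto)
  show "y ~= 0 ==> inv chart0 (sphere_point x y) = x / y" using p0 i0 by (simp add: inv_f_f)
  show "x ~= 0 ==> inv chart1 (sphere_point x y) = y / x" using p1 i1 by (simp add: inv_f_f)
qed

lemma moebius_holomorphic:
  assumes D: "a * d - b * c ~= 0"
  shows "holomorphic_self_map (moebius a b c d)"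
proof -
  \<comment> \<open>Stated for any chart in which the map has the form [p z + q : r z + s], so that
    the affine chart and the chart at infinity are covered by the same argument.\<close>
  have main: "open {z. moebius a b c d (ch z) \<in> range ch'} \<and> (\<lambda>z. inv ch' (moebius a b c d (ch z))) holomorphic_on {z. moebius a b c d (ch z) \<in> range ch'}"
    if ch: "!!z. moebius a b c d (ch z) = sphere_point (p * z + q) (r * z + s)" and n: "p * s - q * r ~= 0" and c': "ch' \<in> charts" for ch ch' p q r s
  proof -
    have nz: "p * z + q ~= 0 \<or> r * z + s ~= 0" for z
    proof (rule ccontr)
      assume "\<not> ?thesis"
      then have "p * z + q = 0" "r * z + s = 0" by auto
      then have "q = - (p * z)" "s = - (r * z)" by (simp_all add: eq_neg_iff_add_eq_0 add.commute)
      then show False using n by simp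
    qed
    note pc = sphere_point_in_chart[OF nz]
    from c' consider "ch' = chart0" | "ch' = chart1" by (auto simp: charts_def)
    then show ?thesis
    proof cases
      case 1
      have S: "{z. moebius a b c d (ch z) \<in> range ch'} = {z. r * z + s ~= 0}" by (simp add: 1 ch pc)
      have "open {z. r * z + s ~= 0}" by (intro open_Collect_neq continuous_intros)
      moreover have "(\<lambda>z. (p * z + q) / (r * z + s)) holomorphic_on {z. r * z + s ~= 0}" by (intro holomorphic_intros) auto
      then have "(\<lambda>z. inv ch' (moebius a b c d (ch z))) holomorphic_on {z. r * z + s ~= 0}"
        by (rule holomorphic_transform) (simp add: 1 ch pc)
      ultimately show ?thesis unfolding S by blast
    next
      case 2
      have S: "{z. moebius a b c d (ch z) \<in> range ch'} = {z. p * z + q ~= 0}" by (simp add: 2 ch pc)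
      have "open {z. p * z + q ~= 0}" by (intro open_Collect_neq continuous_intros)
      moreover have "(\<lambda>z. (r * z + s) / (p * z + q)) holomorphic_on {z. p * z + q ~= 0}" by (intro holomorphic_intros) auto
      then have "(\<lambda>z. inv ch' (moebius a b c d (ch z))) holomorphic_on {z. p * z + q ~= 0}"
        by (rule holomorphic_transform) (simp add: 2 ch pc)
      ultimately show ?thesis unfolding S by blast
    qed
  qed
  have 0: "moebius a b c d (chart0 z) = sphere_point (a * z + b) (c * z + d)" for z by (simp add: chart0_def)
  have 1: "moebius a b c d (chart1 z) = sphere_point (b * z + a) (d * z + c)" for z
    unfolding sphere_point_chart by (subst moebius_point) (simp_all add: add.commute)
  have D': "b * c - a * d ~= 0" using D by auto
  show ?thesis unfolding holomorphic_self_map_def charts_def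
    using main[OF 0 D] main[OF 1 D'] unfolding charts_def by blast
qed

lemma moebius_biholomorphism:
  assumes D: "a * d - b * c ~= 0"
  shows "biholomorphism (moebius a b c d)"
proof -
  have inv: "moebius d' (- b') (- c') a' (moebius a' b' c' d' p) = p" if n: "a' * d' - b' * c' ~= 0" for a' b' c' d' p
  proof -
    obtain x y where xy: "x ~= 0 \<or> y ~= 0" "p = sphere_point x y" by (rule sphere_point_cases)
    define x' y' where "x' = a' * x + b' * y" and "y' = c' * x + d' * y"
    have e: "d' * x' + (- b') * y' = (a' * d' - b' * c') * x" "(- c') * x' + a' * y' = (a' * d' - b' * c') * y"
      by (simp_all add: x'_def y'_def algebra_simps)
    have n': "x' ~= 0 \<or> y' ~= 0" using e n xy(1) by auto
    show ?thesis
      unfolding xy(2) moebius_point[OF xy(1)] x'_def[symmetric] y'_def[symmetric] moebius_point[OF n'] e by (rule sphere_point_scale[OF n])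
  qed
  define g' where "g' = moebius d (- b) (- c) a"
  have D': "d * a - (- b) * (- c) ~= 0" using D by (simp add: mult.commute)
  have l: "g' (moebius a b c d p) = p" for p unfolding g'_def by (rule inv[OF D])
  have r: "moebius a b c d (g' p) = p" for p using inv[OF D', of p] by (simp add: g'_def)
  have b: "bij (moebius a b c d)" by (rule o_bij[of g']) (auto simp: fun_eq_iff l r)
  have "inv (moebius a b c d) = g'" by (rule inv_equality) (rule l r)+
  then show ?thesis unfolding biholomorphism_def using b moebius_holomorphic[OF D] moebius_holomorphic[OF D'] by (simp add: g'_def)
qed

section \<open>The energy density\<close>

lemma cross_quadratic:
  "ccross (p + z *s q + z\<^sup>2 *s r) (q + (2 * z) *s r) = ccross p q + (2 * z) *s ccross p r + z\<^sup>2 *s ccross q r"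
  by (simp add: vec3_eq_iff ccross_nth algebra_simps power2_eq_square)

lemma quartic_growth:
  assumes f: "f holomorphic_on UNIV" and b: "!!z. 1 \<le> norm z ==> (norm (f z))\<^sup>2 \<le> B * norm z ^ 8"
  obtains c0 c1 c2 c3 c4 where "!!z. f z = c0 + c1 * z + c2 * z ^ 2 + c3 * z ^ 3 + c4 * z ^ 4"
proof -
  have "norm (f z) \<le> sqrt B * norm z ^ 4" if z: "1 \<le> norm z" for z
  proof -
    have "norm (f z) \<le> sqrt (B * norm z ^ 8)" using b[OF z] by (simp add: real_le_rsqrt)
    moreover have "sqrt (norm z ^ 8) = norm z ^ 4" by (rule real_sqrt_unique) (simp_all flip: power_mult)
    ultimately show ?thesis by (simp add: real_sqrt_mult)
  qed
  from Liouville_polynomial[OF f this]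
  have e0: "f z = (\<Sum>k\<le>4. (deriv ^^ k) f 0 / fact k * z ^ k)" for z by blast
  define c where "c = (\<lambda>k. (deriv ^^ k) f 0 / fact k)"
  have e: "f z = (\<Sum>k\<le>4. c k * z ^ k)" for z unfolding c_def by (rule e0)
  show ?thesis
    by (rule that[of "c 0" "c 1" "c 2" "c 3" "c 4"]) (simp add: e eval_nat_numeral)
qed

lemma has_wd_real_pd: "has_wd P a b z ==> pd t (\<lambda>w. Re (P w)) z = Re (a * t + b * cnj t)"
  unfolding has_wd_def pd_def by (drule has_derivative_Re, drule frechet_derivative_at) (metis (lifting))

context lifted_chart
begin

text \<open>The trace of \<open>A0 ** adj A0\<close> does not depend on the lift. This relates the
  potentials of lifts in different charts without comparing their extension classes.\<close>

lemma pot_trace: assumes z: "z \<in> U" shows "pot z * trace (A0 z ** adj (A0 z)) = normF z * normG z"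
proof -
  obtain u m w a b e \<alpha> \<gamma> \<delta> \<nu> d where l: "loop_frame (A0 z) (A1 z) (A2 z) (A z) u m w a b e \<alpha> \<gamma> \<delta> \<nu> d"
    by (rule get_frame)
  obtain t \<sigma> where t: "f z = t *s a" "t ~= 0" "vcnj (ccross (f z) (f1 z)) = \<sigma> *s b" "\<sigma> ~= 0"
    by (rule lift_frame[OF z l])
  show ?thesis using lift_values(1,6)[OF z l t(1,3)] by simp
qed

lemma pot_real: assumes z: "z \<in> U"
  shows "pot z = of_real (Re (pot z))" "Re (pot z) > 0" "(norm (ext z))\<^sup>2 \<le> Re (pot z)"
proof -
  have r: "Re (normF z) \<ge> 0" "Re (normG z) \<ge> 0" "normF z = of_real (Re (normF z))" "normG z = of_real (Re (normG z))"
    unfolding normF_def normG_def using hinner_real by blast+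
  have "pot z = of_real (Re (normF z) * Re (normG z) + (norm (ext z))\<^sup>2)"
    unfolding pot_def by (subst r(3), subst r(4)) (simp only: of_real_add of_real_mult complex_norm_square)
  then have p: "Re (pot z) = Re (normF z) * Re (normG z) + (norm (ext z))\<^sup>2" "pot z = of_real (Re (pot z))" by simp_all
  then show "pot z = of_real (Re (pot z))" by blast
  show "(norm (ext z))\<^sup>2 \<le> Re (pot z)" unfolding p(1) using r by simp
  moreover have "0 \<le> Re (pot z)" unfolding p(1) using r by simp
  moreover have "Re (pot z) ~= 0" using A1_A0_adjoint(2)[OF z] p(2) by auto
  ultimately show "Re (pot z) > 0" by linarith
qed

lemma pot_mixed:
  assumes z: "z \<in> U" and q: "has_wd ext (q1 z) 0 z" and q1: "has_wd q1 q2 0 z" and f2: "vwd f2 f3 0 z"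
  shows "\<exists>X. has_wd (\<lambda>z. (hinner (f1 z) (f z) * normG z + normF z * hinner (ccross (f z) (f2 z)) (ccross (f z) (f1 z))) + q1 z * cnj (ext z)) X
     ((hinner (f1 z) (f1 z) * normG z + hinner (f1 z) (f z) * hinner (ccross (f z) (f1 z)) (ccross (f z) (f2 z))
        + hinner (f z) (f1 z) * hinner (ccross (f z) (f2 z)) (ccross (f z) (f1 z))
        + normF z * hinner (ccross (f z) (f2 z)) (ccross (f z) (f2 z))) + q1 z * cnj (q1 z)) z"
proof -
  have k: "vwd (\<lambda>z. ccross (f z) (f1 z)) (ccross (f z) (f2 z)) 0 z"
    using vwd_ccross[OF vwd_f[OF z] vwd_f1[OF z]] by simp
  have k1: "vwd (\<lambda>z. ccross (f z) (f2 z)) (ccross (f1 z) (f2 z) + ccross (f z) f3) 0 z"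
    using vwd_ccross[OF vwd_f[OF z] f2] by simp
  note 1 = has_wd_mult[OF has_wd_hinner[OF vwd_f1[OF z] vwd_f[OF z]] has_wd_hinner[OF k k]]
  note 2 = has_wd_mult[OF has_wd_hinner[OF vwd_f[OF z] vwd_f[OF z]] has_wd_hinner[OF k1 k]]
  note 3 = has_wd_mult[OF q1 has_wd_cnj[OF q]]
  have h0: "hinner 0 v = 0" "hinner v 0 = 0" for v :: "complex^3" by (simp_all add: hinner_def)
  show ?thesis unfolding normF_def normG_def
    by (rule exI, rule has_wd_eq[OF has_wd_add[OF has_wd_add[OF 1 2] 3] refl]) (simp add: h0 algebra_simps)
qed

end

context uniton_two
begin

definition energy :: "(complex => riemann_sphere) => complex => real" where
  "energy c z = Re (trace (A_z \<psi> c z ** adj (A_z \<psi> c z)))"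

lemma energy_trace: "c \<in> charts ==> complex_of_real (energy c z) = trace (A_z \<psi> c z ** adj (A_z \<psi> c z))"
  unfolding energy_def by (rule trace_mult_ctranspose[OF unitary_map, symmetric])

lemma smooth_energy: assumes c: "c \<in> charts" shows "smooth (\<lambda>z. complex_of_real (energy c z))"
proof -
  interpret loop_chart3 "\<lambda>z. A0 (c z)" "\<lambda>z. A1 (c z)" "\<lambda>z. A2 (c z)" "A_z \<psi> c" by (rule chart[OF c])
  have "smooth (\<lambda>z. \<Sum>i\<in>UNIV. \<Sum>j\<in>UNIV. A_z \<psi> c z $ i $ j * cnj (A_z \<psi> c z $ i $ j))"
    by (rule smooth_sum, simp, rule smooth_sum, simp, rule smooth_mult, (rule smooth_vec_nth)+, rule smooth_A,
        rule smooth_cnj, (rule smooth_vec_nth)+, rule smooth_A)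
  moreover have "complex_of_real (energy c z) = (\<Sum>i\<in>UNIV. \<Sum>j\<in>UNIV. A_z \<psi> c z $ i $ j * cnj (A_z \<psi> c z $ i $ j))" for z
    unfolding energy_trace[OF c] by (simp add: trace_def matrix_matrix_mult_def ctranspose_def)
  ultimately show ?thesis by (simp only:)
qed

lemma energy_pos: "c \<in> charts ==> energy c z > 0"
  unfolding energy_def using trace_mult_ctranspose_pos immersion_A_z_nonzero[OF unitary_map _ immersion] by blast

lemma A_z_transition:
  assumes z: "z ~= 0" shows "A_z \<psi> chart0 z = smul (- 1 / z\<^sup>2) (A_z \<psi> chart1 (1 / z))"
proof -
  have p: "chart1 (1 / z) = chart0 z" using z by (simp add: chart0_def chart1_def)
  have 1: "mwd (\<lambda>w. \<psi> (chart0 w)) (smul 2 (\<psi> (chart0 z) ** A_z \<psi> chart0 z)) (smul (-2) (\<psi> (chart0 z) ** adj (A_z \<psi> chart0 z))) z"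
    by (rule mwd_unitary[OF unitary_map]) simp
  have 2: "mwd (\<lambda>w. \<psi> (chart1 w)) (smul 2 (\<psi> (chart1 (1 / z)) ** A_z \<psi> chart1 (1 / z))) (smul (-2) (\<psi> (chart1 (1 / z)) ** adj (A_z \<psi> chart1 (1 / z)))) (1 / z)"
    by (rule mwd_unitary[OF unitary_map]) simp
  have inv: "((\<lambda>z. 1 / z) has_field_derivative (- 1 / z\<^sup>2)) (at z)"
    using z by (auto intro!: derivative_eq_intros simp: power2_eq_square)
  have zz: "z \<in> - {0}" using z by simp
  have ent: "(\<psi> (chart0 z) ** A_z \<psi> chart0 z) $ i $ j = (- 1 / z\<^sup>2) * (\<psi> (chart0 z) ** A_z \<psi> chart1 (1 / z)) $ i $ j" for i j
  proof -
    have a: "has_wd (\<lambda>w. \<psi> (chart1 w) $ i $ j) (smul 2 (\<psi> (chart1 (1 / z)) ** A_z \<psi> chart1 (1 / z)) $ i $ j)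
        (smul (-2) (\<psi> (chart1 (1 / z)) ** adj (A_z \<psi> chart1 (1 / z))) $ i $ j) (1 / z)"
      using 2 unfolding mwd_def by blast
    have e: "\<psi> (chart1 (1 / w)) $ i $ j = \<psi> (chart0 w) $ i $ j" if "w \<in> - {0}" for w
      using that by (simp add: chart0_def chart1_def)
    have "has_wd (\<lambda>w. \<psi> (chart0 w) $ i $ j) (smul 2 (\<psi> (chart1 (1 / z)) ** A_z \<psi> chart1 (1 / z)) $ i $ j * (- 1 / z\<^sup>2))
        (smul (-2) (\<psi> (chart1 (1 / z)) ** adj (A_z \<psi> chart1 (1 / z))) $ i $ j * cnj (- 1 / z\<^sup>2)) z"
      by (rule has_wd_transform[OF has_wd_compose_holo[OF inv a] _ zz e]) auto
    moreover have "has_wd (\<lambda>w. \<psi> (chart0 w) $ i $ j) (smul 2 (\<psi> (chart0 z) ** A_z \<psi> chart0 z) $ i $ j) (smul (-2) (\<psi> (chart0 z) ** adj (A_z \<psi> chart0 z)) $ i $ j) z"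
      using 1 unfolding mwd_def by blast
    ultimately have "smul 2 (\<psi> (chart0 z) ** A_z \<psi> chart0 z) $ i $ j = smul 2 (\<psi> (chart1 (1 / z)) ** A_z \<psi> chart1 (1 / z)) $ i $ j * (- 1 / z\<^sup>2)"
      using has_wd_unique by blast
    moreover have "x = k * y" if "2 * x = 2 * y * k" for x y k :: complex
    proof -
      have "2 * x = 2 * (k * y)" using that by (simp only: mult_ac)
      then show ?thesis by simp
    qed
    ultimately show ?thesis unfolding p smul_nth by blast
  qed
  have "\<psi> (chart0 z) ** A_z \<psi> chart0 z = \<psi> (chart0 z) ** smul (- 1 / z\<^sup>2) (A_z \<psi> chart1 (1 / z))"
    unfolding smul_simps by (simp add: vec_eq_iff smul_nth ent)
  then have "adj (\<psi> (chart0 z)) ** \<psi> (chart0 z) ** A_z \<psi> chart0 z = adj (\<psi> (chart0 z)) ** \<psi> (chart0 z) ** smul (- 1 / z\<^sup>2) (A_z \<psi> chart1 (1 / z))"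
    by (simp only: matrix_mul_assoc[symmetric])
  then show ?thesis using unitary_chart(2)[OF unitary_map, of chart0 z] by simp
qed

lemma energy_transition: assumes z: "z ~= 0" shows "energy chart0 z * norm z ^ 4 = energy chart1 (1 / z)"
proof -
  have "(norm (- 1 / z\<^sup>2))\<^sup>2 * norm z ^ 4 = 1" using z by (simp add: norm_divide norm_power power_divide flip: power_mult)
  moreover have "energy chart0 z = (norm (- 1 / z\<^sup>2))\<^sup>2 * energy chart1 (1 / z)"
    unfolding energy_def trace_mult_ctranspose_sum A_z_transition[OF z] smul_nth norm_mult power_mult_distrib sum_distrib_left ..
  ultimately show ?thesis by (simp add: mult_ac)
qed

text \<open>The conformal factor of the induced metric is the energy density. Since the Laplacian is
  4 dz dzbar, constant curvature K reads dz dzbar ln E = - (K/2) E, so \<kappa> is K/2.\<close>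

lemma energy_curvature:
  assumes cc: "constant_curvature \<psi>"
  obtains \<kappa> where "!!z. \<exists>a. has_wd (\<lambda>w. dz (\<lambda>z. of_real (energy chart0 z)) w / of_real (energy chart0 w)) a (- of_real (\<kappa> * energy chart0 z)) z"
proof -
  obtain K where K: "!!z. gauss_curvature \<psi> chart0 z = K" using cc unfolding constant_curvature_def by auto
  define E where "E = energy chart0"
  define D where "D = dz (\<lambda>z. of_real (E z))"
  have sE: "smooth (\<lambda>z. complex_of_real (E z))" unfolding E_def by (rule smooth_energy) simp
  have pos: "E z > 0" for z unfolding E_def by (rule energy_pos) simp
  have dE: "has_wd (\<lambda>z. of_real (E z)) (D z) (cnj (D z)) z" for z
    using smooth_has_wd[OF sE, of z] has_wd_ln(2)[OF smooth_has_wd[OF sE] pos, of z] by (simp add: D_def)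
  define P where "P = (\<lambda>z. D z / of_real (E z))"
  define L where "L = (\<lambda>w. ln (E w))"
  have dL: "has_wd (\<lambda>w. of_real (L w)) (P w) (cnj (P w)) w" for w
    using has_wd_ln(1)[OF dE pos, of w] by (simp add: P_def L_def)
  have nE: "complex_of_real (E z) ~= 0" for z using pos[of z] by simp
  have dD: "has_wd D (dz D z) (dzbar D z) z" for z using smooth_has_wd[OF smooth_dz[OF sE]] by (simp add: D_def)
  \<comment> \<open>The mixed second derivative of a real function is real, by commuting
    \<open>dz\<close> and \<open>dzbar\<close>.\<close>
  have Dr: "cnj (dzbar D z) = dzbar D z" for z
  proof -
    have "dzbar D z = dz (dzbar (\<lambda>z. of_real (E z))) z" unfolding D_def by (rule dz_dzbar_commute(1)[OF sE])
    moreover have "dzbar (\<lambda>z. of_real (E z)) = (\<lambda>z. cnj (D z))" using has_wd_dzbar[OF dE] by auto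
    moreover have "dz (\<lambda>z. cnj (D z)) z = cnj (dzbar D z)" by (rule has_wd_dz[OF has_wd_cnj[OF dD]])
    ultimately show ?thesis by simp
  qed
  have dP: "has_wd P ((dz D z * of_real (E z) - D z * D z) / (of_real (E z))\<^sup>2) ((dzbar D z * of_real (E z) - D z * cnj (D z)) / (of_real (E z))\<^sup>2) z" for z
    unfolding P_def by (rule has_wd_divide[OF dD dE nE])
  define Pa where "Pa = (\<lambda>z. (dz D z * of_real (E z) - D z * D z) / (of_real (E z))\<^sup>2)"
  define Pb where "Pb = (\<lambda>z. (dzbar D z * of_real (E z) - D z * cnj (D z)) / (complex_of_real (E z))\<^sup>2)"
  have dP': "has_wd P (Pa z) (Pb z) z" for z unfolding Pa_def Pb_def by (rule dP)
  have "cnj (Pb z) = Pb z" for z unfolding Pb_def by (simp add: Dr mult.commute)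
  then have Pr: "Pb z = of_real (Re (Pb z))" for z by (simp add: complex_eq_iff)
  have "pd t L w = Re (P w * t + cnj (P w) * cnj t)" for t w
    using has_wd_real_pd[OF dL, of t w] by simp
  then have l: "pd 1 L = (\<lambda>w. Re (2 * P w))" "pd \<i> L = (\<lambda>w. Re (2 * \<i> * P w))" by auto
  have c: "has_wd (\<lambda>w. s * P w) (s * Pa z) (s * Pb z) z" for s z
    using has_wd_mult[OF has_wd_const[of s] dP'[of z]] by simp
  have "pd 1 (pd 1 L) z + pd \<i> (pd \<i> L) z = 4 * Re (Pb z)" for z
    unfolding l has_wd_real_pd[OF c] by simp
  moreover have "gauss_curvature \<psi> chart0 z = - (pd 1 (pd 1 L) z + pd \<i> (pd \<i> L) z) / (2 * E z)" for z
    unfolding gauss_curvature_def Let_def L_def E_def energy_def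
    by (simp add: induced_metric_conformal[OF unitary_map _ conformal])
  ultimately have "Re (Pb z) = - (K / 2) * E z" for z using K[of z] pos[of z] by (simp add: field_simps)
  then have "Pb z = - of_real (K / 2 * E z)" for z using Pr[of z] by simp
  then have "has_wd P (Pa z) (- of_real (K / 2 * E z)) z" for z using dP'[of z] by simp
  then show ?thesis using that[of "K / 2"] unfolding P_def D_def E_def by blast
qed

end

section \<open>Orthogonal complements in osculating planes\<close>

definition oc :: "complex^3 => complex^3 => (complex^3) set" where
  "oc f g = {v. (\<exists>s t. v = s *s f + t *s g) \<and> hinner v f = 0}"

lemma span2_iff: "v \<in> vec.span {f, g} \<longleftrightarrow> (\<exists>s t. v = s *s f + t *s g)" for f g :: "complex^3"
proof
  assume "v \<in> vec.span {f, g}"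
  then obtain s where "v - s *s f \<in> vec.span {g}" unfolding vec.span_breakdown_eq[of v f] by blast
  then obtain t where "v - s *s f = t *s g" by (auto simp: vec.span_singleton)
  then have "v = s *s f + t *s g" by (simp add: algebra_simps)
  then show "\<exists>s t. v = s *s f + t *s g" by blast
next
  assume "\<exists>s t. v = s *s f + t *s g"
  then obtain s t where "v = s *s f + t *s g" by blast
  then show "v \<in> vec.span {f, g}" by (simp add: vec.span_add vec.span_scale vec.span_base)
qed

lemma osculating_complement_oc: "osculating_complement f 1 z = oc (f z) (dz_vec f z)"
proof -
  have 1: "osculating f 1 z = vec.span {f z}" by (simp add: osculating_def lessThan_Suc)
  have 2: "osculating f (Suc 1) z = vec.span {f z, dz_vec f z}"
    by (simp add: osculating_def lessThan_Suc numeral_2_eq_2 insert_commute)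
  have 3: "(\<forall>u\<in>vec.span {f z}. hinner v u = 0) \<longleftrightarrow> hinner v (f z) = 0" for v
  proof
    assume "\<forall>u\<in>vec.span {f z}. hinner v u = 0"
    then show "hinner v (f z) = 0" using vec.span_base[of "f z" "{f z}"] by blast
  qed (auto simp: vec.span_singleton hinner_simps)
  show ?thesis unfolding osculating_complement_def 1 2 3 span2_iff oc_def ..
qed

lemma oc_subspace: "vec.subspace (oc f g)"
proof -
  have "oc f g = vec.span {f, g} \<inter> {v. hinner v f = 0}" by (simp only: oc_def span2_iff Int_def mem_Collect_eq)
  moreover have "vec.subspace {v. hinner v f = 0}"
    by (auto simp: vec.subspace_def hinner_simps)
  ultimately show ?thesis by (simp add: vec.subspace_inter)
qed

text \<open>The orthogonal complement depends only on the line of \<open>f\<close> and the plane of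
  \<open>f\<close> and \<open>g\<close>; rescaling a lift or changing the coordinate adds multiples
  of \<open>f\<close> to the derivative and has no effect.\<close>

lemma oc_change: assumes "l ~= 0" "n ~= 0" shows "oc (l *s f) (m *s f + n *s g) = oc f g"
proof -
  have "(\<exists>s t. v = s *s (l *s f) + t *s (m *s f + n *s g)) \<longleftrightarrow> (\<exists>s t. v = s *s f + t *s g)" for v
  proof
    assume "\<exists>s t. v = s *s (l *s f) + t *s (m *s f + n *s g)"
    then obtain s t where "v = s *s (l *s f) + t *s (m *s f + n *s g)" by blast
    then have "v = (s * l + t * m) *s f + (t * n) *s g" by (simp add: vec_eq_iff algebra_simps)
    then show "\<exists>s t. v = s *s f + t *s g" by blast
  next
    assume "\<exists>s t. v = s *s f + t *s g"
    then obtain s t where v: "v = s *s f + t *s g" by blast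
    have "v = ((s - t / n * m) / l) *s (l *s f) + (t / n) *s (m *s f + n *s g)"
      unfolding v using assms by (simp add: vec_eq_iff field_simps)
    then show "\<exists>s t. v = s *s (l *s f) + t *s (m *s f + n *s g)" by blast
  qed
  then show ?thesis using assms by (simp add: oc_def hinner_simps)
qed

lemma oc_unitary: assumes U: "adj U ** U = mat 1" shows "(*v) U ` oc f g = oc (U *v f) (U *v g)"
proof -
  have h: "hinner (U *v x) (U *v y) = hinner x y" for x y
    by (simp add: hinner_matrix matrix_vector_mul_assoc U)
  have l: "U *v (s *s f + t *s g) = s *s (U *v f) + t *s (U *v g)" for s t
    by (simp add: vector_distribs vector_scalar_commute)
  show ?thesis
  proof (intro set_eqI iffI)
    fix v assume "v \<in> (*v) U ` oc f g"
    then show "v \<in> oc (U *v f) (U *v g)" by (auto simp: oc_def h) (use l in blast)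
  next
    fix v assume "v \<in> oc (U *v f) (U *v g)"
    then obtain s t where v: "v = s *s (U *v f) + t *s (U *v g)" "hinner v (U *v f) = 0" by (auto simp: oc_def)
    have "v = U *v (s *s f + t *s g)" unfolding l v(1) ..
    moreover from this have "s *s f + t *s g \<in> oc f g" using v(2) unfolding oc_def by (auto simp: h)
    ultimately show "v \<in> (*v) U ` oc f g" by blast
  qed
qed

text \<open>Cramer's rule: the coefficients are quotients of components of cross products, taken at
  an index where the cross product of \<open>f\<close> and \<open>g\<close> is nonzero.\<close>

lemma in_plane:
  assumes n: "ccross f g ~= 0" and o: "hinner v (vcnj (ccross f g)) = 0" shows "\<exists>s t. v = s *s f + t *s g"
proof -
  obtain i where i: "ccross f g $ i ~= 0" using n by (auto simp: vec_eq_iff)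
  define D where "D = hinner v (vcnj (ccross f g))"
  have D: "D = 0" using o by (simp add: D_def)
  have e: "ccross f g $ 1 * v $ 1 = ccross v g $ 1 * f $ 1 + ccross f v $ 1 * g $ 1 + D"
    "ccross f g $ 1 * v $ 2 = ccross v g $ 1 * f $ 2 + ccross f v $ 1 * g $ 2"
    "ccross f g $ 1 * v $ 3 = ccross v g $ 1 * f $ 3 + ccross f v $ 1 * g $ 3"
    "ccross f g $ 2 * v $ 1 = ccross v g $ 2 * f $ 1 + ccross f v $ 2 * g $ 1"
    "ccross f g $ 2 * v $ 2 = ccross v g $ 2 * f $ 2 + ccross f v $ 2 * g $ 2 + D"
    "ccross f g $ 2 * v $ 3 = ccross v g $ 2 * f $ 3 + ccross f v $ 2 * g $ 3"
    "ccross f g $ 3 * v $ 1 = ccross v g $ 3 * f $ 1 + ccross f v $ 3 * g $ 1"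
    "ccross f g $ 3 * v $ 2 = ccross v g $ 3 * f $ 2 + ccross f v $ 3 * g $ 2"
    "ccross f g $ 3 * v $ 3 = ccross v g $ 3 * f $ 3 + ccross f v $ 3 * g $ 3 + D"
    unfolding D_def hinner_3 vcnj_nth complex_cnj_cnj ccross_nth by (simp_all add: algebra_simps)
  have "ccross f g $ 1 *s v = ccross v g $ 1 *s f + ccross f v $ 1 *s g"
    unfolding vec3_eq_iff vector_smult_component vector_add_component by (simp only: e D add_0_right)
  moreover have "ccross f g $ 2 *s v = ccross v g $ 2 *s f + ccross f v $ 2 *s g"
    unfolding vec3_eq_iff vector_smult_component vector_add_component by (simp only: e D add_0_right)
  moreover have "ccross f g $ 3 *s v = ccross v g $ 3 *s f + ccross f v $ 3 *s g"
    unfolding vec3_eq_iff vector_smult_component vector_add_component by (simp only: e D add_0_right)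
  ultimately have "ccross f g $ i *s v = ccross v g $ i *s f + ccross f v $ i *s g" using exhaust_3[of i] by auto
  then have "v = (ccross v g $ i / ccross f g $ i) *s f + (ccross f v $ i / ccross f g $ i) *s g"
    using i by (simp add: vec_eq_iff field_simps)
  then show ?thesis by blast
qed

context lifted_chart
begin

text \<open>When \<open>A1 ** adj A0\<close> vanishes, the unitarity relations make the three
  coefficients Hermitian projections that are mutually orthogonal and sum to the identity.
  \<open>A0\<close> projects to the line of f and \<open>A2\<close> to the normal of its osculating
  plane, which leaves for \<open>A1\<close> the second line of the Frenet frame.\<close>

lemma middle_projection:
  assumes z: "z \<in> U" and h: "A1 z ** adj (A0 z) = 0"
  shows "adj (A1 z) = A1 z" "A1 z ** A1 z = A1 z" "range ((*v) (A1 z)) = oc (f z) (f1 z)"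
proof -
  obtain u m w a b e \<alpha> \<gamma> \<delta> \<nu> d where l: "loop_frame (A0 z) (A1 z) (A2 z) (A z) u m w a b e \<alpha> \<gamma> \<delta> \<nu> d"
    by (rule get_frame)
  obtain t \<sigma> where t: "f z = t *s a" "t ~= 0" "vcnj (ccross (f z) (f1 z)) = \<sigma> *s b" "\<sigma> ~= 0"
    by (rule lift_frame[OF z l])
  have L: "A0 z = outer a u" "A2 z = outer b w" "hinner u u = 1" "hinner w w = 1" using l by (auto simp: loop_frame_def)
  have u0: "u ~= 0" "w ~= 0" using L(3,4) by auto
  have cc: "adj (adj M) = M" for M :: "complex^3^3" by (simp add: ctranspose_def vec_eq_iff)
  have c0: "adj (0 :: complex^3^3) = 0" by (simp add: ctranspose_def vec_eq_iff)
  note R = unitary_relations(5,6,7,11)[of z]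
  have s: "A0 z ** X + A1 z ** X + A2 z ** X = X" for X :: "complex^3^3"
    using arg_cong[OF R(3), of "\<lambda>M. M ** X"] by (simp add: matrix_add_rdistrib')
  have a0: "A0 z ** adj (A0 z) = adj (A0 z)" using s[of "adj (A0 z)"] h R(2) by simp
  have A0h: "adj (A0 z) = A0 z"
  proof -
    have "A0 z ** adj (A0 z) = A0 z" using arg_cong[OF a0, of adj] by (simp only: ctranspose_mult cc)
    from trans[OF a0[symmetric] this] show ?thesis .
  qed
  have "A2 z ** adj (A1 z) = 0" using R(1) h by simp
  from arg_cong[OF this, of adj] have a12: "A1 z ** adj (A2 z) = 0" by (simp add: ctranspose_mult cc c0)
  have a2: "A2 z ** adj (A2 z) = adj (A2 z)" using s[of "adj (A2 z)"] a12 R(4) by simp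
  have A2h: "adj (A2 z) = A2 z"
  proof -
    have "A2 z ** adj (A2 z) = A2 z" using arg_cong[OF a2, of adj] by (simp only: ctranspose_mult cc)
    from trans[OF a2[symmetric] this] show ?thesis .
  qed
  have A1e: "A1 z = mat 1 - A0 z - A2 z" using R(3) by (simp add: algebra_simps)
  have m1: "adj (mat 1 :: complex^3^3) = mat 1" by (auto simp: ctranspose_def mat_def vec_eq_iff)
  show A1h: "adj (A1 z) = A1 z" unfolding A1e ctranspose_diff A0h A2h m1 ..
  have z1: "A1 z ** A0 z = 0" "A1 z ** A2 z = 0" using h a12 unfolding A0h A2h by auto
  have "A1 z ** A1 z = A1 z ** (mat 1 - A0 z - A2 z)" unfolding A1e[symmetric] ..
  also have "\<dots> = A1 z" unfolding matrix_diff_ldistrib z1 by simp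
  finally show "A1 z ** A1 z = A1 z" .
  have z2: "A0 z ** A1 z = 0" "A2 z ** A1 z = 0"
    using arg_cong[OF z1(1), of adj] arg_cong[OF z1(2), of adj] by (simp_all add: ctranspose_mult A0h A1h A2h c0)
  have o: "A0 z = outer u a" "A2 z = outer w b" using A0h A2h unfolding L ctranspose_outer by auto
  have kn: "ccross (f z) (f1 z) ~= 0" using A1_A0_adjoint(4)[OF z] by (auto simp: normG_def hinner_def)
  show "range ((*v) (A1 z)) = oc (f z) (f1 z)"
  proof (intro set_eqI iffI)
    fix v assume "v \<in> range ((*v) (A1 z))"
    then obtain x where v: "v = A1 z *v x" by blast
    have "A0 z *v v = 0" "A2 z *v v = 0" unfolding v by (simp_all add: matrix_vector_mul_assoc z2)
    then have "hinner v a = 0" "hinner v b = 0" unfolding o outer_vec using u0 by auto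
    then have hv: "hinner v (f z) = 0" "hinner v (vcnj (ccross (f z) (f1 z))) = 0"
      unfolding t(3) unfolding t(1) by (simp_all add: hinner_simps)
    show "v \<in> oc (f z) (f1 z)" unfolding oc_def using in_plane[OF kn hv(2)] hv(1) by blast
  next
    fix v assume v: "v \<in> oc (f z) (f1 z)"
    then obtain s r where sr: "v = s *s f z + r *s f1 z" and vf: "hinner v (f z) = 0" by (auto simp: oc_def)
    have vn: "hinner v (vcnj (ccross (f z) (f1 z))) = 0" by (simp add: sr hinner_simps ccross_orthogonal)
    have "hinner v a = 0" using vf t(2) unfolding t(1) by (simp add: hinner_simps)
    moreover have "hinner v b = 0" using vn t(4) unfolding t(3) by (simp add: hinner_simps)
    ultimately have "A0 z *v v = 0" "A2 z *v v = 0" unfolding o by (simp_all add: outer_vec)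
    then have "A1 z *v v = v" unfolding A1e by (simp add: vector_distribs)
    then show "v \<in> range ((*v) (A1 z))" by (metis rangeI)
  qed
qed

end

lemma idx_bij: "bij_betw (idx :: 'r::{finite,linorder} => nat) UNIV {..<CARD('r)}"
proof -
  have lt: "idx i < idx j" if "i < j" for i j :: 'r
    unfolding idx_def by (rule psubset_card_mono) (use that in auto)
  have inj: "inj (idx :: 'r => nat)" by (rule injI) (metis lt less_irrefl linorder_neqE)
  have "idx j < CARD('r)" for j :: 'r unfolding idx_def by (rule psubset_card_mono) auto
  then have sub: "range (idx :: 'r => nat) \<subseteq> {..<CARD('r)}" by auto
  have "card (range (idx :: 'r => nat)) = CARD('r)" by (rule card_image[OF inj])
  then have "range (idx :: 'r => nat) = {..<CARD('r)}" by (intro card_subset_eq[OF _ sub]) auto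
  then show ?thesis using inj by (simp add: bij_betw_def)
qed

text \<open>The squared lengths 1 : 2 : 1 are those of the coefficient vectors of the Veronese
  curve, so orthogonal vectors with these proportions are their image under a unitary matrix and a
  scaling.\<close>

lemma veronese_unitary:
  fixes b0 b1 b2 :: "complex^3"
  assumes o: "hinner b0 b1 = 0" "hinner b0 b2 = 0" "hinner b1 b2 = 0"
    and n: "Re (hinner b1 b1) = 2 * Re (hinner b0 b0)" "Re (hinner b2 b2) = Re (hinner b0 b0)" "Re (hinner b0 b0) > 0"
  obtains V :: "complex^3^3" and r :: complex where "V \<in> unitary_group" "r ~= 0"
    "!!z. V *v veronese_lift0 z = r *s (b0 + z *s b1 + z\<^sup>2 *s b2)" "!!z. V *v dz_vec veronese_lift0 z = r *s (b1 + (2 * z) *s b2)"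
    "V *v veronese_lift1 0 = r *s b2" "V *v dz_vec veronese_lift1 0 = r *s b1"
proof -
  define F where "F = Re (hinner b0 b0)"
  define \<rho> where "\<rho> = complex_of_real (1 / sqrt F)"
  have F: "F > 0" using n by (simp add: F_def)
  define s where "s = (\<lambda>k. complex_of_real (sqrt (real (2 choose k))))"
  have s: "s 0 = 1" "s (Suc 0) = of_real (sqrt 2)" "s 2 = 1" by (simp_all add: s_def)
  define b where "b = (\<lambda>k. if k = 0 then b0 else if k = Suc 0 then b1 else b2)"
  \<comment> \<open>Dividing by the square roots of the binomial coefficients and by the common
    length makes the three vectors orthonormal; they are the columns of \<open>V\<close>.\<close>
  define col where "col = (\<lambda>k. (\<rho> / s k) *s b k)"
  define V :: "complex^3^3" where "V = (\<chi> i j. col (idx j) $ i)"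
  have i3: "idx (j :: 3) < 3" for j using idx_bij[where 'r = 3] by (auto simp: bij_betw_def)
  have inj: "idx i = idx j \<longleftrightarrow> i = j" for i j :: 3 using idx_bij[where 'r = 3] by (auto simp: bij_betw_def inj_eq)
  have ev: "V *v (\<chi> k. x (idx k)) = (\<Sum>k<3. x k *s col k)" for x
  proof -
    have "(V *v (\<chi> k. x (idx k))) $ i = (\<Sum>k<3. x k * col k $ i)" for i
    proof -
      have "(V *v (\<chi> k. x (idx k))) $ i = (\<Sum>j\<in>(UNIV :: 3 set). x (idx j) * col (idx j) $ i)"
        by (simp add: matrix_vector_mult_def V_def mult.commute)
      also have "\<dots> = (\<Sum>k<3. x k * col k $ i)" using sum.reindex_bij_betw[OF idx_bij[where 'r = 3], of "\<lambda>k. x k * col k $ i"] by simp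
      finally show ?thesis .
    qed
    then show ?thesis by (simp add: vec_eq_iff sum_component)
  qed
  have b: "hinner (b k) (b l) = (if k = l then of_real F * (s k * cnj (s k)) else 0)" if "k < 3" "l < 3" for k l
  proof -
    have k: "k = 0 \<or> k = Suc 0 \<or> k = 2" "l = 0 \<or> l = Suc 0 \<or> l = 2" using that by auto
    have r: "hinner b0 b0 = of_real F" "hinner b1 b1 = of_real (2 * F)" "hinner b2 b2 = of_real F"
      using hinner_real(1)[of b0] hinner_real(1)[of b1] hinner_real(1)[of b2] n by (simp_all add: F_def)
    have sq: "complex_of_real (sqrt 2) * complex_of_real (sqrt 2) = 2" by (metis of_real_mult of_real_numeral real_sqrt_mult_self abs_numeral)
    show ?thesis using k by (auto simp: b_def s r o hinner_swap_zero[OF o(1)] hinner_swap_zero[OF o(2)] hinner_swap_zero[OF o(3)] sq)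
  qed
  have sn: "s k ~= 0" if "k < 3" for k using that by (auto simp: s_def)
  have \<rho>: "\<rho> * cnj \<rho> * of_real F = 1"
  proof -
    have "1 / sqrt F * (1 / sqrt F) * F = 1" using F by simp
    then show ?thesis unfolding \<rho>_def by (metis complex_cnj_complex_of_real of_real_1 of_real_mult)
  qed
  have colo: "hinner (col k) (col l) = (if k = l then 1 else 0)" if "k < 3" "l < 3" for k l
  proof (cases "k = l")
    case True
    have "hinner (col k) (col k) = (\<rho> * cnj \<rho> * of_real F) * ((s k / s k) * (cnj (s k) / cnj (s k)))"
      using b[OF that(1) that(1)] by (simp add: col_def hinner_simps mult_ac)
    then show ?thesis using True \<rho> sn[OF that(1)] by simp
  next
    case False
    then show ?thesis using b[OF that] by (simp add: col_def hinner_simps)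
  qed
  have VV: "adj V ** V = mat 1"
  proof -
    have "(adj V ** V) $ i $ j = hinner (col (idx j)) (col (idx i))" for i j
      by (simp add: matrix_matrix_mult_def ctranspose_def V_def hinner_def mult.commute)
    then show ?thesis using colo[OF i3 i3] by (simp add: vec_eq_iff mat_def inj eq_commute)
  qed
  then have "V ** adj V = mat 1" by (rule matrix_left_right_inverse[THEN iffD1])
  then have Vu: "V \<in> unitary_group" using VV by (simp add: unitary_group_def)
  have sc: "(s k * c) *s col k = (\<rho> * c) *s b k" if "k < 3" for k c
    using sn[OF that] by (simp add: col_def vec.scale_scale)
  have l0: "(veronese_lift0 z :: complex^3) = (\<chi> k. s (idx k) * z ^ idx k)" for z by (simp add: veronese_lift0_def s_def)
  have l1: "(veronese_lift1 z :: complex^3) = (\<chi> k. s (idx k) * z ^ (2 - idx k))" for z by (simp add: veronese_lift1_def s_def)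
  have vw: "vwd (\<lambda>z. \<chi> k. s (idx k) * z ^ e (idx k)) (\<chi> k. s (idx k) * (of_nat (e (idx k)) * z ^ (e (idx k) - 1))) 0 z" for e :: "nat => nat" and z :: complex
    unfolding vwd_def by (auto simp: has_wd_field_derivative intro!: derivative_eq_intros)
  have d0: "dz_vec veronese_lift0 z = ((\<chi> k. s (idx k) * (of_nat (idx k) * z ^ (idx k - 1))) :: complex^3)" for z
    unfolding ext[of veronese_lift0, OF l0] by (rule vwd_dz[OF vw[of "\<lambda>k. k"]])
  have d1: "dz_vec veronese_lift1 z = ((\<chi> k. s (idx k) * (of_nat (2 - idx k) * z ^ (2 - idx k - 1))) :: complex^3)" for z
    unfolding ext[of veronese_lift1, OF l1] by (rule vwd_dz[OF vw[of "\<lambda>k. 2 - k"]])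
  have ev3: "V *v (\<chi> k. s (idx k) * x (idx k)) = \<rho> *s (x 0 *s b0 + x 1 *s b1 + x 2 *s b2)" for x
  proof -
    have "V *v (\<chi> k. s (idx k) * x (idx k)) = (\<Sum>k<3. (\<rho> * x k) *s b k)"
      unfolding ev[of "\<lambda>k. s k * x k"] by (rule sum.cong[OF refl], rule sc, simp)
    then show ?thesis by (simp add: eval_nat_numeral b_def vec.scale_scale vec.scale_right_distrib)
  qed
  show ?thesis
  proof (rule that[OF Vu])
    show "\<rho> ~= 0" using \<rho> by auto
    show "V *v veronese_lift0 z = \<rho> *s (b0 + z *s b1 + z\<^sup>2 *s b2)" for z unfolding l0 ev3[of "\<lambda>k. z ^ k"] by simp
    show "V *v dz_vec veronese_lift0 z = \<rho> *s (b1 + (2 * z) *s b2)" for z unfolding d0 ev3[of "\<lambda>k. of_nat k * z ^ (k - 1)"] by simp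
    show "V *v veronese_lift1 0 = \<rho> *s b2" unfolding l1 ev3[of "\<lambda>k. 0 ^ (2 - k)"] by simp
    show "V *v dz_vec veronese_lift1 0 = \<rho> *s b1" unfolding d1 ev3[of "\<lambda>k. of_nat (2 - k) * 0 ^ (2 - k - 1)"] by simp
  qed
qed

section \<open>The normal form of the curve\<close>

definition quad :: "complex^3 => complex^3 => complex^3 => complex => complex => complex^3" where
  "quad a0 a1 a2 x y = y\<^sup>2 *s a0 + (x * y) *s a1 + x\<^sup>2 *s a2"

text \<open>The polar form of \<open>quad\<close>, normalized as the coefficient of the mixed term:
  it is the coefficient of \<zeta> when \<open>quad\<close> is restricted to a line through two
  vectors.\<close>

definition quad_polar :: "complex^3 => complex^3 => complex^3 => complex => complex => complex => complex => complex^3" where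
  "quad_polar a0 a1 a2 x y x' y' = (2 * (y * y')) *s a0 + (x * y' + x' * y) *s a1 + (2 * (x * x')) *s a2"

lemma quad_pencil:
  "quad a0 a1 a2 (a * \<zeta> + b) (c * \<zeta> + d) = quad a0 a1 a2 b d + \<zeta> *s quad_polar a0 a1 a2 a c b d + \<zeta>\<^sup>2 *s quad a0 a1 a2 a c"
  "quad_polar a0 a1 a2 (a * \<zeta> + b) (c * \<zeta> + d) a c = quad_polar a0 a1 a2 a c b d + (2 * \<zeta>) *s quad a0 a1 a2 a c"
  by (simp_all add: quad_def quad_polar_def vec_eq_iff algebra_simps power2_eq_square)

lemma quad_affine:
  assumes "y ~= 0"
  shows "quad a0 a1 a2 x y = y\<^sup>2 *s (a0 + (x / y) *s a1 + (x / y)\<^sup>2 *s a2)"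
    "quad_polar a0 a1 a2 x y x' y' = (2 * (y * y')) *s (a0 + (x / y) *s a1 + (x / y)\<^sup>2 *s a2) + (x' * y - x * y') *s (a1 + (2 * (x / y)) *s a2)"
  using assms by (simp_all add: quad_def quad_polar_def vec_eq_iff field_simps power2_eq_square)

text \<open>The metric is regular at infinity, which excludes \<gamma> = 0; a negative \<gamma>
  would contradict positivity for large z. The determinant condition is positivity at the minimum of
  the form.\<close>

lemma positive_hermitian_function:
  fixes \<alpha> \<gamma> :: real and E1 :: "complex => real"
  assumes pos: "!!z. \<alpha> + 2 * Re (\<beta> * z) + \<gamma> * (norm z)\<^sup>2 > 0"
    and E: "!!z. z ~= 0 ==> E1 (1 / z) * (\<alpha> + 2 * Re (\<beta> * z) + \<gamma> * (norm z)\<^sup>2)\<^sup>2 = (norm z) ^ 4" and c: "continuous_on UNIV E1"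
  shows "\<gamma> > 0" "\<alpha> * \<gamma> > (norm \<beta>)\<^sup>2"
proof -
  \<comment> \<open>The relation between metric and form in the coordinate w = 1 / z. By continuity
    it persists at w = 0, where it says \<open>E1 0 * \<gamma>\<^sup>2 = 1\<close>.\<close>
  define h where "h = (\<lambda>w. E1 w * (\<alpha> * (norm w)\<^sup>2 + 2 * Re (\<beta> * cnj w) + \<gamma>)\<^sup>2 - 1)"
  have "h 0 = 0"
  proof (rule continuous_zero_off_finite[where F = "{0}"])
    show "continuous_on UNIV h" unfolding h_def by (intro continuous_intros c)
    fix w :: complex assume "w \<notin> {0}"
    then have w: "w ~= 0" by simp
    define z where "z = 1 / w"
    have z: "z ~= 0" "1 / z = w" using w by (simp_all add: z_def)
    have n: "norm w * norm z = 1" using w by (simp add: z_def norm_divide)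
    have "cnj w * (of_real ((norm z)\<^sup>2)) = z"
      unfolding complex_norm_square using w by (simp add: z_def)
    then have "\<beta> * z = \<beta> * cnj w * of_real ((norm z)\<^sup>2)" by (simp add: mult_ac)
    then have b: "Re (\<beta> * z) = Re (\<beta> * cnj w) * (norm z)\<^sup>2" by (simp only: Re_complex_of_real times_complex.sel Im_complex_of_real)
    have a: "\<alpha> = \<alpha> * (norm w)\<^sup>2 * (norm z)\<^sup>2"
    proof -
      have "(norm w)\<^sup>2 * (norm z)\<^sup>2 = 1" using n by (simp flip: power_mult_distrib)
      then show ?thesis by (simp add: mult.assoc)
    qed
    have "\<alpha> + 2 * Re (\<beta> * z) + \<gamma> * (norm z)\<^sup>2 = (\<alpha> * (norm w)\<^sup>2 + 2 * Re (\<beta> * cnj w) + \<gamma>) * (norm z)\<^sup>2"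
      unfolding b by (subst a) (simp add: algebra_simps)
    then have "E1 w * ((\<alpha> * (norm w)\<^sup>2 + 2 * Re (\<beta> * cnj w) + \<gamma>) * (norm z)\<^sup>2)\<^sup>2 = (norm z) ^ 4" using E[OF z(1)] z(2) by simp
    then have "(E1 w * (\<alpha> * (norm w)\<^sup>2 + 2 * Re (\<beta> * cnj w) + \<gamma>)\<^sup>2) * norm z ^ 4 = 1 * norm z ^ 4"
      by (simp add: power_mult_distrib flip: power_mult)
    moreover have "norm z ^ 4 ~= 0" using z by simp
    ultimately show "h w = 0" unfolding h_def using mult_right_cancel by (metis cancel_comm_monoid_add_class.diff_cancel)
  qed simp
  then have g0: "\<gamma> ~= 0" by (auto simp: h_def)
  show g: "\<gamma> > 0"
  proof (rule ccontr)
    assume "\<not> \<gamma> > 0"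
    then have g: "\<gamma> < 0" using g0 by simp
    define M where "M = \<bar>\<alpha>\<bar> + 2 * \<bar>Re \<beta>\<bar>"
    \<comment> \<open>A real point so far out that the negative quadratic term outweighs the
      constant and linear ones.\<close>
    define t where "t = 1 + M / (- \<gamma>)"
    have M: "M \<ge> 0" by (simp add: M_def)
    then have t: "t \<ge> 1" using g by (simp add: t_def divide_nonneg_neg)
    have "\<gamma> * t \<le> - M" using g by (simp add: t_def field_simps)
    then have "\<gamma> * t * t \<le> - M * t" using t by (intro mult_right_mono) auto
    moreover have "2 * (Re \<beta> * t) \<le> 2 * \<bar>Re \<beta>\<bar> * t" using t by (simp add: mult_right_mono)
    moreover have "\<alpha> \<le> \<bar>\<alpha>\<bar> * t"
    proof -
      have "\<bar>\<alpha>\<bar> * 1 \<le> \<bar>\<alpha>\<bar> * t" using t by (intro mult_left_mono) auto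
      then show ?thesis by linarith
    qed
    moreover have "M * t = \<bar>\<alpha>\<bar> * t + 2 * \<bar>Re \<beta>\<bar> * t" by (simp add: M_def algebra_simps)
    moreover have "\<alpha> + 2 * (Re \<beta> * t) + \<gamma> * (t * t) > 0" using pos[of "of_real t"] t by (simp add: power2_eq_square)
    ultimately show False by (simp add: mult.assoc)
  qed
  \<comment> \<open>The critical point of the quadratic function, its minimum for positive
    \<gamma>.\<close>
  define z where "z = - cnj \<beta> / of_real \<gamma>"
  have "\<beta> * z = - of_real ((norm \<beta>)\<^sup>2 / \<gamma>)" unfolding z_def of_real_divide complex_norm_square by simp
  then have 1: "Re (\<beta> * z) = - ((norm \<beta>)\<^sup>2 / \<gamma>)" by (simp only: uminus_complex.sel Re_complex_of_real)
  have 2: "\<gamma> * (norm z)\<^sup>2 = (norm \<beta>)\<^sup>2 / \<gamma>" using g by (simp add: z_def norm_divide power_divide power2_eq_square)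
  have "0 < \<alpha> - (norm \<beta>)\<^sup>2 / \<gamma>" using pos[of z] unfolding 1 2 by simp
  then show "\<alpha> * \<gamma> > (norm \<beta>)\<^sup>2" using g by (simp add: field_simps)
qed

context uniton_two
begin

text \<open>Combines the two Liouville results: E = 1/\<phi>^2 and E^2 e = C give e = C \<phi>^4.
  The linear substitution diagonalizing \<phi> acts on f as on a quadratic form and on the extension
  class as on a quartic form, so the comparison of coefficients applies to the transformed data; the
  vanishing of the class is carried back.\<close>

lemma veronese_normal_form:
  assumes cc: "constant_curvature \<psi>"
  obtains a0 a1 a2 a b c d where
    "lifted_chart (\<lambda>z. A0 (chart0 z)) (\<lambda>z. A1 (chart0 z)) (\<lambda>z. A2 (chart0 z)) (A_z \<psi> chart0) UNIV
      (\<lambda>z. a0 + z *s a1 + z\<^sup>2 *s a2) (\<lambda>z. a1 + (2 * z) *s a2) (\<lambda>z. 2 *s a2)"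
    "lifted_chart (\<lambda>z. A0 (chart1 z)) (\<lambda>z. A1 (chart1 z)) (\<lambda>z. A2 (chart1 z)) (A_z \<psi> chart1) UNIV
      (\<lambda>z. a2 + z *s a1 + z\<^sup>2 *s a0) (\<lambda>z. a1 + (2 * z) *s a0) (\<lambda>z. 2 *s a0)"
    "!!z. A1 (chart0 z) ** adj (A0 (chart0 z)) = 0" "a * d - b * c ~= 0"
    "hinner (quad a0 a1 a2 b d) (quad_polar a0 a1 a2 a c b d) = 0" "hinner (quad a0 a1 a2 b d) (quad a0 a1 a2 a c) = 0"
    "hinner (quad_polar a0 a1 a2 a c b d) (quad a0 a1 a2 a c) = 0"
    "Re (hinner (quad_polar a0 a1 a2 a c b d) (quad_polar a0 a1 a2 a c b d)) = 2 * Re (hinner (quad a0 a1 a2 b d) (quad a0 a1 a2 b d))"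
    "Re (hinner (quad a0 a1 a2 a c) (quad a0 a1 a2 a c)) = Re (hinner (quad a0 a1 a2 b d) (quad a0 a1 a2 b d))"
    "Re (hinner (quad a0 a1 a2 b d) (quad a0 a1 a2 b d)) > 0"
proof -
  obtain a0 a1 a2 where l0: "lifted_chart (\<lambda>z. A0 (chart0 z)) (\<lambda>z. A1 (chart0 z)) (\<lambda>z. A2 (chart0 z)) (A_z \<psi> chart0) UNIV
      (\<lambda>z. a0 + z *s a1 + z\<^sup>2 *s a2) (\<lambda>z. a1 + (2 * z) *s a2) (\<lambda>z. 2 *s a2)"
    and l1: "lifted_chart (\<lambda>z. A0 (chart1 z)) (\<lambda>z. A1 (chart1 z)) (\<lambda>z. A2 (chart1 z)) (A_z \<psi> chart1) UNIV
      (\<lambda>z. a2 + z *s a1 + z\<^sup>2 *s a0) (\<lambda>z. a1 + (2 * z) *s a0) (\<lambda>z. 2 *s a0)" by (rule quadratic_lift)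
  define f f1 f2 g g1 g2 where fd: "f = (\<lambda>z. a0 + z *s a1 + z\<^sup>2 *s a2)" "f1 = (\<lambda>z. a1 + (2 * z) *s a2)" "f2 = (\<lambda>z::complex. 2 *s a2)"
    and gd: "g = (\<lambda>z. a2 + z *s a1 + z\<^sup>2 *s a0)" "g1 = (\<lambda>z. a1 + (2 * z) *s a0)" "g2 = (\<lambda>z::complex. 2 *s a0)"
  interpret c0: lifted_chart "\<lambda>z. A0 (chart0 z)" "\<lambda>z. A1 (chart0 z)" "\<lambda>z. A2 (chart0 z)" "A_z \<psi> chart0" UNIV f f1 f2
    unfolding fd by (rule l0)
  interpret c1: lifted_chart "\<lambda>z. A0 (chart1 z)" "\<lambda>z. A1 (chart1 z)" "\<lambda>z. A2 (chart1 z)" "A_z \<psi> chart1" UNIV g g1 g2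
    unfolding gd by (rule l1)
  obtain \<kappa> where curv: "!!z. \<exists>a. has_wd (\<lambda>w. dz (\<lambda>z. of_real (energy chart0 z)) w / of_real (energy chart0 w)) a (- of_real (\<kappa> * energy chart0 z)) z"
    by (rule energy_curvature[OF cc]) blast
  define e e1 where "e = (\<lambda>z. Re (c0.pot z))" and "e1 = (\<lambda>z. Re (c1.pot z))"
  have pe: "c0.pot z = of_real (e z)" "c1.pot z = of_real (e1 z)" "e z > 0" "e1 z > 0" "(norm (c0.ext z))\<^sup>2 \<le> e z" for z
    unfolding e_def e1_def using c0.pot_real c1.pot_real by blast+
  have ff1: "ccross (f z) (f1 z) = ccross a0 a1 + (2 * z) *s ccross a0 a2 + z\<^sup>2 *s ccross a1 a2" for z
    unfolding fd by (rule cross_quadratic)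
  have e_trans: "e z = (norm z) ^ 8 * e1 (1 / z)" if z: "z ~= 0" for z
  proof -
    have p: "chart1 (1 / z) = chart0 z" using z by (simp add: chart0_def chart1_def)
    have g: "g (1 / z) = (1 / z\<^sup>2) *s f z" using z by (simp add: gd fd vec_eq_iff field_simps power2_eq_square)
    have "ccross (g (1 / z)) (g1 (1 / z)) = ccross a2 a1 + (2 * (1 / z)) *s ccross a2 a0 + (1 / z)\<^sup>2 *s ccross a1 a0"
      unfolding gd by (rule cross_quadratic)
    also have "\<dots> = (- 1 / z\<^sup>2) *s ccross (f z) (f1 z)"
      unfolding ff1 using z ccross_swap[of a2 a1] ccross_swap[of a2 a0] ccross_swap[of a1 a0] by (simp add: vec_eq_iff field_simps power2_eq_square)
    finally have k: "ccross (g (1 / z)) (g1 (1 / z)) = (- 1 / z\<^sup>2) *s ccross (f z) (f1 z)" .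
    have F: "c1.normF (1 / z) = (1 / z\<^sup>2) * cnj (1 / z\<^sup>2) * c0.normF z" unfolding c1.normF_def c0.normF_def g by (simp add: hinner_simps)
    have G: "c1.normG (1 / z) = (- 1 / z\<^sup>2) * cnj (- 1 / z\<^sup>2) * c0.normG z" unfolding c1.normG_def c0.normG_def k by (simp add: hinner_simps)
    \<comment> \<open>The same trace appears in both charts, so the ratio of the potentials is the
      ratio of the products of norms.\<close>
    define D where "D = trace (A0 (chart0 z) ** adj (A0 (chart0 z)))"
    have P0: "c0.pot z * D = c0.normF z * c0.normG z" using c0.pot_trace[of z] by (simp add: D_def)
    have P1: "c1.pot (1 / z) * D = c1.normF (1 / z) * c1.normG (1 / z)" using c1.pot_trace[of "1 / z"] unfolding p D_def by simp
    have D: "D ~= 0" using P0 c0.A1_A0_adjoint(3,4)[of z] by auto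
    have "c1.pot (1 / z) * D = ((1 / z\<^sup>2) * cnj (1 / z\<^sup>2)) * ((- 1 / z\<^sup>2) * cnj (- 1 / z\<^sup>2)) * (c0.pot z * D)"
      unfolding P1 P0 F G by (simp only: mult_ac)
    then have "c1.pot (1 / z) * D = (((1 / z\<^sup>2) * cnj (1 / z\<^sup>2)) * ((- 1 / z\<^sup>2) * cnj (- 1 / z\<^sup>2)) * c0.pot z) * D" by (simp only: mult.assoc)
    then have "c1.pot (1 / z) = ((1 / z\<^sup>2) * cnj (1 / z\<^sup>2)) * ((- 1 / z\<^sup>2) * cnj (- 1 / z\<^sup>2)) * c0.pot z"
      by (rule mult_right_cancel[THEN iffD1, OF D])
    from arg_cong[OF this, of norm] have "norm (c1.pot (1 / z)) = norm (c0.pot z) / norm z ^ 8"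
      using z by (simp add: norm_mult norm_divide norm_power flip: power_add power_mult)
    then have "e1 (1 / z) = e z / norm z ^ 8" using pe(3)[of z] pe(4)[of "1 / z"] by (simp add: pe(1,2))
    then show ?thesis using z by simp
  qed
  have e1c: "continuous_on UNIV e1"
  proof -
    have "isCont c1.pot z" for z
    proof -
      obtain q where "has_wd c1.ext q 0 z" using c1.ext_holomorphic by blast
      from has_wd_isCont[OF c1.energy_identity(1)[OF UNIV_I this]] show ?thesis .
    qed
    then show ?thesis unfolding e1_def by (intro continuous_on_Re continuous_at_imp_continuous_on) blast
  qed
  have exth: "c0.ext holomorphic_on UNIV"
    unfolding holomorphic_on_open[OF open_UNIV] using c0.ext_holomorphic by (auto simp: has_wd_field_derivative)
  define q1 where "q1 = deriv c0.ext"
  have q: "has_wd c0.ext (q1 z) 0 z" for z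
    unfolding q1_def has_wd_field_derivative by (rule holomorphic_derivI[OF exth open_UNIV UNIV_I])
  have "q1 holomorphic_on UNIV" unfolding q1_def by (rule holomorphic_deriv[OF exth open_UNIV])
  then have q2: "has_wd q1 (deriv q1 z) 0 z" for z
    unfolding has_wd_field_derivative by (rule holomorphic_derivI[OF _ open_UNIV UNIV_I])
  obtain B where B: "B > 0" "!!z. 1 \<le> norm z ==> \<bar>e1 (1 / z)\<bar> \<le> B" by (rule bounded_chart_infinity[OF e1c]) blast
  \<comment> \<open>The extension class is bounded by the potential, which grows like |z|^8; hence
    the class is a polynomial of degree at most four.\<close>
  have "(norm (c0.ext z))\<^sup>2 \<le> B * norm z ^ 8" if z: "1 \<le> norm z" for z
  proof -
    have "z ~= 0" using z by auto
    then have "e z = norm z ^ 8 * e1 (1 / z)" by (rule e_trans)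
    also have "\<dots> \<le> norm z ^ 8 * B" using B(2)[OF z] by (intro mult_left_mono) auto
    finally show ?thesis using pe(5)[of z] by (simp add: mult.commute)
  qed
  from quartic_growth[OF exth this] obtain k0 k1 k2 k3 k4 where
    ext: "!!z. c0.ext z = k0 + k1 * z + k2 * z ^ 2 + k3 * z ^ 3 + k4 * z ^ 4" by blast
  define ez where "ez = (\<lambda>z. (hinner (f1 z) (f z) * c0.normG z + c0.normF z * hinner (ccross (f z) (f2 z)) (ccross (f z) (f1 z))) + q1 z * cnj (c0.ext z))"
  define ezzb where "ezzb = (\<lambda>z. (hinner (f1 z) (f1 z) * c0.normG z + hinner (f1 z) (f z) * hinner (ccross (f z) (f1 z)) (ccross (f z) (f2 z))
        + hinner (f z) (f1 z) * hinner (ccross (f z) (f2 z)) (ccross (f z) (f1 z))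
        + c0.normF z * hinner (ccross (f z) (f2 z)) (ccross (f z) (f2 z))) + q1 z * cnj (q1 z))"
  define ec where "ec = (\<lambda>z. (hinner (f z) (f1 z) * c0.normG z + c0.normF z * hinner (ccross (f z) (f1 z)) (ccross (f z) (f2 z))) + c0.ext z * cnj (q1 z))"
  have d1: "has_wd (\<lambda>z. of_real (e z)) (ez z) (ec z) z" for z
    using c0.energy_identity(1)[OF UNIV_I q, of z] unfolding ez_def ec_def pe(1)[symmetric] .
  have ecc: "ec z = cnj (ez z)" for z by (rule has_wd_ln(2)[OF d1 pe(3)])
  have d1': "has_wd (\<lambda>z. of_real (e z)) (ez z) (cnj (ez z)) z" for z using d1[of z] by (simp only: ecc)
  have "vwd f2 0 0 z" for z unfolding fd by (rule vwd_const)
  from c0.pot_mixed[OF UNIV_I q q2 this]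
  have "\<exists>X. has_wd ez X (ezzb z) z" for z unfolding ez_def ezzb_def .
  then have d2: "has_wd ez (dz ez z) (ezzb z) z" for z using has_wd_dz by fastforce
  have pot: "of_real (energy chart0 z * (e z)\<^sup>2) = of_real (e z) * ezzb z - ez z * cnj (ez z)" for z
    using c0.energy_identity(2)[OF UNIV_I q, of z] energy_trace[of chart0 z]
    unfolding ecc[symmetric] unfolding ez_def ezzb_def ec_def by (simp add: pe(1))
  have sE: "smooth (\<lambda>z. complex_of_real (energy chart0 z))" "smooth (\<lambda>z. complex_of_real (energy chart1 z))"
    by (rule smooth_energy, simp)+
  have pE: "energy chart0 z > 0" "energy chart1 z > 0" for z by (rule energy_pos, simp)+
  have E1c: "continuous_on UNIV (energy chart1)"
  proof -
    have "continuous_on UNIV (\<lambda>z. Re (complex_of_real (energy chart1 z)))" by (intro continuous_on_Re smooth_continuous sE)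
    then show ?thesis by simp
  qed
  obtain \<alpha> \<gamma> \<beta> where \<phi>: "!!z. energy chart0 z * (\<alpha> + 2 * Re (\<beta> * z) + \<gamma> * (norm z)\<^sup>2)\<^sup>2 = 1"
    "!!z. \<alpha> + 2 * Re (\<beta> * z) + \<gamma> * (norm z)\<^sup>2 > 0"
    by (rule constant_curvature_metric[OF sE pE energy_transition curv]) (assumption | rule that)+
  obtain C where C: "C > 0" "!!z. (energy chart0 z)\<^sup>2 * e z = C"
    by (rule constant_curvature_potential[OF sE(1) pE pe(3,4) E1c e1c energy_transition e_trans curv d1' d2 pot]) (assumption | rule that)+
  define \<phi> where "\<phi> = (\<lambda>z. \<alpha> + 2 * Re (\<beta> * z) + \<gamma> * (norm z)\<^sup>2)"
  \<comment> \<open>C = E^2 e, and \<open>E * \<phi>\<^sup>2 = 1\<close>.\<close>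
  have e\<phi>: "e z = C * \<phi> z ^ 4" for z
  proof -
    have "C * \<phi> z ^ 4 = (energy chart0 z * (\<phi> z)\<^sup>2)\<^sup>2 * e z"
      unfolding C(2)[of z, symmetric] by (simp add: power_mult_distrib mult_ac flip: power_mult)
    then show ?thesis using \<phi>(1)[of z] by (simp add: \<phi>_def)
  qed
  have "energy chart1 (1 / z) * (\<alpha> + 2 * Re (\<beta> * z) + \<gamma> * (norm z)\<^sup>2)\<^sup>2 = norm z ^ 4" if "z ~= 0" for z
    unfolding energy_transition[OF that, symmetric] using \<phi>(1)[of z] by (simp add: mult_ac)
  note gp = positive_hermitian_function[OF \<phi>(2) this E1c]
  obtain x0 y0 where xy: "x0 ~= 0 \<or> y0 ~= 0" "k0 * y0 ^ 4 + k1 * x0 * y0 ^ 3 + k2 * x0 ^ 2 * y0 ^ 2 + k3 * x0 ^ 3 * y0 + k4 * x0 ^ 4 = 0"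
    by (rule homogeneous_root)
  obtain s a b c d where bd: "b = s * x0" "d = s * y0" and det: "a * d - b * c ~= 0"
    and frame: "!!\<zeta>. of_real \<gamma> * ((a * \<zeta> + b) * cnj (a * \<zeta> + b)) + \<beta> * ((a * \<zeta> + b) * cnj (c * \<zeta> + d)) + cnj \<beta> * ((c * \<zeta> + d) * cnj (a * \<zeta> + b))
      + of_real \<alpha> * ((c * \<zeta> + d) * cnj (c * \<zeta> + d)) = 1 + \<zeta> * cnj \<zeta>"
    by (rule hermitian_form_frame[OF gp xy(1)]) (assumption | rule that)+
  define D where "D = a * d - b * c"
  \<comment> \<open>The class in the new coordinate. With Y = c \<zeta> + d the curve scales by Y^2
    and its cross product by Y^2 D; the class must scale by D Y^4 for the potential to keep its
    form.\<close>
  define qh where "qh = (\<lambda>\<zeta>. D * (k0 * (c * \<zeta> + d) ^ 4 + k1 * (a * \<zeta> + b) * (c * \<zeta> + d) ^ 3 + k2 * (a * \<zeta> + b) ^ 2 * (c * \<zeta> + d) ^ 2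
     + k3 * (a * \<zeta> + b) ^ 3 * (c * \<zeta> + d) + k4 * (a * \<zeta> + b) ^ 4))"
  have qh0: "qh 0 = 0"
  proof -
    have "qh 0 = D * s ^ 4 * (k0 * y0 ^ 4 + k1 * x0 * y0 ^ 3 + k2 * x0 ^ 2 * y0 ^ 2 + k3 * x0 ^ 3 * y0 + k4 * x0 ^ 4)"
      by (simp add: qh_def bd power_mult_distrib power2_eq_square power3_eq_cube power4_eq_xxxx algebra_simps)
    then show ?thesis using xy(2) by simp
  qed
  have qhe: "qh \<zeta> = D * (c * \<zeta> + d) ^ 4 * c0.ext ((a * \<zeta> + b) / (c * \<zeta> + d))" if n: "c * \<zeta> + d ~= 0" for \<zeta>
  proof -
    define X Y where "X = a * \<zeta> + b" and "Y = c * \<zeta> + d"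
    have "Y ~= 0" using n by (simp add: Y_def)
    then have "Y ^ 4 * (k0 + k1 * (X / Y) + k2 * (X / Y) ^ 2 + k3 * (X / Y) ^ 3 + k4 * (X / Y) ^ 4)
       = k0 * Y ^ 4 + k1 * X * Y ^ 3 + k2 * X ^ 2 * Y ^ 2 + k3 * X ^ 3 * Y + k4 * X ^ 4"
      by (simp add: field_simps power2_eq_square power3_eq_cube power4_eq_xxxx)
    then show ?thesis unfolding qh_def ext X_def[symmetric] Y_def[symmetric] by (simp only: mult.assoc)
  qed
  define b0 b1 b2 where "b0 = quad a0 a1 a2 b d" and "b1 = quad_polar a0 a1 a2 a c b d" and "b2 = quad a0 a1 a2 a c"
  define bb where "bb = (\<lambda>\<zeta>. b0 + \<zeta> *s b1 + \<zeta>\<^sup>2 *s b2)"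
  define kk where "kk = (\<lambda>\<zeta>. ccross b0 b1 + (2 * \<zeta>) *s ccross b0 b2 + \<zeta>\<^sup>2 *s ccross b1 b2)"
  have kb: "kk \<zeta> = ccross (bb \<zeta>) (b1 + (2 * \<zeta>) *s b2)" for \<zeta> unfolding kk_def bb_def by (rule cross_quadratic[symmetric])
  define C' where "C' = (norm D)\<^sup>2 * C"
  have C': "C' > 0" using det C(1) by (simp add: C'_def D_def)
  \<comment> \<open>The potential identity multiplied by |D|^2 |Y|^8. The form \<phi> times |Y|^2
    becomes 1 + |\<zeta>|^2 by the choice of frame; the possible zero of Y is filled in by
    continuity afterwards.\<close>
  have id0: "hinner (bb \<zeta>) (bb \<zeta>) * hinner (kk \<zeta>) (kk \<zeta>) + qh \<zeta> * cnj (qh \<zeta>) = of_real C' * (1 + \<zeta> * cnj \<zeta>) ^ 4"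
    if n: "c * \<zeta> + d ~= 0" for \<zeta>
  proof -
    define X Y where "X = a * \<zeta> + b" and "Y = c * \<zeta> + d"
    define z where "z = X / Y"
    have Y: "Y ~= 0" using n by (simp add: Y_def)
    have b: "bb \<zeta> = Y\<^sup>2 *s f z"
      unfolding bb_def b0_def b1_def b2_def quad_pencil(1)[symmetric] X_def[symmetric] Y_def[symmetric] quad_affine(1)[OF Y] fd z_def ..
    have "b1 + (2 * \<zeta>) *s b2 = (2 * (Y * c)) *s f z + (a * Y - X * c) *s f1 z"
      unfolding b1_def b2_def quad_pencil(2)[symmetric] X_def[symmetric] Y_def[symmetric] quad_affine(2)[OF Y] fd z_def ..
    moreover have "a * Y - X * c = D" by (simp add: X_def Y_def D_def algebra_simps)
    ultimately have k: "kk \<zeta> = (Y\<^sup>2 * D) *s ccross (f z) (f1 z)"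
      unfolding kb b by (simp add: ccross_simps vec.scale_scale)
    have qz: "qh \<zeta> = D * Y ^ 4 * c0.ext z" using qhe[OF n] by (simp add: X_def Y_def z_def)
    have "hinner (bb \<zeta>) (bb \<zeta>) * hinner (kk \<zeta>) (kk \<zeta>) + qh \<zeta> * cnj (qh \<zeta>)
      = (D * cnj D) * (Y * cnj Y) ^ 4 * c0.pot z"
      unfolding b k qz c0.pot_def c0.normF_def c0.normG_def
      by (simp add: hinner_simps power2_eq_square power4_eq_xxxx algebra_simps)
    also have "\<dots> = of_real C' * ((Y * cnj Y) * of_real (\<phi> z)) ^ 4"
      unfolding pe(1) e\<phi> C'_def of_real_mult unfolding complex_norm_square unfolding of_real_power power_mult_distrib by (simp only: mult_ac)
    also have "(Y * cnj Y) * of_real (\<phi> z) = 1 + \<zeta> * cnj \<zeta>"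
    proof -
      have "complex_of_real (\<phi> z) = of_real \<alpha> + \<beta> * z + cnj \<beta> * cnj z + of_real \<gamma> * (z * cnj z)"
      proof -
        have "complex_of_real (2 * Re (\<beta> * z)) = \<beta> * z + cnj (\<beta> * z)" by (rule complex_add_cnj[symmetric])
        then show ?thesis unfolding \<phi>_def of_real_add of_real_mult[of \<gamma>] complex_norm_square by simp
      qed
      then have "(Y * cnj Y) * of_real (\<phi> z) = of_real \<gamma> * (X * cnj X) + \<beta> * (X * cnj Y) + cnj \<beta> * (Y * cnj X) + of_real \<alpha> * (Y * cnj Y)"
        using Y by (simp add: z_def field_simps)
      then show ?thesis unfolding X_def Y_def frame .
    qed
    finally show ?thesis .
  qed
  have id: "hinner (bb \<zeta>) (bb \<zeta>) * hinner (kk \<zeta>) (kk \<zeta>) + qh \<zeta> * cnj (qh \<zeta>) = of_real C' * (1 + \<zeta> * cnj \<zeta>) ^ 4" for \<zeta>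
  proof -
    define H where "H = (\<lambda>\<zeta>. hinner (bb \<zeta>) (bb \<zeta>) * hinner (kk \<zeta>) (kk \<zeta>) + qh \<zeta> * cnj (qh \<zeta>) - of_real C' * (1 + \<zeta> * cnj \<zeta>) ^ 4)"
    have "H \<zeta> = 0"
    proof (rule continuous_zero_off_finite[where f = H and F = "{\<zeta>. c * \<zeta> + d = 0}"])
      show "continuous_on UNIV H"
        unfolding H_def bb_def kk_def qh_def hinner_3 vector_add_component vector_smult_component by (intro continuous_intros)
      have sub: "{\<zeta>. c * \<zeta> + d = 0} \<subseteq> {- d / c}"
      proof
        fix \<zeta> assume "\<zeta> \<in> {\<zeta>. c * \<zeta> + d = 0}"
        then have h: "c * \<zeta> = - d" by (simp add: eq_neg_iff_add_eq_0)
        then have "c ~= 0" using det by auto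
        then show "\<zeta> \<in> {- d / c}" using h by (simp add: field_simps)
      qed
      show "finite {\<zeta>. c * \<zeta> + d = 0}" by (rule finite_subset[OF sub]) simp
    qed (simp add: H_def id0)
    then show ?thesis by (simp add: H_def)
  qed
  have qhh: "qh holomorphic_on UNIV" unfolding qh_def by (intro holomorphic_intros)
  \<comment> \<open>The class is again bounded by the right side of the identity, which puts it into
    the expanded form needed for comparing coefficients.\<close>
  have qb: "(norm (qh \<zeta>))\<^sup>2 \<le> (C' * 16) * norm \<zeta> ^ 8" if z: "1 \<le> norm \<zeta>" for \<zeta>
  proof -
    obtain u v where uv: "u \<ge> 0" "v \<ge> 0" "hinner (bb \<zeta>) (bb \<zeta>) = of_real u" "hinner (kk \<zeta>) (kk \<zeta>) = of_real v" using hinner_real by blast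
    have "complex_of_real (u * v + (norm (qh \<zeta>))\<^sup>2) = of_real (C' * (1 + (norm \<zeta>)\<^sup>2) ^ 4)"
      using id[of \<zeta>] unfolding uv complex_norm_square[symmetric] by simp
    then have "u * v + (norm (qh \<zeta>))\<^sup>2 = C' * (1 + (norm \<zeta>)\<^sup>2) ^ 4" by (simp only: of_real_eq_iff)
    then have "(norm (qh \<zeta>))\<^sup>2 \<le> C' * (1 + (norm \<zeta>)\<^sup>2) ^ 4" using mult_nonneg_nonneg[OF uv(1,2)] by linarith
    also have "\<dots> \<le> C' * (2 * (norm \<zeta>)\<^sup>2) ^ 4"
      using C' z by (intro mult_left_mono power_mono) auto
    also have "\<dots> = (C' * 16) * norm \<zeta> ^ 8" by (simp add: power_mult_distrib flip: power_mult)
    finally show ?thesis .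
  qed
  obtain r0 r1 r2 r3 r4 where r: "!!z. qh z = r0 + r1 * z + r2 * z ^ 2 + r3 * z ^ 3 + r4 * z ^ 4" using quartic_growth[OF qhh qb] by blast
  have "r0 = 0" using r[of 0] qh0 by simp
  then have r': "qh z = r1 * z + r2 * z ^ 2 + r3 * z ^ 3 + r4 * z ^ 4" for z using r by simp
  note id' = id[unfolded r' bb_def kk_def]
  note V = veronese_coefficients[OF C' id']
  have qz: "qh \<zeta> = 0" for \<zeta> unfolding r' using V(7-10) by simp
  \<comment> \<open>Every point except possibly a / c has a preimage under the Moebius
    transformation; the exception follows by continuity.\<close>
  have "c0.ext z = 0" for z
  proof (rule continuous_zero_off_finite[where f = c0.ext and F = "{a / c}"])
    show "continuous_on UNIV c0.ext" by (rule holomorphic_on_imp_continuous_on[OF exth])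
    fix z assume z: "z \<notin> {a / c}"
    have n: "a - c * z ~= 0"
    proof
      assume h: "a - c * z = 0"
      then have "c ~= 0" using det by auto
      then show False using h z by (simp add: field_simps)
    qed
    define \<zeta> where "\<zeta> = (d * z - b) / (a - c * z)"
    have Y: "c * \<zeta> + d = D / (a - c * z)" using n by (simp add: \<zeta>_def D_def field_simps)
    have X: "a * \<zeta> + b = D * z / (a - c * z)" using n by (simp add: \<zeta>_def D_def field_simps)
    have Dn: "D ~= 0" using det by (simp add: D_def)
    have Yn: "c * \<zeta> + d ~= 0" unfolding Y using n Dn by simp
    have "(a * \<zeta> + b) / (c * \<zeta> + d) = z" unfolding X Y using n Dn by simp
    then show "c0.ext z = 0" using qhe[OF Yn] qz[of \<zeta>] Yn Dn by simp
  qed simp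
  then have "A1 (chart0 z) ** adj (A0 (chart0 z)) = 0" for z
    using c0.A1_A0_adjoint(1)[of z] by (simp add: vec_eq_iff smul_nth)
  then show ?thesis using that[OF l0 l1 _ det V(1-6)[unfolded b0_def b1_def b2_def]] by blast
qed

end

section \<open>Conclusion\<close>

lemma projection_conjugate:
  fixes V B :: "complex^3^3"
  assumes V: "V \<in> unitary_group" and S: "vec.subspace S" and B: "adj B = B" "B ** B = B" "range ((*v) B) = (*v) V ` S"
  shows "B = V ** proj S ** adj V"
proof (rule projection_unique[OF B(1,2)])
  note p = proj_properties[OF S]
  have VV: "adj V ** V = mat 1" using V by (simp add: unitary_group_def)
  have cc: "adj (adj M) = M" for M :: "complex^3^3" by (simp add: ctranspose_def vec_eq_iff)
  show "adj (V ** proj S ** adj V) = V ** proj S ** adj V"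
    by (simp add: ctranspose_mult cc p matrix_mul_assoc)
  have "V ** proj S ** adj V ** (V ** proj S ** adj V) = V ** (proj S ** (adj V ** V) ** proj S) ** adj V"
    by (simp only: matrix_mul_assoc)
  then show "V ** proj S ** adj V ** (V ** proj S ** adj V) = V ** proj S ** adj V"
    by (simp add: VV p)
  have "range ((*v) (V ** proj S ** adj V)) = (*v) V ` S"
  proof (intro set_eqI iffI)
    fix y assume "y \<in> range ((*v) (V ** proj S ** adj V))"
    then obtain x where "y = V *v (proj S *v (adj V *v x))" by (auto simp: matrix_vector_mul_assoc matrix_mul_assoc)
    then show "y \<in> (*v) V ` S" using proj_in[OF S] by blast
  next
    fix y assume "y \<in> (*v) V ` S"
    then obtain s where s: "s \<in> S" "y = V *v s" by blast
    have "(V ** proj S ** adj V) *v y = V *v (proj S *v ((adj V ** V) *v s))"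
      unfolding s(2) by (simp only: matrix_vector_mul_assoc matrix_mul_assoc)
    also have "\<dots> = y" using s by (simp add: VV proj_fix[OF S])
    finally show "y \<in> range ((*v) (V ** proj S ** adj V))" by (metis rangeI)
  qed
  then show "range ((*v) B) = range ((*v) (V ** proj S ** adj V))" using B(3) by simp
qed

context uniton_two
begin

lemma coefficient_sum: "A0 p + A1 p + A2 p = mat 1"
proof -
  obtain c z where c: "c \<in> charts" "p = c z" by (rule sphere_chart)
  interpret loop_chart3 "\<lambda>z. A0 (c z)" "\<lambda>z. A1 (c z)" "\<lambda>z. A2 (c z)" "A_z \<psi> c" by (rule chart[OF c(1)])
  show ?thesis using unitary_relations(7)[of z] by (simp add: c(2))
qed

text \<open>The map \<open>A0 - A1 + A2\<close> is the extended solution at \<open>-1\<close>, which agrees with \<open>\<psi>\<close> up to a constant.\<close>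

lemma psi_representation:
  assumes h: "!!p. adj (A1 p) = A1 p" "!!p. A1 p ** A1 p = A1 p"
  obtains C where "C \<in> unitary_group" "!!p. \<psi> p = C ** (mat 1 - A1 p - A1 p)"
proof -
  define N where "N = (\<lambda>p. A0 p - A1 p + A2 p)"
  have cc: "adj (adj M) = M" for M :: "complex^3^3" by (simp add: ctranspose_def vec_eq_iff)
  have cs: "adj (smul k M) = smul (cnj k) (adj M)" for k and M :: "complex^3^3" by (simp add: ctranspose_def vec_eq_iff smul_nth)
  have m1: "adj (mat 1 :: complex^3^3) = mat 1" by (auto simp: ctranspose_def mat_def vec_eq_iff)
  have N: "N p = mat 1 - A1 p - A1 p" for p unfolding N_def coefficient_sum[of p, symmetric] by simp
  have Nh: "adj (N p) = N p" for p unfolding N ctranspose_diff h(1) m1 ..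
  have NN: "N p ** N p = mat 1" for p
    unfolding N by (simp only: matrix_distribs h(2) matrix_mul_lid matrix_mul_rid) simp
  \<comment> \<open>\<psi> and \<open>N\<close> satisfy the same first-order system, with the same
    \<open>A_z\<close>, so their quotient has vanishing derivatives; since N is Hermitian with
    square 1, it is unitary and the quotient determines the constant.\<close>
  have const: "\<psi> (c z) ** adj (N (c z)) = \<psi> (c w) ** adj (N (c w))" if c: "c \<in> charts" for c z w
  proof -
    interpret loop_chart3 "\<lambda>z. A0 (c z)" "\<lambda>z. A1 (c z)" "\<lambda>z. A2 (c z)" "A_z \<psi> c" by (rule chart[OF c])
    have "mwd (\<lambda>z. \<psi> (c z) ** adj (N (c z))) 0 0 z" for z
    proof -
      define A where "A = A_z \<psi> c z"
      have 1: "- (A1 (c z) ** A) - (A1 (c z) - A2 (c z)) ** A + A2 (c z) ** A = smul 2 (N (c z) ** A)"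
        using A0_A[of z] by (simp add: A_def N_def matrix_distribs vec_eq_iff smul_nth)
      have 2: "- (A0 (c z) ** adj A) - (A0 (c z) - A1 (c z)) ** adj A + A1 (c z) ** adj A = smul (- 2) (N (c z) ** adj A)"
        using A2_A_adjoint[of z] by (simp add: A_def N_def matrix_distribs vec_eq_iff smul_nth)
      have "mwd (\<lambda>z. N (c z)) (smul 2 (N (c z) ** A)) (smul (- 2) (N (c z) ** adj A)) z"
        unfolding N_def unfolding 1[unfolded N_def, symmetric] 2[unfolded N_def, symmetric] unfolding A_def
        by (rule mwd_add[OF mwd_diff[OF mwd_A0 mwd_A1] mwd_A2])
      note d = mwd_mult[OF mwd_unitary[OF unitary_map c, of z] mwd_ctranspose[OF this]]
      have "smul 2 (\<psi> (c z) ** A) ** adj (N (c z)) + \<psi> (c z) ** adj (smul (- 2) (N (c z) ** adj A)) = 0"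
        unfolding cs ctranspose_mult cc smul_simps by (simp add: vec_eq_iff smul_nth matrix_mul_assoc)
      moreover have "smul (- 2) (\<psi> (c z) ** adj A) ** adj (N (c z)) + \<psi> (c z) ** adj (smul 2 (N (c z) ** A)) = 0"
        unfolding cs ctranspose_mult cc smul_simps by (simp add: vec_eq_iff smul_nth matrix_mul_assoc)
      ultimately show ?thesis using d unfolding A_def by simp
    qed
    then have "has_wd (\<lambda>z. (\<psi> (c z) ** adj (N (c z))) $ i $ j) 0 0 z" for i j z by (simp add: mwd_def)
    from has_wd_zero_imp_constant[OF this] show ?thesis unfolding vec_eq_iff by blast
  qed
  define C where "C = \<psi> (chart0 1) ** adj (N (chart0 1))"
  have C: "\<psi> p ** adj (N p) = C" for p
  proof -
    obtain c z where c: "c \<in> charts" "p = c z" by (rule sphere_chart)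
    have "c 1 = chart0 1" using c(1) by (auto simp: charts_def chart0_def chart1_def)
    then show ?thesis using const[OF c(1), of z 1] unfolding C_def c(2) by simp
  qed
  have rep: "\<psi> p = C ** N p" for p
  proof -
    have "C ** N p = \<psi> p ** (N p ** N p)" unfolding C[of p, symmetric] Nh by (simp only: matrix_mul_assoc)
    then show ?thesis by (simp add: NN)
  qed
  have u: "\<psi> p ** adj (\<psi> p) = mat 1" "adj (\<psi> p) ** \<psi> p = mat 1" for p
    using unitary_map unfolding smooth_unitary_map_def unitary_group_def by auto
  define p0 where "p0 = chart0 1"
  have "C ** adj C = \<psi> p0 ** (N p0 ** N p0) ** adj (\<psi> p0)"
    unfolding C[of p0, symmetric] ctranspose_mult cc Nh by (simp only: matrix_mul_assoc)
  then have 1: "C ** adj C = mat 1" by (simp add: NN u)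
  have "adj C ** C = N p0 ** (adj (\<psi> p0) ** \<psi> p0) ** N p0"
    unfolding C[of p0, symmetric] ctranspose_mult cc Nh by (simp only: matrix_mul_assoc)
  then have "adj C ** C = mat 1" by (simp add: NN u)
  then show ?thesis using that[of C] 1 rep unfolding N unitary_group_def by blast
qed

lemma congruent_to_veronese:
  assumes cc: "constant_curvature \<psi>"
  shows "unitarily_congruent \<psi> (\<lambda>p. proj (veronese 1 p) - proj_perp (veronese 1 p))"
proof -
  obtain a0 a1 a2 a b c d where
    l0: "lifted_chart (\<lambda>z. A0 (chart0 z)) (\<lambda>z. A1 (chart0 z)) (\<lambda>z. A2 (chart0 z)) (A_z \<psi> chart0) UNIV
      (\<lambda>z. a0 + z *s a1 + z\<^sup>2 *s a2) (\<lambda>z. a1 + (2 * z) *s a2) (\<lambda>z. 2 *s a2)" and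
    l1: "lifted_chart (\<lambda>z. A0 (chart1 z)) (\<lambda>z. A1 (chart1 z)) (\<lambda>z. A2 (chart1 z)) (A_z \<psi> chart1) UNIV
      (\<lambda>z. a2 + z *s a1 + z\<^sup>2 *s a0) (\<lambda>z. a1 + (2 * z) *s a0) (\<lambda>z. 2 *s a0)" and
    h0: "!!z. A1 (chart0 z) ** adj (A0 (chart0 z)) = 0" and det: "a * d - b * c ~= 0" and
    o: "hinner (quad a0 a1 a2 b d) (quad_polar a0 a1 a2 a c b d) = 0" "hinner (quad a0 a1 a2 b d) (quad a0 a1 a2 a c) = 0"
    "hinner (quad_polar a0 a1 a2 a c b d) (quad a0 a1 a2 a c) = 0" and
    n: "Re (hinner (quad_polar a0 a1 a2 a c b d) (quad_polar a0 a1 a2 a c b d)) = 2 * Re (hinner (quad a0 a1 a2 b d) (quad a0 a1 a2 b d))"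
    "Re (hinner (quad a0 a1 a2 a c) (quad a0 a1 a2 a c)) = Re (hinner (quad a0 a1 a2 b d) (quad a0 a1 a2 b d))"
    "Re (hinner (quad a0 a1 a2 b d) (quad a0 a1 a2 b d)) > 0"
    by (rule veronese_normal_form[OF cc]) blast
  interpret c0: lifted_chart "\<lambda>z. A0 (chart0 z)" "\<lambda>z. A1 (chart0 z)" "\<lambda>z. A2 (chart0 z)" "A_z \<psi> chart0" UNIV
    "\<lambda>z. a0 + z *s a1 + z\<^sup>2 *s a2" "\<lambda>z. a1 + (2 * z) *s a2" "\<lambda>z. 2 *s a2" by (rule l0)
  interpret c1: lifted_chart "\<lambda>z. A0 (chart1 z)" "\<lambda>z. A1 (chart1 z)" "\<lambda>z. A2 (chart1 z)" "A_z \<psi> chart1" UNIV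
    "\<lambda>z. a2 + z *s a1 + z\<^sup>2 *s a0" "\<lambda>z. a1 + (2 * z) *s a0" "\<lambda>z. 2 *s a0" by (rule l1)
  have h1: "A1 (chart1 z) ** adj (A0 (chart1 z)) = 0" for z
  proof (rule continuous_zero_off_finite[where F = "{0}"])
    show "continuous_on UNIV (\<lambda>z. A1 (chart1 z) ** adj (A0 (chart1 z)))"
      by (intro continuous_on_matrix_mult continuous_on_ctranspose c1.continuous_coefficients)
    show "A1 (chart1 z) ** adj (A0 (chart1 z)) = 0" if "z \<notin> {0}" for z
    proof -
      have "chart1 z = chart0 (1 / z)" using that by (simp add: chart0_def chart1_def)
      then show ?thesis using h0 by simp
    qed
  qed simp
  note m0 = c0.middle_projection[OF UNIV_I h0]
  note m1 = c1.middle_projection[OF UNIV_I h1]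
  have herm: "adj (A1 p) = A1 p" "A1 p ** A1 p = A1 p" for p
  proof -
    obtain ch z where ch: "ch \<in> charts" "p = ch z" by (rule sphere_chart)
    then show "adj (A1 p) = A1 p" "A1 p ** A1 p = A1 p" using m0(1,2) m1(1,2) by (auto simp: charts_def)
  qed
  \<comment> \<open>Homogeneous coordinates treat both charts at once. The auxiliary vector (x', y')
    is any vector independent of (x, y); it supplies a derivative direction along the curve.\<close>
  have range_point: "range ((*v) (A1 (sphere_point x y))) = oc (quad a0 a1 a2 x y) (quad_polar a0 a1 a2 x y x' y')" if D: "x' * y - x * y' ~= 0" for x y x' y'
  proof (cases "y = 0")
    case False
    have sp: "sphere_point x y = chart0 (x / y)" using False by (simp add: sphere_point_def chart0_def)
    show ?thesis unfolding quad_affine[OF False] sp m0(3)[of "x / y"]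
      by (rule oc_change[symmetric]) (use D False in auto)
  next
    case True
    then have x: "x ~= 0" "y' ~= 0" using D by auto
    have "sphere_point x y = chart1 0" using True by (simp add: sphere_point_def chart1_def)
    moreover have "range ((*v) (A1 (chart1 0))) = oc a2 a1" using m1(3)[of 0] by simp
    moreover have "quad a0 a1 a2 x y = x\<^sup>2 *s a2" "quad_polar a0 a1 a2 x y x' y' = (2 * (x * x')) *s a2 + (x * y') *s a1"
      using True by (simp_all add: quad_def quad_polar_def add.commute)
    ultimately show ?thesis using oc_change[of "x\<^sup>2" "x * y'" a2 "2 * (x * x')" a1] x by simp
  qed
  obtain C where C: "C \<in> unitary_group" "!!p. \<psi> p = C ** (mat 1 - A1 p - A1 p)" by (rule psi_representation[OF herm]) blast
  obtain V r where V: "V \<in> unitary_group" and r: "r ~= 0"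
    and v: "!!z. V *v veronese_lift0 z = r *s (quad a0 a1 a2 b d + z *s quad_polar a0 a1 a2 a c b d + z\<^sup>2 *s quad a0 a1 a2 a c)"
      "!!z. V *v dz_vec veronese_lift0 z = r *s (quad_polar a0 a1 a2 a c b d + (2 * z) *s quad a0 a1 a2 a c)"
      "V *v veronese_lift1 0 = r *s quad a0 a1 a2 a c" "V *v dz_vec veronese_lift1 0 = r *s quad_polar a0 a1 a2 a c b d"
    by (rule veronese_unitary[OF o n]) blast
  have VV: "adj V ** V = mat 1" "V ** adj V = mat 1" using V by (simp_all add: unitary_group_def)
  have CC: "adj C ** C = mat 1" "C ** adj C = mat 1" using C(1) by (simp_all add: unitary_group_def)
  define g where "g = moebius a b c d"
  have sc: "oc (r *s x) (r *s y) = oc x y" for x y using oc_change[OF r r, of x 0 y] by simp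
  have key: "vec.subspace (veronese 1 p :: (complex^3) set) \<and> range ((*v) (A1 (g p))) = (*v) V ` (veronese 1 p)" for p
  proof (cases p)
    case (Affine \<zeta>)
    have ve: "(veronese 1 p :: (complex^3) set) = oc (veronese_lift0 \<zeta>) (dz_vec veronese_lift0 \<zeta>)"
      unfolding Affine veronese.simps by (rule osculating_complement_oc)
    have D: "a * (c * \<zeta> + d) - (a * \<zeta> + b) * c ~= 0" using det by (simp add: algebra_simps)
    have "range ((*v) (A1 (g p))) = oc (V *v veronese_lift0 \<zeta>) (V *v dz_vec veronese_lift0 \<zeta>)"
      unfolding Affine g_def moebius.simps range_point[OF D] quad_pencil v sc ..
    then show ?thesis unfolding ve oc_unitary[OF VV(1)] using oc_subspace by blast
  next
    case Infty
    have ve: "(veronese 1 p :: (complex^3) set) = oc (veronese_lift1 0) (dz_vec veronese_lift1 0)"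
      unfolding Infty veronese.simps by (rule osculating_complement_oc)
    have D: "b * c - a * d ~= 0" using det by auto
    have "range ((*v) (A1 (g p))) = oc (V *v veronese_lift1 0) (V *v dz_vec veronese_lift1 0)"
      unfolding Infty g_def moebius.simps range_point[OF D] v sc ..
    then show ?thesis unfolding ve oc_unitary[OF VV(1)] using oc_subspace by blast
  qed
  have A1g: "A1 (g p) = V ** proj (veronese 1 p) ** adj V" for p
    using projection_conjugate[OF V _ herm[of "g p"]] key[of p] by blast
  \<comment> \<open>The minus sign turns the reflection \<open>mat 1 - 2 P\<close> of the
    representation of \<psi> into \<open>2 P - mat 1\<close>, the difference of the two
    projections.\<close>
  define U where "U = - (adj V ** adj C)"
  have ct: "adj (adj M) = M" for M :: "complex^3^3" by (simp add: ctranspose_def vec_eq_iff)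
  have "U ** adj U = adj V ** (adj C ** C) ** V"
    by (simp add: U_def ctranspose_simps ct matrix_distribs matrix_mul_assoc)
  then have U1: "U ** adj U = mat 1" by (simp add: CC VV)
  have "adj U ** U = C ** (V ** adj V) ** adj C"
    by (simp add: U_def ctranspose_simps ct matrix_distribs matrix_mul_assoc)
  then have U2: "adj U ** U = mat 1" by (simp add: CC VV)
  have "proj (veronese 1 p) - proj_perp (veronese 1 p) = U ** \<psi> (g p) ** V" for p
  proof -
    define P where "P = (proj (veronese 1 p) :: complex^3^3)"
    have "U ** \<psi> (g p) ** V = - (adj V ** (adj C ** C) ** (mat 1 - A1 (g p) - A1 (g p)) ** V)"
      unfolding U_def C(2) by (simp add: matrix_distribs matrix_mul_assoc)
    also have "\<dots> = - (adj V ** V) + adj V ** A1 (g p) ** V + adj V ** A1 (g p) ** V"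
      by (simp only: CC matrix_distribs matrix_mul_lid matrix_mul_rid) simp
    also have "adj V ** A1 (g p) ** V = (adj V ** V) ** P ** (adj V ** V)"
      unfolding A1g P_def by (simp only: matrix_mul_assoc)
    finally have "U ** \<psi> (g p) ** V = - mat 1 + P + P" by (simp add: VV)
    then show ?thesis unfolding proj_perp_def P_def by (simp add: algebra_simps)
  qed
  moreover have "U \<in> unitary_group" using U1 U2 by (simp add: unitary_group_def)
  moreover have "biholomorphism g" unfolding g_def by (rule moebius_biholomorphism[OF det])
  ultimately show ?thesis unfolding unitarily_congruent_def using V by blast
qed

end

theorem corollary5p6:
  fixes \<psi> :: "riemann_sphere \<Rightarrow> complex^3^3"
  assumes "minimal_immersion \<psi>"
    and "constant_curvature \<psi>"
    and "has_uniton_number \<psi> 2"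
    and "totally_unramified_harmonic TYPE(2) \<psi>"
  shows "unitarily_congruent \<psi>
    (\<lambda>p. proj (veronese 1 p) - proj_perp (veronese 1 p))"
proof -
  obtain \<Psi> where N: "normalized_extended_solution 2 \<psi> \<Psi>"
    and T: "totally_unramified (X_bundle \<Psi> :: riemann_sphere \<Rightarrow> (complex^(2 \<times> 3)) set)"
    using assms(4) unfolding totally_unramified_harmonic_def by auto
  obtain A0 A1 A2 where P: "!!p \<mu>. norm \<mu> = 1 ==> \<Psi> p \<mu> = A0 p + mat \<mu> ** A1 p + mat (\<mu>\<^sup>2) ** A2 p"
    by (rule normalized_polynomial[OF N]) blast
  have n1: "\<not> has_polynomial_extended_solution \<psi> 1" using assms(3) by (simp add: has_uniton_number_def)
  interpret uniton_two \<psi> \<Psi> A0 A1 A2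
    by unfold_locales (use assms(1) N P T n1 in blast)+
  show ?thesis by (rule congruent_to_veronese[OF assms(2)])
qed

end
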